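(* Let $\mathcal{W}$ be an $s$-admissible dictionary (respectively, an admissible dictionary), and let $\alpha=\frac1p-\frac12$, where $\frac{2d}{s}<p<2$ (respectively, $0<p<2$). Then $\mathfrak{M}^p(\mathbb{R}^d)$ is continuously embedded in $\mathcal{A}^\alpha_p(\mathcal{W})$.
   Context: Notation. $\mathcal{HS}=\mathcal{HS}(L^2(\mathbb{R}^d))$ is the Hilbert space of Hilbert–Schmidt operators on $L^2(\mathbb{R}^d)$; $\mathcal{B}(\mathcal{K})$ the bounded operators on a Hilbert space $\mathcal{K}$. For $W\in\mathcal{B}(L^2(\mathbb{R}^d))$, $L_W\in\mathcal{B}(\mathcal{HS})$ is $L_WH:=WH$. For $z=(x,\omega)\in\mathbb{R}^{2d}$, $\pi(z)f(t)=e^{2\pi i\omega\cdot t}f(t-x)$. $\varphi_0(t)=2^{d/4}e^{-\pi|t|^2}$, $\Phi_0=\varphi_0\otimes\varphi_0$, where $(f\otimes g)\psi=\langle\psi,g\rangle f$. $\nu_s(z)=(1+|z|)^s$ on $\mathbb{R}^{2d}$, and $M^1_{\nu_s}(\mathbb{R}^d)=\{f\in L^2(\mathbb{R}^d):\|f\|_{M^1_{\nu_s}}:=\int_{\mathbb{R}^{2d}}|\langle f,\pi(z)\varphi_0\rangle|\nu_s(z)\,dz<\infty\}$. g-frames. A countable family $(U_\lambda)_{\lambda\in\Lambda}$ in $\mathcal{B}(\mathcal{K})$ is a g-frame for a separable Hilbert space $\mathcal{K}$ if there are $0<A\le B<\infty$ with $A\|f\|^2\le\sum_\lambda\|U_\lambda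 f\|^2\le B\|f\|^2$ for all $f\in\mathcal{K}$. Its g-frame operator is $S_{\mathcal{U}}f=\sum_\lambda U_\lambda^*U_\lambda f$ and its canonical dual is $\widetilde U_\lambda=U_\lambda S_{\mathcal{U}}^{-1}$. Lattice. Throughout, $\Lambda=\frac1N\mathbb{Z}^d\times\frac1N\mathbb{Z}^d$, with $N\in\mathbb{N}$ such that $\mathcal{G}=(G_\lambda)_{\lambda\in\Lambda}$, $G_\lambda=L_{\Phi_0\pi(\lambda)^*}$, is a g-frame for $\mathcal{HS}$ (such $N$ exists; moreover $\mathcal{G}$ then satisfies, for every $\sigma>0$, $\|G_\lambda G_\mu^*\|\le C_\sigma(1+|\lambda-\mu|)^{-\sigma}$). Admissible dictionaries. Let $s>2d$ and $\Psi=\sum_{k=1}^\infty\phi_k\otimes\psi_k$ with $\phi_k\in M^1_{\nu_s}(\mathbb{R}^d)$, $\psi_k\in L^2(\mathbb{R}^d)$ and $\sum_k\|\phi_k\|_{M^1_{\nu_s}}\|\psi_k\|_{L^2}<\infty$, and assume $(\Psi^*\pi(\lambda)^* )_{\lambda\in\Lambda}$ is a g-frame for $L^2(\mathbb{R}^d)$. Then $\mathcal{W}=(W_\lambda)_{\lambda\in\Lambda}$, $W_\lambda:=L_{\Psi^*\pi(\lambda)^*}$, is called an $s$-admissible dictionary. If $\mathcal{W}$ is an $s$-admissible dictionary for all $s>2d$, it is called an admissible dictionary. (Such $\mathcal{W}$ is a g-frame for $\mathcal{HS}$.) Approximation spaces. For $n\in\mathbb{N}$ let $\Sigma_n(\mathcal{W})=\{\sum_{\lambda\in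 K}W_\lambda^*H_\lambda:H_\lambda\in\mathcal{HS},\,K\subset\Lambda,\,|K|\le n\}$ and $\Sigma_0(\mathcal{W})=\{0\}$. The best $n$-term approximation error of $F\in\mathcal{HS}$ is $\sigma_n(F,\mathcal{W})=\inf_{H\in\Sigma_n(\mathcal{W})}\|F-H\|_{\mathcal{HS}}$. For $0<\alpha<\infty$ and $0<p<\infty$, $$\mathcal{A}^\alpha_p(\mathcal{W})=\Big\{F\in\mathcal{HS}:\|F\|_{\mathcal{A}^\alpha_p(\mathcal{W})}:=\Big(\sum_{n=1}^\infty\big(n^\alpha\sigma_{n-1}(F,\mathcal{W})\big)^p\frac1n\Big)^{1/p}<\infty\Big\}.$$ Operator coorbit spaces (unweighted). $\mathfrak{S}$ is the space of Schwartz operators: operators $T$ on $L^2(\mathbb{R}^d)$ with $\sup_{\alpha,\beta\in\mathbb{N}_0^d}(1+|\alpha|+|\beta|)^k|\langle\psi_\alpha,T\psi_\beta\rangle|<\infty$ for all $k$, with $(\psi_\alpha)$ the Hermite basis; its dual $\mathfrak{S}'$ is identified with the continuous operators $\mathscr{S}(\mathbb{R}^d)\to\mathscr{S}'(\mathbb{R}^d)$, so $\mathcal{HS}\subset\mathfrak{S}'$. For $1\le p<\infty$, $\mathfrak{M}^p(\mathbb{R}^d)$ is the space of $F\in\mathfrak{S}'$ with $\|F\|_{\mathfrak{M}^p}=(\int_{\mathbb{R}^{2d}}\|\Phi_0^*\pi(z)^*F\|_{\mathcal{HS}}^p\,dz)^{1/p}<\infty$, where $\Phi_0^*\pi(z)^*F$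 is the operator $\psi\mapsto\langle F\psi,\pi(z)\varphi_0\rangle\varphi_0$. For $0<p<1$, $\mathfrak{M}^p(\mathbb{R}^d):=\mathcal{C}o^p(\mathcal{G})$, the completion of $\{\sum_\lambda G_\lambda^*H_\lambda:(H_\lambda)\text{ finitely supported in }\mathcal{HS}\}$ with respect to the quasi-norm $\|F\|=(\sum_\lambda\|\widetilde G_\lambda F\|_{\mathcal{HS}}^p)^{1/p}$; since $\ell^p\subset\ell^2$, it is identified with the space $\{F\in\mathcal{HS}:(\widetilde G_\lambda F)_\lambda\in\ell^p(\Lambda;\mathcal{HS})\}$ with this quasi-norm. *)

theory Defs
  imports "HOL-Analysis.Analysis"
begin

section \<open>Complex Hilbert spaces\<close>


class complex_inner = real_inner +
  fixes scaleC :: "complex \<Rightarrow> 'a \<Rightarrow> 'a"  (infixr "*\<^sub>C" 75)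
    and cinner :: "'a \<Rightarrow> 'a \<Rightarrow> complex"
  assumes scaleC_add_right: "c *\<^sub>C (x + y) = c *\<^sub>C x + c *\<^sub>C y"
    and scaleC_add_left: "(b + c) *\<^sub>C x = b *\<^sub>C x + c *\<^sub>C x"
    and scaleC_scaleC: "b *\<^sub>C c *\<^sub>C x = (b * c) *\<^sub>C x"
    and scaleR_scaleC: "r *\<^sub>R x = complex_of_real r *\<^sub>C x"
    and cinner_commute: "cinner x y = cnj (cinner y x)"
    and cinner_add_left: "cinner (x + y) z = cinner x z + cinner y z"
    and cinner_scaleC_left: "cinner (c *\<^sub>C x) y = c * cinner x y"
    and inner_cinner: "inner x y = Re (cinner x y)"

class complex_hilbert = complex_inner + complete_space


lemma cinner_add_right: "cinner x (y + z) = cinner x y + cinner x z"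
  for x :: "'a::complex_inner"
  by (subst (1 2 3) cinner_commute) (simp add: cinner_add_left)

lemma cinner_scaleC_right: "cinner x (c *\<^sub>C y) = cnj c * cinner x y"
  for x :: "'a::complex_inner"
  by (subst (1 2) cinner_commute) (simp add: cinner_scaleC_left)

lemma scaleC_zero_left: "0 *\<^sub>C x = 0" for x :: "'a::complex_inner"
  using scaleC_add_left[of 0 0 x] by simp

lemma scaleC_zero_right: "c *\<^sub>C (0::'a::complex_inner) = 0" for c
  using scaleC_add_right[of c 0 "0::'a"] by simp

lemma scaleC_diff_right: "c *\<^sub>C (x - y) = c *\<^sub>C x - c *\<^sub>C y" for x :: "'a::complex_inner"
  using scaleC_add_right[of c "x - y" y] by simp

lemma scaleC_one: "1 *\<^sub>C x = x" for x :: "'a::complex_inner"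
  using scaleR_scaleC[of 1 x] by simp

lemma cinner_zero_left: "cinner 0 x = 0" for x :: "'a::complex_inner"
  using cinner_add_left[of 0 0 x] by simp

lemma cinner_zero_right: "cinner x 0 = 0" for x :: "'a::complex_inner"
  using cinner_add_right[of x 0 0] by simp

lemma cinner_self: "cinner x x = complex_of_real ((norm x)\<^sup>2)" for x :: "'a::complex_inner"
proof -
  have "Im (cinner x x) = 0"
    using arg_cong[OF cinner_commute[of x x], of Im] by simp
  then show ?thesis
    by (simp add: complex_eq_iff power2_norm_eq_inner inner_cinner del: of_real_power)
qed

lemma norm_scaleC: "norm (c *\<^sub>C x) = cmod c * norm x" for x :: "'a::complex_inner"
proof -
  have "complex_of_real ((norm (c *\<^sub>C x))\<^sup>2) = complex_of_real ((cmod c * norm x)\<^sup>2)"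
    by (simp add: cinner_self[symmetric] cinner_scaleC_left cinner_scaleC_right power_mult_distrib
        complex_norm_square mult.assoc del: of_real_power)
  then have "(norm (c *\<^sub>C x))\<^sup>2 = (cmod c * norm x)\<^sup>2"
    by (simp only: of_real_eq_iff)
  then show ?thesis by (simp add: power2_eq_iff_nonneg)
qed

lemma norm_cinner_le: "cmod (cinner x y) \<le> norm x * norm y" for x :: "'a::complex_inner"
proof (cases "cinner x y = 0")
  case False
  define c where "c = cnj (cinner x y) / cmod (cinner x y)"
  have "cinner (c *\<^sub>C x) y = cinner x y * cnj (cinner x y) / complex_of_real (cmod (cinner x y))"
    by (simp only: c_def cinner_scaleC_left times_divide_eq_left mult.commute[of "cnj (cinner x y)"])
  also have "\<dots> = complex_of_real (cmod (cinner x y))"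
    unfolding complex_norm_square[symmetric] using False by (simp add: power2_eq_square)
  finally have "cinner (c *\<^sub>C x) y = complex_of_real (cmod (cinner x y))" .
  then have "cmod (cinner x y) = inner (c *\<^sub>C x) y"
    by (simp add: inner_cinner)
  also have "\<dots> \<le> norm (c *\<^sub>C x) * norm y" by (rule norm_cauchy_schwarz)
  also have "norm (c *\<^sub>C x) = norm x"
    using False by (simp add: norm_scaleC c_def norm_divide)
  finally show ?thesis .
qed simp

lemma tendsto_scaleC: "((\<lambda>n. c *\<^sub>C f n) \<longlongrightarrow> c *\<^sub>C l) F" if "(f \<longlongrightarrow> l) F"
  for f :: "'b \<Rightarrow> 'a::complex_inner"
proof -
  have "bounded_linear (\<lambda>x::'a. c *\<^sub>C x)"
    by (rule bounded_linear_intro[of _ "cmod c"])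
       (simp_all add: scaleC_add_right scaleR_scaleC scaleC_scaleC norm_scaleC mult.commute)
  from bounded_linear.tendsto[OF this that] show ?thesis .
qed

lemma complement_nontrivial:
  fixes M :: "'h::complex_hilbert set"
  assumes cl: "closed M" and sub: "subspace M" and cM: "\<And>c x. x \<in> M \<Longrightarrow> c *\<^sub>C x \<in> M"
    and x: "x \<notin> M"
  shows "\<exists>z. z \<noteq> 0 \<and> (\<forall>y\<in>M. cinner z y = 0)"
proof -
  define d where "d = infdist x M"
  have ne: "M \<noteq> {}" using subspace_0[OF sub] by auto
  have dle: "d \<le> norm (x - y)" if "y \<in> M" for y
    using infdist_le[OF that, of x] by (simp add: d_def dist_norm)
  have d0: "d \<ge> 0" by (simp add: d_def infdist_nonneg)
  have "\<exists>y\<in>M. norm (x - y) < d + 1 / Suc n" for n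
  proof -
    have "(INF a\<in>M. dist x a) < d + 1 / Suc n" using ne by (simp add: d_def infdist_def)
    then show ?thesis
      by (subst (asm) cINF_less_iff) (use ne in \<open>auto simp: dist_norm intro!: bdd_belowI2[of _ 0]\<close>)
  qed
  then obtain y where y: "\<And>n. y n \<in> M" "\<And>n. norm (x - y n) < d + 1 / Suc n" by metis
  have lim: "(\<lambda>n. norm (x - y n)) \<longlonglongrightarrow> d"
  proof (rule tendsto_sandwich[of "\<lambda>_. d" _ _ "\<lambda>n. d + 1 / Suc n"])
    show "(\<lambda>n. d + 1 / Suc n) \<longlonglongrightarrow> d"
      using tendsto_add[OF tendsto_const[of d] LIMSEQ_inverse_real_of_nat] by (simp add: inverse_eq_divide)
    show "\<forall>\<^sub>F n in sequentially. d \<le> norm (x - y n)"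
      using dle[OF y(1)] by (rule eventuallyI)
    show "\<forall>\<^sub>F n in sequentially. norm (x - y n) \<le> d + 1 / Suc n"
      using less_imp_le[OF y(2)] by (rule eventuallyI)
  qed simp
  have para: "(norm (y m - y n))\<^sup>2 \<le> 2 * (norm (x - y m))\<^sup>2 + 2 * (norm (x - y n))\<^sup>2 - 4 * d\<^sup>2" for m n
  proof -
    have "(1/2) *\<^sub>R (y m + y n) \<in> M"
      using sub y by (simp add: subspace_add subspace_scale)
    then have "d\<^sup>2 \<le> (norm (x - (1/2) *\<^sub>R (y m + y n)))\<^sup>2"
      using dle d0 by (intro power_mono) auto
    then show ?thesis
      by (simp add: power2_norm_eq_inner inner_diff inner_add inner_commute algebra_simps)
  qed
  have "Cauchy y"
  proof (rule metric_CauchyI)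
    fix e :: real assume e: "e > 0"
    have "(\<lambda>n. (norm (x - y n))\<^sup>2) \<longlonglongrightarrow> d\<^sup>2" by (intro tendsto_intros lim)
    then have "\<forall>\<^sub>F n in sequentially. (norm (x - y n))\<^sup>2 < d\<^sup>2 + e\<^sup>2 / 4"
      by (rule order_tendstoD) (use e in auto)
    then obtain N where N: "\<And>n. n \<ge> N \<Longrightarrow> (norm (x - y n))\<^sup>2 < d\<^sup>2 + e\<^sup>2 / 4"
      by (auto simp: eventually_sequentially)
    have "dist (y m) (y n) < e" if "m \<ge> N" "n \<ge> N" for m n
    proof (rule power2_less_imp_less)
      show "(dist (y m) (y n))\<^sup>2 < e\<^sup>2"
        using para[of m n] N[OF that(1)] N[OF that(2)] by (simp add: dist_norm)
    qed (use e in auto)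
    then show "\<exists>N. \<forall>m\<ge>N. \<forall>n\<ge>N. dist (y m) (y n) < e" by blast
  qed
  then obtain p where p: "y \<longlonglongrightarrow> p"
    using Cauchy_convergent convergent_def by blast
  have pM: "p \<in> M" using closed_sequentially[OF cl _ p] y by blast
  have np: "norm (x - p) = d"
    by (rule LIMSEQ_unique[OF _ lim]) (intro tendsto_intros p)
  have orth: "inner (x - p) v = 0" if v: "v \<in> M" for v
  proof (cases "v = 0")
    case False
    define t where "t = inner (x - p) v / inner v v"
    have "p + t *\<^sub>R v \<in> M" using sub pM v by (simp add: subspace_add subspace_scale)
    then have "d\<^sup>2 \<le> (norm (x - (p + t *\<^sub>R v)))\<^sup>2"
      using dle d0 by (intro power_mono) auto
    also have "\<dots> = inner ((x - p) - t *\<^sub>R v) ((x - p) - t *\<^sub>R v)"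
      by (simp add: power2_norm_eq_inner diff_diff_eq)
    also have "\<dots> = d\<^sup>2 - 2 * t * inner (x - p) v + t * (t * inner v v)"
    proof -
      have "inner (w - t *\<^sub>R v) (w - t *\<^sub>R v) = inner w w - 2 * t * inner w v + t * (t * inner v v)" for w
        by (simp add: inner_diff inner_commute[of v w] algebra_simps)
      from this[of "x - p"] show ?thesis by (simp only: np[symmetric] power2_norm_eq_inner)
    qed
    also have "\<dots> = d\<^sup>2 - (inner (x - p) v)\<^sup>2 / inner v v"
      using False by (simp add: t_def power2_eq_square)
    finally have "(inner (x - p) v)\<^sup>2 / inner v v \<le> 0" by simp
    moreover have "inner v v > 0" using False by simp
    ultimately have "(inner (x - p) v)\<^sup>2 \<le> 0" by (simp add: divide_le_0_iff)
    then show ?thesis by simp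
  qed simp
  have "cinner (x - p) v = 0" if v: "v \<in> M" for v
  proof -
    have "Re (cinner (x - p) (\<i> *\<^sub>C v)) = 0"
      using orth[OF cM[OF v]] by (simp add: inner_cinner)
    then show ?thesis
      using orth[OF v] by (simp add: inner_cinner cinner_scaleC_right complex_eq_iff)
  qed
  moreover have "x - p \<noteq> 0" using pM x by auto
  ultimately show ?thesis by blast
qed

text \<open>In a Hilbert space an orthonormal set is an orthonormal basis iff its orthogonal complement
  is trivial.\<close>

definition orthonormal_basis :: "'a::complex_inner set \<Rightarrow> bool" where
  "orthonormal_basis E \<longleftrightarrow>
     (\<forall>x\<in>E. \<forall>y\<in>E. cinner x y = (if x = y then 1 else 0)) \<and>
     (\<forall>x. (\<forall>e\<in>E. cinner x e = 0) \<longrightarrow> x = 0)"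

lemma orthonormal_basis_exists: "\<exists>E::'a::complex_inner set. orthonormal_basis E"
proof -
  let ?P = "\<lambda>E::'a set. \<forall>x\<in>E. \<forall>y\<in>E. cinner x y = (if x = y then 1 else 0)"
  have "\<exists>M\<in>Collect ?P. \<forall>X\<in>Collect ?P. M \<subseteq> X \<longrightarrow> X = M"
  proof (rule subset_Zorn)
    fix C assume C: "subset.chain (Collect ?P) C"
    have "\<Union>C \<in> Collect ?P"
    proof (clarify)
      fix x y X Y assume xy: "x \<in> X" "X \<in> C" "y \<in> Y" "Y \<in> C"
      then have "X \<subseteq> Y \<or> Y \<subseteq> X" using C by (meson subset.chain_def subset_chain_def)
      moreover have "?P X" "?P Y" using C xy unfolding subset.chain_def by blast+
      ultimately show "cinner x y = (if x = y then 1 else 0)" using xy by blast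
    qed
    then show "\<exists>U\<in>Collect ?P. \<forall>X\<in>C. X \<subseteq> U" by blast
  qed
  then obtain E where E: "?P E" and max: "\<And>X. ?P X \<Longrightarrow> E \<subseteq> X \<Longrightarrow> X = E" by auto
  have "x = 0" if x: "\<forall>e\<in>E. cinner x e = 0" for x
  proof (rule ccontr)
    assume nz: "x \<noteq> 0"
    define u where "u = complex_of_real (inverse (norm x)) *\<^sub>C x"
    have uE: "cinner u e = 0" "cinner e u = 0" if "e \<in> E" for e
      using x that cinner_commute[of e x] by (simp_all add: u_def cinner_scaleC_left cinner_scaleC_right)
    have uu: "cinner u u = 1"
      using nz by (simp add: cinner_self u_def norm_scaleC norm_inverse)
    have "?P (insert u E)"
      using E uE uu by auto
    then have "insert u E = E" by (rule max) auto
    then have "u \<in> E" by auto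
    then show False using uE(1) uu by auto
  qed
  with E have "orthonormal_basis E" unfolding orthonormal_basis_def by blast
  then show ?thesis by blast
qed

definition onb :: "'a::complex_inner set" where
  "onb = (SOME E. orthonormal_basis E)"

lemma orthonormal_basis_onb: "orthonormal_basis onb"
  unfolding onb_def by (rule someI_ex[OF orthonormal_basis_exists])

definition bounded_clinear :: "('a::complex_inner \<Rightarrow> 'b::complex_inner) \<Rightarrow> bool" where
  "bounded_clinear T \<longleftrightarrow> bounded_linear T \<and> (\<forall>c x. T (c *\<^sub>C x) = c *\<^sub>C T x)"

lemma bounded_clinear_pos:
  assumes "bounded_clinear T" obtains K where "\<And>x. norm (T x) \<le> K * norm x" "K \<ge> 0"
proof -
  obtain K where "K \<ge> 0" "\<And>x. norm (T x) \<le> norm x * K"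
    using bounded_linear.nonneg_bounded assms by (metis bounded_clinear_def)
  then show ?thesis using that[of K] by (simp add: mult.commute)
qed

lemma bounded_clinearI:
  assumes "\<And>x y. T (x + y) = T x + T y" "\<And>c x. T (c *\<^sub>C x) = c *\<^sub>C T x"
    "\<And>x. norm (T x) \<le> K * norm x"
  shows "bounded_clinear T"
  unfolding bounded_clinear_def
  using assms by (auto intro!: bounded_linear_intro[of T K] simp: scaleR_scaleC mult.commute)

text \<open>The class of Hilbert--Schmidt operators and their inner product do not depend on the choice of
  the orthonormal basis \<^const>\<open>onb\<close>.\<close>

definition hilbert_schmidt :: "('h::complex_hilbert \<Rightarrow> 'h) \<Rightarrow> bool" where
  "hilbert_schmidt T \<longleftrightarrow>
     bounded_clinear T \<and> (\<lambda>e. (norm (T e))\<^sup>2) summable_on onb"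

typedef (overloaded) 'h hs = "{T::'h::complex_hilbert \<Rightarrow> 'h. hilbert_schmidt T}"
  morphisms hs_apply Abs_hs
  by (rule exI[of _ "\<lambda>x. 0"])
     (auto simp: hilbert_schmidt_def scaleC_zero_right intro!: bounded_clinearI[of _ 0])

setup_lifting type_definition_hs

lemma hs_norm_bound:
  assumes T: "hilbert_schmidt T"
  shows "norm (T x) \<le> sqrt (\<Sum>\<^sub>\<infinity>e\<in>onb. (norm (T e))\<^sup>2) * norm x"
proof -
  define s where "s = (\<Sum>\<^sub>\<infinity>e\<in>onb. (norm (T e))\<^sup>2)"
  have sum: "(\<lambda>e. (norm (T e))\<^sup>2) summable_on onb" and bl: "bounded_linear T"
    and cT: "\<And>c x. T (c *\<^sub>C x) = c *\<^sub>C T x"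
    using T by (auto simp: hilbert_schmidt_def bounded_clinear_def)
  have E: "\<And>x y. x \<in> onb \<Longrightarrow> y \<in> onb \<Longrightarrow> cinner x y = (if x = y then 1 else (0::complex))"
    and tot: "\<And>x::'a. \<forall>e\<in>onb. cinner x e = 0 \<Longrightarrow> x = 0"
    using orthonormal_basis_onb by (auto simp: orthonormal_basis_def)
  define V where "V = {\<Sum>e\<in>F. c e *\<^sub>C e | c F. finite F \<and> F \<subseteq> (onb::'a set)}"
  have VI: "(\<Sum>e\<in>F. c e *\<^sub>C e) \<in> V" if "finite F" "F \<subseteq> onb" for c F
    using that by (auto simp: V_def)
  have Vadd: "a + b \<in> V" if ab: "a \<in> V" "b \<in> V" for a b
  proof -
    obtain c F d G where *: "a = (\<Sum>e\<in>F. c e *\<^sub>C e)" "finite F" "F \<subseteq> onb"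
      "b = (\<Sum>e\<in>G. d e *\<^sub>C e)" "finite G" "G \<subseteq> onb"
      using ab by (auto simp: V_def)
    define c' d' where "c' e = (if e \<in> F then c e else 0)" and "d' e = (if e \<in> G then d e else 0)" for e
    have "a = (\<Sum>e\<in>F \<union> G. c' e *\<^sub>C e)"
      unfolding *(1) using * by (intro sum.mono_neutral_cong_left) (auto simp: c'_def scaleC_zero_left)
    moreover have "b = (\<Sum>e\<in>F \<union> G. d' e *\<^sub>C e)"
      unfolding *(4) using * by (intro sum.mono_neutral_cong_left) (auto simp: d'_def scaleC_zero_left)
    ultimately have "a + b = (\<Sum>e\<in>F \<union> G. (c' e + d' e) *\<^sub>C e)"
      by (simp add: scaleC_add_left sum.distrib)
    then show ?thesis using VI[of "F \<union> G" "\<lambda>e. c' e + d' e"] * by simp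
  qed
  have scsum: "c *\<^sub>C (\<Sum>e\<in>F. f e) = (\<Sum>e\<in>F. c *\<^sub>C f e)" for c F and f :: "'a \<Rightarrow> 'a"
    by (induction F rule: infinite_finite_induct) (auto simp: scaleC_zero_right scaleC_add_right)
  have Vsc: "c *\<^sub>C a \<in> V" if "a \<in> V" for a c
  proof -
    obtain d F where "a = (\<Sum>e\<in>F. d e *\<^sub>C e)" "finite F" "F \<subseteq> onb" using \<open>a \<in> V\<close> by (auto simp: V_def)
    then show ?thesis using VI[of F "\<lambda>e. c * d e"] by (simp add: scsum scaleC_scaleC)
  qed
  have subV: "subspace V"
    unfolding subspace_def using Vadd Vsc VI[of "{}"] by (auto simp: scaleR_scaleC)
  have dense: "closure V = UNIV"
  proof (rule ccontr)
    assume "closure V \<noteq> UNIV"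
    then obtain x where x: "x \<notin> closure V" by auto
    have cc: "c *\<^sub>C a \<in> closure V" if aV: "a \<in> closure V" for a c
    proof -
      obtain f where "\<And>n. f n \<in> V" "f \<longlonglongrightarrow> a"
        using aV unfolding closure_sequential by blast
      then have "\<forall>n. c *\<^sub>C f n \<in> V" "(\<lambda>n. c *\<^sub>C f n) \<longlonglongrightarrow> c *\<^sub>C a"
        using Vsc tendsto_scaleC by blast+
      then show ?thesis
        unfolding closure_sequential by (intro exI[of _ "\<lambda>n. c *\<^sub>C f n"] conjI)
    qed
    have ca: "a + b \<in> closure V" if ab: "a \<in> closure V" "b \<in> closure V" for a b
    proof -
      obtain f g where "\<And>n. f n \<in> V" "f \<longlonglongrightarrow> a" "\<And>n. g n \<in> V" "g \<longlonglongrightarrow> b"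
        using ab unfolding closure_sequential by blast
      then have "\<forall>n. f n + g n \<in> V" "(\<lambda>n. f n + g n) \<longlonglongrightarrow> a + b"
        using Vadd tendsto_add by blast+
      then show ?thesis
        unfolding closure_sequential by (intro exI[of _ "\<lambda>n. f n + g n"] conjI)
    qed
    have "0 \<in> closure V" using subspace_0[OF subV] closure_subset by blast
    then have sc: "subspace (closure V)"
      unfolding subspace_def using ca cc by (auto simp: scaleR_scaleC)
    obtain z where z: "z \<noteq> 0" "\<forall>y\<in>closure V. cinner z y = 0"
      using complement_nontrivial[OF closed_closure sc cc x] by blast
    have "e \<in> closure V" if "e \<in> onb" for e
      using VI[of "{e}" "\<lambda>_. 1"] that closure_subset by (auto simp: scaleC_one)
    then show False using tot z by blast
  qed
  have onV: "norm (T a) \<le> sqrt s * norm a" if "a \<in> V" for a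
  proof -
    obtain c F where a: "a = (\<Sum>e\<in>F. c e *\<^sub>C e)" and F: "finite F" "F \<subseteq> onb"
      using \<open>a \<in> V\<close> by (auto simp: V_def)
    have cs: "cinner (\<Sum>e\<in>F. f e) y = (\<Sum>e\<in>F. cinner (f e) y)" for f :: "'a \<Rightarrow> 'a" and y
      by (induction F rule: infinite_finite_induct) (auto simp: cinner_zero_left cinner_add_left)
    have ce: "cinner a e = c e" if "e \<in> F" for e
    proof -
      have "cinner (c x *\<^sub>C x) e = (if x = e then c e else 0)" if "x \<in> F" for x
        using E[of x e] subsetD[OF F(2) that] subsetD[OF F(2) \<open>e \<in> F\<close>] by (auto simp: cinner_scaleC_left)
      then have "cinner a e = (\<Sum>x\<in>F. if x = e then c e else 0)"
        unfolding a cs by (intro sum.cong) auto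
      then show ?thesis using F that by simp
    qed
    have "complex_of_real ((norm a)\<^sup>2) = (\<Sum>e\<in>F. c e * cinner e a)"
      by (subst cinner_self[symmetric], subst (1) a) (simp add: cs cinner_scaleC_left)
    also have "\<dots> = complex_of_real (\<Sum>e\<in>F. (cmod (c e))\<^sup>2)"
      unfolding of_real_sum
      by (intro sum.cong refl, subst cinner_commute)
         (simp add: ce complex_norm_square del: of_real_power)
    finally have na: "(norm a)\<^sup>2 = (\<Sum>e\<in>F. (cmod (c e))\<^sup>2)" by (simp only: of_real_eq_iff)
    have "norm (T a) \<le> (\<Sum>e\<in>F. norm (T (c e *\<^sub>C e)))"
      unfolding a linear_sum[OF bounded_linear.linear[OF bl]] by (rule norm_sum)
    also have "\<dots> = (\<Sum>e\<in>F. cmod (c e) * norm (T e))" by (simp add: cT norm_scaleC)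
    finally have "(norm (T a))\<^sup>2 \<le> (\<Sum>e\<in>F. cmod (c e) * norm (T e))\<^sup>2"
      by (intro power_mono) auto
    also have "\<dots> \<le> (\<Sum>e\<in>F. (cmod (c e))\<^sup>2) * (\<Sum>e\<in>F. (norm (T e))\<^sup>2)"
      by (rule Cauchy_Schwarz_ineq_sum)
    also have "\<dots> \<le> (norm a)\<^sup>2 * s"
      unfolding na s_def by (intro mult_left_mono finite_sum_le_infsum sum F sum_nonneg) auto
    also have "\<dots> = (sqrt s * norm a)\<^sup>2"
      by (simp add: power_mult_distrib s_def infsum_nonneg)
    finally show ?thesis
      by (rule power2_le_imp_le) (simp add: s_def infsum_nonneg)
  qed
  have "closed {x. norm (T x) \<le> sqrt s * norm x}"
    by (intro closed_Collect_le continuous_intros linear_continuous_on bl)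
  then have "closure V \<subseteq> {x. norm (T x) \<le> sqrt s * norm x}"
    using onV by (intro closure_minimal) auto
  then show ?thesis unfolding dense s_def by auto
qed

lemma hs_onb_summable: "(\<lambda>e. (norm (hs_apply T e))\<^sup>2) summable_on onb"
  using hs_apply[of T] by (simp add: hilbert_schmidt_def)

lemma hs_summable_cinner:
  "hilbert_schmidt S \<Longrightarrow> hilbert_schmidt T \<Longrightarrow> (\<lambda>e. cinner (S e) (T e)) summable_on onb"
proof (rule Infinite_Sum.abs_summable_summable, rule summable_on_comparison_test)
  assume "hilbert_schmidt S" "hilbert_schmidt T"
  then show "(\<lambda>e. (norm (S e))\<^sup>2 + (norm (T e))\<^sup>2) summable_on onb"
    by (intro summable_on_add) (auto simp: hilbert_schmidt_def)
  fix e
  have "cmod (cinner (S e) (T e)) \<le> norm (S e) * norm (T e)" by (rule norm_cinner_le)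
  also have "2 * \<dots> \<le> (norm (S e))\<^sup>2 + (norm (T e))\<^sup>2"
    using sum_squares_bound[of "norm (S e)" "norm (T e)"] by simp
  finally show "cmod (cinner (S e) (T e)) \<le> (norm (S e))\<^sup>2 + (norm (T e))\<^sup>2"
    by (smt (verit) mult_nonneg_nonneg norm_ge_zero)
qed simp_all

lemma hilbert_schmidt_zero: "hilbert_schmidt (\<lambda>x. 0)"
  by (auto simp: hilbert_schmidt_def scaleC_zero_right intro!: bounded_clinearI[of _ 0])

lemma hilbert_schmidt_add:
  assumes "hilbert_schmidt S" "hilbert_schmidt T"
  shows "hilbert_schmidt (\<lambda>x. S x + T x)"
proof -
  have bl: "bounded_clinear (\<lambda>x. S x + T x)"
    using assms by (auto simp: hilbert_schmidt_def bounded_clinear_def scaleC_add_right bounded_linear_add)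
  have "(\<lambda>e. (norm (S e + T e))\<^sup>2) summable_on onb"
  proof (rule summable_on_comparison_test)
    show "(\<lambda>e. 2 * (norm (S e))\<^sup>2 + 2 * (norm (T e))\<^sup>2) summable_on onb"
      using assms by (intro summable_on_add summable_on_cmult_right) (auto simp: hilbert_schmidt_def)
    show "(norm (S e + T e))\<^sup>2 \<le> 2 * (norm (S e))\<^sup>2 + 2 * (norm (T e))\<^sup>2" for e
    proof -
      have "(norm (S e + T e))\<^sup>2 \<le> (norm (S e) + norm (T e))\<^sup>2"
        by (simp add: norm_triangle_ineq)
      also have "\<dots> \<le> 2 * (norm (S e))\<^sup>2 + 2 * (norm (T e))\<^sup>2"
        using sum_squares_bound[of "norm (S e)" "norm (T e)"] by (simp add: power2_sum)
      finally show ?thesis .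
    qed
  qed auto
  with bl show ?thesis by (simp add: hilbert_schmidt_def)
qed

lemma hilbert_schmidt_scaleC:
  assumes "hilbert_schmidt T" shows "hilbert_schmidt (\<lambda>x. c *\<^sub>C T x)"
proof -
  obtain K where "\<And>x. norm (T x) \<le> K * norm x" "K \<ge> 0"
    using bounded_clinear_pos assms unfolding hilbert_schmidt_def by blast
  then have "norm (c *\<^sub>C T x) \<le> (cmod c * K) * norm x" for x
    by (simp add: norm_scaleC mult_left_mono mult.assoc)
  then have "bounded_clinear (\<lambda>x. c *\<^sub>C T x)"
    using assms
    by (intro bounded_clinearI[of _ "cmod c * K"])
       (auto simp: hilbert_schmidt_def bounded_clinear_def linear_simps(1) scaleC_add_right
         scaleC_scaleC mult.commute)
  moreover have "(\<lambda>e. (norm (c *\<^sub>C T e))\<^sup>2) summable_on onb"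
    using assms by (simp add: norm_scaleC power_mult_distrib summable_on_cmult_right hilbert_schmidt_def)
  ultimately show ?thesis by (simp add: hilbert_schmidt_def)
qed

instantiation hs :: (complex_hilbert) complex_inner
begin

lift_definition zero_hs :: "'a hs" is "\<lambda>x. 0" by (rule hilbert_schmidt_zero)

lift_definition plus_hs :: "'a hs \<Rightarrow> 'a hs \<Rightarrow> 'a hs" is "\<lambda>S T x. S x + T x"
  by (rule hilbert_schmidt_add)

lift_definition scaleC_hs :: "complex \<Rightarrow> 'a hs \<Rightarrow> 'a hs" is "\<lambda>c T x. c *\<^sub>C T x"
  by (rule hilbert_schmidt_scaleC)

lift_definition cinner_hs :: "'a hs \<Rightarrow> 'a hs \<Rightarrow> complex" is
  "\<lambda>S T. \<Sum>\<^sub>\<infinity>e\<in>onb. cinner (S e) (T e)" .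

definition "uminus S = (-1) *\<^sub>C S" for S :: "'a hs"
definition "S - T = S + (-1) *\<^sub>C T" for S T :: "'a hs"
definition "r *\<^sub>R S = complex_of_real r *\<^sub>C S" for S :: "'a hs"
definition "inner S T = Re (cinner S T)" for S T :: "'a hs"
definition "norm S = sqrt (inner S S)" for S :: "'a hs"
definition "sgn S = complex_of_real (inverse (norm S)) *\<^sub>C S" for S :: "'a hs"
definition "dist S T = norm (S - T)" for S T :: "'a hs"
definition "(uniformity :: ('a hs \<times> 'a hs) filter) = (INF e\<in>{0<..}. principal {(x, y). dist x y < e})"
definition "open A = (\<forall>x\<in>A. \<forall>\<^sub>F (x', y) in uniformity. x' = x \<longrightarrow> y \<in> A)" for A :: "'a hs set"

instance
proof
  have a1: "(b + c) *\<^sub>C x = b *\<^sub>C x + c *\<^sub>C x" for b c and x :: "'a hs"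
    by transfer (simp add: scaleC_add_left)
  have a2: "c *\<^sub>C (x + y) = c *\<^sub>C x + c *\<^sub>C y" for c and x y :: "'a hs"
    by transfer (simp add: scaleC_add_right)
  have a3: "b *\<^sub>C c *\<^sub>C x = (b * c) *\<^sub>C x" for b c and x :: "'a hs"
    by transfer (simp add: scaleC_scaleC)
  have a4: "1 *\<^sub>C x = x" for x :: "'a hs"
    by transfer (simp add: scaleC_one)
  have a5: "0 *\<^sub>C x = 0" for x :: "'a hs"
    by transfer (simp add: scaleC_zero_left)
  show "x + y + z = x + (y + z)" for x y z :: "'a hs"
    by transfer (simp add: add.assoc)
  show "x + y = y + x" for x y :: "'a hs"
    by transfer (simp add: add.commute)
  show "0 + x = x" for x :: "'a hs"
    by transfer simp
  show "- x + x = 0" for x :: "'a hs"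
    using a1[of "-1" 1 x] by (simp add: uminus_hs_def a4 a5)
  show "x - y = x + - y" for x y :: "'a hs"
    by (simp add: uminus_hs_def minus_hs_def)
  show "c *\<^sub>C (x + y) = c *\<^sub>C x + c *\<^sub>C y" for c and x y :: "'a hs" by (rule a2)
  show "(b + c) *\<^sub>C x = b *\<^sub>C x + c *\<^sub>C x" for b c and x :: "'a hs" by (rule a1)
  show "b *\<^sub>C c *\<^sub>C x = (b * c) *\<^sub>C x" for b c and x :: "'a hs" by (rule a3)
  show "r *\<^sub>R x = complex_of_real r *\<^sub>C x" for r and x :: "'a hs"
    by (simp add: scaleR_hs_def)
  show "r *\<^sub>R (x + y) = r *\<^sub>R x + r *\<^sub>R y" for r and x y :: "'a hs"
    by (simp add: scaleR_hs_def a2)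
  show "(r + t) *\<^sub>R x = r *\<^sub>R x + t *\<^sub>R x" for r t and x :: "'a hs"
    by (simp add: scaleR_hs_def a1)
  show "r *\<^sub>R t *\<^sub>R x = (r * t) *\<^sub>R x" for r t and x :: "'a hs"
    by (simp add: scaleR_hs_def a3)
  show "1 *\<^sub>R x = x" for x :: "'a hs"
    by (simp add: scaleR_hs_def a4)
  show cc: "cinner x y = cnj (cinner y x)" for x y :: "'a hs"
    by transfer (simp flip: infsum_cnj cinner_commute)
  show ca: "cinner (x + y) z = cinner x z + cinner y z" for x y z :: "'a hs"
    by transfer (simp add: cinner_add_left infsum_add hs_summable_cinner)
  show cm: "cinner (c *\<^sub>C x) y = c * cinner x y" for c and x y :: "'a hs"
    by transfer (simp add: cinner_scaleC_left infsum_cmult_right hs_summable_cinner)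
  show "inner x y = Re (cinner x y)" for x y :: "'a hs"
    by (simp add: inner_hs_def)
  show "inner x y = inner y x" for x y :: "'a hs"
    unfolding inner_hs_def by (subst cc) simp
  show "inner (x + y) z = inner x z + inner y z" for x y z :: "'a hs"
    by (simp add: inner_hs_def ca)
  show "inner (r *\<^sub>R x) y = r * inner x y" for r and x y :: "'a hs"
    by (simp add: inner_hs_def scaleR_hs_def cm)
  have ii: "inner x x = (\<Sum>\<^sub>\<infinity>e\<in>onb. (norm (hs_apply x e))\<^sup>2)" for x :: "'a hs"
    unfolding inner_hs_def cinner_hs.rep_eq
    using infsum_Re[OF hs_summable_cinner[of "hs_apply x" "hs_apply x"]] hs_apply[of x]
    by (simp add: cinner_self del: of_real_power)
  show "0 \<le> inner x x" for x :: "'a hs"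
    unfolding ii by (rule infsum_nonneg) simp
  show "inner x x = 0 \<longleftrightarrow> x = 0" for x :: "'a hs"
  proof
    assume "inner x x = 0"
    then have "norm (hs_apply x v) \<le> 0" for v
      using hs_norm_bound[of "hs_apply x" v] hs_apply[of x] by (simp add: ii)
    then show "x = 0" by transfer (simp add: fun_eq_iff)
  qed (simp add: ii zero_hs.rep_eq)
  show "norm x = sqrt (inner x x)" for x :: "'a hs" by (simp add: norm_hs_def)
  show "sgn x = inverse (norm x) *\<^sub>R x" for x :: "'a hs" by (simp add: sgn_hs_def scaleR_hs_def)
  show "dist x y = norm (x - y)" for x y :: "'a hs" by (simp add: dist_hs_def)
  show "(uniformity :: ('a hs \<times> 'a hs) filter) = (INF e\<in>{0<..}. principal {(x, y). dist x y < e})"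
    by (rule uniformity_hs_def)
  show "open A = (\<forall>x\<in>A. \<forall>\<^sub>F (x', y) in uniformity. x' = x \<longrightarrow> y \<in> A)" for A :: "'a hs set"
    by (rule open_hs_def)
qed

end

lemma norm_hs_eq: "norm T = sqrt (\<Sum>\<^sub>\<infinity>e\<in>onb. (norm (hs_apply T e))\<^sup>2)"
proof -
  have "inner T T = (\<Sum>\<^sub>\<infinity>e\<in>onb. (norm (hs_apply T e))\<^sup>2)"
    unfolding inner_hs_def cinner_hs.rep_eq
    using infsum_Re[OF hs_summable_cinner[of "hs_apply T" "hs_apply T"]] hs_apply[of T]
    by (simp add: cinner_self del: of_real_power)
  then show ?thesis by (simp add: norm_hs_def)
qed

lemma norm_hs_apply_le: "norm (hs_apply T x) \<le> norm T * norm x"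
  using hs_norm_bound[of "hs_apply T" x] hs_apply[of T] by (simp add: norm_hs_eq)

lemma hs_apply_diff: "hs_apply (S - T) x = hs_apply S x - hs_apply T x"
  using scaleR_scaleC[of "-1" "hs_apply T x"]
  by (simp add: minus_hs_def plus_hs.rep_eq scaleC_hs.rep_eq)

lemma hs_finite_sum_le:
  "finite F \<Longrightarrow> F \<subseteq> onb \<Longrightarrow> (\<Sum>e\<in>F. (norm (hs_apply T e))\<^sup>2) \<le> (norm T)\<^sup>2"
  by (simp add: norm_hs_eq infsum_nonneg finite_sum_le_infsum hs_onb_summable)

instance hs :: (complex_hilbert) complex_hilbert
proof
  fix X :: "nat \<Rightarrow> 'a hs"
  assume C: "Cauchy X"
  have "Cauchy (\<lambda>n. hs_apply (X n) x)" for x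
  proof (rule metric_CauchyI)
    fix e :: real assume e: "e > 0"
    obtain M where M: "\<And>m n. m \<ge> M \<Longrightarrow> n \<ge> M \<Longrightarrow> dist (X m) (X n) < e / (norm x + 1)"
      using metric_CauchyD[OF C, of "e / (norm x + 1)"] e by (auto simp: add_nonneg_pos)
    have "dist (hs_apply (X m) x) (hs_apply (X n) x) < e" if "m \<ge> M" "n \<ge> M" for m n
    proof -
      have "dist (hs_apply (X m) x) (hs_apply (X n) x) \<le> norm (X m - X n) * norm x"
        using norm_hs_apply_le[of "X m - X n" x] by (simp add: dist_norm hs_apply_diff)
      also have "\<dots> \<le> e / (norm x + 1) * norm x"
        using M[OF that] by (intro mult_right_mono) (auto simp: dist_norm)
      also have "\<dots> < e" using e by (simp add: field_simps add_pos_nonneg)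
      finally show ?thesis .
    qed
    then show "\<exists>M. \<forall>m\<ge>M. \<forall>n\<ge>M. dist (hs_apply (X m) x) (hs_apply (X n) x) < e" by blast
  qed
  then have "\<forall>x. \<exists>y. (\<lambda>n. hs_apply (X n) x) \<longlonglongrightarrow> y"
    using Cauchy_convergent convergent_def by blast
  then obtain T where T: "\<And>x. (\<lambda>n. hs_apply (X n) x) \<longlonglongrightarrow> T x" by metis
  obtain K where K: "\<And>n. norm (X n) \<le> K"
    using cauchy_imp_bounded[OF C] by (auto simp: bounded_iff)
  have bl: "bounded_linear (hs_apply (X n))" and cX: "hs_apply (X n) (c *\<^sub>C x) = c *\<^sub>C hs_apply (X n) x" for n c x
    using hs_apply[of "X n"] by (auto simp: hilbert_schmidt_def bounded_clinear_def)
  have bT: "bounded_clinear T"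
  proof (rule bounded_clinearI)
    show "T (x + y) = T x + T y" for x y
      using T[of "x + y"] tendsto_add[OF T[of x] T[of y]]
      by (intro LIMSEQ_unique) (simp_all add: linear_simps(1)[OF bl])
    show "T (c *\<^sub>C x) = c *\<^sub>C T x" for c x
      using T[of "c *\<^sub>C x"] tendsto_scaleC[OF T[of x], of c]
      by (intro LIMSEQ_unique) (simp_all add: cX)
    show "norm (T x) \<le> K * norm x" for x
      by (rule tendsto_upperbound[OF tendsto_norm[OF T[of x]]])
         (auto intro!: always_eventually order_trans[OF norm_hs_apply_le] mult_right_mono K)
  qed
  have fin: "(\<Sum>x\<in>F. (norm (hs_apply (X n) x - T x))\<^sup>2) \<le> e\<^sup>2"
    if "finite F" "F \<subseteq> onb" "\<And>m. m \<ge> M \<Longrightarrow> dist (X n) (X m) \<le> e" for F n M e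
  proof (rule tendsto_upperbound)
    show "(\<lambda>m. \<Sum>x\<in>F. (norm (hs_apply (X n) x - hs_apply (X m) x))\<^sup>2)
        \<longlonglongrightarrow> (\<Sum>x\<in>F. (norm (hs_apply (X n) x - T x))\<^sup>2)"
      by (intro tendsto_intros T)
    show "\<forall>\<^sub>F m in sequentially. (\<Sum>x\<in>F. (norm (hs_apply (X n) x - hs_apply (X m) x))\<^sup>2) \<le> e\<^sup>2"
      using eventually_ge_at_top[of M]
    proof eventually_elim
      case (elim m)
      have "(\<Sum>x\<in>F. (norm (hs_apply (X n) x - hs_apply (X m) x))\<^sup>2) \<le> (norm (X n - X m))\<^sup>2"
        using hs_finite_sum_le[OF that(1,2), of "X n - X m"] by (simp add: hs_apply_diff)
      also have "\<dots> \<le> e\<^sup>2" using that(3)[OF elim] by (intro power_mono) (auto simp: dist_norm)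
      finally show ?case .
    qed
  qed simp
  have bdiff: "bounded_clinear (\<lambda>x. hs_apply (X n) x - T x)" for n
    using bT bl[of n] cX[of n]
    by (auto simp: bounded_clinear_def bounded_linear_sub scaleC_diff_right)
  have hsd: "hilbert_schmidt (\<lambda>x. hs_apply (X n) x - T x)"
    if "\<And>m. m \<ge> M \<Longrightarrow> dist (X n) (X m) \<le> e" for n M e
    unfolding hilbert_schmidt_def
  proof (intro conjI bdiff nonneg_bdd_above_summable_on)
    show "bdd_above (sum (\<lambda>x. (norm (hs_apply (X n) x - T x))\<^sup>2) ` {F. F \<subseteq> onb \<and> finite F})"
      using fin that by (intro bdd_aboveI2[of _ _ "e\<^sup>2"]) auto
  qed simp
  obtain M where M: "\<And>m n. m \<ge> M \<Longrightarrow> n \<ge> M \<Longrightarrow> dist (X m) (X n) < 1"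
    using metric_CauchyD[OF C, of 1] by auto
  have hT: "hilbert_schmidt T"
  proof -
    have "hilbert_schmidt (\<lambda>x. hs_apply (X M) x - T x)"
      by (rule hsd[of M]) (use M in \<open>auto intro: less_imp_le\<close>)
    from hilbert_schmidt_add[OF _ hilbert_schmidt_scaleC[OF this, of "-1"], of "hs_apply (X M)"]
    have "hilbert_schmidt (\<lambda>x. hs_apply (X M) x + (-1) *\<^sub>C (hs_apply (X M) x - T x))"
      using hs_apply[of "X M"] by simp
    moreover have "(-1) *\<^sub>C x = - x" for x :: 'a using scaleR_scaleC[of "-1" x] by simp
    ultimately show ?thesis by simp
  qed
  define L where "L = Abs_hs T"
  have L: "hs_apply L = T" unfolding L_def using hT by (intro Abs_hs_inverse) simp
  have "X \<longlonglongrightarrow> L"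
  proof (rule metric_LIMSEQ_I)
    fix e :: real assume e: "e > 0"
    obtain M where M: "\<And>m n. m \<ge> M \<Longrightarrow> n \<ge> M \<Longrightarrow> dist (X m) (X n) < e / 2"
      using metric_CauchyD[OF C, of "e/2"] e by auto
    have "dist (X n) L < e" if n: "n \<ge> M" for n
    proof -
      have "(\<Sum>\<^sub>\<infinity>x\<in>onb. (norm (hs_apply (X n) x - T x))\<^sup>2) \<le> (e/2)\<^sup>2"
        using hs_onb_summable[of "X n - L"]
        by (intro infsum_le_finite_sums fin[of _ M])
           (use M n in \<open>auto simp: hs_apply_diff L intro: less_imp_le\<close>)
      then have "dist (X n) L \<le> e/2"
        unfolding dist_norm norm_hs_eq hs_apply_diff L
        using e by (intro real_le_lsqrt infsum_nonneg) auto
      then show ?thesis using e by simp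
    qed
    then show "\<exists>M. \<forall>n\<ge>M. dist (X n) L < e" by blast
  qed
  then show "convergent X" by (rule convergentI)
qed

section \<open>The Hilbert space \<open>L\<^sup>2\<close>\<close>

definition square_integrable :: "('a::euclidean_space \<Rightarrow> complex) \<Rightarrow> bool" where
  "square_integrable f \<longleftrightarrow>
     f \<in> borel_measurable lborel \<and> integrable lborel (\<lambda>x. (cmod (f x))\<^sup>2)"

lemma sq_int_meas: "square_integrable f \<Longrightarrow> f \<in> borel_measurable borel"
  by (simp add: square_integrable_def)

lemma sq_int_zero: "square_integrable (\<lambda>x. 0)"
  by (simp add: square_integrable_def)

lemma sq_int_add:
  assumes "square_integrable f" "square_integrable g"
  shows "square_integrable (\<lambda>x. f x + g x)"
proof -
  note [measurable] = assms[THEN sq_int_meas]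
  have "integrable lborel (\<lambda>x. (cmod (f x + g x))\<^sup>2)"
  proof (rule Bochner_Integration.integrable_bound)
    show "integrable lborel (\<lambda>x. 2 * (cmod (f x))\<^sup>2 + 2 * (cmod (g x))\<^sup>2)"
      using assms by (simp add: square_integrable_def)
    show "AE x in lborel. norm ((cmod (f x + g x))\<^sup>2)
            \<le> norm (2 * (cmod (f x))\<^sup>2 + 2 * (cmod (g x))\<^sup>2)"
    proof (rule AE_I2)
      fix x
      have "(cmod (f x + g x))\<^sup>2 \<le> (cmod (f x) + cmod (g x))\<^sup>2"
        by (simp add: norm_triangle_ineq)
      also have "\<dots> \<le> 2 * (cmod (f x))\<^sup>2 + 2 * (cmod (g x))\<^sup>2"
        using sum_squares_bound[of "cmod (f x)" "cmod (g x)"] by (simp add: power2_sum)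
      finally show "norm ((cmod (f x + g x))\<^sup>2)
            \<le> norm (2 * (cmod (f x))\<^sup>2 + 2 * (cmod (g x))\<^sup>2)" by simp
    qed
  qed simp
  then show ?thesis by (simp add: square_integrable_def)
qed

lemma sq_int_cmult:
  assumes "square_integrable f" shows "square_integrable (\<lambda>x. c * f x)"
  using assms sq_int_meas[OF assms, measurable]
  by (simp add: square_integrable_def norm_mult power_mult_distrib)

lemma measurable_cnj [measurable (raw)]:
  "f \<in> borel_measurable M \<Longrightarrow> (\<lambda>x. cnj (f x)) \<in> borel_measurable M"
  by (rule measurable_compose[of f M borel cnj borel])
     (auto intro!: borel_measurable_continuous_onI continuous_intros)

lemma sq_int_mult_cnj:
  assumes "square_integrable f" "square_integrable g"
  shows "integrable lborel (\<lambda>x. f x * cnj (g x))"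
proof -
  note [measurable] = assms[THEN sq_int_meas]
  show ?thesis
  proof (rule Bochner_Integration.integrable_bound)
    show "integrable lborel (\<lambda>x. (cmod (f x))\<^sup>2 + (cmod (g x))\<^sup>2)"
      using assms by (simp add: square_integrable_def)
    show "AE x in lborel. norm (f x * cnj (g x)) \<le> norm ((cmod (f x))\<^sup>2 + (cmod (g x))\<^sup>2)"
    proof (rule AE_I2)
      fix x
      have "2 * (cmod (f x) * cmod (g x)) \<le> (cmod (f x))\<^sup>2 + (cmod (g x))\<^sup>2"
        using sum_squares_bound[of "cmod (f x)" "cmod (g x)"] by simp
      then have "cmod (f x) * cmod (g x) \<le> (cmod (f x))\<^sup>2 + (cmod (g x))\<^sup>2"
        by (smt (verit) mult_nonneg_nonneg norm_ge_zero)
      then show "norm (f x * cnj (g x)) \<le> norm ((cmod (f x))\<^sup>2 + (cmod (g x))\<^sup>2)"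
        by (simp add: norm_mult)
    qed
  qed simp
qed

text \<open>\<open>L\<^sup>2\<close> is the quotient of the square-integrable functions by equality almost everywhere;
  \<open>to_L2 f\<close> is the class of \<open>f\<close>, and is meaningful only for square-integrable \<open>f\<close>.\<close>

definition L2_rel :: "('a::euclidean_space \<Rightarrow> complex) \<Rightarrow> ('a \<Rightarrow> complex) \<Rightarrow> bool" where
  "L2_rel f g \<longleftrightarrow> square_integrable f \<and> square_integrable g \<and> (AE x in lborel. f x = g x)"

quotient_type (overloaded) 'a L2 = "'a::euclidean_space \<Rightarrow> complex" / partial: L2_rel
  morphisms rep_L2 to_L2
proof (rule part_equivpI)
  show "\<exists>f. L2_rel f f"
    by (rule exI[of _ "\<lambda>x. 0"]) (simp add: L2_rel_def sq_int_zero)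
  show "symp L2_rel"
    by (rule sympI) (auto simp: L2_rel_def elim: AE_mp)
  show "transp L2_rel"
  proof (rule transpI)
    fix f g h assume "L2_rel f g" "L2_rel g h"
    moreover from this have "AE x in lborel. f x = h x"
      by (auto simp: L2_rel_def elim: AE_mp[OF _ AE_mp])
    ultimately show "L2_rel f h" by (simp add: L2_rel_def)
  qed
qed

text \<open>The inner product is linear in its first argument.\<close>

instantiation L2 :: (euclidean_space) complex_inner
begin

lift_definition zero_L2 :: "'a L2" is "\<lambda>x. 0"
  by (simp add: L2_rel_def sq_int_zero)

lift_definition plus_L2 :: "'a L2 \<Rightarrow> 'a L2 \<Rightarrow> 'a L2" is "\<lambda>f g x. f x + g x"
  by (auto simp: L2_rel_def sq_int_add)

lift_definition scaleC_L2 :: "complex \<Rightarrow> 'a L2 \<Rightarrow> 'a L2" is "\<lambda>c f x. c * f x"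
  by (auto simp: L2_rel_def sq_int_cmult)

lift_definition cinner_L2 :: "'a L2 \<Rightarrow> 'a L2 \<Rightarrow> complex" is
  "\<lambda>f g. \<integral>x. f x * cnj (g x) \<partial>lborel"
  apply (rule integral_cong_AE)
  apply (auto simp: L2_rel_def dest!: sq_int_meas)[2]
  apply (auto simp: L2_rel_def)
  done

definition "uminus f = (-1) *\<^sub>C f" for f :: "'a L2"
definition "f - g = f + (-1) *\<^sub>C g" for f g :: "'a L2"
definition "r *\<^sub>R f = complex_of_real r *\<^sub>C f" for f :: "'a L2"
definition "inner f g = Re (cinner f g)" for f g :: "'a L2"
definition "norm f = sqrt (inner f f)" for f :: "'a L2"
definition "sgn f = complex_of_real (inverse (norm f)) *\<^sub>C f" for f :: "'a L2"
definition "dist f g = norm (f - g)" for f g :: "'a L2"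
definition "(uniformity :: ('a L2 \<times> 'a L2) filter) = (INF e\<in>{0<..}. principal {(x, y). dist x y < e})"
definition "open S = (\<forall>x\<in>S. \<forall>\<^sub>F (x', y) in uniformity. x' = x \<longrightarrow> y \<in> S)" for S :: "'a L2 set"

instance
proof
  have a1: "(b + c) *\<^sub>C x = b *\<^sub>C x + c *\<^sub>C x" for b c and x :: "'a L2"
    by transfer (auto simp: L2_rel_def algebra_simps intro!: sq_int_add sq_int_cmult)
  have a2: "c *\<^sub>C (x + y) = c *\<^sub>C x + c *\<^sub>C y" for c and x y :: "'a L2"
    by transfer (auto simp: L2_rel_def algebra_simps intro!: sq_int_add sq_int_cmult)
  have a3: "b *\<^sub>C c *\<^sub>C x = (b * c) *\<^sub>C x" for b c and x :: "'a L2"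
    by transfer (auto simp: L2_rel_def algebra_simps intro!: sq_int_cmult)
  have a4: "1 *\<^sub>C x = x" for x :: "'a L2"
    by transfer (auto simp: L2_rel_def)
  have a5: "0 *\<^sub>C x = 0" for x :: "'a L2"
    by transfer (auto simp: L2_rel_def sq_int_zero)
  show "x + y + z = x + (y + z)" for x y z :: "'a L2"
    by transfer (auto simp: L2_rel_def algebra_simps intro!: sq_int_add)
  show comm: "x + y = y + x" for x y :: "'a L2"
    by transfer (auto simp: L2_rel_def algebra_simps intro!: sq_int_add)
  show "0 + x = x" for x :: "'a L2"
    by transfer (auto simp: L2_rel_def)
  show "- x + x = 0" for x :: "'a L2"
    using a1[of "-1" 1 x] by (simp add: uminus_L2_def a4 a5)
  show "x - y = x + - y" for x y :: "'a L2"
    by (simp add: uminus_L2_def minus_L2_def)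
  show "c *\<^sub>C (x + y) = c *\<^sub>C x + c *\<^sub>C y" for c and x y :: "'a L2" by (rule a2)
  show "(b + c) *\<^sub>C x = b *\<^sub>C x + c *\<^sub>C x" for b c and x :: "'a L2" by (rule a1)
  show "b *\<^sub>C c *\<^sub>C x = (b * c) *\<^sub>C x" for b c and x :: "'a L2" by (rule a3)
  show "r *\<^sub>R x = complex_of_real r *\<^sub>C x" for r and x :: "'a L2"
    by (simp add: scaleR_L2_def)
  show "r *\<^sub>R (x + y) = r *\<^sub>R x + r *\<^sub>R y" for r and x y :: "'a L2"
    by (simp add: scaleR_L2_def a2)
  show "(r + t) *\<^sub>R x = r *\<^sub>R x + t *\<^sub>R x" for r t and x :: "'a L2"
    by (simp add: scaleR_L2_def a1)
  show "r *\<^sub>R t *\<^sub>R x = (r * t) *\<^sub>R x" for r t and x :: "'a L2"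
    by (simp add: scaleR_L2_def a3)
  show "1 *\<^sub>R x = x" for x :: "'a L2"
    by (simp add: scaleR_L2_def a4)
  show cc: "cinner x y = cnj (cinner y x)" for x y :: "'a L2"
    by transfer (simp add: mult.commute flip: Bochner_Integration.integral_cnj)
  show ca: "cinner (x + y) z = cinner x z + cinner y z" for x y z :: "'a L2"
    by transfer (auto simp: L2_rel_def distrib_right sq_int_mult_cnj)
  show cm: "cinner (c *\<^sub>C x) y = c * cinner x y" for c and x y :: "'a L2"
    by transfer (auto simp: L2_rel_def mult.assoc)
  show "inner x y = Re (cinner x y)" for x y :: "'a L2"
    by (simp add: inner_L2_def)
  show "inner x y = inner y x" for x y :: "'a L2"
    unfolding inner_L2_def by (subst cc) simp
  show "inner (x + y) z = inner x z + inner y z" for x y z :: "'a L2"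
    by (simp add: inner_L2_def ca)
  show "inner (r *\<^sub>R x) y = r * inner x y" for r and x y :: "'a L2"
    by (simp add: inner_L2_def scaleR_L2_def cm)
  have rc: "Re (\<integral>x. f x * cnj (f x) \<partial>lborel) = (\<integral>x. (cmod (f x))\<^sup>2 \<partial>lborel)"
    for f :: "'a \<Rightarrow> complex"
    by (simp add: complex_norm_square[symmetric] flip: of_real_power)
  show "0 \<le> inner x x" for x :: "'a L2"
    unfolding inner_L2_def by transfer (simp add: rc)
  show "inner x x = 0 \<longleftrightarrow> x = 0" for x :: "'a L2"
    unfolding inner_L2_def
    apply transfer
    apply (auto simp: rc L2_rel_def sq_int_zero)
     apply (subst (asm) integral_nonneg_eq_0_iff_AE)
       apply (auto simp: square_integrable_def)[3]
    apply (subst integral_nonneg_eq_0_iff_AE)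
      apply (auto simp: square_integrable_def)
    done
  show "norm x = sqrt (inner x x)" for x :: "'a L2" by (simp add: norm_L2_def)
  show "sgn x = inverse (norm x) *\<^sub>R x" for x :: "'a L2" by (simp add: sgn_L2_def scaleR_L2_def)
  show "dist x y = norm (x - y)" for x y :: "'a L2" by (simp add: dist_L2_def)
  show "(uniformity :: ('a L2 \<times> 'a L2) filter) = (INF e\<in>{0<..}. principal {(x, y). dist x y < e})"
    by (rule uniformity_L2_def)
  show "open S = (\<forall>x\<in>S. \<forall>\<^sub>F (x', y) in uniformity. x' = x \<longrightarrow> y \<in> S)" for S :: "'a L2 set"
    by (rule open_L2_def)
qed

end

lemma L2_cases:
  fixes x :: "'a::euclidean_space L2"
  obtains f where "square_integrable f" "x = to_L2 f"
proof
  have "L2_rel (rep_L2 x) (rep_L2 x)" by (rule Quotient_rep_reflp[OF Quotient_L2])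
  then show "square_integrable (rep_L2 x)" by (simp add: L2_rel_def)
  show "x = to_L2 (rep_L2 x)" by (simp add: Quotient_abs_rep[OF Quotient_L2])
qed

lemma to_L2_minus:
  assumes "square_integrable f" "square_integrable g"
  shows "to_L2 f - to_L2 g = to_L2 (\<lambda>x. f x - g x)"
proof -
  have "L2_rel f f" "L2_rel g g" using assms by (auto simp: L2_rel_def)
  then show ?thesis
    using sq_int_cmult[OF assms(2), of "-1"]
    by (simp add: minus_L2_def scaleC_L2.abs_eq plus_L2.abs_eq L2_rel_def)
qed

lemma norm_to_L2:
  assumes "square_integrable f"
  shows "ennreal ((norm (to_L2 f))\<^sup>2) = (\<integral>\<^sup>+x. ennreal ((cmod (f x))\<^sup>2) \<partial>lborel)"
proof -
  have "L2_rel f f" using assms by (auto simp: L2_rel_def)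
  then have "cinner (to_L2 f) (to_L2 f) = (\<integral>x. complex_of_real ((cmod (f x))\<^sup>2) \<partial>lborel)"
    by (simp add: cinner_L2.abs_eq complex_norm_square del: of_real_power)
  then have "(norm (to_L2 f))\<^sup>2 = (\<integral>x. (cmod (f x))\<^sup>2 \<partial>lborel)"
    by (simp add: power2_norm_eq_inner inner_cinner del: of_real_power)
  then show ?thesis
    using assms by (subst nn_integral_eq_integral) (auto simp: square_integrable_def)
qed

lemma norm_diff_to_L2:
  assumes "square_integrable f" "square_integrable g"
  shows "ennreal ((norm (to_L2 f - to_L2 g))\<^sup>2) = (\<integral>\<^sup>+x. ennreal ((cmod (f x - g x))\<^sup>2) \<partial>lborel)"
  using sq_int_add[OF assms(1) sq_int_cmult[OF assms(2), of "-1"]]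
  by (simp add: to_L2_minus[OF assms] norm_to_L2)

lemma summable_of_weighted_squares:
  fixes d :: "nat \<Rightarrow> complex"
  assumes "(\<Sum>k. ennreal (2 ^ k * (cmod (d k))\<^sup>2)) < \<infinity>"
  shows "summable d"
proof -
  have s: "summable (\<lambda>k. 2 ^ k * (cmod (d k))\<^sup>2)"
    by (rule summable_suminf_not_top) (use assms in auto)
  have b: "cmod (d k) \<le> 2 ^ k * (cmod (d k))\<^sup>2 + (1/2) ^ k" for k
  proof -
    have "0 \<le> 2 ^ k * (cmod (d k) - (1/2)^k)\<^sup>2" by simp
    also have "\<dots> = 2 ^ k * (cmod (d k))\<^sup>2 + (1/2) ^ k - 2 * cmod (d k)"
      by (simp add: power2_diff algebra_simps power_divide power2_eq_square)
    finally show ?thesis by (smt (verit) norm_ge_zero)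
  qed
  have "summable (\<lambda>k. 2 ^ k * (cmod (d k))\<^sup>2 + (1/2) ^ k)"
    by (intro summable_add s summable_geometric) simp
  then show ?thesis
    by (rule summable_comparison_test') (rule b)
qed

instance L2 :: (euclidean_space) complex_hilbert
proof
  fix X :: "nat \<Rightarrow> 'a L2"
  assume "Cauchy X"
  then have "\<forall>k. \<exists>M. \<forall>m\<ge>M. \<forall>n\<ge>M. dist (X m) (X n) < (1/2)^k"
    by (intro allI metric_CauchyD) auto
  then obtain B where B: "\<And>k m n. m \<ge> B k \<Longrightarrow> n \<ge> B k \<Longrightarrow> dist (X m) (X n) < (1/2)^k"
    by metis
  define r where "r k = k + (\<Sum>j\<le>k. B j)" for k
  have rB: "r k \<ge> B k" for k
    using member_le_sum[of k "{..k}" B] by (simp add: r_def)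
  have rS: "r (Suc k) \<ge> r k" for k by (simp add: r_def)
  have "\<forall>m. \<exists>f. square_integrable f \<and> X m = to_L2 f" by (meson L2_cases)
  then obtain w where w: "\<And>m. square_integrable (w m)" "\<And>m. X m = to_L2 (w m)" by metis
  note [measurable] = w(1)[THEN sq_int_meas]
  define u where "u k = w (r k)" for k
  have [measurable]: "u k \<in> borel_measurable borel" for k by (simp add: u_def)
  define v where "v t = lim (\<lambda>k. u k t)" for t
  have [measurable]: "v \<in> borel_measurable borel"
    unfolding v_def by measurable
  have nd: "ennreal ((dist (X m) (X (r k)))\<^sup>2) = (\<integral>\<^sup>+t. ennreal ((cmod (w m t - u k t))\<^sup>2) \<partial>lborel)" for m k
    using norm_diff_to_L2[OF w(1) w(1), of m "r k"] by (simp add: dist_norm w(2) u_def)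
  have "(\<integral>\<^sup>+t. (\<Sum>k. ennreal (2 ^ k * (cmod (u (Suc k) t - u k t))\<^sup>2)) \<partial>lborel)
      = (\<Sum>k. \<integral>\<^sup>+t. ennreal (2 ^ k * (cmod (u (Suc k) t - u k t))\<^sup>2) \<partial>lborel)"
    by (rule nn_integral_suminf) measurable
  also have "\<dots> = (\<Sum>k. ennreal (2 ^ k * (dist (X (r (Suc k))) (X (r k)))\<^sup>2))"
    by (simp add: ennreal_mult nn_integral_cmult nd[of "r (Suc k)" for k] u_def[of "Suc k" for k])
  also have "\<dots> \<le> (\<Sum>k. ennreal ((1/2) ^ k))"
  proof (intro suminf_le ennreal_leI)
    fix k
    have "dist (X (r (Suc k))) (X (r k)) \<le> (1/2)^k"
      using B[of k "r (Suc k)" "r k"] rB[of k] rS[of k] by simp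
    then have "2 ^ k * (dist (X (r (Suc k))) (X (r k)))\<^sup>2 \<le> 2 ^ k * ((1/2)^k)\<^sup>2"
      by (intro mult_left_mono power_mono) auto
    also have "\<dots> = (1/2)^k" by (simp add: power2_eq_square power_divide)
    finally show "2 ^ k * (dist (X (r (Suc k))) (X (r k)))\<^sup>2 \<le> (1/2)^k" .
  qed auto
  also have "\<dots> < \<infinity>"
    by (subst suminf_ennreal2) (auto intro!: summable_geometric)
  finally have "AE t in lborel. (\<Sum>k. ennreal (2 ^ k * (cmod (u (Suc k) t - u k t))\<^sup>2)) \<noteq> \<infinity>"
    by (intro nn_integral_PInf_AE) auto
  then have conv: "AE t in lborel. (\<lambda>k. u k t) \<longlonglongrightarrow> v t"
  proof eventually_elim
    fix t assume "(\<Sum>k. ennreal (2 ^ k * (cmod (u (Suc k) t - u k t))\<^sup>2)) \<noteq> \<infinity>"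
    then have "summable (\<lambda>k. u (Suc k) t - u k t)"
      by (intro summable_of_weighted_squares) (simp add: less_top)
    then have "convergent (\<lambda>n. \<Sum>k<n. u (Suc k) t - u k t)"
      by (simp add: summable_iff_convergent)
    then have "convergent (\<lambda>n. u n t - u 0 t)"
      by (simp only: sum_lessThan_telescope[of "\<lambda>n. u n t"])
    then have "convergent (\<lambda>n. (u n t - u 0 t) + u 0 t)"
      by (intro convergent_add convergent_const)
    then show "(\<lambda>k. u k t) \<longlonglongrightarrow> v t"
      by (simp add: v_def convergent_LIMSEQ_iff)
  qed
  have fatou: "(\<integral>\<^sup>+t. ennreal ((cmod (w m t - v t))\<^sup>2) \<partial>lborel) \<le> ennreal (e\<^sup>2)"
    if "e > 0" "\<And>k. k \<ge> K \<Longrightarrow> dist (X m) (X (r k)) \<le> e" for m e K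
  proof -
    have "(\<integral>\<^sup>+t. ennreal ((cmod (w m t - v t))\<^sup>2) \<partial>lborel)
        = (\<integral>\<^sup>+t. liminf (\<lambda>k. ennreal ((cmod (w m t - u k t))\<^sup>2)) \<partial>lborel)"
    proof (rule nn_integral_cong_AE)
      show "AE t in lborel. ennreal ((cmod (w m t - v t))\<^sup>2)
          = liminf (\<lambda>k. ennreal ((cmod (w m t - u k t))\<^sup>2))"
        using conv
      proof eventually_elim
        case (elim t)
        then have "(\<lambda>k. ennreal ((cmod (w m t - u k t))\<^sup>2)) \<longlonglongrightarrow> ennreal ((cmod (w m t - v t))\<^sup>2)"
          by (intro tendsto_intros)
        then show ?case by (intro lim_imp_Liminf[symmetric]) simp_all
      qed
    qed
    also have "\<dots> \<le> liminf (\<lambda>k. \<integral>\<^sup>+t. ennreal ((cmod (w m t - u k t))\<^sup>2) \<partial>lborel)"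
      by (rule nn_integral_liminf) measurable
    also have "\<dots> = liminf (\<lambda>k. ennreal ((dist (X m) (X (r k)))\<^sup>2))"
      by (simp add: nd)
    also have "\<dots> \<le> liminf (\<lambda>k::nat. ennreal (e\<^sup>2))"
    proof (rule Liminf_mono)
      show "\<forall>\<^sub>F k in sequentially. ennreal ((dist (X m) (X (r k)))\<^sup>2) \<le> ennreal (e\<^sup>2)"
        using eventually_ge_at_top[of K]
        by eventually_elim (use that in \<open>auto intro!: ennreal_leI power_mono\<close>)
    qed
    also have "\<dots> = ennreal (e\<^sup>2)" by (simp add: Liminf_const)
    finally show ?thesis .
  qed
  have rk: "r k \<ge> k" for k by (simp add: r_def)
  have sqd: "square_integrable (\<lambda>t. w (B 0) t - v t)"
  proof -
    have "(\<integral>\<^sup>+t. ennreal ((cmod (w (B 0) t - v t))\<^sup>2) \<partial>lborel) \<le> ennreal (1\<^sup>2)"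
      by (rule fatou[of 1 "B 0"]) (use B[of 0 "B 0"] in \<open>auto intro!: less_imp_le le_trans[OF _ rk]\<close>)
    then have "integrable lborel (\<lambda>t. (cmod (w (B 0) t - v t))\<^sup>2)"
      by (intro integrableI_bounded) (auto simp: le_less_trans)
    then show ?thesis by (simp add: square_integrable_def)
  qed
  have sv: "square_integrable v"
    using sq_int_add[OF w(1)[of "B 0"] sq_int_cmult[OF sqd, of "-1"]] by simp
  have "X \<longlonglongrightarrow> to_L2 v"
  proof (rule metric_LIMSEQ_I)
    fix e :: real assume e: "e > 0"
    obtain k where k: "(1/2::real)^k < e"
      using e real_arch_pow_inv[of e "1/2"] by auto
    have "dist (X m) (to_L2 v) < e" if "m \<ge> B k" for m
    proof -
      have "(\<integral>\<^sup>+t. ennreal ((cmod (w m t - v t))\<^sup>2) \<partial>lborel) \<le> ennreal (((1/2)^k)\<^sup>2)"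
        by (rule fatou[of _ "B k"]) (use B[of k m] that in \<open>auto intro!: less_imp_le le_trans[OF _ rk]\<close>)
      then have "(dist (X m) (to_L2 v))\<^sup>2 \<le> ((1/2)^k)\<^sup>2"
        by (simp only: dist_norm w(2) flip: norm_diff_to_L2[OF w(1) sv, of m])
            (subst (asm) ennreal_le_iff; simp)
      then have "dist (X m) (to_L2 v) \<le> (1/2)^k"
        by (rule power2_le_imp_le) simp
      then show ?thesis using k by simp
    qed
    then show "\<exists>M. \<forall>m\<ge>M. dist (X m) (to_L2 v) < e" by blast
  qed
  then show "convergent X" by (rule convergentI)
qed

lemma AE_lborel_translate:
  fixes x :: "'a::euclidean_space"
  assumes "AE t in lborel. P t"
  shows "AE t in lborel. P (t - x)"
proof -
  obtain S where S: "{t. \<not> P t} \<subseteq> S" "S \<in> sets borel" "emeasure lborel S = 0"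
    using assms by (auto elim!: AE_E)
  have "AE t in (distr lborel borel ((+) (- x)) :: 'a measure). t \<notin> S"
    unfolding lborel_distr_plus using S by (intro AE_not_in) (auto simp: null_sets_def)
  then have "AE t in lborel. - x + t \<notin> S"
    using S(2) by (subst (asm) AE_distr_iff) auto
  then show ?thesis
    by eventually_elim (use S(1) in auto)
qed

text \<open>Time-frequency shift \<open>\<pi>(x, \<omega>)\<close>.\<close>

definition tf_shift_fun :: "'a \<times> 'a \<Rightarrow> ('a::euclidean_space \<Rightarrow> complex) \<Rightarrow> 'a \<Rightarrow> complex" where
  "tf_shift_fun z f t = exp (2 * pi * \<i> * (snd z \<bullet> t)) * f (t - fst z)"

lift_definition tf_shift :: "'a \<times> 'a \<Rightarrow> 'a::euclidean_space L2 \<Rightarrow> 'a L2" is tf_shift_fun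
proof -
  fix z :: "'a \<times> 'a" and f g :: "'a \<Rightarrow> complex"
  assume fg: "L2_rel f g"
  have si: "square_integrable (tf_shift_fun z h)" if "square_integrable h" for h
  proof -
    note [measurable] = sq_int_meas[OF that]
    have "integrable (distr lborel borel ((+) (- fst z))) (\<lambda>t. (cmod (h t))\<^sup>2)"
      using that by (simp add: lborel_distr_plus square_integrable_def)
    then have "integrable lborel (\<lambda>t. (cmod (h (t - fst z)))\<^sup>2)"
      by (subst (asm) integrable_distr_eq) auto
    moreover have "tf_shift_fun z h \<in> borel_measurable borel"
      unfolding tf_shift_fun_def
      by (rule borel_measurable_times)
         (auto intro!: borel_measurable_continuous_onI[of "\<lambda>t. exp (_ t)"] continuous_intros)
    ultimately show ?thesis
      by (simp add: square_integrable_def tf_shift_fun_def norm_mult)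
  qed
  show "L2_rel (tf_shift_fun z f) (tf_shift_fun z g)"
    using fg AE_lborel_translate[of "\<lambda>t. f t = g t" "fst z"]
    by (auto simp: L2_rel_def si tf_shift_fun_def)
qed

section \<open>Adjoints and g-frames\<close>

definition cadjoint :: "('a::complex_inner \<Rightarrow> 'b::complex_inner) \<Rightarrow> 'b \<Rightarrow> 'a" where
  "cadjoint T = (THE S. \<forall>x y. cinner (T x) y = cinner x (S y))"

definition g_frame :: "'i set \<Rightarrow> ('i \<Rightarrow> 'k::complex_hilbert \<Rightarrow> 'k) \<Rightarrow> bool" where
  "g_frame \<Lambda> U \<longleftrightarrow>
     countable \<Lambda> \<and> (\<forall>l\<in>\<Lambda>. bounded_clinear (U l)) \<and>
     (\<exists>A B. 0 < A \<and> A \<le> B \<and>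
        (\<forall>f. (\<lambda>l. (norm (U l f))\<^sup>2) summable_on \<Lambda> \<and>
             A * (norm f)\<^sup>2 \<le> (\<Sum>\<^sub>\<infinity>l\<in>\<Lambda>. (norm (U l f))\<^sup>2) \<and>
             (\<Sum>\<^sub>\<infinity>l\<in>\<Lambda>. (norm (U l f))\<^sup>2) \<le> B * (norm f)\<^sup>2))"

definition g_frame_operator :: "'i set \<Rightarrow> ('i \<Rightarrow> 'k::complex_hilbert \<Rightarrow> 'k) \<Rightarrow> 'k \<Rightarrow> 'k" where
  "g_frame_operator \<Lambda> U f = (\<Sum>\<^sub>\<infinity>l\<in>\<Lambda>. cadjoint (U l) (U l f))"

definition canonical_dual ::
    "'i set \<Rightarrow> ('i \<Rightarrow> 'k::complex_hilbert \<Rightarrow> 'k) \<Rightarrow> 'i \<Rightarrow> 'k \<Rightarrow> 'k" where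
  "canonical_dual \<Lambda> U l = U l \<circ> inv (g_frame_operator \<Lambda> U)"

text \<open>Left multiplication \<open>L\<^sub>W H = W H\<close> on Hilbert--Schmidt operators; meaningful for bounded \<open>W\<close>,
  for which \<open>W \<circ> H\<close> is again Hilbert--Schmidt.\<close>

definition left_mult :: "('h::complex_hilbert \<Rightarrow> 'h) \<Rightarrow> 'h hs \<Rightarrow> 'h hs" where
  "left_mult W H = Abs_hs (W \<circ> hs_apply H)"

text \<open>\<open>rank_one f g\<close> is the operator \<open>f \<otimes> g\<close>.\<close>

definition rank_one :: "'h::complex_inner \<Rightarrow> 'h \<Rightarrow> 'h \<Rightarrow> 'h" where
  "rank_one f g h = cinner h g *\<^sub>C f"

section \<open>Gabor systems and admissible dictionaries\<close>

definition gaussian_fun :: "'a::euclidean_space \<Rightarrow> complex" where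
  "gaussian_fun t = complex_of_real (2 powr (real DIM('a) / 4) * exp (- pi * (norm t)\<^sup>2))"

definition gaussian :: "'a::euclidean_space L2" where
  "gaussian = to_L2 gaussian_fun"

definition lattice :: "nat \<Rightarrow> ('a::euclidean_space \<times> 'a) set" where
  "lattice N = {(x, \<omega>). \<forall>b\<in>Basis. real N * (x \<bullet> b) \<in> \<int> \<and> real N * (\<omega> \<bullet> b) \<in> \<int>}"

definition gabor_G :: "'a \<times> 'a \<Rightarrow> 'a::euclidean_space L2 hs \<Rightarrow> 'a L2 hs" where
  "gabor_G l = left_mult (rank_one gaussian gaussian \<circ> cadjoint (tf_shift l))"

definition M1_norm :: "real \<Rightarrow> 'a::euclidean_space L2 \<Rightarrow> ennreal" where
  "M1_norm s f = (\<integral>\<^sup>+z. ennreal (cmod (cinner f (tf_shift z gaussian)) * (1 + norm z) powr s) \<partial>lborel)"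

text \<open>The series \<open>\<Psi> = \<Sum>k. \<phi> k \<otimes> \<psi> k\<close> is stated pointwise; by the summability condition it converges
  absolutely even in operator and Hilbert--Schmidt norm, so the mode of convergence is immaterial.\<close>

definition s_admissible_dictionary ::
    "('a \<times> 'a) set \<Rightarrow> real \<Rightarrow> ('a \<times> 'a \<Rightarrow> 'a::euclidean_space L2 hs \<Rightarrow> 'a L2 hs) \<Rightarrow> bool" where
  "s_admissible_dictionary \<Lambda> s W \<longleftrightarrow>
     2 * real DIM('a) < s \<and>
     (\<exists>\<Psi> \<phi> \<psi>.
        (\<forall>k::nat. M1_norm s (\<phi> k) < \<infinity>) \<and>
        (\<Sum>k. M1_norm s (\<phi> k) * ennreal (norm (\<psi> k))) < \<infinity> \<and>
        (\<forall>h. (\<lambda>k. rank_one (\<phi> k) (\<psi> k) h) sums \<Psi> h) \<and>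
        g_frame \<Lambda> (\<lambda>l. cadjoint \<Psi> \<circ> cadjoint (tf_shift l)) \<and>
        (\<forall>l\<in>\<Lambda>. W l = left_mult (cadjoint \<Psi> \<circ> cadjoint (tf_shift l))))"

definition admissible_dictionary ::
    "('a \<times> 'a) set \<Rightarrow> ('a \<times> 'a \<Rightarrow> 'a::euclidean_space L2 hs \<Rightarrow> 'a L2 hs) \<Rightarrow> bool" where
  "admissible_dictionary \<Lambda> W \<longleftrightarrow> (\<forall>s > 2 * real DIM('a). s_admissible_dictionary \<Lambda> s W)"

section \<open>Approximation spaces\<close>

definition n_term :: "'i set \<Rightarrow> ('i \<Rightarrow> 'k::complex_hilbert \<Rightarrow> 'k) \<Rightarrow> nat \<Rightarrow> 'k set" where
  "n_term \<Lambda> W n =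
     {(\<Sum>l\<in>K. cadjoint (W l) (H l)) | K H. K \<subseteq> \<Lambda> \<and> finite K \<and> card K \<le> n}"

definition n_term_error :: "'i set \<Rightarrow> ('i \<Rightarrow> 'k::complex_hilbert \<Rightarrow> 'k) \<Rightarrow> nat \<Rightarrow> 'k \<Rightarrow> real" where
  "n_term_error \<Lambda> W n F = (INF H\<in>n_term \<Lambda> W n. norm (F - H))"

text \<open>The sum over \<open>n \<ge> 1\<close> in the quasi-norm is reindexed to start at \<open>0\<close>.\<close>

definition approx_term ::
    "'i set \<Rightarrow> ('i \<Rightarrow> 'k::complex_hilbert \<Rightarrow> 'k) \<Rightarrow> real \<Rightarrow> real \<Rightarrow> 'k \<Rightarrow> nat \<Rightarrow> real" where
  "approx_term \<Lambda> W \<alpha> p F n =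
     (real (Suc n) powr \<alpha> * n_term_error \<Lambda> W n F) powr p * (1 / real (Suc n))"

definition approx_space ::
    "'i set \<Rightarrow> ('i \<Rightarrow> 'k::complex_hilbert \<Rightarrow> 'k) \<Rightarrow> real \<Rightarrow> real \<Rightarrow> 'k set" where
  "approx_space \<Lambda> W \<alpha> p = {F. summable (approx_term \<Lambda> W \<alpha> p F)}"

definition approx_norm ::
    "'i set \<Rightarrow> ('i \<Rightarrow> 'k::complex_hilbert \<Rightarrow> 'k) \<Rightarrow> real \<Rightarrow> real \<Rightarrow> 'k \<Rightarrow> real" where
  "approx_norm \<Lambda> W \<alpha> p F = (\<Sum>n. approx_term \<Lambda> W \<alpha> p F n) powr (1 / p)"

section \<open>Schwartz functions and continuous operators from \<open>\<S>\<close> to \<open>\<S>'\<close>\<close>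

primrec iter_partial :: "'a list \<Rightarrow> ('a::euclidean_space \<Rightarrow> complex) \<Rightarrow> 'a \<Rightarrow> complex" where
  "iter_partial [] f = f"
| "iter_partial (b # bs) f = (\<lambda>x. frechet_derivative (iter_partial bs f) (at x) b)"

definition schwartz :: "('a::euclidean_space \<Rightarrow> complex) set" where
  "schwartz = {f. \<forall>bs. set bs \<subseteq> Basis \<longrightarrow>
     iter_partial bs f differentiable_on UNIV \<and>
     (\<forall>k. bounded (range (\<lambda>x. (1 + norm x) ^ k *\<^sub>R iter_partial bs f x)))}"

text \<open>An increasing sequence of norms generating the Fr\'echet topology of \<open>\<S>\<close>.\<close>

definition schwartz_norm :: "nat \<Rightarrow> ('a::euclidean_space \<Rightarrow> complex) \<Rightarrow> real" where
  "schwartz_norm k f =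
     (\<Sum>bs | set bs \<subseteq> Basis \<and> length bs \<le> k. SUP x. (1 + norm x) ^ k * cmod (iter_partial bs f x))"

definition schwartz_bounded :: "(('a::euclidean_space \<Rightarrow> complex) \<Rightarrow> complex) \<Rightarrow> bool" where
  "schwartz_bounded u \<longleftrightarrow> (\<exists>C k. \<forall>f\<in>schwartz. cmod (u f) \<le> C * schwartz_norm k f)"

text \<open>A continuous operator \<open>F : \<S> \<rightarrow> \<S>'\<close> is represented by the form \<open>F f g = \<langle>F f, g\<rangle>\<close>, where \<open>\<langle>_, _\<rangle>\<close> extends
  the inner product of \<open>L\<^sup>2\<close>: tempered distributions are the continuous antilinear functionals on
  \<open>\<S>\<close>. Continuity into the weak-* topology of \<open>\<S>'\<close> is required, i.e. continuity of \<open>f \<mapsto> \<langle>F f, g\<rangle>\<close> for each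
  \<open>g\<close>; as \<open>\<S>\<close> is a Fr\'echet space this is equivalent to continuity into the strong topology.
  The form is set to \<open>0\<close> off \<open>\<S> \<times> \<S>\<close>, so that equality of forms is equality of operators.\<close>

type_synonym 'a form = "('a \<Rightarrow> complex) \<Rightarrow> ('a \<Rightarrow> complex) \<Rightarrow> complex"

definition schwartz_operators_dual :: "'a::euclidean_space form set" where
  "schwartz_operators_dual = {F.
     (\<forall>f\<in>schwartz. \<forall>g\<in>schwartz. \<forall>h\<in>schwartz. \<forall>a b.
        F (\<lambda>x. a * f x + b * g x) h = a * F f h + b * F g h \<and>
        F h (\<lambda>x. a * f x + b * g x) = cnj a * F h f + cnj b * F h g) \<and>
     (\<forall>f\<in>schwartz. schwartz_bounded (F f)) \<and>
     (\<forall>g\<in>schwartz. schwartz_bounded (\<lambda>f. F f g)) \<and>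
     (\<forall>f g. f \<notin> schwartz \<or> g \<notin> schwartz \<longrightarrow> F f g = 0)}"

text \<open>The inclusion of the Hilbert--Schmidt operators.\<close>

definition hs_form :: "'a::euclidean_space L2 hs \<Rightarrow> 'a form" where
  "hs_form H f g =
     (if f \<in> schwartz \<and> g \<in> schwartz then cinner (hs_apply H (to_L2 f)) (to_L2 g) else 0)"

section \<open>Operator coorbit spaces\<close>

text \<open>Hilbert--Schmidt norm of an operator given on the dense subspace \<open>\<S>\<close> of \<open>L\<^sup>2\<close>: the norm of its
  (unique) Hilbert--Schmidt extension, and \<open>\<infinity>\<close> (the infimum of the empty set) if there is none.\<close>

definition hs_ennorm :: "(('a::euclidean_space \<Rightarrow> complex) \<Rightarrow> 'a L2) \<Rightarrow> ennreal" where
  "hs_ennorm T = (INF H \<in> {H. \<forall>f\<in>schwartz. hs_apply H (to_L2 f) = T f}. ennreal (norm H))"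

text \<open>The operator \<open>\<Phi>\<^sub>0\<^sup>* \<pi>(z)\<^sup>* F\<close>.\<close>

definition localized :: "'a::euclidean_space form \<Rightarrow> 'a \<times> 'a \<Rightarrow> ('a \<Rightarrow> complex) \<Rightarrow> 'a L2" where
  "localized F z f = F f (tf_shift_fun z gaussian_fun) *\<^sub>C gaussian"

definition ennpowr :: "ennreal \<Rightarrow> real \<Rightarrow> ennreal" where
  "ennpowr x p = (if x = \<infinity> then \<infinity> else ennreal (enn2real x powr p))"

definition op_modulation_ennorm :: "real \<Rightarrow> 'a::euclidean_space form \<Rightarrow> ennreal" where
  "op_modulation_ennorm p F =
     ennpowr (\<integral>\<^sup>+z. ennpowr (hs_ennorm (localized F z)) p \<partial>lborel) (1 / p)"

definition coorbit :: "('a \<times> 'a) set \<Rightarrow> real \<Rightarrow> 'a::euclidean_space L2 hs set" where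
  "coorbit \<Lambda> p = {F. (\<lambda>l. norm (canonical_dual \<Lambda> gabor_G l F) powr p) summable_on \<Lambda>}"

definition coorbit_norm :: "('a \<times> 'a) set \<Rightarrow> real \<Rightarrow> 'a::euclidean_space L2 hs \<Rightarrow> real" where
  "coorbit_norm \<Lambda> p F = (\<Sum>\<^sub>\<infinity>l\<in>\<Lambda>. norm (canonical_dual \<Lambda> gabor_G l F) powr p) powr (1 / p)"

text \<open>For all \<open>p\<close> the space is realised inside the dual of the Schwartz operators; for \<open>p < 1\<close> through
  the injective map \<^const>\<open>hs_form\<close>.\<close>

definition op_modulation :: "('a \<times> 'a) set \<Rightarrow> real \<Rightarrow> 'a::euclidean_space form set" where
  "op_modulation \<Lambda> p =
     (if p < 1 then hs_form ` coorbit \<Lambda> p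
      else {F \<in> schwartz_operators_dual. op_modulation_ennorm p F < \<infinity>})"

definition op_modulation_norm :: "('a \<times> 'a) set \<Rightarrow> real \<Rightarrow> 'a::euclidean_space form \<Rightarrow> real" where
  "op_modulation_norm \<Lambda> p F =
     (if p < 1 then coorbit_norm \<Lambda> p (inv hs_form F) else enn2real (op_modulation_ennorm p F))"

text \<open>Continuous inclusion of quasi-normed spaces, \<open>X\<close> with quasi-norm \<open>nX\<close> into \<open>Y\<close> with quasi-norm
  \<open>nY\<close>, where the elements of \<open>Y\<close> are identified with elements of the ambient space of \<open>X\<close> by the
  injective map \<open>\<iota>\<close>.\<close>

definition continuously_embedded ::
    "'x set \<Rightarrow> ('x \<Rightarrow> real) \<Rightarrow> ('y \<Rightarrow> 'x) \<Rightarrow> 'y set \<Rightarrow> ('y \<Rightarrow> real) \<Rightarrow> bool" where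
  "continuously_embedded X nX \<iota> Y nY \<longleftrightarrow>
     X \<subseteq> \<iota> ` Y \<and> (\<exists>C. \<forall>y\<in>Y. \<iota> y \<in> X \<longrightarrow> nY y \<le> C * nX (\<iota> y))"

end

theory Submission
  imports Defs "HOL-Probability.Characteristic_Functions"
begin

text \<open>Every operator \<open>F\<close> in the modulation space has an expansion \<open>F = \<Sum>\<^sub>m \<gamma>\<^sub>m \<otimes> r\<^sub>m\<close> over the lattice in
  which \<open>\<gamma>\<^sub>m\<close> is localized at \<open>m\<close>, that is \<open>|\<langle>\<gamma>\<^sub>m, \<pi>(u)\<phi>\<^sub>0\<rangle>| \<le> C (1 + |u - m|)\<^sup>-\<^sup>s\<close> with \<open>C\<close> independent of \<open>F\<close>,
  and \<open>(r\<^sub>m)\<close> is a sequence in \<open>\<ell>\<^sup>p\<close> bounded by the quasi-norm of \<open>F\<close>. Such expansions lie in the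
  approximation space, for the following reasons.

  The dictionary comes from a frame \<open>U\<^sub>l = \<Psi>\<^sup>* \<pi>(l)\<^sup>*\<close> of \<open>L\<^sup>2\<close>, and its frame operator \<open>S\<close> has a kernel with
  respect to the coherent states \<open>\<pi>(z)\<phi>\<^sub>0\<close> that decays like \<open>(1 + |z - w|)\<^sup>-\<^sup>s\<close>. Off-diagonal decay survives
  inversion: by the Neumann series it suffices to sum the powers of a contraction with decaying
  kernel, and Brandenburg's trick shows that the decay constants of these powers are summable
  (\<open>offdiag_powers_summable\<close>, \<open>localized_frame_inverse\<close>). Thus the canonical dual coefficients
  \<open>H\<^sub>l = U\<^sub>l S\<^sup>-\<^sup>1 F\<close> satisfy \<open>|H\<^sub>l| \<le> K \<Sum>\<^sub>m (1 + |l - m|)\<^sup>-\<^sup>s |r\<^sub>m|\<close>. Convolution with this kernel is bounded on \<open>\<ell>\<^sup>p\<close>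
  because \<open>s p > 2d\<close> and \<open>s > 2d\<close> (\<open>decay_convolution_lp\<close>), so \<open>(H\<^sub>l)\<close> is in \<open>\<ell>\<^sup>p\<close>. Keeping the \<open>n\<close>
  largest coefficients leaves an \<open>\<ell>\<^sup>2\<close> tail, and Hardy's inequality sums these tails with the weight of
  the approximation space (\<open>lp_coefficients_approx_space\<close>). These steps form
  \<open>localized_expansion_approx_space\<close>.

  For \<open>p < 1\<close> the expansion of \<open>F\<close> is the one given by the g-frame \<open>G\<close>: there \<open>\<gamma>\<^sub>m\<close> is a coherent state and
  \<open>r\<^sub>m\<close> is dominated by the canonical dual coefficient. For \<open>p \<ge> 1\<close> the form \<open>F\<close> is only known to be
  a continuous operator from \<open>\<S>\<close> to \<open>\<S>'\<close>. An averaging argument finds a shift \<open>z\<^sub>0\<close> of the lattice on which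
  the sum of the local norms is at most a constant times the integral in the modulation norm
  (\<open>good_shift\<close>). By Riesz' theorem the functional \<open>f \<mapsto> \<langle>F f, \<pi>(z\<^sub>0 + m)\<phi>\<^sub>0\<rangle>\<close> is the inner product with a
  vector \<open>r\<^sub>m\<close>, and \<open>\<gamma>\<^sub>m\<close> is taken as the dual of the shifted Gabor frame, which is localized uniformly in \<open>z\<^sub>0\<close>.
  That the resulting Hilbert--Schmidt operator is \<open>F\<close> follows by applying \<open>F f\<close> term by term to the frame
  expansion of a Schwartz function \<open>g\<close>. This is legitimate as the expansion converges in the topology of
  \<open>\<S>\<close>: its coefficients decay rapidly, so the partial sums are bounded in all seminorms, and on bounded
  sets convergence in \<open>L\<^sup>2\<close> implies convergence in \<open>\<S>\<close> (\<open>schwartz_norm_tendsto_0\<close>).\<close>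



section \<open>Complex Hilbert spaces: duality and square-summable series\<close>

instance complex_hilbert \<subseteq> banach ..

lemma cinner_minus_left: "cinner (- x) y = - cinner x y" for x :: "'a::complex_inner"
  using cinner_add_left[of x "- x" y] by (simp add: cinner_zero_left add_eq_0_iff)

lemma cinner_minus_right: "cinner x (- y) = - cinner x y" for x :: "'a::complex_inner"
  using cinner_add_right[of x y "- y"] by (simp add: cinner_zero_right add_eq_0_iff)

lemma cinner_diff_left: "cinner (x - y) z = cinner x z - cinner y z" for x :: "'a::complex_inner"
  using cinner_add_left[of x "- y" z] by (simp add: cinner_minus_left)

lemma cinner_diff_right: "cinner x (y - z) = cinner x y - cinner x z" for x :: "'a::complex_inner"
  using cinner_add_right[of x y "- z"] by (simp add: cinner_minus_right)

lemma cinner_sum_left: "cinner (sum f F) y = (\<Sum>i\<in>F. cinner (f i) y)" for y :: "'a::complex_inner"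
  by (induction F rule: infinite_finite_induct) (auto simp: cinner_zero_left cinner_add_left)

lemma cinner_sum_right: "cinner y (sum f F) = (\<Sum>i\<in>F. cinner y (f i))" for y :: "'a::complex_inner"
  by (induction F rule: infinite_finite_induct) (auto simp: cinner_zero_right cinner_add_right)

lemma cinner_scaleR_left: "cinner (r *\<^sub>R x) y = complex_of_real r * cinner x y"
  for x :: "'a::complex_inner"
  by (simp add: scaleR_scaleC cinner_scaleC_left)

lemma cinner_scaleR_right: "cinner x (r *\<^sub>R y) = complex_of_real r * cinner x y"
  for x :: "'a::complex_inner"
  by (simp add: scaleR_scaleC cinner_scaleC_right)

lemma bounded_linear_cinner_left: "bounded_linear (\<lambda>x::'a::complex_inner. cinner x y)"
  by (rule bounded_linear_intro[of _ "norm y"])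
     (auto simp: cinner_add_left cinner_scaleR_left scaleR_conv_of_real norm_cinner_le)

lemma bounded_linear_cinner_right: "bounded_linear (\<lambda>y::'a::complex_inner. cinner x y)"
  by (rule bounded_linear_intro[of _ "norm x"])
     (auto simp: cinner_add_right cinner_scaleR_right scaleR_conv_of_real
       intro: order_trans[OF norm_cinner_le] eq_refl mult.commute)

lemma bounded_linear_scaleC: "bounded_linear (\<lambda>x::'a::complex_inner. c *\<^sub>C x)"
  by (rule bounded_linear_intro[of _ "cmod c"])
     (simp_all add: scaleC_add_right scaleR_scaleC scaleC_scaleC norm_scaleC mult.commute)

lemma tendsto_cinner_left: "(f \<longlongrightarrow> l) F \<Longrightarrow> ((\<lambda>n. cinner (f n) y) \<longlongrightarrow> cinner l y) F"
  for l :: "'a::complex_inner"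
  by (rule bounded_linear.tendsto[OF bounded_linear_cinner_left])

lemma cinner_ext_right: "(\<And>x. cinner x y = cinner x z) \<Longrightarrow> y = z" for y :: "'a::complex_inner"
proof -
  assume *: "\<And>x. cinner x y = cinner x z"
  have "cinner (y - z) (y - z) = 0" by (simp add: cinner_diff_right *)
  then show "y = z" using cinner_self[of "y - z"] by simp
qed

lemma cinner_ext_left: "(\<And>x. cinner y x = cinner z x) \<Longrightarrow> y = z" for y :: "'a::complex_inner"
  using cinner_ext_right[of y z] by (metis cinner_commute)

text \<open>A complex subspace with trivial orthogonal complement is dense; a closed property that is stable
  under linear combinations therefore holds everywhere as soon as it holds on a total set.\<close>

lemma total_set_induct:
  fixes P :: "'h::complex_hilbert \<Rightarrow> bool"
  assumes tot: "\<And>x. (\<And>v. v \<in> V \<Longrightarrow> cinner x v = 0) \<Longrightarrow> x = 0"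
    and V: "\<And>v. v \<in> V \<Longrightarrow> P v"
    and zero: "P 0" and add: "\<And>x y. P x \<Longrightarrow> P y \<Longrightarrow> P (x + y)" and sc: "\<And>c x. P x \<Longrightarrow> P (c *\<^sub>C x)"
    and cl: "closed {x. P x}"
  shows "P x"
proof (rule ccontr)
  assume "\<not> P x"
  then have x: "x \<notin> {x. P x}" by simp
  have sub: "subspace {x. P x}"
    unfolding subspace_def using zero add sc by (auto simp: scaleR_scaleC)
  obtain z where z: "z \<noteq> 0" "\<forall>y\<in>{x. P x}. cinner z y = 0"
    using complement_nontrivial[OF cl sub _ x] sc by auto
  then show False using tot[of z] V by auto
qed

lemma bounded_clinear_add: "bounded_clinear T \<Longrightarrow> T (x + y) = T x + T y"
  by (simp add: bounded_clinear_def linear_simps)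

lemma bounded_clinear_scaleC: "bounded_clinear T \<Longrightarrow> T (c *\<^sub>C x) = c *\<^sub>C T x"
  by (simp add: bounded_clinear_def)

lemma bounded_clinear_zero: "bounded_clinear T \<Longrightarrow> T 0 = 0"
  by (simp add: bounded_clinear_def linear_simps)

lemma bounded_clinear_bl: "bounded_clinear T \<Longrightarrow> bounded_linear T"
  by (simp add: bounded_clinear_def)

lemma bounded_clinear_comp:
  "bounded_clinear S \<Longrightarrow> bounded_clinear T \<Longrightarrow> bounded_clinear (\<lambda>x. S (T x))"
  unfolding bounded_clinear_def by (auto intro: bounded_linear_compose)

lemma bounded_clinear_compo:
  "bounded_clinear S \<Longrightarrow> bounded_clinear T \<Longrightarrow> bounded_clinear (S \<circ> T)"
  using bounded_clinear_comp[of S T] by (simp add: comp_def)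

lemma bounded_clinear_sum: "bounded_clinear T \<Longrightarrow> T (sum f F) = (\<Sum>i\<in>F. T (f i))"
  by (induction F rule: infinite_finite_induct) (auto simp: bounded_clinear_zero bounded_clinear_add)

lemma rank_one_cinner: "cinner (rank_one f g x) y = cinner x (rank_one g f y)"
proof -
  have "cinner f y = cnj (cinner y f)" by (rule cinner_commute)
  then show ?thesis by (simp add: rank_one_def cinner_scaleC_left cinner_scaleC_right)
qed

lemma bounded_clinear_rank_one: "bounded_clinear (rank_one f g)"
proof (rule bounded_clinearI[of _ "norm g * norm f"])
  show "norm (rank_one f g x) \<le> norm g * norm f * norm x" for x
    using mult_right_mono[OF norm_cinner_le[of x g] norm_ge_zero[of f]]
    by (simp add: rank_one_def norm_scaleC mult_ac)
qed (auto simp: rank_one_def cinner_add_left scaleC_add_left cinner_scaleC_left scaleC_scaleC)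

lemma closure_complex_subspace:
  fixes V :: "'h::complex_inner set"
  assumes V: "0 \<in> V" "\<And>x y. x \<in> V \<Longrightarrow> y \<in> V \<Longrightarrow> x + y \<in> V" "\<And>c x. x \<in> V \<Longrightarrow> c *\<^sub>C x \<in> V"
  shows "subspace (closure V)" "x \<in> closure V \<Longrightarrow> c *\<^sub>C x \<in> closure V"
proof -
  have sc: "c *\<^sub>C x \<in> closure V" if x: "x \<in> closure V" for c x
  proof -
    obtain y where y: "\<forall>n. y n \<in> V" "y \<longlonglongrightarrow> x" using x unfolding closure_sequential by blast
    have "\<forall>n. c *\<^sub>C y n \<in> V" using y(1) V(3) by blast
    with tendsto_scaleC[OF y(2), of c] show ?thesis unfolding closure_sequential by (intro exI conjI)
  qed
  have ad: "x + y \<in> closure V" if xy: "x \<in> closure V" "y \<in> closure V" for x y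
  proof -
    obtain f g where f: "\<forall>n. f n \<in> V" "f \<longlonglongrightarrow> x" and g: "\<forall>n. g n \<in> V" "g \<longlonglongrightarrow> y"
      using xy unfolding closure_sequential by blast
    have "\<forall>n. f n + g n \<in> V" using f(1) g(1) V(2) by blast
    with tendsto_add[OF f(2) g(2)] show ?thesis unfolding closure_sequential by (intro exI conjI)
  qed
  have "0 \<in> closure V" using V(1) closure_subset by blast
  then show "subspace (closure V)" using ad sc by (simp add: subspace_def scaleR_scaleC)
  show "x \<in> closure V \<Longrightarrow> c *\<^sub>C x \<in> closure V" by (rule sc)
qed

text \<open>As for functionals on the whole space, the representing vector is orthogonal to the closure of
  the kernel. It lies in the closure of \<open>V\<close>, which carries the bound over to its norm.\<close>

lemma riesz_on_dense:
  fixes V :: "'h::complex_hilbert set" and f :: "'h \<Rightarrow> complex"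
  assumes V: "0 \<in> V" "\<And>x y. x \<in> V \<Longrightarrow> y \<in> V \<Longrightarrow> x + y \<in> V" "\<And>c x. x \<in> V \<Longrightarrow> c *\<^sub>C x \<in> V"
    and add: "\<And>x y. x \<in> V \<Longrightarrow> y \<in> V \<Longrightarrow> f (x + y) = f x + f y"
    and sc: "\<And>c x. x \<in> V \<Longrightarrow> f (c *\<^sub>C x) = c * f x"
    and bd: "\<And>x. x \<in> V \<Longrightarrow> cmod (f x) \<le> m * norm x" and m: "m \<ge> 0"
    and dense: "\<And>z. (\<And>x. x \<in> V \<Longrightarrow> cinner z x = 0) \<Longrightarrow> z = 0"
  shows "\<exists>r. norm r \<le> m \<and> (\<forall>x\<in>V. f x = cinner x r)"
proof (cases "\<forall>x\<in>V. f x = 0")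
  case True
  then show ?thesis using m by (intro exI[of _ 0]) (simp add: cinner_zero_right)
next
  case False
  then obtain x0 where x0: "x0 \<in> V" "f x0 \<noteq> 0" by blast
  define Z where "Z = {x\<in>V. f x = 0}"
  have f0: "f 0 = 0" using sc[OF V(1), of 0] by (simp add: scaleC_zero_left)
  have Z: "0 \<in> Z" "\<And>x y. x \<in> Z \<Longrightarrow> y \<in> Z \<Longrightarrow> x + y \<in> Z" "\<And>c x. x \<in> Z \<Longrightarrow> c *\<^sub>C x \<in> Z"
    using V f0 add sc by (auto simp: Z_def)
  have diff: "x - y = x + (-1) *\<^sub>C y" for x y :: 'h
    using scaleR_scaleC[of "-1" y] by simp
  have "x0 \<notin> closure Z"
  proof
    assume "x0 \<in> closure Z"
    moreover have "cmod (f x0) / (m + 1) > 0" using x0 m by simp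
    ultimately obtain y where y: "y \<in> Z" "dist y x0 < cmod (f x0) / (m + 1)"
      unfolding closure_approachable by blast
    have yV: "y \<in> V" "f y = 0" using y by (auto simp: Z_def)
    have "f (x0 - y) = f x0" unfolding diff using yV x0 V by (simp add: add sc)
    then have "cmod (f x0) \<le> m * norm (x0 - y)"
      using bd[of "x0 - y"] yV x0 V by (simp add: diff)
    also have "\<dots> \<le> (m + 1) * dist y x0"
      by (intro mult_mono) (use m in \<open>auto simp: dist_norm norm_minus_commute\<close>)
    also have "\<dots> < cmod (f x0)" using y(2) m by (simp add: field_simps)
    finally show False by simp
  qed
  then obtain z where z: "z \<noteq> 0" "\<And>y. y \<in> Z \<Longrightarrow> cinner z y = 0"
    using complement_nontrivial[OF closed_closure closure_complex_subspace[OF Z]] closure_subset by (metis subsetD)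
  have ker: "cinner x z = (f x / f x0) * cinner x0 z" if x: "x \<in> V" for x
  proof -
    have eq: "x - (f x / f x0) *\<^sub>C x0 = x + (- (f x / f x0)) *\<^sub>C x0"
      by (simp add: diff scaleC_scaleC)
    have "x - (f x / f x0) *\<^sub>C x0 \<in> Z"
      unfolding eq using x x0 V add[OF x V(3)[OF x0(1), of "- (f x / f x0)"]] by (simp add: Z_def sc)
    then have "cinner z (x - (f x / f x0) *\<^sub>C x0) = 0" by (rule z(2))
    then have "cinner (x - (f x / f x0) *\<^sub>C x0) z = 0" using cinner_commute[of "x - (f x / f x0) *\<^sub>C x0" z] by simp
    then show ?thesis by (simp add: cinner_diff_left cinner_scaleC_left)
  qed
  have nz: "cinner x0 z \<noteq> 0"
  proof
    assume "cinner x0 z = 0"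
    then have "cinner z x = 0" if "x \<in> V" for x
      using ker[OF that] cinner_commute[of z x] by simp
    then show False using dense z(1) by blast
  qed
  define r where "r = cnj (f x0 / cinner x0 z) *\<^sub>C z"
  have rep: "f x = cinner x r" if "x \<in> V" for x
    using ker[OF that] nz x0 by (simp add: r_def cinner_scaleC_right)
  have "r \<in> closure V"
  proof (rule ccontr)
    assume "r \<notin> closure V"
    then obtain w where "w \<noteq> 0" "\<forall>y\<in>closure V. cinner w y = 0"
      using complement_nontrivial[OF closed_closure closure_complex_subspace[OF V]] by blast
    then show False using dense[of w] closure_subset by (metis subsetD)
  qed
  moreover have "closed {x. cmod (cinner x r) \<le> m * norm x}"
    by (intro closed_Collect_le continuous_intros linear_continuous_on[OF bounded_linear_cinner_left])
  then have "closure V \<subseteq> {x. cmod (cinner x r) \<le> m * norm x}"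
    using bd rep by (intro closure_minimal) auto
  ultimately have "(norm r)\<^sup>2 \<le> m * norm r"
    using cinner_self[of r] by (auto simp del: of_real_power simp: norm_of_real)
  then have "norm r \<le> m" using m by (cases "r = 0") (auto simp: power2_eq_square)
  then show ?thesis using rep by blast
qed

theorem riesz_representation:
  fixes f :: "'h::complex_hilbert \<Rightarrow> complex"
  assumes add: "\<And>x y. f (x + y) = f x + f y" and sc: "\<And>c x. f (c *\<^sub>C x) = c * f x"
    and bd: "\<And>x. cmod (f x) \<le> K * norm x"
  shows "\<exists>r. \<forall>x. f x = cinner x r"
proof -
  have "\<exists>r. norm r \<le> max K 0 \<and> (\<forall>x\<in>UNIV. f x = cinner x r)"
  proof (rule riesz_on_dense)
    show "cmod (f x) \<le> max K 0 * norm x" for x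
      by (rule order_trans[OF bd mult_right_mono]) simp_all
    show "z = 0" if "\<And>x. x \<in> UNIV \<Longrightarrow> cinner z x = 0" for z
      using that[of z] cinner_self[of z] by simp
  qed (simp_all add: add sc)
  then show ?thesis by blast
qed

lemma cadjoint_eqI:
  assumes "\<And>x y. cinner (T x) y = cinner x (S y)"
  shows "cadjoint T = S"
  unfolding cadjoint_def
proof (rule the_equality)
  fix S' assume "\<forall>x y. cinner (T x) y = cinner x (S' y)"
  then show "S' = S" using assms by (intro ext cinner_ext_right) metis
qed (use assms in auto)

lemma cinner_cadjoint:
  fixes T :: "'a::complex_hilbert \<Rightarrow> 'b::complex_inner"
  assumes T: "bounded_clinear T"
  shows "cinner (T x) y = cinner x (cadjoint T y)"
proof -
  obtain K where K: "\<And>x. norm (T x) \<le> K * norm x" "K \<ge> 0" using bounded_clinear_pos[OF T] by blast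
  have "\<exists>r. \<forall>x. cinner (T x) y = cinner x r" for y
  proof (rule riesz_representation)
    show "cmod (cinner (T x) y) \<le> (K * norm y) * norm x" for x
      using order_trans[OF norm_cinner_le mult_right_mono[OF K(1)]] by (simp add: mult_ac)
  qed (auto simp: bounded_clinear_add[OF T] bounded_clinear_scaleC[OF T] cinner_add_left cinner_scaleC_left)
  then obtain S where S: "\<And>x y. cinner (T x) y = cinner x (S y)" by metis
  then have "cadjoint T = S" by (rule cadjoint_eqI)
  with S show ?thesis by simp
qed

lemma cinner_cadjoint':
  fixes T :: "'a::complex_hilbert \<Rightarrow> 'b::complex_inner"
  assumes T: "bounded_clinear T"
  shows "cinner (cadjoint T y) x = cinner y (T x)"
  by (subst (1 2) cinner_commute) (simp add: cinner_cadjoint[OF T])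

lemma norm_cadjoint_le:
  fixes T :: "'a::complex_hilbert \<Rightarrow> 'b::complex_inner"
  assumes T: "bounded_clinear T" and K: "\<And>x. norm (T x) \<le> K * norm x" "K \<ge> 0"
  shows "norm (cadjoint T y) \<le> K * norm y"
proof (cases "cadjoint T y = 0")
  case False
  have "complex_of_real ((norm (cadjoint T y))\<^sup>2) = cinner (T (cadjoint T y)) y"
    by (simp add: cinner_cadjoint[OF T] cinner_self)
  from arg_cong[OF this, of cmod]
  have "(norm (cadjoint T y))\<^sup>2 = cmod (cinner (T (cadjoint T y)) y)"
    by (simp del: of_real_power)
  also have "\<dots> \<le> (K * norm (cadjoint T y)) * norm y"
    using order_trans[OF norm_cinner_le mult_right_mono[OF K(1)]] by simp
  finally show ?thesis using False by (simp add: power2_eq_square)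
qed (use K in auto)

lemma bounded_clinear_cadjoint:
  fixes T :: "'a::complex_hilbert \<Rightarrow> 'b::complex_inner"
  assumes T: "bounded_clinear T"
  shows "bounded_clinear (cadjoint T)"
proof -
  obtain K where K: "\<And>x. norm (T x) \<le> K * norm x" "K \<ge> 0" using bounded_clinear_pos[OF T] by blast
  show ?thesis
  proof (rule bounded_clinearI)
    show "norm (cadjoint T y) \<le> K * norm y" for y by (rule norm_cadjoint_le[OF T K])
    show "cadjoint T (x + y) = cadjoint T x + cadjoint T y" for x y
      by (rule cinner_ext_right) (simp add: cinner_add_right cinner_cadjoint[OF T, symmetric])
    show "cadjoint T (c *\<^sub>C x) = c *\<^sub>C cadjoint T x" for c x
      by (rule cinner_ext_right) (simp add: cinner_scaleC_right cinner_cadjoint[OF T, symmetric])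
  qed
qed

lemma cadjoint_rank_one: "cadjoint (rank_one f g) = rank_one g f"
  by (rule cadjoint_eqI) (rule rank_one_cinner)

text \<open>The model case of the hypothesis: \<open>v\<close> is the synthesis of a square-summable sequence along a
  Bessel family. Tails of \<open>a\<close> then control all finite subsums, so the series converges
  unconditionally, although it need not converge absolutely.\<close>

lemma square_dominated_summable:
  fixes v :: "'i \<Rightarrow> 'k::banach" and a :: "'i \<Rightarrow> real"
  assumes dom: "\<And>F. finite F \<Longrightarrow> F \<subseteq> I \<Longrightarrow> (norm (sum v F))\<^sup>2 \<le> B * sum a F"
    and a: "a summable_on I" and a0: "\<And>i. i \<in> I \<Longrightarrow> a i \<ge> 0" and B: "B \<ge> 0"
  shows "v summable_on I" and "(norm (infsum v I))\<^sup>2 \<le> B * infsum a I"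
proof -
  have "\<exists>P. eventually P (finite_subsets_at_top I) \<and>
              (\<forall>F F'. P F \<and> P F' \<longrightarrow> dist (sum v F) (sum v F') < e)" if e: "e > 0" for e
  proof -
    define d where "d = (e/4)\<^sup>2 / (B + 1)"
    have d: "d > 0" using e B by (simp add: d_def)
    obtain F0 where F0: "finite F0" "F0 \<subseteq> I" "dist (sum a F0) (infsum a I) \<le> d"
      using infsum_finite_approximation[OF a d] by blast
    have small: "norm (sum v F) < e / 2" if F: "finite F" "F \<subseteq> I" "F \<inter> F0 = {}" for F
    proof -
      have "sum a F + sum a F0 \<le> infsum a I"
        using finite_sum_le_infsum[OF a, of "F \<union> F0"] F F0 a0 by (simp add: sum.union_disjoint)
      then have "sum a F \<le> d" using F0(3) by (simp add: dist_real_def)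
      then have "(norm (sum v F))\<^sup>2 \<le> B * d"
        using dom[OF F(1,2)] B by (meson mult_left_mono order_trans)
      also have "\<dots> \<le> (B + 1) * d" using d by (simp add: algebra_simps)
      also have "\<dots> = (e/4)\<^sup>2" using B by (simp add: d_def)
      finally have "norm (sum v F) \<le> e / 4"
        by (rule power2_le_imp_le) (use e in simp)
      then show ?thesis using e by simp
    qed
    have "dist (sum v F) (sum v F') < e"
      if F: "finite F" "F0 \<subseteq> F" "F \<subseteq> I" and F': "finite F'" "F0 \<subseteq> F'" "F' \<subseteq> I" for F F'
    proof -
      have "sum v F - sum v F' = sum v (F - F') - sum v (F' - F)"
        using sum.Int_Diff[OF F(1), of v F'] sum.Int_Diff[OF F'(1), of v F]
        by (simp add: Int_commute)
      then have "dist (sum v F) (sum v F') \<le> norm (sum v (F - F')) + norm (sum v (F' - F))"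
        by (simp add: dist_norm norm_triangle_ineq4)
      also have "\<dots> < e / 2 + e / 2"
        using F F' by (intro add_strict_mono small) auto
      finally show ?thesis by simp
    qed
    then show ?thesis
      using F0 by (intro exI[of _ "\<lambda>F. finite F \<and> F0 \<subseteq> F \<and> F \<subseteq> I"])
        (auto simp: eventually_finite_subsets_at_top)
  qed
  then have "cauchy_filter (filtermap (sum v) (finite_subsets_at_top I))"
    by (simp add: cauchy_filter_metric_filtermap)
  moreover have "complete (UNIV::'k set)"
    by (meson Cauchy_convergent UNIV_I complete_def convergent_def)
  ultimately obtain L' where "(sum v \<longlongrightarrow> L') (finite_subsets_at_top I)"
    using complete_uniform[where S=UNIV] by (force simp add: filterlim_def)
  then have hs: "(v has_sum L') I" by (simp add: has_sum_def)
  then show "v summable_on I" by (auto simp: summable_on_def)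
  have lim: "((\<lambda>F. (norm (sum v F))\<^sup>2) \<longlongrightarrow> (norm L')\<^sup>2) (finite_subsets_at_top I)"
    using hs unfolding has_sum_def by (intro tendsto_intros)
  have "(norm L')\<^sup>2 \<le> B * infsum a I"
  proof (rule tendsto_upperbound[OF lim])
    show "\<forall>\<^sub>F F in finite_subsets_at_top I. (norm (sum v F))\<^sup>2 \<le> B * infsum a I"
    proof (rule eventually_finite_subsets_at_top_weakI)
      fix F assume F: "finite F" "F \<subseteq> I"
      have "sum a F \<le> infsum a I"
        by (rule finite_sum_le_infsum[OF a F]) (use a0 in auto)
      then show "(norm (sum v F))\<^sup>2 \<le> B * infsum a I"
        using order_trans[OF dom[OF F] mult_left_mono] B by blast
    qed
  qed simp
  then show "(norm (infsum v I))\<^sup>2 \<le> B * infsum a I"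
    using infsumI[OF hs] by simp
qed

definition bessel :: "'i set \<Rightarrow> ('i \<Rightarrow> 'k::complex_hilbert \<Rightarrow> 'l::complex_hilbert) \<Rightarrow> real \<Rightarrow> bool" where
  "bessel I U B \<longleftrightarrow> B \<ge> 0 \<and> (\<forall>l\<in>I. bounded_clinear (U l)) \<and>
     (\<forall>F f. finite F \<longrightarrow> F \<subseteq> I \<longrightarrow> (\<Sum>l\<in>F. (norm (U l f))\<^sup>2) \<le> B * (norm f)\<^sup>2)"

lemma bessel_synthesis_le:
  assumes U: "bessel I U B" and F: "finite F" "F \<subseteq> I"
  shows "(norm (\<Sum>l\<in>F. cadjoint (U l) (h l)))\<^sup>2 \<le> B * (\<Sum>l\<in>F. (norm (h l))\<^sup>2)"
proof -
  define g where "g = (\<Sum>l\<in>F. cadjoint (U l) (h l))"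
  define S where "S = (\<Sum>l\<in>F. (norm (h l))\<^sup>2)"
  have S0: "S \<ge> 0" by (simp add: S_def sum_nonneg)
  have bc: "bounded_clinear (U l)" if "l \<in> F" for l using U F that by (auto simp: bessel_def)
  have "cinner g g = (\<Sum>l\<in>F. cinner (h l) (U l g))"
    by (subst (1) g_def) (simp add: cinner_sum_left cinner_cadjoint' bc)
  then have "complex_of_real ((norm g)\<^sup>2) = (\<Sum>l\<in>F. cinner (h l) (U l g))"
    by (simp add: cinner_self)
  from arg_cong[OF this, of cmod]
  have "(norm g)\<^sup>2 = cmod (\<Sum>l\<in>F. cinner (h l) (U l g))"
    by (simp del: of_real_power)
  also have "\<dots> \<le> (\<Sum>l\<in>F. norm (h l) * norm (U l g))"
    by (rule order_trans[OF norm_sum]) (intro sum_mono norm_cinner_le)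
  finally have "((norm g)\<^sup>2)\<^sup>2 \<le> (\<Sum>l\<in>F. norm (h l) * norm (U l g))\<^sup>2"
    by (intro power_mono) auto
  also have "\<dots> \<le> S * (\<Sum>l\<in>F. (norm (U l g))\<^sup>2)"
    unfolding S_def by (rule Cauchy_Schwarz_ineq_sum)
  also have "\<dots> \<le> S * (B * (norm g)\<^sup>2)"
    using U F S0 by (intro mult_left_mono) (auto simp: bessel_def)
  finally have *: "((norm g)\<^sup>2) * ((norm g)\<^sup>2) \<le> (B * S) * (norm g)\<^sup>2"
    by (simp add: power2_eq_square mult_ac)
  have "(norm g)\<^sup>2 \<le> B * S"
  proof (cases "g = 0")
    case True
    then show ?thesis using U S0 by (simp add: bessel_def)
  next
    case False
    then have "(norm g)\<^sup>2 > 0" by simp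
    then show ?thesis using * by (rule mult_right_le_imp_le[rotated])
  qed
  then show ?thesis by (simp add: g_def S_def)
qed

lemma bessel_synthesis_summable:
  assumes U: "bessel I U B" and h: "(\<lambda>l. (norm (h l))\<^sup>2) summable_on I"
  shows "(\<lambda>l. cadjoint (U l) (h l)) summable_on I"
    and "(norm (\<Sum>\<^sub>\<infinity>l\<in>I. cadjoint (U l) (h l)))\<^sup>2 \<le> B * (\<Sum>\<^sub>\<infinity>l\<in>I. (norm (h l))\<^sup>2)"
proof -
  have B: "B \<ge> 0" using U by (simp add: bessel_def)
  note * = square_dominated_summable[of I "\<lambda>l. cadjoint (U l) (h l)" B "\<lambda>l. (norm (h l))\<^sup>2",
      OF bessel_synthesis_le[OF U] h _ B]
  show "(\<lambda>l. cadjoint (U l) (h l)) summable_on I"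
    by (rule *(1)) auto
  show "(norm (\<Sum>\<^sub>\<infinity>l\<in>I. cadjoint (U l) (h l)))\<^sup>2 \<le> B * (\<Sum>\<^sub>\<infinity>l\<in>I. (norm (h l))\<^sup>2)"
    by (rule *(2)) auto
qed

lemma bessel_summable:
  assumes U: "bessel I U B"
  shows "(\<lambda>l. (norm (U l f))\<^sup>2) summable_on I" "(\<Sum>\<^sub>\<infinity>l\<in>I. (norm (U l f))\<^sup>2) \<le> B * (norm f)\<^sup>2"
proof -
  show s: "(\<lambda>l. (norm (U l f))\<^sup>2) summable_on I"
    by (rule nonneg_bdd_above_summable_on)
       (use U in \<open>auto simp: bessel_def intro!: bdd_aboveI2[of _ _ "B * (norm f)\<^sup>2"]\<close>)
  show "(\<Sum>\<^sub>\<infinity>l\<in>I. (norm (U l f))\<^sup>2) \<le> B * (norm f)\<^sup>2"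
    by (rule infsum_le_finite_sums[OF s]) (use U in \<open>auto simp: bessel_def\<close>)
qed

section \<open>Frame operators and their Neumann series\<close>

lemma bounded_clinear_id: "bounded_clinear (\<lambda>x. x)"
  by (simp add: bounded_clinear_def bounded_linear_ident)

lemma bounded_clinear_funpow: "bounded_clinear (T ^^ n)" if T: "bounded_clinear T"
  for T :: "'k::complex_inner \<Rightarrow> 'k"
proof (induction n)
  case 0
  have "T ^^ 0 = (\<lambda>x. x)" by (rule ext) simp
  then show ?case using bounded_clinear_id by (simp only:)
next
  case (Suc n)
  show ?case using bounded_clinear_comp[OF T Suc] by simp
qed

text \<open>The residual of the approximate solution \<open>x / B\<close> of \<open>S y = x\<close>; its powers sum to \<open>B S\<^sup>-\<^sup>1\<close>.\<close>

definition neumann_step :: "real \<Rightarrow> ('k::complex_hilbert \<Rightarrow> 'k) \<Rightarrow> 'k \<Rightarrow> 'k" where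
  "neumann_step B S x = x - (1/B) *\<^sub>R S x"

lemma bounded_clinear_neumann_step:
  assumes S: "bounded_clinear S" shows "bounded_clinear (neumann_step B S)"
  unfolding bounded_clinear_def
proof
  show "bounded_linear (neumann_step B S)"
    unfolding neumann_step_def[abs_def] using bounded_clinear_bl[OF S]
    by (intro bounded_linear_sub bounded_linear_ident bounded_linear_const_scaleR)
  show "\<forall>c x. neumann_step B S (c *\<^sub>C x) = c *\<^sub>C neumann_step B S x"
    by (simp add: neumann_step_def bounded_clinear_scaleC[OF S] scaleC_diff_right scaleR_scaleC
        scaleC_scaleC mult.commute)
qed

text \<open>The contraction estimate is the Cauchy--Schwarz inequality for the positive form of \<open>R = 1 - S/B\<close>:
  expand \<open>\<langle>R(x - R x / q), x - R x / q\<rangle> \<ge> 0\<close>.\<close>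

lemma norm_neumann_step_le:
  fixes S :: "'k::complex_hilbert \<Rightarrow> 'k"
  assumes S: "bounded_clinear S" and sa: "\<And>x y. cinner (S x) y = cinner x (S y)"
    and AB: "0 < A" "A < B"
    and lo: "\<And>x. A * (norm x)\<^sup>2 \<le> Re (cinner (S x) x)" and hi: "\<And>x. Re (cinner (S x) x) \<le> B * (norm x)\<^sup>2"
  shows "norm (neumann_step B S x) \<le> (1 - A / B) * norm x"
proof -
  define R where "R = neumann_step B S"
  define q where "q = 1 - A / B"
  have q: "q > 0" using AB by (simp add: q_def)
  have inS: "inner (S x) y = inner x (S y)" for x y by (simp add: inner_cinner sa)
  have Rx: "R x = x - (1/B) *\<^sub>R S x" for x by (simp add: R_def neumann_step_def)
  have inR: "inner (R x) y = inner x (R y)" for x y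
    by (simp add: Rx inner_diff inS)
  have bc: "bounded_clinear R" unfolding R_def by (rule bounded_clinear_neumann_step[OF S])
  note Rlin = bounded_clinear_bl[OF bc]
  have pos: "0 \<le> inner (R x) x" for x
  proof -
    have "inner (S x) x \<le> B * inner x x" using hi[of x] by (simp add: inner_cinner power2_norm_eq_inner)
    then show ?thesis using AB by (simp add: Rx inner_diff field_simps)
  qed
  have up: "inner (R x) x \<le> q * (norm x)\<^sup>2" for x
  proof -
    have "A * inner x x \<le> inner (S x) x" using lo[of x] by (simp add: inner_cinner power2_norm_eq_inner)
    then show ?thesis using AB by (simp add: q_def Rx inner_diff power2_norm_eq_inner field_simps)
  qed
  have "0 \<le> inner (R (x - (1/q) *\<^sub>R R x)) (x - (1/q) *\<^sub>R R x)" by (rule pos)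
  also have "\<dots> = inner (R x) x - 2 / q * inner (R x) (R x) + (1/q)\<^sup>2 * inner (R (R x)) (R x)"
    using inR[of "R x" x]
    by (simp add: linear_simps[OF Rlin] inner_diff power2_eq_square algebra_simps)
  also have "\<dots> \<le> q * (norm x)\<^sup>2 - 2 / q * (norm (R x))\<^sup>2 + (1/q)\<^sup>2 * (q * (norm (R x))\<^sup>2)"
    using up[of x] up[of "R x"] mult_left_mono[OF up[of "R x"], of "(1/q)\<^sup>2"]
    by (simp add: power2_norm_eq_inner)
  also have "\<dots> = q * (norm x)\<^sup>2 - (norm (R x))\<^sup>2 / q"
    using q by (simp add: power2_eq_square field_simps)
  finally have "(norm (R x))\<^sup>2 \<le> (q * norm x)\<^sup>2"
    using q by (simp add: field_simps power2_eq_square)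
  then show ?thesis unfolding R_def q_def by (rule power2_le_imp_le) (use AB in simp)
qed

lemma norm_funpow_le:
  fixes R :: "'k::real_normed_vector \<Rightarrow> 'k"
  assumes "\<And>x. norm (R x) \<le> q * norm x" "q \<ge> 0"
  shows "norm ((R ^^ n) x) \<le> q ^ n * norm x"
proof (induction n)
  case (Suc n)
  have "norm ((R ^^ Suc n) x) \<le> q * norm ((R ^^ n) x)" using assms(1)[of "(R ^^ n) x"] by simp
  also have "\<dots> \<le> q * (q ^ n * norm x)" by (rule mult_left_mono[OF Suc]) fact
  finally show ?case by simp
qed simp

lemma neumann_series:
  fixes S :: "'k::complex_hilbert \<Rightarrow> 'k"
  assumes S: "bounded_clinear S" and B: "B > 0" and q: "0 \<le> q" "q < 1"
    and con: "\<And>x. norm (neumann_step B S x) \<le> q * norm x"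
  shows "bij S" and "(\<lambda>n. (1/B) *\<^sub>R (neumann_step B S ^^ n) y) sums inv S y"
proof -
  define R where "R = neumann_step B S"
  have bR: "bounded_clinear R" unfolding R_def by (rule bounded_clinear_neumann_step[OF S])
  have nR: "norm ((R ^^ n) x) \<le> q ^ n * norm x" for n x
    by (rule norm_funpow_le) (use con q in \<open>auto simp: R_def\<close>)
  have SR: "S x = B *\<^sub>R (x - R x)" for x using B by (simp add: R_def neumann_step_def)
  have smb: "summable (\<lambda>n. (1/B) *\<^sub>R (R ^^ n) y)" for y
  proof (rule summable_comparison_test')
    show "summable (\<lambda>n. (1/B) * (q ^ n * norm y))"
      using q by (intro summable_mult summable_mult2 summable_geometric) auto
    show "norm ((1/B) *\<^sub>R (R ^^ n) y) \<le> (1/B) * (q ^ n * norm y)" for n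
      using nR[of n y] B by (simp add: divide_right_mono)
  qed
  define T where "T y = (\<Sum>n. (1/B) *\<^sub>R (R ^^ n) y)" for y
  have T: "(\<lambda>n. (1/B) *\<^sub>R (R ^^ n) y) sums T y" for y
    unfolding T_def by (rule summable_sums[OF smb])
  have tel: "(\<lambda>n. (R ^^ n) y - (R ^^ Suc n) y) sums y" for y
  proof -
    have "(\<lambda>n. (R ^^ n) y) \<longlonglongrightarrow> 0"
    proof (rule Lim_null_comparison)
      show "(\<lambda>n. q ^ n * norm y) \<longlonglongrightarrow> 0"
        using q by (intro tendsto_mult_left_zero LIMSEQ_realpow_zero) auto
    qed (use nR in auto)
    from telescope_sums'[OF this] show ?thesis by simp
  qed
  have ST: "S (T y) = y" for y
  proof -
    have "(\<lambda>n. S ((1/B) *\<^sub>R (R ^^ n) y)) sums S (T y)"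
      by (rule bounded_linear.sums[OF bounded_clinear_bl[OF S] T])
    moreover have "S ((1/B) *\<^sub>R (R ^^ n) y) = (R ^^ n) y - (R ^^ Suc n) y" for n
      using B by (simp add: linear_simps[OF bounded_clinear_bl[OF S]]) (simp add: SR)
    ultimately show ?thesis using tel[of y] sums_unique2 by simp
  qed
  have TS: "T (S y) = y" for y
  proof -
    have "(1/B) *\<^sub>R (R ^^ n) (S y) = (R ^^ n) y - (R ^^ Suc n) y" for n
    proof -
      note l = linear_simps[OF bounded_clinear_bl[OF bounded_clinear_funpow[OF bR, of n]]]
      show ?thesis using B by (simp add: SR l funpow_swap1)
    qed
    then show ?thesis using T[of "S y"] tel[of y] sums_unique2 by simp
  qed
  show "bij S" by (rule o_bij[of T]) (auto simp: ST TS)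
  then have "inv S = T" using ST by (metis bij_inv_eq_iff ext)
  then show "(\<lambda>n. (1/B) *\<^sub>R (neumann_step B S ^^ n) y) sums inv S y"
    using T[of y] by (simp add: R_def)
qed

text \<open>The upper bound is taken strictly larger than the lower one, so that the contraction factor
  \<open>1 - A / B\<close> of the Neumann series is positive and real powers of it make sense.\<close>

definition frame_bounds :: "'i set \<Rightarrow> ('i \<Rightarrow> 'k::complex_hilbert \<Rightarrow> 'k) \<Rightarrow> real \<Rightarrow> real \<Rightarrow> bool" where
  "frame_bounds I U A B \<longleftrightarrow> (\<forall>l\<in>I. bounded_clinear (U l)) \<and> 0 < A \<and> A < B \<and>
        (\<forall>f. (\<lambda>l. (norm (U l f))\<^sup>2) summable_on I \<and>
             A * (norm f)\<^sup>2 \<le> (\<Sum>\<^sub>\<infinity>l\<in>I. (norm (U l f))\<^sup>2) \<and>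
             (\<Sum>\<^sub>\<infinity>l\<in>I. (norm (U l f))\<^sup>2) \<le> B * (norm f)\<^sup>2)"

lemma g_frame_imp_frame_bounds: "g_frame I U \<Longrightarrow> \<exists>A B. frame_bounds I U A B"
proof -
  assume "g_frame I U"
  then obtain A B where bc: "\<forall>l\<in>I. bounded_clinear (U l)" and AB: "0 < A" "A \<le> B"
    and *: "\<And>f. (\<lambda>l. (norm (U l f))\<^sup>2) summable_on I" "\<And>f. A * (norm f)\<^sup>2 \<le> (\<Sum>\<^sub>\<infinity>l\<in>I. (norm (U l f))\<^sup>2)"
      "\<And>f. (\<Sum>\<^sub>\<infinity>l\<in>I. (norm (U l f))\<^sup>2) \<le> B * (norm f)\<^sup>2"
    unfolding g_frame_def by blast
  have "A / 2 * (norm f)\<^sup>2 \<le> (\<Sum>\<^sub>\<infinity>l\<in>I. (norm (U l f))\<^sup>2)" for f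
    by (rule order_trans[OF _ *(2)]) (use AB in \<open>auto intro!: mult_right_mono\<close>)
  then have "frame_bounds I U (A/2) B"
    unfolding frame_bounds_def using bc AB * by auto
  then show ?thesis by blast
qed

lemma frame_bounds_bessel:
  assumes "frame_bounds I U A B" shows "bessel I U B"
  unfolding bessel_def
proof (intro conjI allI impI)
  fix F f assume F: "finite F" "F \<subseteq> I"
  have "(\<Sum>l\<in>F. (norm (U l f))\<^sup>2) \<le> (\<Sum>\<^sub>\<infinity>l\<in>I. (norm (U l f))\<^sup>2)"
    using assms F by (intro finite_sum_le_infsum) (auto simp: frame_bounds_def)
  also have "\<dots> \<le> B * (norm f)\<^sup>2" using assms by (simp add: frame_bounds_def)
  finally show "(\<Sum>l\<in>F. (norm (U l f))\<^sup>2) \<le> B * (norm f)\<^sup>2" .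
qed (use assms in \<open>auto simp: frame_bounds_def\<close>)

lemma g_frame_operator_has_sum:
  assumes U: "bessel I U B"
  shows "((\<lambda>l. cadjoint (U l) (U l f)) has_sum g_frame_operator I U f) I"
  unfolding g_frame_operator_def
  by (rule has_sum_infsum[OF bessel_synthesis_summable(1)[OF U bessel_summable(1)[OF U]]])

lemma bounded_clinear_infsum_bound:
  assumes "bounded_clinear (V::'k::complex_hilbert \<Rightarrow> 'l::complex_hilbert)" "(v has_sum x) I"
  shows "((\<lambda>l. V (v l)) has_sum V x) I"
  by (rule has_sum_bounded_linear[OF bounded_clinear_bl]) fact+

lemma g_frame_operator_cinner:
  assumes U: "bessel I U B"
  shows "((\<lambda>l. cinner (U l f) (U l g)) has_sum cinner (g_frame_operator I U f) g) I"
proof -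
  have "((\<lambda>l. cinner (cadjoint (U l) (U l f)) g) has_sum cinner (g_frame_operator I U f) g) I"
    by (rule has_sum_bounded_linear[OF bounded_linear_cinner_left g_frame_operator_has_sum[OF U]])
  moreover have "cinner (cadjoint (U l) (U l f)) g = cinner (U l f) (U l g)" if "l \<in> I" for l
    using U that by (simp add: bessel_def cinner_cadjoint')
  ultimately show ?thesis by (simp cong: has_sum_cong)
qed

lemma g_frame_operator_selfadjoint:
  assumes U: "bessel I U B"
  shows "cinner (g_frame_operator I U f) g = cinner f (g_frame_operator I U g)"
proof -
  have "((\<lambda>l. cnj (cinner (U l g) (U l f))) has_sum cnj (cinner (g_frame_operator I U g) f)) I"
    using g_frame_operator_cinner[OF U, of g f] by simp
  moreover have "cnj (cinner (U l g) (U l f)) = cinner (U l f) (U l g)" for l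
    by (metis cinner_commute)
  ultimately have "((\<lambda>l. cinner (U l f) (U l g)) has_sum cnj (cinner (g_frame_operator I U g) f)) I"
    by simp
  then have "cinner (g_frame_operator I U f) g = cnj (cinner (g_frame_operator I U g) f)"
    using g_frame_operator_cinner[OF U, of f g] has_sum_unique by blast
  then show ?thesis by (metis cinner_commute)
qed

lemma bounded_clinear_g_frame_operator:
  assumes U: "bessel I U B"
  shows "bounded_clinear (g_frame_operator I U)"
proof (rule bounded_clinearI)
  let ?S = "g_frame_operator I U"
  note sa = g_frame_operator_selfadjoint[OF U]
  show "?S (x + y) = ?S x + ?S y" for x y
    by (rule cinner_ext_left) (simp add: sa cinner_add_left)
  show "?S (c *\<^sub>C x) = c *\<^sub>C ?S x" for c x
    by (rule cinner_ext_left) (simp add: sa cinner_scaleC_left)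
  have B: "B \<ge> 0" using U by (simp add: bessel_def)
  show "norm (?S x) \<le> B * norm x" for x
  proof (rule power2_le_imp_le)
    have "(norm (?S x))\<^sup>2 \<le> B * (\<Sum>\<^sub>\<infinity>l\<in>I. (norm (U l x))\<^sup>2)"
      unfolding g_frame_operator_def by (rule bessel_synthesis_summable(2)[OF U bessel_summable(1)[OF U]])
    also have "\<dots> \<le> B * (B * (norm x)\<^sup>2)" by (intro mult_left_mono bessel_summable(2)[OF U] B)
    finally show "(norm (?S x))\<^sup>2 \<le> (B * norm x)\<^sup>2" by (simp add: power2_eq_square mult_ac)
  qed (use B in simp)
qed

lemma frame_operator_Re:
  assumes U: "bessel I U B"
  shows "Re (cinner (g_frame_operator I U f) f) = (\<Sum>\<^sub>\<infinity>l\<in>I. (norm (U l f))\<^sup>2)"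
proof -
  have "((\<lambda>l. Re (cinner (U l f) (U l f))) has_sum Re (cinner (g_frame_operator I U f) f)) I"
    by (intro has_sum_Re g_frame_operator_cinner[OF U])
  then show ?thesis by (simp add: cinner_self infsumI del: of_real_power)
qed

lemma frame_neumann:
  assumes U: "frame_bounds I U A B"
  defines "S \<equiv> g_frame_operator I U"
  shows "bij S" "(\<lambda>n. (1/B) *\<^sub>R (neumann_step B S ^^ n) y) sums inv S y"
    "norm (neumann_step B S y) \<le> (1 - A/B) * norm y" "0 < 1 - A/B" "1 - A/B < 1" "B > 0"
    "bounded_clinear S" "bounded_clinear (neumann_step B S)"
proof -
  note be = frame_bounds_bessel[OF U]
  have AB: "0 < A" "A < B" using U by (auto simp: frame_bounds_def)
  show B: "B > 0" using AB by simp
  show q: "0 < 1 - A/B" "1 - A/B < 1" using AB by auto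
  show bS: "bounded_clinear S" unfolding S_def by (rule bounded_clinear_g_frame_operator[OF be])
  then show "bounded_clinear (neumann_step B S)" by (rule bounded_clinear_neumann_step)
  show con: "norm (neumann_step B S y) \<le> (1 - A/B) * norm y" for y
    by (rule norm_neumann_step_le[OF bS _ AB])
       (use U in \<open>auto simp: S_def g_frame_operator_selfadjoint[OF be] frame_operator_Re[OF be, unfolded g_frame_operator_selfadjoint[OF be]] frame_bounds_def\<close>)
  show "bij S" "(\<lambda>n. (1/B) *\<^sub>R (neumann_step B S ^^ n) y) sums inv S y"
    by (rule neumann_series[OF bS B _ q(2) con]; use q in simp)+
qed

lemma frame_operator_inverse:
  assumes U: "frame_bounds I U A B"
  defines "S \<equiv> g_frame_operator I U"
  shows "S (inv S x) = x" "inv S (S x) = x" "bounded_clinear (inv S)"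
    "cinner (inv S x) y = cinner x (inv S y)"
    "((\<lambda>l. cadjoint (U l) (U l (inv S f))) has_sum f) I"
proof -
  note be = frame_bounds_bessel[OF U]
  note fn = frame_neumann[OF U, folded S_def]
  show SI: "S (inv S x) = x" for x using fn(1) by (simp add: bij_is_surj surj_f_inv_f)
  show "inv S (S x) = x" for x using fn(1) by (simp add: bij_is_inj)
  show sa: "cinner (inv S x) y = cinner x (inv S y)" for x y
    using g_frame_operator_selfadjoint[OF be, of "inv S x" "inv S y", folded S_def] by (simp add: SI)
  have AB: "0 < A" "A < B" using U by (auto simp: frame_bounds_def)
  show "bounded_clinear (inv S)"
  proof (rule bounded_clinearI)
    show "inv S (x + y) = inv S x + inv S y" for x y
      by (rule cinner_ext_left) (simp add: sa cinner_add_left)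
    show "inv S (c *\<^sub>C x) = c *\<^sub>C inv S x" for c x
      by (rule cinner_ext_left) (simp add: sa cinner_scaleC_left)
    show "norm (inv S x) \<le> (1/A) * norm x" for x
    proof -
      define y where "y = inv S x"
      have "A * (norm y)\<^sup>2 \<le> Re (cinner (S y) y)"
        using U frame_operator_Re[OF be, of y] by (simp add: frame_bounds_def S_def)
      also have "\<dots> \<le> norm (S y) * norm y"
        by (rule order_trans[OF complex_Re_le_cmod norm_cinner_le])
      finally have "A * norm y * norm y \<le> norm x * norm y"
        by (simp add: y_def SI power2_eq_square mult_ac)
      then have "A * norm y \<le> norm x"
        by (cases "y = 0") auto
      then show ?thesis using AB by (simp add: y_def field_simps)
    qed
  qed
  show "((\<lambda>l. cadjoint (U l) (U l (inv S f))) has_sum f) I"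
    using g_frame_operator_has_sum[OF be, of "inv S f", folded S_def] by (simp add: SI)
qed

section \<open>Hilbert--Schmidt operators\<close>

lemma bounded_clinear_hs_apply: "bounded_clinear (hs_apply T)"
  using hs_apply[of T] by (simp add: hilbert_schmidt_def)

lemma norm_hs_power2: "(norm T)\<^sup>2 = (\<Sum>\<^sub>\<infinity>e\<in>onb. (norm (hs_apply T e))\<^sup>2)"
  by (simp add: norm_hs_eq infsum_nonneg)

lemma bounded_clinear_hs_eval: "bounded_clinear (\<lambda>T. hs_apply T x)"
  by (rule bounded_clinearI[of _ "norm x"])
     (use norm_hs_apply_le in \<open>auto simp: plus_hs.rep_eq scaleC_hs.rep_eq mult.commute[of "norm x"]\<close>)

lemma hs_apply_sum: "hs_apply (sum f F) x = (\<Sum>i\<in>F. hs_apply (f i) x)"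
  by (rule bounded_clinear_sum[OF bounded_clinear_hs_eval])

lemma has_sum_hs_apply: "(f has_sum T) I \<Longrightarrow> ((\<lambda>i. hs_apply (f i) x) has_sum hs_apply T x) I"
  by (rule has_sum_bounded_linear[OF bounded_clinear_bl[OF bounded_clinear_hs_eval]])

lemma hs_eqI: "(\<And>x. hs_apply S x = hs_apply T x) \<Longrightarrow> S = T"
  by (metis ext hs_apply_inject)

lemma hilbert_schmidt_comp:
  assumes V: "bounded_clinear V" and T: "hilbert_schmidt T"
  shows "hilbert_schmidt (V \<circ> T)"
proof -
  obtain K where K: "\<And>x. norm (V x) \<le> K * norm x" "K \<ge> 0" using bounded_clinear_pos[OF V] by blast
  have "(\<lambda>e. (norm (V (T e)))\<^sup>2) summable_on onb"
  proof (rule summable_on_comparison_test)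
    show "(\<lambda>e. K\<^sup>2 * (norm (T e))\<^sup>2) summable_on onb"
      using T by (intro summable_on_cmult_right) (simp add: hilbert_schmidt_def)
    show "(norm (V (T e)))\<^sup>2 \<le> K\<^sup>2 * (norm (T e))\<^sup>2" for e
      using power_mono[OF K(1), of "T e" 2] by (simp add: power_mult_distrib)
  qed auto
  moreover have "bounded_clinear (V \<circ> T)"
    using V T by (intro bounded_clinear_compo) (auto simp: hilbert_schmidt_def)
  ultimately show ?thesis by (simp add: hilbert_schmidt_def)
qed

lemma hs_apply_left_mult:
  assumes "bounded_clinear V"
  shows "hs_apply (left_mult V H) = V \<circ> hs_apply H"
  unfolding left_mult_def using hilbert_schmidt_comp[OF assms] hs_apply[of H]
  by (intro Abs_hs_inverse) simp

lemma norm_left_mult_le: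
  assumes V: "bounded_clinear V" and K: "\<And>x. norm (V x) \<le> K * norm x" "K \<ge> 0"
  shows "norm (left_mult V H) \<le> K * norm H"
proof (rule power2_le_imp_le)
  have "(norm (left_mult V H))\<^sup>2 = (\<Sum>\<^sub>\<infinity>e\<in>onb. (norm (V (hs_apply H e)))\<^sup>2)"
    by (simp add: norm_hs_power2 hs_apply_left_mult[OF V])
  also have "\<dots> \<le> (\<Sum>\<^sub>\<infinity>e\<in>onb. K\<^sup>2 * (norm (hs_apply H e))\<^sup>2)"
  proof (rule infsum_mono)
    show "(\<lambda>e. (norm (V (hs_apply H e)))\<^sup>2) summable_on onb"
      using hs_onb_summable[of "left_mult V H"] by (simp add: hs_apply_left_mult[OF V])
    show "(\<lambda>e. K\<^sup>2 * (norm (hs_apply H e))\<^sup>2) summable_on onb"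
      by (intro summable_on_cmult_right hs_onb_summable)
    show "(norm (V (hs_apply H e)))\<^sup>2 \<le> K\<^sup>2 * (norm (hs_apply H e))\<^sup>2" for e
      using power_mono[OF K(1), of "hs_apply H e" 2] by (simp add: power_mult_distrib)
  qed
  also have "\<dots> = (K * norm H)\<^sup>2"
    by (simp add: infsum_cmult_right hs_onb_summable norm_hs_power2 power_mult_distrib)
  finally show "(norm (left_mult V H))\<^sup>2 \<le> (K * norm H)\<^sup>2" .
qed (use K in simp)

lemma bounded_clinear_left_mult:
  assumes V: "bounded_clinear V"
  shows "bounded_clinear (left_mult V)"
proof -
  obtain K where K: "\<And>x. norm (V x) \<le> K * norm x" "K \<ge> 0" using bounded_clinear_pos[OF V] by blast
  show ?thesis
    by (rule bounded_clinearI[of _ K])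
       (auto intro!: hs_eqI norm_left_mult_le[OF V K] simp: hs_apply_left_mult[OF V] plus_hs.rep_eq
         scaleC_hs.rep_eq bounded_clinear_add[OF V] bounded_clinear_scaleC[OF V])
qed

lemma cadjoint_left_mult:
  assumes V: "bounded_clinear V"
  shows "cadjoint (left_mult V) = left_mult (cadjoint V)"
  by (rule cadjoint_eqI)
     (simp add: cinner_hs.rep_eq hs_apply_left_mult[OF V]
        hs_apply_left_mult[OF bounded_clinear_cadjoint[OF V]] cinner_cadjoint[OF V])

lemma has_sum_sum:
  fixes f :: "'i \<Rightarrow> 'e \<Rightarrow> 'b::{topological_comm_monoid_add,t2_space}"
  assumes "\<And>l. l \<in> F \<Longrightarrow> f l summable_on E"
  shows "((\<lambda>e. \<Sum>l\<in>F. f l e) has_sum (\<Sum>l\<in>F. infsum (f l) E)) E"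
  using assms by (induction F rule: infinite_finite_induct) (auto intro!: has_sum_add)

text \<open>The squared Hilbert--Schmidt norm is the sum over an orthonormal basis, so the Bessel inequality
  for \<open>U\<close> can be applied to each basis vector and summed.\<close>

lemma bessel_left_mult:
  fixes U :: "'i \<Rightarrow> 'h::complex_hilbert \<Rightarrow> 'h"
  assumes U: "bessel I U B"
  shows "bessel I (\<lambda>l. left_mult (U l)) B"
  unfolding bessel_def
proof (intro conjI ballI allI impI)
  show "B \<ge> 0" using U by (simp add: bessel_def)
  show "bounded_clinear (left_mult (U l))" if "l \<in> I" for l
    using U that by (intro bounded_clinear_left_mult) (simp add: bessel_def)
  fix F and H :: "'h hs" assume F: "finite F" "F \<subseteq> I"
  have bc: "bounded_clinear (U l)" if "l \<in> F" for l using U F that by (auto simp: bessel_def)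
  have sm: "(\<lambda>e. (norm (U l (hs_apply H e)))\<^sup>2) summable_on onb" if "l \<in> F" for l
    using hs_onb_summable[of "left_mult (U l) H"] by (simp add: hs_apply_left_mult[OF bc[OF that]])
  have "(\<Sum>l\<in>F. (norm (left_mult (U l) H))\<^sup>2) = (\<Sum>l\<in>F. \<Sum>\<^sub>\<infinity>e\<in>onb. (norm (U l (hs_apply H e)))\<^sup>2)"
    by (intro sum.cong) (auto simp: norm_hs_power2 hs_apply_left_mult[OF bc])
  also have "\<dots> = (\<Sum>\<^sub>\<infinity>e\<in>onb. \<Sum>l\<in>F. (norm (U l (hs_apply H e)))\<^sup>2)"
    by (rule infsumI[OF has_sum_sum[OF sm], symmetric])
  also have "\<dots> \<le> (\<Sum>\<^sub>\<infinity>e\<in>onb. B * (norm (hs_apply H e))\<^sup>2)"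
    using U F has_sum_imp_summable[OF has_sum_sum[OF sm]]
    by (intro infsum_mono summable_on_cmult_right hs_onb_summable) (auto simp: bessel_def)
  also have "\<dots> = B * (norm H)\<^sup>2"
    by (simp add: infsum_cmult_right hs_onb_summable norm_hs_power2)
  finally show "(\<Sum>l\<in>F. (norm (left_mult (U l) H))\<^sup>2) \<le> B * (norm H)\<^sup>2" .
qed

lemma bessel_inequality_onb:
  fixes x :: "'h::complex_hilbert"
  assumes F: "finite F" "F \<subseteq> onb"
  shows "(\<Sum>e\<in>F. (cmod (cinner e x))\<^sup>2) \<le> (norm x)\<^sup>2"
proof -
  have E: "cinner a b = (if a = b then 1 else 0)" if "a \<in> F" "b \<in> F" for a b :: 'h
    using orthonormal_basis_onb[where 'a='h] subsetD[OF F(2)] that by (auto simp: orthonormal_basis_def)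
  define y where "y = (\<Sum>e\<in>F. cinner x e *\<^sub>C e)"
  have *: "cinner x e * cinner e x = complex_of_real ((cmod (cinner e x))\<^sup>2)" for e
    by (subst cinner_commute[of x e]) (simp add: complex_norm_square mult.commute del: of_real_power)
  have yx: "cinner y x = complex_of_real (\<Sum>e\<in>F. (cmod (cinner e x))\<^sup>2)"
    by (simp add: y_def cinner_sum_left cinner_scaleC_left * del: of_real_power)
  have ye: "cinner y e = cinner x e" if "e \<in> F" for e
  proof -
    have "cinner y e = (\<Sum>a\<in>F. if a = e then cinner x e else 0)"
      unfolding y_def cinner_sum_left cinner_scaleC_left using that by (intro sum.cong) (auto simp: E)
    then show ?thesis using F that by simp
  qed
  have "cinner y y = (\<Sum>e\<in>F. cnj (cinner x e) * cinner y e)"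
    by (subst (2) y_def) (simp add: cinner_sum_right cinner_scaleC_right)
  also have "\<dots> = (\<Sum>e\<in>F. cnj (cinner x e) * cinner x e)" by (intro sum.cong) (auto simp: ye)
  also have "\<dots> = cinner y x"
    by (simp add: y_def cinner_sum_left cinner_scaleC_left cinner_commute[symmetric] mult.commute)
  finally have yy: "cinner y y = cinner y x" .
  have xy: "cinner x y = cinner y x"
    by (subst cinner_commute) (simp only: yx complex_cnj_complex_of_real)
  have "0 \<le> Re (cinner (x - y) (x - y))" by (simp add: cinner_self del: of_real_power)
  also have "cinner (x - y) (x - y) = cinner x x - cinner y x"
    by (simp only: cinner_diff_left cinner_diff_right yy xy) simp
  also have "Re \<dots> = (norm x)\<^sup>2 - (\<Sum>e\<in>F. (cmod (cinner e x))\<^sup>2)"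
    by (simp only: yx cinner_self minus_complex.sel Re_complex_of_real)
  finally show ?thesis by simp
qed

lemma summable_onb_cinner:
  "(\<lambda>e. (cmod (cinner e x))\<^sup>2) summable_on onb" "(\<Sum>\<^sub>\<infinity>e\<in>onb. (cmod (cinner e x))\<^sup>2) \<le> (norm x)\<^sup>2"
  for x :: "'h::complex_hilbert"
proof -
  show s: "(\<lambda>e. (cmod (cinner e x))\<^sup>2) summable_on onb"
    by (rule nonneg_bdd_above_summable_on) (auto intro!: bdd_aboveI2 bessel_inequality_onb)
  show "(\<Sum>\<^sub>\<infinity>e\<in>onb. (cmod (cinner e x))\<^sup>2) \<le> (norm x)\<^sup>2"
    by (rule infsum_le_finite_sums[OF s bessel_inequality_onb])
qed

lift_definition hs_rank_one :: "'h::complex_hilbert \<Rightarrow> 'h \<Rightarrow> 'h hs" is rank_one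
  unfolding hilbert_schmidt_def
  by (auto simp: bounded_clinear_rank_one rank_one_def norm_scaleC power_mult_distrib
      intro!: summable_on_cmult_left summable_onb_cinner)

text \<open>Applied to an orthonormal basis vector \<open>e\<close>, the sum is a linear combination of the \<open>\<gamma>\<^sub>l\<close> with
  coefficients \<open>\<langle>e, r\<^sub>l\<rangle>\<close>, so the Bessel property of \<open>\<gamma>\<close> and Bessel's inequality for the basis combine.\<close>

lemma hs_rank_one_sum_le:
  fixes \<gamma> r :: "'i \<Rightarrow> 'h::complex_hilbert"
  assumes g: "\<And>F c. finite F \<Longrightarrow> F \<subseteq> I \<Longrightarrow> (norm (\<Sum>l\<in>F. c l *\<^sub>C \<gamma> l))\<^sup>2 \<le> B * (\<Sum>l\<in>F. (cmod (c l))\<^sup>2)"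
    and B: "B \<ge> 0" and F: "finite F" "F \<subseteq> I"
  shows "(norm (\<Sum>l\<in>F. hs_rank_one (\<gamma> l) (r l)))\<^sup>2 \<le> B * (\<Sum>l\<in>F. (norm (r l))\<^sup>2)"
  unfolding norm_hs_power2
proof (rule infsum_le_finite_sums[OF hs_onb_summable])
  fix E :: "'h set" assume E: "finite E" "E \<subseteq> onb"
  have "(\<Sum>e\<in>E. (norm (hs_apply (\<Sum>l\<in>F. hs_rank_one (\<gamma> l) (r l)) e))\<^sup>2)
      = (\<Sum>e\<in>E. (norm (\<Sum>l\<in>F. cinner e (r l) *\<^sub>C \<gamma> l))\<^sup>2)"
    by (simp add: hs_apply_sum hs_rank_one.rep_eq rank_one_def)
  also have "\<dots> \<le> (\<Sum>e\<in>E. B * (\<Sum>l\<in>F. (cmod (cinner e (r l)))\<^sup>2))"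
    by (intro sum_mono g F)
  also have "\<dots> = B * (\<Sum>l\<in>F. \<Sum>e\<in>E. (cmod (cinner e (r l)))\<^sup>2)"
    by (subst sum.swap) (simp add: sum_distrib_left)
  also have "\<dots> \<le> B * (\<Sum>l\<in>F. (norm (r l))\<^sup>2)"
    by (intro mult_left_mono sum_mono bessel_inequality_onb E B)
  finally show "(\<Sum>e\<in>E. (norm (hs_apply (\<Sum>l\<in>F. hs_rank_one (\<gamma> l) (r l)) e))\<^sup>2) \<le> B * (\<Sum>l\<in>F. (norm (r l))\<^sup>2)" .
qed

lemma norm_left_mult_rank_le:
  assumes "bounded_clinear V" "hs_apply H = rank_one f g"
  shows "norm (left_mult V H) \<le> norm (V f) * norm g"
proof (rule power2_le_imp_le)
  have "(norm (left_mult V H))\<^sup>2 = (\<Sum>\<^sub>\<infinity>e\<in>onb. (cmod (cinner e g))\<^sup>2 * (norm (V f))\<^sup>2)"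
    by (simp add: norm_hs_power2 hs_apply_left_mult[OF assms(1)] assms(2) rank_one_def
        bounded_clinear_scaleC[OF assms(1)] norm_scaleC power_mult_distrib)
  also have "\<dots> \<le> (norm g)\<^sup>2 * (norm (V f))\<^sup>2"
    by (simp add: infsum_cmult_left summable_onb_cinner mult_right_mono)
  finally show "(norm (left_mult V H))\<^sup>2 \<le> (norm (V f) * norm g)\<^sup>2" by (simp add: power_mult_distrib mult.commute)
qed simp

section \<open>Gaussian integrals\<close>

lemma lborel_translate:
  fixes f :: "'a::euclidean_space \<Rightarrow> 'b::{banach, second_countable_topology}"
  assumes f: "f \<in> borel_measurable borel"
  shows "integrable lborel (\<lambda>x. f (c + x)) \<longleftrightarrow> integrable lborel f"
    and "(\<integral>x. f (c + x) \<partial>lborel) = (\<integral>x. f x \<partial>lborel)"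
proof -
  show "integrable lborel (\<lambda>x. f (c + x)) \<longleftrightarrow> integrable lborel f"
    using integrable_distr_eq[of "(+) c" lborel borel f] f by (simp add: lborel_distr_plus)
  show "(\<integral>x. f (c + x) \<partial>lborel) = (\<integral>x. f x \<partial>lborel)"
    using integral_distr[of "(+) c" lborel borel f] f by (simp add: lborel_distr_plus)
qed

lemma nn_integral_lborel_translate:
  fixes f :: "'a::euclidean_space \<Rightarrow> ennreal"
  assumes f: "f \<in> borel_measurable borel"
  shows "(\<integral>\<^sup>+x. f (c + x) \<partial>lborel) = (\<integral>\<^sup>+x. f x \<partial>lborel)"
  using nn_integral_distr[of "(+) c" lborel borel f] f by (simp add: lborel_distr_plus)

text \<open>A rescaled form of the characteristic function of the standard normal distribution.\<close>

lemma gaussian_integral_1d: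
  fixes a k :: real
  assumes a: "a > 0"
  shows "integrable lborel (\<lambda>t. complex_of_real (exp (- a * t\<^sup>2)) * cis (k * t))"
    and "(\<integral>t. complex_of_real (exp (- a * t\<^sup>2)) * cis (k * t) \<partial>lborel)
       = complex_of_real (sqrt (pi / a) * exp (- k\<^sup>2 / (4 * a)))"
proof -
  define c where "c = 1 / sqrt (2 * a)"
  have c: "c > 0" and c2: "c\<^sup>2 = 1 / (2 * a)" using a by (auto simp: c_def power_divide)
  define F where "F t = complex_of_real (exp (- a * t\<^sup>2)) * cis (k * t)" for t
  have Fc: "F (0 + c * x) = complex_of_real (sqrt (2 * pi)) * (std_normal_density x *\<^sub>R iexp ((k * c) * x))" for x
  proof -
    have "a * (c * x)\<^sup>2 = x\<^sup>2 / 2" using a by (simp add: power_mult_distrib c2)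
    then show ?thesis
      by (simp add: F_def std_normal_density_def scaleR_conv_of_real cis_conv_exp mult_ac)
  qed
  have i0: "integrable lborel (\<lambda>x. std_normal_density x *\<^sub>R iexp ((k * c) * x))"
  proof (rule Bochner_Integration.integrable_bound[OF integrable_std_normal_moment[of 0]])
    show "(\<lambda>x. std_normal_density x *\<^sub>R iexp ((k * c) * x)) \<in> borel_measurable lborel" by measurable
  qed (auto simp: norm_mult)
  have "integrable lborel (\<lambda>x. F (0 + c * x))"
    unfolding Fc by (intro integrable_mult_right i0)
  then have iF: "integrable lborel F"
    using lborel_integrable_real_affine_iff[of c F 0] c by simp
  then show "integrable lborel (\<lambda>t. complex_of_real (exp (- a * t\<^sup>2)) * cis (k * t))"
    by (simp add: F_def[abs_def])
  have "char std_normal_distribution (k * c) = (\<integral>x. std_normal_density x *\<^sub>R iexp ((k * c) * x) \<partial>lborel)"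
    unfolding char_def by (subst integral_density) (auto simp: mult.commute)
  then have ch: "(\<integral>x. std_normal_density x *\<^sub>R iexp ((k * c) * x) \<partial>lborel) = complex_of_real (exp (- ((k * c)\<^sup>2) / 2))"
    by (simp add: char_std_normal_distribution)
  have "(\<integral>t. F t \<partial>lborel) = \<bar>c\<bar> *\<^sub>R (\<integral>x. F (0 + c * x) \<partial>lborel)"
    by (rule lborel_integral_real_affine) (use c in simp)
  also have "\<dots> = complex_of_real (c * sqrt (2 * pi) * exp (- ((k * c)\<^sup>2) / 2))"
    unfolding Fc Bochner_Integration.integral_mult_right_zero ch
    using c by (simp add: scaleR_conv_of_real)
  also have "c * sqrt (2 * pi) = sqrt (pi / a)"
    using a by (simp add: c_def real_sqrt_divide[symmetric] real_sqrt_mult[symmetric])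
  also have "- ((k * c)\<^sup>2) / 2 = - k\<^sup>2 / (4 * a)" by (simp add: power_mult_distrib c2)
  finally show "(\<integral>t. complex_of_real (exp (- a * t\<^sup>2)) * cis (k * t) \<partial>lborel)
       = complex_of_real (sqrt (pi / a) * exp (- k\<^sup>2 / (4 * a)))"
    by (simp add: F_def[abs_def])
qed

lemma cis_sum: "cis (sum f F) = (\<Prod>i\<in>F. cis (f i))"
  by (induction F rule: infinite_finite_induct) (auto simp: cis_mult[symmetric])

lemma gaussian_integral:
  fixes k :: "'a::euclidean_space"
  assumes a: "a > 0"
  shows "integrable lborel (\<lambda>t::'a. complex_of_real (exp (- a * (norm t)\<^sup>2)) * cis (k \<bullet> t))"
    and "(\<integral>t. complex_of_real (exp (- a * (norm t)\<^sup>2)) * cis (k \<bullet> t) \<partial>lborel)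
       = complex_of_real ((pi / a) powr (real DIM('a) / 2) * exp (- (norm k)\<^sup>2 / (4 * a)))"
proof -
  interpret product_sigma_finite "\<lambda>_::'a. lborel :: real measure" ..
  define g where "g b t = complex_of_real (exp (- a * t\<^sup>2)) * cis ((k \<bullet> b) * t)" for b :: 'a and t
  define F where "F t = complex_of_real (exp (- a * (norm t)\<^sup>2)) * cis (k \<bullet> t)" for t :: 'a
  have prodF: "F t = (\<Prod>b\<in>Basis. g b (t \<bullet> b))" for t
  proof -
    have "- a * (norm t)\<^sup>2 = (\<Sum>b\<in>Basis. - a * (t \<bullet> b)\<^sup>2)"
    proof -
      have "(norm t)\<^sup>2 = (\<Sum>b\<in>Basis. (t \<bullet> b)\<^sup>2)"
        unfolding power2_norm_eq_inner by (subst euclidean_inner) (simp add: power2_eq_square)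
      then show ?thesis by (simp add: sum_distrib_left sum_negf)
    qed
    moreover have "k \<bullet> t = (\<Sum>b\<in>Basis. (k \<bullet> b) * (t \<bullet> b))" by (rule euclidean_inner)
    ultimately show ?thesis
      by (simp only: F_def g_def exp_sum[OF finite_Basis] cis_sum of_real_prod prod.distrib)
  qed
  define T where "T f = (\<Sum>b\<in>Basis. f b *\<^sub>R b)" for f :: "'a \<Rightarrow> real"
  have Tb: "T f \<bullet> b = f b" if "b \<in> Basis" for f b
    using that by (simp add: T_def inner_sum_left inner_Basis if_distrib cong: if_cong)
  have [measurable]: "T \<in> measurable (\<Pi>\<^sub>M b\<in>Basis. lborel) borel"
    unfolding T_def[abs_def] by measurable
  have [measurable]: "F \<in> borel_measurable borel"
    unfolding F_def by (intro borel_measurable_continuous_onI continuous_intros)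
  have FT: "F (T f) = (\<Prod>b\<in>Basis. g b (f b))" for f
    unfolding prodF by (intro prod.cong refl) (simp add: Tb)
  have gi: "integrable lborel (g b)" for b
    unfolding g_def[abs_def] by (rule gaussian_integral_1d[OF a])
  have lb: "lborel = distr (\<Pi>\<^sub>M b\<in>Basis. lborel) borel T"
    unfolding T_def by (rule lborel_eq)
  show "integrable lborel (\<lambda>t::'a. complex_of_real (exp (- a * (norm t)\<^sup>2)) * cis (k \<bullet> t))"
    unfolding F_def[symmetric, abs_def]
    by (subst lb, subst integrable_distr_eq) (auto simp: FT intro!: product_integrable_prod gi)
  have "(\<integral>t. F t \<partial>lborel) = (\<integral>f. F (T f) \<partial>(\<Pi>\<^sub>M b\<in>Basis. lborel))"
    by (subst lb, subst integral_distr) auto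
  also have "\<dots> = (\<Prod>b\<in>Basis. \<integral>t. g b t \<partial>lborel)"
    unfolding FT by (rule product_integral_prod) (auto intro: gi)
  also have "\<dots> = (\<Prod>b\<in>Basis. complex_of_real (sqrt (pi / a) * exp (- (k \<bullet> b)\<^sup>2 / (4 * a))))"
    unfolding g_def by (simp only: gaussian_integral_1d(2)[OF a])
  also have "\<dots> = complex_of_real (sqrt (pi / a) ^ DIM('a) * exp (\<Sum>b\<in>(Basis::'a set). - (k \<bullet> b)\<^sup>2 / (4 * a)))"
    by (simp only: of_real_prod[symmetric] prod.distrib prod_constant exp_sum[OF finite_Basis])
  also have "(\<Sum>b\<in>(Basis::'a set). - (k \<bullet> b)\<^sup>2 / (4 * a)) = - (norm k)\<^sup>2 / (4 * a)"
  proof -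
    have "(norm k)\<^sup>2 = (\<Sum>b\<in>Basis. (k \<bullet> b)\<^sup>2)"
      unfolding power2_norm_eq_inner by (subst euclidean_inner) (simp add: power2_eq_square)
    then show ?thesis by (simp add: sum_negf sum_divide_distrib)
  qed
  also have "sqrt (pi / a) ^ DIM('a) = (pi / a) powr (real DIM('a) / 2)"
    using a by (simp add: powr_half_sqrt[symmetric] powr_power)
  finally show "(\<integral>t. complex_of_real (exp (- a * (norm t)\<^sup>2)) * cis (k \<bullet> t) \<partial>lborel)
       = complex_of_real ((pi / a) powr (real DIM('a) / 2) * exp (- (norm k)\<^sup>2 / (4 * a)))"
    by (simp add: F_def[abs_def])
qed

section \<open>Time-frequency shifts and coherent states\<close>

lemma L2_rel_refl: "square_integrable f \<Longrightarrow> L2_rel f f"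
  by (simp add: L2_rel_def)

lemma cinner_to_L2:
  "square_integrable f \<Longrightarrow> square_integrable g \<Longrightarrow> cinner (to_L2 f) (to_L2 g) = (\<integral>x. f x * cnj (g x) \<partial>lborel)"
  by (simp add: cinner_L2.abs_eq L2_rel_refl)

lemma to_L2_add:
  "square_integrable f \<Longrightarrow> square_integrable g \<Longrightarrow> to_L2 f + to_L2 g = to_L2 (\<lambda>x. f x + g x)"
  by (simp add: plus_L2.abs_eq L2_rel_refl)

lemma to_L2_scaleC: "square_integrable f \<Longrightarrow> c *\<^sub>C to_L2 f = to_L2 (\<lambda>x. c * f x)"
  by (simp add: scaleC_L2.abs_eq L2_rel_refl)

lemma tf_shift_fun_cis: "tf_shift_fun z f t = cis (2 * pi * (snd z \<bullet> t)) * f (t - fst z)"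
  by (simp add: tf_shift_fun_def cis_conv_exp mult_ac)

lemma sq_int_tf_shift:
  assumes "square_integrable f" shows "square_integrable (tf_shift_fun z f)"
proof -
  have "rel_fun L2_rel L2_rel (tf_shift_fun z) (tf_shift_fun z)"
    using tf_shift.rsp unfolding rel_fun_def[of "(=)"] by blast
  then show ?thesis using L2_rel_refl[OF assms] by (auto simp: rel_fun_def L2_rel_def)
qed

lemma tf_shift_to_L2: "square_integrable f \<Longrightarrow> tf_shift z (to_L2 f) = to_L2 (tf_shift_fun z f)"
  by (simp add: tf_shift.abs_eq L2_rel_refl)

lemma cinner_tf_shift: "cinner (tf_shift z f) (tf_shift z g) = cinner f g"
proof -
  obtain f0 g0 where fg: "square_integrable f0" "f = to_L2 f0" "square_integrable g0" "g = to_L2 g0"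
    using L2_cases by metis
  note [measurable] = fg(1,3)[THEN sq_int_meas]
  have "tf_shift_fun z f0 x * cnj (tf_shift_fun z g0 x) = f0 (- fst z + x) * cnj (g0 (- fst z + x))" for x
    by (simp add: tf_shift_fun_cis cis_cnj mult_ac cis_mult)
  then have "cinner (tf_shift z f) (tf_shift z g) = (\<integral>x. f0 (- fst z + x) * cnj (g0 (- fst z + x)) \<partial>lborel)"
    using fg by (simp add: tf_shift_to_L2 cinner_to_L2 sq_int_tf_shift)
  also have "\<dots> = cinner f g"
    using fg lborel_translate(2)[of "\<lambda>x. f0 x * cnj (g0 x)" "- fst z"] by (simp add: cinner_to_L2)
  finally show ?thesis .
qed

lemma norm_tf_shift: "norm (tf_shift z f) = norm f"
  using cinner_tf_shift[of z f f] by (simp add: cinner_self del: of_real_power) 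

lemma bounded_clinear_tf_shift: "bounded_clinear (tf_shift z)"
proof (rule bounded_clinearI[of _ 1])
  show "norm (tf_shift z f) \<le> 1 * norm f" for f by (simp add: norm_tf_shift)
  show "tf_shift z (f + g) = tf_shift z f + tf_shift z g" for f g
  proof -
    obtain f0 g0 where fg: "square_integrable f0" "f = to_L2 f0" "square_integrable g0" "g = to_L2 g0"
      using L2_cases by metis
    then show ?thesis
      by (simp add: to_L2_add tf_shift_to_L2 sq_int_add sq_int_tf_shift)
         (simp add: tf_shift_fun_def[abs_def] distrib_left)
  qed
  show "tf_shift z (c *\<^sub>C f) = c *\<^sub>C tf_shift z f" for c f
  proof -
    obtain f0 where fg: "square_integrable f0" "f = to_L2 f0" using L2_cases by metis
    then show ?thesis
      by (simp add: to_L2_scaleC tf_shift_to_L2 sq_int_cmult sq_int_tf_shift)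
         (simp add: tf_shift_fun_def[abs_def] mult_ac)
  qed
qed

lemma tf_shift_fun_comp:
  "tf_shift_fun z (tf_shift_fun w f) = (\<lambda>t. cis (- 2 * pi * (snd w \<bullet> fst z)) * tf_shift_fun (z + w) f t)"
proof
  fix t
  have "cis (2 * pi * (snd z \<bullet> t)) * cis (2 * pi * (snd w \<bullet> (t - fst z)))
      = cis (- 2 * pi * (snd w \<bullet> fst z)) * cis (2 * pi * (snd (z + w) \<bullet> t))"
    unfolding cis_mult by (simp add: inner_add_left inner_diff_right algebra_simps)
  then show "tf_shift_fun z (tf_shift_fun w f) t = cis (- 2 * pi * (snd w \<bullet> fst z)) * tf_shift_fun (z + w) f t"
    by (simp add: tf_shift_fun_cis diff_diff_eq mult.assoc[symmetric])
qed

lemma tf_shift_comp: "tf_shift z (tf_shift w f) = cis (- 2 * pi * (snd w \<bullet> fst z)) *\<^sub>C tf_shift (z + w) f"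
proof -
  obtain f0 where fg: "square_integrable f0" "f = to_L2 f0" using L2_cases by metis
  then show ?thesis
    by (simp only: tf_shift_to_L2 sq_int_tf_shift to_L2_scaleC) (simp only: tf_shift_fun_comp)
qed

text \<open>Centred at the midpoint of the two positions, the integrand is a Gaussian times a character.\<close>

lemma gaussian_overlap_integral:
  fixes z w :: "'a::euclidean_space \<times> 'a"
  shows "integrable lborel (\<lambda>t. tf_shift_fun w gaussian_fun t * cnj (tf_shift_fun z gaussian_fun t))"
    and "(\<integral>t. tf_shift_fun w gaussian_fun t * cnj (tf_shift_fun z gaussian_fun t) \<partial>lborel)
       = complex_of_real (exp (- pi / 2 * (norm (w - z))\<^sup>2)) * cis (pi * ((snd w - snd z) \<bullet> (fst w + fst z)))"
proof -
  define m where "m = (1/2) *\<^sub>R (fst w + fst z)"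
  define eta where "eta = snd w - snd z"
  define F where "F t = tf_shift_fun w gaussian_fun t * cnj (tf_shift_fun z gaussian_fun t)" for t :: 'a
  define C where "C = complex_of_real (2 powr (real DIM('a) / 2) * exp (- pi / 2 * (norm (fst w - fst z))\<^sup>2))
      * cis (2 * pi * (eta \<bullet> m))"
  have Fm: "F (m + u) = C * (complex_of_real (exp (- (2 * pi) * (norm u)\<^sup>2)) * cis (((2 * pi) *\<^sub>R eta) \<bullet> u))" for u
  proof -
    have e1: "m + u - fst w = u - (1/2) *\<^sub>R (fst w - fst z)"
      by (simp add: m_def algebra_simps) (metis (no_types) scaleR_half_double scaleR_2 scaleR_add_right scaleR_half_double add.commute)
    have e2: "m + u - fst z = u + (1/2) *\<^sub>R (fst w - fst z)"
      by (simp add: m_def algebra_simps) (metis (no_types) scaleR_half_double scaleR_2 scaleR_add_right scaleR_half_double add.commute)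
    have n: "(norm (m + u - fst w))\<^sup>2 + (norm (m + u - fst z))\<^sup>2 = 2 * (norm u)\<^sup>2 + (norm (fst w - fst z))\<^sup>2 / 2"
      unfolding e1 e2 power2_norm_eq_inner by (simp add: inner_diff inner_add algebra_simps inner_commute) (simp add: field_simps)
    have g: "gaussian_fun (m + u - fst w) * gaussian_fun (m + u - fst z)
        = complex_of_real (2 powr (real DIM('a) / 2) * exp (- pi / 2 * (norm (fst w - fst z))\<^sup>2) * exp (- (2 * pi) * (norm u)\<^sup>2))"
    proof -
      have "2 powr (real DIM('a) / 4) * 2 powr (real DIM('a) / 4) = (2::real) powr (real DIM('a) / 2)"
        by (simp add: powr_add[symmetric])
      moreover have "exp (- pi * (norm (m + u - fst w))\<^sup>2) * exp (- pi * (norm (m + u - fst z))\<^sup>2)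
          = exp (- pi / 2 * (norm (fst w - fst z))\<^sup>2) * exp (- (2 * pi) * (norm u)\<^sup>2)"
      proof -
        have "- pi * (norm (m + u - fst w))\<^sup>2 + - pi * (norm (m + u - fst z))\<^sup>2
            = - pi * ((norm (m + u - fst w))\<^sup>2 + (norm (m + u - fst z))\<^sup>2)" by (simp add: algebra_simps)
        also have "\<dots> = - pi / 2 * (norm (fst w - fst z))\<^sup>2 + - (2 * pi) * (norm u)\<^sup>2"
          unfolding n by (simp add: algebra_simps)
        finally show ?thesis by (simp only: exp_add[symmetric])
      qed
      ultimately show ?thesis
        unfolding gaussian_fun_def of_real_mult[symmetric] by (simp only: of_real_eq_iff mult_ac) (simp only: mult.assoc[symmetric])
    qed
    have c: "cis (2 * pi * (snd w \<bullet> (m + u))) * cnj (cis (2 * pi * (snd z \<bullet> (m + u))))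
        = cis (2 * pi * (eta \<bullet> m)) * cis (((2 * pi) *\<^sub>R eta) \<bullet> u)"
      unfolding cis_cnj cis_mult by (simp add: eta_def inner_diff_left inner_add_right algebra_simps)
    have "F (m + u) = (cis (2 * pi * (snd w \<bullet> (m + u))) * cnj (cis (2 * pi * (snd z \<bullet> (m + u)))))
        * (gaussian_fun (m + u - fst w) * gaussian_fun (m + u - fst z))"
      by (simp add: F_def tf_shift_fun_cis gaussian_fun_def mult_ac)
    then show ?thesis unfolding c g C_def of_real_mult by (simp only: mult_ac)
  qed
  have Fmeas: "F \<in> borel_measurable borel"
    unfolding F_def tf_shift_fun_def gaussian_fun_def
    by (intro borel_measurable_continuous_onI continuous_intros)
  note gi = gaussian_integral[of "2 * pi" "(2 * pi) *\<^sub>R eta"]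
  have "integrable lborel (\<lambda>u. F (m + u))"
    unfolding Fm by (intro integrable_mult_right gi) simp
  then show "integrable lborel (\<lambda>t. tf_shift_fun w gaussian_fun t * cnj (tf_shift_fun z gaussian_fun t))"
    unfolding F_def[symmetric] using lborel_translate(1)[OF Fmeas, of m] by simp
  have "(\<integral>t. F t \<partial>lborel) = (\<integral>u. F (m + u) \<partial>lborel)" using lborel_translate(2)[OF Fmeas, of m] by simp
  also have "\<dots> = C * complex_of_real ((pi / (2 * pi)) powr (real DIM('a) / 2) * exp (- (norm ((2 * pi) *\<^sub>R eta))\<^sup>2 / (4 * (2 * pi))))"
    unfolding Fm Bochner_Integration.integral_mult_right_zero by (subst gi(2)) simp_all
  also have "- (norm ((2 * pi) *\<^sub>R eta))\<^sup>2 / (4 * (2 * pi)) = - pi / 2 * (norm eta)\<^sup>2"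
    by (simp add: power_mult_distrib power2_eq_square field_simps)
  also have "(pi / (2 * pi)) powr (real DIM('a) / 2) = 2 powr (- (real DIM('a) / 2))"
    by (simp add: powr_minus powr_divide field_simps)
  also have "C * complex_of_real (2 powr (- (real DIM('a) / 2)) * exp (- pi / 2 * (norm eta)\<^sup>2))
     = complex_of_real ((2 powr (real DIM('a) / 2) * 2 powr (- (real DIM('a) / 2)))
         * (exp (- pi / 2 * (norm (fst w - fst z))\<^sup>2) * exp (- pi / 2 * (norm eta)\<^sup>2))) * cis (2 * pi * (eta \<bullet> m))"
    unfolding C_def of_real_mult by (simp only: mult_ac)
  also have "2 powr (real DIM('a) / 2) * 2 powr (- (real DIM('a) / 2)) = (1::real)"
    by (simp add: powr_add[symmetric])
  also have "exp (- pi / 2 * (norm (fst w - fst z))\<^sup>2) * exp (- pi / 2 * (norm eta)\<^sup>2) = exp (- pi / 2 * (norm (w - z))\<^sup>2)"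
  proof -
    have "(norm (w - z))\<^sup>2 = (norm (fst w - fst z))\<^sup>2 + (norm eta)\<^sup>2"
      by (simp add: norm_prod_def eta_def)
    then show ?thesis by (simp add: exp_add[symmetric] algebra_simps)
  qed
  also have "2 * pi * (eta \<bullet> m) = pi * ((snd w - snd z) \<bullet> (fst w + fst z))"
    by (simp add: m_def eta_def)
  finally show "(\<integral>t. tf_shift_fun w gaussian_fun t * cnj (tf_shift_fun z gaussian_fun t) \<partial>lborel)
       = complex_of_real (exp (- pi / 2 * (norm (w - z))\<^sup>2)) * cis (pi * ((snd w - snd z) \<bullet> (fst w + fst z)))"
    by (simp add: F_def)
qed

lemma sq_int_gaussian: "square_integrable (gaussian_fun :: 'a::euclidean_space \<Rightarrow> complex)"
proof -
  have "gaussian_fun \<in> borel_measurable (borel :: 'a measure)"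
    unfolding gaussian_fun_def by (intro borel_measurable_continuous_onI continuous_intros)
  moreover have "integrable lborel (\<lambda>t::'a. gaussian_fun t * cnj (gaussian_fun t))"
    using gaussian_overlap_integral(1)[of 0 "0::'a \<times> 'a"] by (simp add: tf_shift_fun_def)
  then have "integrable lborel (\<lambda>t::'a. Re (gaussian_fun t * cnj (gaussian_fun t)))"
    by (rule integrable_Re)
  then have "integrable lborel (\<lambda>t::'a. (cmod (gaussian_fun t))\<^sup>2)"
    by (simp only: complex_norm_square[symmetric] Re_complex_of_real)
  ultimately show ?thesis by (simp add: square_integrable_def)
qed

abbreviation coherent :: "'a \<times> 'a \<Rightarrow> 'a::euclidean_space L2" where
  "coherent z \<equiv> tf_shift z gaussian"

lemma coherent_to_L2: "coherent z = to_L2 (tf_shift_fun z gaussian_fun)"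
  by (simp add: gaussian_def tf_shift_to_L2 sq_int_gaussian)

lemma cinner_coherent:
  "cinner (coherent w) (coherent z)
     = complex_of_real (exp (- pi / 2 * (norm (w - z))\<^sup>2)) * cis (pi * ((snd w - snd z) \<bullet> (fst w + fst z)))"
  by (simp add: coherent_to_L2 cinner_to_L2 sq_int_tf_shift sq_int_gaussian gaussian_overlap_integral)

lemma norm_coherent: "norm (coherent z) = 1"
proof -
  have "(norm (coherent z))\<^sup>2 = 1" using cinner_coherent[of z z] by (simp add: cinner_self del: of_real_power)
  then show ?thesis using power2_eq_iff_nonneg[of "norm (coherent z)" 1] by simp
qed

lemma norm_gaussian: "norm gaussian = 1"
  using norm_coherent[of 0] by (simp add: norm_tf_shift)

lemma cmod_cinner_coherent: "cmod (cinner (coherent w) (coherent z)) = exp (- pi / 2 * (norm (w - z))\<^sup>2)"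
  by (simp add: cinner_coherent norm_mult)

lemma continuous_coherent: "continuous_on UNIV (coherent :: 'a \<times> 'a \<Rightarrow> 'a::euclidean_space L2)"
  unfolding continuous_on_def
proof (intro ballI)
  fix z :: "'a \<times> 'a"
  have "((\<lambda>w. (norm (coherent w - coherent z))\<^sup>2) \<longlongrightarrow> 0) (at z)"
  proof -
    have eq: "(norm (coherent w - coherent z))\<^sup>2 = 2 - 2 * Re (cinner (coherent w) (coherent z))" for w
    proof -
      have "Re (cinner (coherent z) (coherent w)) = Re (cinner (coherent w) (coherent z))"
        by (subst cinner_commute) simp
      moreover have "Re (cinner (coherent u) (coherent u)) = 1" for u :: "'a \<times> 'a"
        by (simp add: cinner_self norm_coherent)
      ultimately have "Re (cinner (coherent w - coherent z) (coherent w - coherent z))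
          = 2 - 2 * Re (cinner (coherent w) (coherent z))"
        by (simp add: cinner_diff_left cinner_diff_right)
      then show ?thesis by (simp add: cinner_self del: of_real_power)
    qed
    have "((\<lambda>w. 2 - 2 * Re (cinner (coherent w) (coherent z))) \<longlongrightarrow>
        2 - 2 * Re (complex_of_real (exp (- pi / 2 * (norm (z - z))\<^sup>2)) * cis (pi * ((snd z - snd z) \<bullet> (fst z + fst z))))) (at z)"
      unfolding cinner_coherent by (intro tendsto_intros)
    then show ?thesis by (simp add: eq)
  qed
  then have "((\<lambda>w. sqrt ((norm (coherent w - coherent z))\<^sup>2)) \<longlongrightarrow> sqrt 0) (at z)" by (rule tendsto_real_sqrt)
  then have "((\<lambda>w. coherent w - coherent z) \<longlongrightarrow> 0) (at z)" by (simp add: tendsto_norm_zero_iff)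
  then show "(coherent \<longlongrightarrow> coherent z) (at z within UNIV)" by (simp add: LIM_zero_iff)
qed

section \<open>Polynomial weights\<close>

definition decay :: "real \<Rightarrow> 'b::real_normed_vector \<Rightarrow> real" where
  "decay s z = (1 + norm z) powr (- s)"

lemma one_plus_norm_pos: "0 < 1 + norm z"
  by (rule add_pos_nonneg) auto

lemma decay_pos: "decay s z > 0"
  using one_plus_norm_pos[of z] by (simp add: decay_def)

lemma decay_nonneg: "decay s z \<ge> 0"
  using decay_pos[of s z] by simp

lemma decay_le_1: "s \<ge> 0 \<Longrightarrow> decay s z \<le> 1"
  using powr_mono[of "-s" 0 "1 + norm z"] one_plus_norm_pos[of z] by (simp add: decay_def)

lemma decay_minus_commute: "decay s (x - y) = decay s (y - x)"
  by (simp add: decay_def norm_minus_commute)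

lemma decay_powr: "decay s z powr p = decay (s * p) z"
  by (simp add: decay_def powr_powr)

lemma decay_mono: "s \<le> t \<Longrightarrow> decay t z \<le> decay s z"
  unfolding decay_def by (rule powr_mono) auto

lemma decay_le_shift:
  assumes s: "s \<ge> 0" shows "decay s u \<le> (1 + norm v) powr s * decay s (u + v)"
proof -
  have "1 + norm (u + v) \<le> (1 + norm u) * (1 + norm v)"
  proof -
    have "(1 + norm u) * (1 + norm v) = 1 + norm u + norm v + norm u * norm v" by (simp add: algebra_simps)
    moreover have "0 \<le> norm u * norm v" by simp
    ultimately show ?thesis using norm_triangle_ineq[of u v] by linarith
  qed
  then have "(1 + norm (u + v)) powr s \<le> (1 + norm u) powr s * (1 + norm v) powr s"
    using powr_mono2[OF s, of "1 + norm (u+v)"] by (simp add: powr_mult[symmetric])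
  then show ?thesis
    using one_plus_norm_pos[of u] one_plus_norm_pos[of "u + v"]
    by (simp add: decay_def powr_minus divide_simps mult_ac)
qed

text \<open>If \<open>u + v\<close> is large then \<open>u\<close> or \<open>v\<close> is at least half as large.\<close>

lemma decay_half:
  assumes s: "s \<ge> 0"
  shows "decay s u \<le> 2 powr s * decay s (u + v) \<or> decay s v \<le> 2 powr s * decay s (u + v)"
proof -
  have key: "decay s a \<le> 2 powr s * decay s (a + b)" if le: "norm b \<le> norm a" for a b :: 'a
  proof -
    have "1 + norm (a + b) \<le> 2 * (1 + norm a)"
      using norm_triangle_ineq[of a b] le by simp
    then have "(1 + norm (a + b)) powr s \<le> 2 powr s * (1 + norm a) powr s"
      using powr_mono2[OF s, of "1 + norm (a+b)"] by (simp add: powr_mult[symmetric])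
    then show "decay s a \<le> 2 powr s * decay s (a + b)"
      using one_plus_norm_pos[of a] one_plus_norm_pos[of "a + b"]
      by (simp add: decay_def powr_minus divide_simps mult_ac)
  qed
  show ?thesis
    using key[of v u] key[of u v] by (cases "norm v \<le> norm u") (simp_all add: add.commute)
qed

lemma decay_mult_le:
  assumes s: "s \<ge> 0"
  shows "decay s u * decay s v \<le> 2 powr s * decay s (u + v) * (decay s u + decay s v)"
proof -
  have nn: "decay s a \<ge> 0" for a :: 'a by (rule decay_nonneg)
  consider "decay s u \<le> 2 powr s * decay s (u + v)" | "decay s v \<le> 2 powr s * decay s (u + v)"
    using decay_half[OF s] by blast
  then show ?thesis
  proof cases
    case 1
    have "decay s u * decay s v \<le> 2 powr s * decay s (u + v) * decay s v"
      by (rule mult_right_mono[OF 1 nn])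
    also have "\<dots> \<le> 2 powr s * decay s (u + v) * (decay s u + decay s v)"
      by (rule mult_left_mono) (auto simp: nn)
    finally show ?thesis .
  next
    case 2
    have "decay s u * decay s v \<le> decay s u * (2 powr s * decay s (u + v))"
      by (rule mult_left_mono[OF 2 nn])
    also have "\<dots> \<le> 2 powr s * decay s (u + v) * (decay s u + decay s v)"
      using nn[of u] nn[of v] nn[of "u + v"] by (simp add: algebra_simps)
    finally show ?thesis .
  qed
qed

lemma decay_measurable [measurable]: "decay s \<in> borel_measurable (borel :: 'b::euclidean_space measure)"
  unfolding decay_def by measurable

text \<open>On the dyadic shell \<open>2\<^sup>k \<le> 1 + |u| < 2\<^sup>k\<^sup>+\<^sup>1\<close> the weight is at most \<open>2\<^sup>-\<^sup>k\<^sup>t\<close>, and the shell has volume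
  \<open>O(2\<^sup>k\<^sup>n)\<close>; the resulting series is geometric.\<close>

lemma decay_integrable:
  assumes t: "t > real DIM('b::euclidean_space)"
  shows "integrable lborel (decay t :: 'b \<Rightarrow> real)"
proof (rule integrableI_bounded)
  define n where "n = DIM('b)"
  have [measurable]: "ball x r \<in> sets borel" for x :: 'b and r by simp
  have t0: "t > 0" using t by (rule le_less_trans[rotated]) simp
  define a where "a k = ennreal ((2::real) powr (- (real k * t)))" for k :: nat
  have pw: "ennreal (norm (decay t u)) \<le> (\<Sum>k. a k * indicator (ball 0 (2 ^ Suc k)) u)" for u :: 'b
  proof -
    define k where "k = nat \<lfloor>log 2 (1 + norm u)\<rfloor>"
    have l0: "log 2 (1 + norm u) \<ge> 0" using one_plus_norm_pos[of u] by simp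
    have kl: "real k \<le> log 2 (1 + norm u)" "log 2 (1 + norm u) < real k + 1"
      using l0 by (auto simp: k_def)
    have "2 powr real k \<le> 1 + norm u"
      using kl(1) one_plus_norm_pos[of u] by (simp add: le_log_iff)
    then have "decay t u \<le> (2 powr real k) powr (- t)"
      unfolding decay_def using t0 by (intro powr_mono2') auto
    then have d: "ennreal (norm (decay t u)) \<le> a k"
      by (simp add: a_def powr_powr decay_nonneg ennreal_leI)
    have "1 + norm u < 2 powr (real k + 1)"
      using kl(2) one_plus_norm_pos[of u] by (simp add: log_less_iff)
    also have "\<dots> = 2 ^ Suc k" by (simp add: powr_realpow[symmetric] powr_add)
    finally have u: "u \<in> ball 0 (2 ^ Suc k)" by simp
    have "ennreal (norm (decay t u)) \<le> a k * indicator (ball 0 (2 ^ Suc k)) u"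
      using d u by simp
    also have "\<dots> \<le> (\<Sum>k. a k * indicator (ball 0 (2 ^ Suc k)) u)"
      using sum_le_suminf[of "\<lambda>j. a j * indicator (ball 0 (2 ^ Suc j)) u" "{k}"]
      by (simp only: finite.intros sum.insert sum.empty empty_iff not_False_eq_True add_0_right) simp
    finally show ?thesis .
  qed
  have "(\<integral>\<^sup>+u. ennreal (norm (decay t u)) \<partial>(lborel :: 'b measure))
      \<le> (\<integral>\<^sup>+u. (\<Sum>k. a k * indicator (ball 0 (2 ^ Suc k)) u) \<partial>(lborel :: 'b measure))"
    by (intro nn_integral_mono pw)
  also have "\<dots> = (\<Sum>k. \<integral>\<^sup>+u. a k * indicator (ball 0 (2 ^ Suc k)) u \<partial>(lborel :: 'b measure))"
    by (rule nn_integral_suminf) measurable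
  also have "\<dots> = (\<Sum>k. a k * emeasure lborel (ball (0::'b) (2 ^ Suc k)))"
    by (simp add: nn_integral_cmult)
  also have "\<dots> = (\<Sum>k. ennreal (unit_ball_vol (real n) * 2 ^ n * (2 powr (real n - t)) ^ k))"
  proof (intro suminf_cong)
    fix k
    have "2 powr - (real k * t) * (2 ^ Suc k) ^ n = (2::real) ^ n * (2 powr (real n - t)) ^ k"
    proof -
      have e: "(2 ^ Suc k) ^ n = (2::real) powr (real (Suc k) * real n)"
        by (simp only: power_mult[symmetric] of_nat_mult[symmetric] powr_realpow zero_less_numeral)
      have "(2::real) ^ n = 2 powr real n" by (simp add: powr_realpow)
      moreover have "(2 powr (real n - t)) ^ k = (2::real) powr (real k * (real n - t))"
        by (simp add: powr_power)
      ultimately show ?thesis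
        unfolding e by (simp only: powr_add[symmetric]) (simp add: algebra_simps)
    qed
    then show "a k * emeasure lborel (ball (0::'b) (2 ^ Suc k))
        = ennreal (unit_ball_vol (real n) * 2 ^ n * (2 powr (real n - t)) ^ k)"
      unfolding a_def n_def by (subst emeasure_ball) (auto simp: ennreal_mult[symmetric] mult_ac)
  qed
  also have "\<dots> < \<infinity>"
  proof -
    have "2 powr (real n - t) < (2::real) powr 0"
      using t by (intro powr_less_mono) (auto simp: n_def)
    then have "summable (\<lambda>k. unit_ball_vol (real n) * 2 ^ n * (2 powr (real n - t)) ^ k)"
      by (intro summable_mult summable_geometric) simp
    then show ?thesis by (subst suminf_ennreal2) auto
  qed
  finally show "(\<integral>\<^sup>+u. ennreal (norm (decay t u)) \<partial>(lborel :: 'b measure)) < \<infinity>" .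
qed measurable

definition decay_integral :: "'b::euclidean_space itself \<Rightarrow> real \<Rightarrow> real" where
  "decay_integral _ t = (\<integral>u. decay t (u::'b) \<partial>lborel)"

lemma decay_integral_nonneg: "decay_integral TYPE('b::euclidean_space) t \<ge> 0"
  unfolding decay_integral_def by (rule Bochner_Integration.integral_nonneg) (rule decay_nonneg)

lemma decay_integral_shift:
  assumes t: "t > real DIM('b::euclidean_space)"
  shows "integrable lborel (\<lambda>u::'b. decay t (u - w))" "(\<integral>u. decay t (u - w) \<partial>(lborel :: 'b measure)) = decay_integral TYPE('b) t"
    "integrable lborel (\<lambda>u::'b. decay t (w - u))" "(\<integral>u. decay t (w - u) \<partial>(lborel :: 'b measure)) = decay_integral TYPE('b) t"
proof -
  note m = decay_measurable[of t, where ?'b='b]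
  show i: "integrable lborel (\<lambda>u::'b. decay t (u - w))"
    using lborel_translate(1)[OF m, of "- w"] decay_integrable[OF t] by simp
  show e: "(\<integral>u. decay t (u - w) \<partial>(lborel :: 'b measure)) = decay_integral TYPE('b) t"
    using lborel_translate(2)[OF m, of "- w"] by (simp add: decay_integral_def)
  show "integrable lborel (\<lambda>u::'b. decay t (w - u))" using i by (simp add: decay_minus_commute[of t w])
  show "(\<integral>u. decay t (w - u) \<partial>(lborel :: 'b measure)) = decay_integral TYPE('b) t" using e by (simp add: decay_minus_commute[of t w])
qed

section \<open>Sums over separated sets\<close>

text \<open>The translates of the ball by the points of \<open>\<Lambda>\<close> are disjoint, so the integrals over them add up
  to at most the whole integral.\<close>

lemma separated_tile:
  fixes h :: "'b::euclidean_space \<Rightarrow> ennreal"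
  assumes c: "countable \<Lambda>" and sep: "\<And>l m. l \<in> \<Lambda> \<Longrightarrow> m \<in> \<Lambda> \<Longrightarrow> l \<noteq> m \<Longrightarrow> dist l m \<ge> 2 * \<delta>"
    and h: "h \<in> borel_measurable borel"
  shows "(\<integral>\<^sup>+u. (\<integral>\<^sup>+l. h (l + u) \<partial>count_space \<Lambda>) * indicator (ball 0 \<delta>) u \<partial>lborel) \<le> (\<integral>\<^sup>+u. h u \<partial>lborel)"
proof -
  note [measurable] = h
  have [measurable]: "ball x r \<in> sets borel" for x :: 'b and r by simp
  have "(\<integral>\<^sup>+u. (\<integral>\<^sup>+l. h (l + u) \<partial>count_space \<Lambda>) * indicator (ball 0 \<delta>) u \<partial>lborel)
      = (\<integral>\<^sup>+u. (\<integral>\<^sup>+l. h (l + u) * indicator (ball 0 \<delta>) u \<partial>count_space \<Lambda>) \<partial>lborel)"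
    by (simp add: nn_integral_multc)
  also have "\<dots> = (\<integral>\<^sup>+l. (\<integral>\<^sup>+u. h (l + u) * indicator (ball 0 \<delta>) u \<partial>lborel) \<partial>count_space \<Lambda>)"
    by (rule nn_integral_count_space_nn_integral[OF c]) measurable
  also have "\<dots> = (\<integral>\<^sup>+l. (\<integral>\<^sup>+u. h u * indicator (ball l \<delta>) u \<partial>lborel) \<partial>count_space \<Lambda>)"
  proof (rule nn_integral_cong)
    fix l :: 'b
    have "indicator (ball 0 \<delta>) u = (indicator (ball l \<delta>) (l + u) :: ennreal)" for u
    proof -
      have "dist l (l + u) = dist 0 u" by (simp add: dist_norm)
      then show ?thesis by (simp add: indicator_def)
    qed
    then show "(\<integral>\<^sup>+u. h (l + u) * indicator (ball 0 \<delta>) u \<partial>lborel) = (\<integral>\<^sup>+u. h u * indicator (ball l \<delta>) u \<partial>lborel)"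
      using nn_integral_lborel_translate[of "\<lambda>u. h u * indicator (ball l \<delta>) u" l] by simp
  qed
  also have "\<dots> = (\<integral>\<^sup>+u. (\<integral>\<^sup>+l. h u * indicator (ball l \<delta>) u \<partial>count_space \<Lambda>) \<partial>lborel)"
    by (rule nn_integral_count_space_nn_integral[OF c, symmetric]) measurable
  also have "\<dots> \<le> (\<integral>\<^sup>+u. h u \<partial>lborel)"
  proof (rule nn_integral_mono)
    fix u
    have "(\<integral>\<^sup>+l. indicator (ball l \<delta>) u \<partial>count_space \<Lambda>) = (\<integral>\<^sup>+l. indicator {l\<in>\<Lambda>. u \<in> ball l \<delta>} l \<partial>count_space \<Lambda>)"
      by (rule nn_integral_cong) (auto simp: indicator_def)
    also have "\<dots> = emeasure (count_space \<Lambda>) {l\<in>\<Lambda>. u \<in> ball l \<delta>}" by (rule nn_integral_indicator) auto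
    also have "\<dots> \<le> 1"
    proof (cases "\<exists>m\<in>\<Lambda>. u \<in> ball m \<delta>")
      case True
      then obtain m where m: "m \<in> \<Lambda>" "u \<in> ball m \<delta>" by blast
      have "{l\<in>\<Lambda>. u \<in> ball l \<delta>} \<subseteq> {m}"
      proof
        fix l assume l: "l \<in> {l\<in>\<Lambda>. u \<in> ball l \<delta>}"
        have "dist l m \<le> dist l u + dist m u" by (rule dist_triangle2)
        then have "dist l m < 2 * \<delta>" using l m by simp
        then show "l \<in> {m}" using sep[of l m] l m by force
      qed
      then have "{l\<in>\<Lambda>. u \<in> ball l \<delta>} = {m}" using m by blast
      then show ?thesis using m by (simp add: emeasure_count_space)
    next
      case False
      then have "{l\<in>\<Lambda>. u \<in> ball l \<delta>} = {}" by blast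
      then show ?thesis by (simp only: emeasure_empty zero_le)
    qed
    finally have "(\<integral>\<^sup>+l. indicator (ball l \<delta>) u \<partial>count_space \<Lambda>) \<le> 1" .
    then have "h u * (\<integral>\<^sup>+l. indicator (ball l \<delta>) u \<partial>count_space \<Lambda>) \<le> h u * 1" by (intro mult_left_mono) auto
    then show "(\<integral>\<^sup>+l. h u * indicator (ball l \<delta>) u \<partial>count_space \<Lambda>) \<le> h u" by (simp add: nn_integral_cmult)
  qed
  finally show ?thesis .
qed

lemma sum_le_nn_integral_count_space:
  fixes h :: "'b \<Rightarrow> ennreal"
  assumes "finite F" "F \<subseteq> \<Lambda>"
  shows "sum h F \<le> (\<integral>\<^sup>+l. h l \<partial>count_space \<Lambda>)"
proof -
  have "sum h F = (\<integral>\<^sup>+l. h l \<partial>count_space F)" by (simp add: nn_integral_count_space_finite assms)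
  also have "\<dots> = (\<integral>\<^sup>+l. h l * indicator F l \<partial>count_space UNIV)"
    by (simp add: nn_integral_count_space_indicator)
  also have "\<dots> \<le> (\<integral>\<^sup>+l. h l * indicator \<Lambda> l \<partial>count_space UNIV)"
    by (rule nn_integral_mono) (use assms(2) in \<open>auto simp: indicator_def\<close>)
  also have "\<dots> = (\<integral>\<^sup>+l. h l \<partial>count_space \<Lambda>)"
    by (simp add: nn_integral_count_space_indicator)
  finally show ?thesis .
qed

text \<open>On each tile the weight varies by a bounded factor only, which compares the sum with the integral.\<close>

lemma separated_decay_sum:
  fixes \<Lambda> :: "'b::euclidean_space set"
  assumes c: "countable \<Lambda>" and sep: "\<And>l m. l \<in> \<Lambda> \<Longrightarrow> m \<in> \<Lambda> \<Longrightarrow> l \<noteq> m \<Longrightarrow> dist l m \<ge> 2 * \<delta>"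
    and d: "\<delta> > 0" and t: "t > real DIM('b)"
  shows "\<exists>C\<ge>0. \<forall>z F. finite F \<longrightarrow> F \<subseteq> \<Lambda> \<longrightarrow> (\<Sum>l\<in>F. decay t (l - z)) \<le> C"
proof -
  define V where "V = measure lborel (ball (0::'b) \<delta>)"
  have V: "V > 0" using d by (simp add: V_def)
  have Ve: "emeasure lborel (ball (0::'b) \<delta>) = ennreal V"
    unfolding V_def by (rule emeasure_eq_ennreal_measure) (use d in \<open>simp add: emeasure_ball\<close>)
  have t0: "t \<ge> 0" using t by (rule le_less_trans[rotated, THEN less_imp_le]) simp
  define I where "I = decay_integral TYPE('b) t"
  define C where "C = (1 + \<delta>) powr t * I / V"
  have "(\<Sum>l\<in>F. decay t (l - z)) \<le> C" if F: "finite F" "F \<subseteq> \<Lambda>" for z F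
  proof -
    define h where "h u = ennreal ((1 + \<delta>) powr t * decay t (u - z))" for u :: 'b
    have [measurable]: "h \<in> borel_measurable borel" unfolding h_def by measurable
    define S where "S = (\<Sum>l\<in>F. decay t (l - z))"
    have S0: "S \<ge> 0" unfolding S_def by (intro sum_nonneg) (simp add: decay_nonneg)
    have *: "ennreal S \<le> (\<integral>\<^sup>+l. h (l + u) \<partial>count_space \<Lambda>)" if u: "u \<in> ball 0 \<delta>" for u
    proof -
      have "ennreal S = (\<Sum>l\<in>F. ennreal (decay t (l - z)))"
        unfolding S_def by (simp add: sum_ennreal decay_nonneg)
      also have "\<dots> \<le> (\<Sum>l\<in>F. h (l + u))"
      proof (rule sum_mono)
        fix l
        have "decay t (l - z) \<le> (1 + norm u) powr t * decay t (l - z + u)" by (rule decay_le_shift[OF t0])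
        also have "\<dots> \<le> (1 + \<delta>) powr t * decay t (l - z + u)"
          using u t0 by (intro mult_right_mono powr_mono2) (auto simp: decay_nonneg)
        finally show "ennreal (decay t (l - z)) \<le> h (l + u)" by (simp add: h_def ennreal_leI algebra_simps)
      qed
      also have "\<dots> \<le> (\<integral>\<^sup>+l. h (l + u) \<partial>count_space \<Lambda>)"
        by (rule sum_le_nn_integral_count_space[OF F])
      finally show ?thesis .
    qed
    have "ennreal (S * V) = (\<integral>\<^sup>+u. ennreal S * indicator (ball 0 \<delta>) u \<partial>(lborel :: 'b measure))"
      using S0 V by (simp add: nn_integral_cmult_indicator Ve ennreal_mult)
    also have "\<dots> \<le> (\<integral>\<^sup>+u. (\<integral>\<^sup>+l. h (l + u) \<partial>count_space \<Lambda>) * indicator (ball 0 \<delta>) u \<partial>lborel)"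
      by (intro nn_integral_mono) (use * in \<open>auto simp: indicator_def\<close>)
    also have "\<dots> \<le> (\<integral>\<^sup>+u. h u \<partial>lborel)" by (rule separated_tile[OF c sep]) auto
    also have "\<dots> = ennreal ((1 + \<delta>) powr t * I)"
      unfolding h_def I_def decay_integral_shift(2)[OF t, of z, symmetric]
      by (subst nn_integral_eq_integral) (use decay_integral_shift(1)[OF t] in \<open>auto simp: decay_nonneg\<close>)
    finally have "S * V \<le> (1 + \<delta>) powr t * I"
      by (subst (asm) ennreal_le_iff) (auto simp: I_def decay_integral_nonneg)
    then show ?thesis using V by (simp add: C_def S_def field_simps)
  qed
  moreover have "C \<ge> 0" using V by (simp add: C_def I_def decay_integral_nonneg)
  ultimately show ?thesis by blast
qed

lemma decay_convolution_sum:
  assumes C: "\<And>z F. finite F \<Longrightarrow> F \<subseteq> \<Lambda> \<Longrightarrow> (\<Sum>l\<in>F. decay s (l - z)) \<le> C" and s: "s \<ge> 0"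
    and F: "finite F" "F \<subseteq> \<Lambda>"
  shows "(\<Sum>l\<in>F. decay s (l - w) * decay s (l - z)) \<le> 2 powr s * (2 * C) * decay s (w - z)"
proof -
  have "(\<Sum>l\<in>F. decay s (l - w) * decay s (l - z))
      \<le> (\<Sum>l\<in>F. 2 powr s * decay s (w - z) * (decay s (l - w) + decay s (l - z)))"
  proof (rule sum_mono)
    fix l
    have "decay s (w - l) * decay s (l - z) \<le> 2 powr s * decay s ((w - l) + (l - z)) * (decay s (w - l) + decay s (l - z))"
      by (rule decay_mult_le[OF s])
    then show "decay s (l - w) * decay s (l - z) \<le> 2 powr s * decay s (w - z) * (decay s (l - w) + decay s (l - z))"
      by (simp add: decay_minus_commute[of s w l])
  qed
  also have "\<dots> = 2 powr s * decay s (w - z) * ((\<Sum>l\<in>F. decay s (l - w)) + (\<Sum>l\<in>F. decay s (l - z)))"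
    unfolding sum.distrib[symmetric] by (rule sum_distrib_left[symmetric])
  also have "\<dots> \<le> 2 powr s * decay s (w - z) * (C + C)"
    by (intro mult_left_mono add_mono C F) (auto simp: decay_nonneg)
  finally show ?thesis by (simp add: mult_ac)
qed

section \<open>The coherent frame and its resolution of the identity\<close>

lemma tf_shift_surj: "\<exists>f'. f = tf_shift z f' \<and> norm f' = norm f"
proof -
  define c where "c = cis (- 2 * pi * (snd (- z) \<bullet> fst z))"
  have c: "cnj c * c = 1" by (simp add: c_def cis_cnj cis_mult)
  have t0: "tf_shift 0 f = f"
  proof -
    obtain f0 where "square_integrable f0" "f = to_L2 f0" using L2_cases by metis
    then show ?thesis by (simp add: tf_shift_to_L2) (simp add: tf_shift_fun_def[abs_def])
  qed
  have "tf_shift z (cnj c *\<^sub>C tf_shift (- z) f) = cnj c *\<^sub>C (c *\<^sub>C tf_shift (z + (- z)) f)"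
    unfolding bounded_clinear_scaleC[OF bounded_clinear_tf_shift] tf_shift_comp c_def ..
  also have "\<dots> = f" by (simp add: scaleC_scaleC c scaleC_one t0)
  finally show ?thesis
    by (intro exI[of _ "cnj c *\<^sub>C tf_shift (- z) f"]) (simp add: norm_scaleC norm_tf_shift c_def)
qed

lemma cmod_cinner_tf_shift_coherent:
  "cmod (cinner (tf_shift l f) (coherent (l + u))) = cmod (cinner f (coherent u))"
  "cmod (cinner (coherent (l + u)) (tf_shift l f)) = cmod (cinner (coherent u) f)"
proof -
  have e: "tf_shift l (coherent u) = cis (- 2 * pi * (snd u \<bullet> fst l)) *\<^sub>C coherent (l + u)"
    by (rule tf_shift_comp)
  have "cmod (cinner f (coherent u)) = cmod (cinner (tf_shift l f) (tf_shift l (coherent u)))"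
    by (simp only: cinner_tf_shift)
  then show "cmod (cinner (tf_shift l f) (coherent (l + u))) = cmod (cinner f (coherent u))"
    unfolding e by (simp add: cinner_scaleC_right norm_mult)
  have "cmod (cinner (coherent u) f) = cmod (cinner (tf_shift l (coherent u)) (tf_shift l f))"
    by (simp only: cinner_tf_shift)
  then show "cmod (cinner (coherent (l + u)) (tf_shift l f)) = cmod (cinner (coherent u) f)"
    unfolding e by (simp add: cinner_scaleC_left norm_mult)
qed

lemma cmod_cinner_commute: "cmod (cinner f g) = cmod (cinner g f)"
  by (subst cinner_commute) simp

lemma norm_hs_rank_one: "norm (hs_rank_one f g) = norm f * sqrt (\<Sum>\<^sub>\<infinity>e\<in>onb. (cmod (cinner e g))\<^sup>2)"
proof -
  have "(norm (hs_rank_one f g))\<^sup>2 = (\<Sum>\<^sub>\<infinity>e\<in>onb. (cmod (cinner e g))\<^sup>2) * (norm f)\<^sup>2"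
    by (simp add: norm_hs_power2 hs_rank_one.rep_eq rank_one_def norm_scaleC power_mult_distrib
        infsum_cmult_left summable_onb_cinner)
  then have "norm (hs_rank_one f g) = sqrt ((\<Sum>\<^sub>\<infinity>e\<in>onb. (cmod (cinner e g))\<^sup>2) * (norm f)\<^sup>2)"
    by (metis norm_ge_zero real_sqrt_unique)
  then show ?thesis by (simp add: real_sqrt_mult)
qed

lemma bounded_clinear_gabor: "bounded_clinear (rank_one gaussian gaussian \<circ> cadjoint (tf_shift l))"
  by (intro bounded_clinear_compo bounded_clinear_rank_one bounded_clinear_cadjoint bounded_clinear_tf_shift)

lemma gabor_G_rank_one:
  "gabor_G l (hs_rank_one f g) = cinner f (coherent l) *\<^sub>C hs_rank_one gaussian g"
  by (rule hs_eqI)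
     (simp add: gabor_G_def hs_apply_left_mult[OF bounded_clinear_gabor] hs_rank_one.rep_eq rank_one_def
       scaleC_hs.rep_eq bounded_clinear_scaleC[OF bounded_clinear_cadjoint[OF bounded_clinear_tf_shift]]
       cinner_scaleC_left cinner_cadjoint'[OF bounded_clinear_tf_shift] scaleC_scaleC mult.commute)

text \<open>The rank-one form turns the frame of coherent states over the shifted lattice \<open>z\<^sub>0 + \<Lambda>\<close> into
  a g-frame.\<close>

definition coherent_op :: "'a \<times> 'a \<Rightarrow> 'a \<times> 'a \<Rightarrow> 'a::euclidean_space L2 \<Rightarrow> 'a L2" where
  "coherent_op z0 l = rank_one gaussian (coherent (z0 + l))"

lemma norm_coherent_op: "norm (coherent_op z0 l f) = cmod (cinner f (coherent (z0 + l)))"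
  by (simp add: coherent_op_def rank_one_def norm_scaleC norm_gaussian)

lemma coherent_op_adjoint: "cadjoint (coherent_op z0 l) (coherent_op z0 l f) = cinner f (coherent (z0 + l)) *\<^sub>C coherent (z0 + l)"
  by (simp add: coherent_op_def cadjoint_rank_one rank_one_def cinner_scaleC_left cinner_self norm_gaussian)

definition stft :: "'a::euclidean_space L2 \<Rightarrow> 'a \<times> 'a \<Rightarrow> complex" where
  "stft f u = cinner f (coherent u)"

lemma continuous_stft: "continuous_on UNIV (stft f)"
  unfolding stft_def[abs_def]
  by (rule continuous_on_compose2[OF linear_continuous_on[OF bounded_linear_cinner_right] continuous_coherent]) auto

lemma stft_measurable [measurable]: "stft f \<in> borel_measurable borel"
  by (rule borel_measurable_continuous_onI[OF continuous_stft])

lemma stft_zero: "stft 0 = (\<lambda>u. 0)"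
  by (rule ext) (simp add: stft_def cinner_zero_left)

lemma stft_add: "stft (f + g) = (\<lambda>u. stft f u + stft g u)"
  by (rule ext) (simp add: stft_def cinner_add_left)

lemma stft_scaleC: "stft (c *\<^sub>C f) = (\<lambda>u. c * stft f u)"
  by (rule ext) (simp add: stft_def cinner_scaleC_left)

text \<open>With \<open>c = (w + z)/2\<close> the integrand at \<open>c + v\<close> is a constant times
  \<open>exp (- \<pi> |v|\<^sup>2)\<close> times a character, so this is a Gaussian Fourier integral.\<close>

lemma moyal_coherent:
  fixes w z :: "'a::euclidean_space \<times> 'a"
  shows "integrable lborel (\<lambda>u. stft (coherent w) u * cnj (stft (coherent z) u))"
    and "(\<integral>u. stft (coherent w) u * cnj (stft (coherent z) u) \<partial>lborel) = cinner (coherent w) (coherent z)"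
proof -
  define F where "F u = stft (coherent w) u * cnj (stft (coherent z) u)" for u :: "'a \<times> 'a"
  define c where "c = (1/2) *\<^sub>R (w + z)"
  define k where "k = (pi *\<^sub>R (snd w - snd z), pi *\<^sub>R (fst z - fst w))"
  define C where "C = complex_of_real (exp (- pi / 4 * (norm (w - z))\<^sup>2))
      * cis (pi * (snd w \<bullet> fst w - snd z \<bullet> fst z) + k \<bullet> c)"
  have Fc: "F (c + v) = C * (complex_of_real (exp (- pi * (norm v)\<^sup>2)) * cis (k \<bullet> v))" for v
  proof -
    define u where "u = c + v"
    have e1: "w - u = (1/2) *\<^sub>R (w - z) - v"
      by (simp add: u_def c_def prod_eq_iff algebra_simps) (simp add: scaleR_add_left[symmetric])
    have e2: "z - u = - (1/2) *\<^sub>R (w - z) - v"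
      by (simp add: u_def c_def prod_eq_iff algebra_simps) (simp add: scaleR_add_left[symmetric])
    have n: "(norm (w - u))\<^sup>2 + (norm (z - u))\<^sup>2 = 2 * (norm v)\<^sup>2 + (norm (w - z))\<^sup>2 / 2"
      unfolding e1 e2 power2_norm_eq_inner
      by (simp add: inner_diff inner_add algebra_simps inner_commute) (simp add: field_simps)
    have ex: "exp (- pi / 2 * (norm (w - u))\<^sup>2) * exp (- pi / 2 * (norm (z - u))\<^sup>2)
        = exp (- pi / 4 * (norm (w - z))\<^sup>2) * exp (- pi * (norm v)\<^sup>2)"
    proof -
      have "- pi / 2 * (norm (w - u))\<^sup>2 + - pi / 2 * (norm (z - u))\<^sup>2
         = - pi / 2 * ((norm (w - u))\<^sup>2 + (norm (z - u))\<^sup>2)" by (simp add: algebra_simps)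
      also have "\<dots> = - pi / 4 * (norm (w - z))\<^sup>2 + - pi * (norm v)\<^sup>2"
        unfolding n by (simp add: algebra_simps)
      finally show ?thesis by (simp only: exp_add[symmetric])
    qed
    have ph: "cis (pi * ((snd w - snd u) \<bullet> (fst w + fst u))) * cnj (cis (pi * ((snd z - snd u) \<bullet> (fst z + fst u))))
        = cis (pi * (snd w \<bullet> fst w - snd z \<bullet> fst z) + k \<bullet> c) * cis (k \<bullet> v)"
    proof -
      have "pi * ((snd w - snd u) \<bullet> (fst w + fst u)) + - (pi * ((snd z - snd u) \<bullet> (fst z + fst u)))
         = pi * (snd w \<bullet> fst w - snd z \<bullet> fst z) + k \<bullet> u"
        by (simp add: k_def inner_prod_def inner_diff inner_add inner_commute algebra_simps)
      also have "\<dots> = pi * (snd w \<bullet> fst w - snd z \<bullet> fst z) + k \<bullet> c + k \<bullet> v"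
        by (simp add: u_def inner_add_right)
      finally show ?thesis by (simp only: cis_cnj cis_mult)
    qed
    have "F u = complex_of_real (exp (- pi / 2 * (norm (w - u))\<^sup>2) * exp (- pi / 2 * (norm (z - u))\<^sup>2))
        * (cis (pi * ((snd w - snd u) \<bullet> (fst w + fst u))) * cnj (cis (pi * ((snd z - snd u) \<bullet> (fst z + fst u)))))"
      unfolding F_def stft_def cinner_coherent complex_cnj_mult complex_cnj_complex_of_real of_real_mult by (simp only: mult_ac)
    then have "F u = C * (complex_of_real (exp (- pi * (norm v)\<^sup>2)) * cis (k \<bullet> v))"
      unfolding ex ph C_def of_real_mult by (simp only: mult_ac)
    then show ?thesis by (simp only: u_def)
  qed
  have [measurable]: "F \<in> borel_measurable borel" unfolding F_def by measurable
  note gi = gaussian_integral[OF pi_gt_zero, of k]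
  have "integrable lborel (\<lambda>v. F (c + v))" unfolding Fc by (intro integrable_mult_right gi)
  then show "integrable lborel (\<lambda>u. stft (coherent w) u * cnj (stft (coherent z) u))"
    unfolding F_def[symmetric] using lborel_translate(1)[of F c] by simp
  have nk: "(norm k)\<^sup>2 = pi\<^sup>2 * (norm (w - z))\<^sup>2"
    by (simp add: k_def norm_prod_def power_mult_distrib norm_minus_commute[of "fst z"] distrib_left
        scaleR_diff_right[symmetric] del: scaleR_diff_right)
  have "(\<integral>u. F u \<partial>lborel) = (\<integral>v. F (c + v) \<partial>lborel)" using lborel_translate(2)[of F c] by simp
  also have "\<dots> = C * complex_of_real ((pi / pi) powr (real DIM('a \<times> 'a) / 2) * exp (- (norm k)\<^sup>2 / (4 * pi)))"
    unfolding Fc Bochner_Integration.integral_mult_right_zero by (simp only: gi(2))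
  also have "(pi / pi) powr (real DIM('a \<times> 'a) / 2) * exp (- (norm k)\<^sup>2 / (4 * pi)) = exp (- pi / 4 * (norm (w - z))\<^sup>2)"
    unfolding nk by (simp add: power2_eq_square)
  also have "C * complex_of_real (exp (- pi / 4 * (norm (w - z))\<^sup>2)) = cinner (coherent w) (coherent z)"
  proof -
    have "pi * (snd w \<bullet> fst w - snd z \<bullet> fst z) + k \<bullet> c = pi * ((snd w - snd z) \<bullet> (fst w + fst z))"
      by (simp add: k_def c_def inner_prod_def inner_diff inner_add inner_commute algebra_simps)
    moreover have "exp (- pi / 4 * (norm (w - z))\<^sup>2) * exp (- pi / 4 * (norm (w - z))\<^sup>2) = exp (- pi / 2 * (norm (w - z))\<^sup>2)"
      by (simp add: exp_add[symmetric])
    ultimately show ?thesis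
      unfolding C_def cinner_coherent by (simp only: mult_ac of_real_mult[symmetric])
  qed
  finally show "(\<integral>u. stft (coherent w) u * cnj (stft (coherent z) u) \<partial>lborel) = cinner (coherent w) (coherent z)"
    by (simp add: F_def)
qed

inductive_set cspan :: "'k::complex_inner set \<Rightarrow> 'k set" for V where
  cspan_zero: "0 \<in> cspan V"
| cspan_base: "v \<in> V \<Longrightarrow> v \<in> cspan V"
| cspan_add: "x \<in> cspan V \<Longrightarrow> y \<in> cspan V \<Longrightarrow> x + y \<in> cspan V"
| cspan_scaleC: "x \<in> cspan V \<Longrightarrow> c *\<^sub>C x \<in> cspan V"

lemma closure_cspan:
  fixes V :: "'h::complex_hilbert set"
  assumes tot: "\<And>x. (\<And>v. v \<in> V \<Longrightarrow> cinner x v = 0) \<Longrightarrow> x = 0"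
  shows "x \<in> closure (cspan V)"
proof (rule total_set_induct[where V = V and P = "\<lambda>x. x \<in> closure (cspan V)", OF tot])
  show "v \<in> closure (cspan V)" if "v \<in> V" for v using that closure_subset cspan_base by blast
  show "0 \<in> closure (cspan V)" using closure_subset cspan_zero by blast
  show "x + y \<in> closure (cspan V)" if xy: "x \<in> closure (cspan V)" "y \<in> closure (cspan V)" for x y
  proof -
    obtain f where "\<And>n. f n \<in> cspan V" "f \<longlonglongrightarrow> x"
      using xy(1) unfolding closure_sequential by blast
    moreover obtain g where "\<And>n. g n \<in> cspan V" "g \<longlonglongrightarrow> y"
      using xy(2) unfolding closure_sequential by blast
    ultimately show ?thesis
      unfolding closure_sequential by (intro exI[of _ "\<lambda>n. f n + g n"]) (auto intro: cspan_add tendsto_add)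
  qed
  show "c *\<^sub>C x \<in> closure (cspan V)" if x: "x \<in> closure (cspan V)" for c x
  proof -
    obtain f where "\<And>n. f n \<in> cspan V" "f \<longlonglongrightarrow> x" using x unfolding closure_sequential by blast
    then show ?thesis
      unfolding closure_sequential by (intro exI[of _ "\<lambda>n. c *\<^sub>C f n"]) (auto intro: cspan_scaleC tendsto_scaleC)
  qed
qed (auto intro: closed_closure)

locale gaussian_gabor_frame =
  fixes N :: nat and \<Lambda> :: "('a::euclidean_space \<times> 'a) set"
  assumes N_pos: "N > 0" and Lat: "\<Lambda> = lattice N" and frame: "g_frame \<Lambda> gabor_G"
begin

lemma countable_Lambda: "countable \<Lambda>"
  using frame by (simp add: g_frame_def)

definition sep_radius :: real where "sep_radius = 1 / (2 * real N)"

lemma sep_radius_pos: "sep_radius > 0"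
  using N_pos by (simp add: sep_radius_def)

lemma Lambda_separated:
  assumes "l \<in> \<Lambda>" "m \<in> \<Lambda>" "l \<noteq> m"
  shows "dist l m \<ge> 2 * sep_radius"
proof -
  have coord: "1 / real N \<le> norm (x - y)"
    if xy: "\<And>b. b \<in> Basis \<Longrightarrow> real N * (x \<bullet> b) \<in> \<int>" "\<And>b. b \<in> Basis \<Longrightarrow> real N * (y \<bullet> b) \<in> \<int>" "x \<noteq> y" for x y :: 'a
  proof -
    obtain b where b: "b \<in> Basis" "(x - y) \<bullet> b \<noteq> 0"
      using xy(3) euclidean_eq_iff[of x y] by (auto simp: inner_diff_left)
    have "real N * (x \<bullet> b) - real N * (y \<bullet> b) \<in> \<int>" by (intro Ints_diff xy b)
    then have "real N * ((x - y) \<bullet> b) \<in> \<int>" by (simp add: inner_diff_left algebra_simps)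
    then have "1 \<le> \<bar>real N * ((x - y) \<bullet> b)\<bar>"
      by (rule Ints_nonzero_abs_ge1) (use b N_pos in simp)
    then have "1 / real N \<le> \<bar>(x - y) \<bullet> b\<bar>" using N_pos by (simp add: abs_mult field_simps)
    also have "\<dots> \<le> norm (x - y)" by (rule Basis_le_norm[OF b(1)])
    finally show ?thesis .
  qed
  have lm: "l - m = (fst l - fst m, snd l - snd m)" by (simp add: prod_eq_iff)
  have "1 / real N \<le> norm (l - m)"
  proof (cases "fst l = fst m")
    case False
    then have "1 / real N \<le> norm (fst l - fst m)" using assms by (intro coord) (auto simp: Lat lattice_def)
    also have "\<dots> \<le> norm (l - m)" unfolding lm by (rule norm_fst_le)
    finally show ?thesis .
  next
    case True
    then have "snd l \<noteq> snd m" using assms by (auto simp: prod_eq_iff)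
    then have "1 / real N \<le> norm (snd l - snd m)" using assms by (intro coord) (auto simp: Lat lattice_def)
    also have "\<dots> \<le> norm (l - m)" unfolding lm by (rule norm_snd_le)
    finally show ?thesis .
  qed
  then show ?thesis by (simp add: sep_radius_def dist_norm)
qed

lemma lattice_decay_sum:
  assumes "t > 2 * real DIM('a)"
  shows "\<exists>C\<ge>0. \<forall>z F. finite F \<longrightarrow> F \<subseteq> \<Lambda> \<longrightarrow> (\<Sum>l\<in>F. decay t (l - z)) \<le> C"
  by (rule separated_decay_sum[OF countable_Lambda Lambda_separated sep_radius_pos]) (use assms in auto)

text \<open>Tested on rank-one operators \<open>f \<otimes> g\<close>, the g-frame inequality is the Gabor frame inequality for
  \<open>f\<close>; a unitary time-frequency shift moves the lattice without changing the bounds.\<close>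

lemma coherent_frame_bounds: "\<exists>A B. \<forall>z0. frame_bounds \<Lambda> (coherent_op z0) A B"
proof -
  obtain A B where AB: "frame_bounds \<Lambda> (gabor_G :: _ \<Rightarrow> 'a L2 hs \<Rightarrow> _) A B"
    using g_frame_imp_frame_bounds[OF frame] by blast
  define g where "g = (gaussian :: 'a L2)"
  define k where "k = (\<Sum>\<^sub>\<infinity>e\<in>onb. (cmod (cinner e g))\<^sup>2)"
  have n: "(norm (hs_rank_one f g))\<^sup>2 = (norm f)\<^sup>2 * k" for f
    unfolding norm_hs_rank_one k_def by (simp add: power_mult_distrib infsum_nonneg)
  have ng: "norm g = 1" by (simp add: g_def norm_gaussian)
  have k: "k > 0"
  proof (rule ccontr)
    assume "\<not> k > 0"
    then have "(norm (hs_rank_one g g))\<^sup>2 \<le> 0" by (simp add: n ng)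
    then have "hs_rank_one g g = 0" by simp
    then have "hs_apply (hs_rank_one g g) g = 0" by (simp add: zero_hs.rep_eq)
    then have "norm (cinner g g *\<^sub>C g) = 0" by (simp add: hs_rank_one.rep_eq rank_one_def)
    then show False by (simp add: norm_scaleC cinner_self ng)
  qed
  have G: "(norm (gabor_G l (hs_rank_one f g)))\<^sup>2 = (cmod (cinner f (coherent l)))\<^sup>2 * k" for l f
    using n[of gaussian] by (simp add: gabor_G_rank_one norm_scaleC power_mult_distrib norm_gaussian)
  have base: "(\<lambda>l. (cmod (cinner f (coherent l)))\<^sup>2) summable_on \<Lambda>"
    "A * (norm f)\<^sup>2 \<le> (\<Sum>\<^sub>\<infinity>l\<in>\<Lambda>. (cmod (cinner f (coherent l)))\<^sup>2)"
    "(\<Sum>\<^sub>\<infinity>l\<in>\<Lambda>. (cmod (cinner f (coherent l)))\<^sup>2) \<le> B * (norm f)\<^sup>2" for f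
  proof -
    have "(\<lambda>l. (norm (gabor_G l H))\<^sup>2) summable_on \<Lambda>" for H :: "'a L2 hs"
      using AB by (simp add: frame_bounds_def)
    from this[of "hs_rank_one f g"] have "(\<lambda>l. (cmod (cinner f (coherent l)))\<^sup>2 * k) summable_on \<Lambda>"
      by (simp only: G)
    then show s: "(\<lambda>l. (cmod (cinner f (coherent l)))\<^sup>2) summable_on \<Lambda>"
      using k by (simp add: summable_on_cmult_left')
    have e: "(\<Sum>\<^sub>\<infinity>l\<in>\<Lambda>. (norm (gabor_G l (hs_rank_one f g)))\<^sup>2) = (\<Sum>\<^sub>\<infinity>l\<in>\<Lambda>. (cmod (cinner f (coherent l)))\<^sup>2) * k"
      unfolding G by (rule infsum_cmult_left) (rule s)
    have "A * ((norm f)\<^sup>2 * k) \<le> (\<Sum>\<^sub>\<infinity>l\<in>\<Lambda>. (cmod (cinner f (coherent l)))\<^sup>2) * k"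
      using AB unfolding frame_bounds_def e[symmetric] n[symmetric] by blast
    then show "A * (norm f)\<^sup>2 \<le> (\<Sum>\<^sub>\<infinity>l\<in>\<Lambda>. (cmod (cinner f (coherent l)))\<^sup>2)"
      using k by (simp add: mult.assoc[symmetric])
    have "(\<Sum>\<^sub>\<infinity>l\<in>\<Lambda>. (cmod (cinner f (coherent l)))\<^sup>2) * k \<le> B * ((norm f)\<^sup>2 * k)"
      using AB unfolding frame_bounds_def e[symmetric] n[symmetric] by blast
    then show "(\<Sum>\<^sub>\<infinity>l\<in>\<Lambda>. (cmod (cinner f (coherent l)))\<^sup>2) \<le> B * (norm f)\<^sup>2"
      using k by (simp add: mult.assoc[symmetric])
  qed
  have "frame_bounds \<Lambda> (coherent_op z0) A B" for z0
    unfolding frame_bounds_def norm_coherent_op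
  proof (intro conjI allI ballI)
    fix f :: "'a L2"
    obtain f' where f': "f = tf_shift z0 f'" "norm f' = norm f" using tf_shift_surj by blast
    have e: "cmod (cinner f (coherent (z0 + l))) = cmod (cinner f' (coherent l))" for l
      unfolding f'(1) by (rule cmod_cinner_tf_shift_coherent)
    show "(\<lambda>l. (cmod (cinner f (coherent (z0 + l))))\<^sup>2) summable_on \<Lambda>"
      "A * (norm f)\<^sup>2 \<le> (\<Sum>\<^sub>\<infinity>l\<in>\<Lambda>. (cmod (cinner f (coherent (z0 + l))))\<^sup>2)"
      "(\<Sum>\<^sub>\<infinity>l\<in>\<Lambda>. (cmod (cinner f (coherent (z0 + l))))\<^sup>2) \<le> B * (norm f)\<^sup>2"
      unfolding e f'(2)[symmetric] by (rule base)+
  qed (use AB in \<open>auto simp: frame_bounds_def coherent_op_def intro: bounded_clinear_rank_one\<close>)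
  then show ?thesis by blast
qed

lemma coherent_total:
  assumes "\<And>l. l \<in> \<Lambda> \<Longrightarrow> cinner x (coherent l) = 0"
  shows "x = 0"
proof -
  obtain A B where AB: "frame_bounds \<Lambda> (coherent_op (0::'a\<times>'a)) A B" using coherent_frame_bounds by blast
  have "(\<Sum>\<^sub>\<infinity>l\<in>\<Lambda>. (cmod (cinner x (coherent l)))\<^sup>2) = 0"
    by (rule infsum_0) (simp add: assms)
  moreover have "A * (norm x)\<^sup>2 \<le> (\<Sum>\<^sub>\<infinity>l\<in>\<Lambda>. (norm (coherent_op 0 l x))\<^sup>2)"
    using AB unfolding frame_bounds_def by blast
  ultimately have "A * (norm x)\<^sup>2 \<le> 0" by (simp add: norm_coherent_op)
  then show ?thesis using AB by (simp add: frame_bounds_def mult_le_0_iff)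
qed

lemma coherent_total_UNIV:
  assumes "\<And>v. v \<in> range coherent \<Longrightarrow> cinner x v = 0" shows "x = (0 :: 'a L2)"
  by (rule coherent_total) (use assms in auto)

text \<open>The identity holds for coherent states by an explicit Gaussian integral, hence for their linear span;
  Fatou's lemma bounds the transform on all of \<open>L\<^sup>2\<close>, and density does the rest.\<close>

theorem moyal:
  fixes f g :: "'a L2"
  shows "square_integrable (stft f)" "cinner (to_L2 (stft f)) (to_L2 (stft g)) = cinner f g"
proof -
  let ?V = "range (coherent :: 'a \<times> 'a \<Rightarrow> 'a L2)"
  have sq_coh: "square_integrable (stft (coherent w))" for w :: "'a \<times> 'a"
  proof -
    have "integrable lborel (\<lambda>u. Re (stft (coherent w) u * cnj (stft (coherent w) u)))"
      by (rule integrable_Re[OF moyal_coherent(1)])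
    then show ?thesis
      by (simp add: square_integrable_def complex_norm_square[symmetric] del: of_real_power)
  qed
  have sq: "square_integrable (stft f)" if "f \<in> cspan ?V" for f
    using that
  proof induction
    case (cspan_base v)
    then show ?case using sq_coh by blast
  qed (simp_all add: stft_zero stft_add stft_scaleC sq_int_add sq_int_cmult sq_int_zero)
  have iso: "cinner (to_L2 (stft f)) (to_L2 (stft g)) = cinner f g" if f: "f \<in> cspan ?V" and g: "g \<in> cspan ?V" for f g
    using f
  proof induction
    case cspan_zero
    have "stft 0 = (\<lambda>u. 0 * stft g u)" by (rule ext) (simp add: stft_def cinner_zero_left)
    then have "to_L2 (stft 0) = 0 *\<^sub>C to_L2 (stft g)" by (simp only: to_L2_scaleC[OF sq[OF g]])
    then show ?case by (simp add: cinner_zero_left scaleC_zero_left)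
  next
    case (cspan_base v)
    then obtain w where w: "v = coherent w" by blast
    show ?case unfolding w using g
    proof induction
      case cspan_zero
      have "stft 0 = (\<lambda>u. 0 * stft (coherent w) u)" by (rule ext) (simp add: stft_def cinner_zero_left)
      then have "to_L2 (stft 0) = 0 *\<^sub>C to_L2 (stft (coherent w))" by (simp only: to_L2_scaleC[OF sq_coh])
      then show ?case by (simp add: cinner_zero_right scaleC_zero_left)
    next
      case (cspan_base v)
      then show ?case by (auto simp: cinner_to_L2[OF sq_coh sq_coh] moyal_coherent)
    next
      case (cspan_add x y)
      then show ?case by (simp add: stft_add to_L2_add[symmetric] sq cinner_add_right)
    next
      case (cspan_scaleC x c)
      then show ?case by (simp add: stft_scaleC to_L2_scaleC[symmetric] sq cinner_scaleC_right)
    qed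
  next
    case (cspan_add x y)
    then show ?case by (simp add: stft_add to_L2_add[symmetric] sq cinner_add_left)
  next
    case (cspan_scaleC x c)
    then show ?case by (simp add: stft_scaleC to_L2_scaleC[symmetric] sq cinner_scaleC_left)
  qed
  have bound: "(\<integral>\<^sup>+u. ennreal ((cmod (stft f u))\<^sup>2) \<partial>lborel) \<le> ennreal ((norm f)\<^sup>2)" for f :: "'a L2"
  proof -
    have "f \<in> closure (cspan ?V)" by (rule closure_cspan) (rule coherent_total_UNIV)
    then obtain x where x: "\<And>n. x n \<in> cspan ?V" "x \<longlonglongrightarrow> f" unfolding closure_sequential by blast
    have nx: "(\<integral>\<^sup>+u. ennreal ((cmod (stft (x n) u))\<^sup>2) \<partial>lborel) = ennreal ((norm (x n))\<^sup>2)" for n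
    proof -
      have "complex_of_real ((norm (to_L2 (stft (x n))))\<^sup>2) = complex_of_real ((norm (x n))\<^sup>2)"
        unfolding cinner_self[symmetric] by (rule iso[OF x(1) x(1)])
      then show ?thesis by (simp only: norm_to_L2[OF sq[OF x(1)], symmetric] of_real_eq_iff)
    qed
    have lim: "(\<lambda>n. ennreal ((cmod (stft (x n) u))\<^sup>2)) \<longlonglongrightarrow> ennreal ((cmod (stft f u))\<^sup>2)" for u
      unfolding stft_def by (intro tendsto_intros tendsto_cinner_left x(2))
    have "(\<integral>\<^sup>+u. ennreal ((cmod (stft f u))\<^sup>2) \<partial>lborel) = (\<integral>\<^sup>+u. liminf (\<lambda>n. ennreal ((cmod (stft (x n) u))\<^sup>2)) \<partial>lborel)"
      using lim_imp_Liminf[OF _ lim] by simp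
    also have "\<dots> \<le> liminf (\<lambda>n. \<integral>\<^sup>+u. ennreal ((cmod (stft (x n) u))\<^sup>2) \<partial>lborel)"
      by (rule nn_integral_liminf) measurable
    also have "\<dots> = ennreal ((norm f)\<^sup>2)"
      unfolding nx by (intro lim_imp_Liminf tendsto_intros x(2)) simp
    finally show ?thesis .
  qed
  show sqf: "square_integrable (stft f)" for f :: "'a L2"
    unfolding square_integrable_def
    by (auto intro!: integrableI_bounded le_less_trans[OF bound] simp: ennreal_less_top)
  define L where "L f = to_L2 (stft f)" for f :: "'a L2"
  have bL: "bounded_clinear L"
  proof (rule bounded_clinearI[of _ 1])
    show "L (x + y) = L x + L y" for x y by (simp add: L_def stft_add to_L2_add sqf)
    show "L (c *\<^sub>C x) = c *\<^sub>C L x" for c x by (simp add: L_def stft_scaleC to_L2_scaleC sqf)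
    show "norm (L x) \<le> 1 * norm x" for x
    proof -
      have "ennreal ((norm (L x))\<^sup>2) \<le> ennreal ((norm x)\<^sup>2)"
        unfolding L_def norm_to_L2[OF sqf] by (rule bound)
      then have "(norm (L x))\<^sup>2 \<le> (norm x)\<^sup>2" by (subst (asm) ennreal_le_iff) auto
      then show ?thesis using power2_le_imp_le by auto
    qed
  qed
  have blL: "bounded_linear L" by (rule bounded_clinear_bl[OF bL])
  have half: "cinner (L x) (L y) = cinner x y" if y: "y \<in> cspan ?V" for x y
  proof (rule total_set_induct[where V = ?V and P = "\<lambda>x. cinner (L x) (L y) = cinner x y", OF coherent_total_UNIV])
    show "cinner (L v) (L y) = cinner v y" if "v \<in> ?V" for v
      unfolding L_def by (rule iso[OF cspan_base[OF that] y])
    show "closed {x. cinner (L x) (L y) = cinner x y}"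
      by (intro closed_Collect_eq linear_continuous_on bounded_linear_cinner_left
          bounded_linear_compose[OF bounded_linear_cinner_left blL])
  qed (auto simp: cinner_add_left cinner_scaleC_left cinner_zero_left bounded_clinear_zero[OF bL]
        bounded_clinear_add[OF bL] bounded_clinear_scaleC[OF bL])
  have "cinner (L f) (L g) = cinner f g"
  proof (rule total_set_induct[where V = ?V and P = "\<lambda>y. cinner (L f) (L y) = cinner f y", OF coherent_total_UNIV])
    show "cinner (L f) (L v) = cinner f v" if "v \<in> ?V" for v
      by (rule half[OF cspan_base[OF that]])
    show "closed {y. cinner (L f) (L y) = cinner f y}"
      by (intro closed_Collect_eq linear_continuous_on bounded_linear_cinner_right
          bounded_linear_compose[OF bounded_linear_cinner_right blL])
  qed (auto simp: cinner_add_right cinner_scaleC_right cinner_zero_right bounded_clinear_zero[OF bL]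
        bounded_clinear_add[OF bL] bounded_clinear_scaleC[OF bL])
  then show "cinner (to_L2 (stft f)) (to_L2 (stft g)) = cinner f g" by (simp add: L_def)
qed

lemma moyal_integral:
  fixes f g :: "'a L2"
  shows "integrable lborel (\<lambda>u. stft f u * cnj (stft g u))"
    "(\<integral>u. stft f u * cnj (stft g u) \<partial>lborel) = cinner f g"
  using moyal(2)[of f g] by (simp_all add: cinner_to_L2 moyal(1) sq_int_mult_cnj)

end

section \<open>Inverse-closedness: off-diagonal decay survives inversion\<close>

text \<open>The kernel is tested against coherent states at all points of phase space, not just at lattice
  points: by Moyal's identity composition of operators then becomes an integral over phase space.\<close>

definition offdiag :: "real \<Rightarrow> real \<Rightarrow> ('a::euclidean_space L2 \<Rightarrow> 'a L2) \<Rightarrow> bool" where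
  "offdiag s j T \<longleftrightarrow> (\<forall>w z. cmod (cinner (T (coherent w)) (coherent z)) \<le> j * decay s (z - w))"

lemma offdiagD: "offdiag s j T \<Longrightarrow> cmod (cinner (T (coherent w)) (coherent z)) \<le> j * decay s (z - w)"
  unfolding offdiag_def by blast

lemma offdiag_mono: "offdiag s j T \<Longrightarrow> j \<le> k \<Longrightarrow> offdiag s k T"
  unfolding offdiag_def by (meson mult_right_mono decay_nonneg order_trans)

text \<open>\<open>(1 + r)\<^sup>s \<le> exp (s r) \<le> exp (\<pi> r\<^sup>2 / 2 + s\<^sup>2 / (2 \<pi>))\<close>.\<close>

lemma exp_neg_square_le_decay:
  assumes s: "s \<ge> 0"
  shows "exp (- pi / 2 * (norm v)\<^sup>2) \<le> exp (s\<^sup>2 / (2 * pi)) * decay s v"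
proof -
  define r where "r = norm v"
  have r: "r \<ge> 0" by (simp add: r_def)
  have "s * r \<le> pi / 2 * r\<^sup>2 + s\<^sup>2 / (2 * pi)"
  proof -
    have "0 \<le> (pi * r - s)\<^sup>2 / (2 * pi)" by simp
    also have "\<dots> = pi / 2 * r\<^sup>2 + s\<^sup>2 / (2 * pi) - s * r"
      by (simp add: power2_diff power2_eq_square field_simps)
    finally show ?thesis by simp
  qed
  moreover have "(1 + r) powr s \<le> exp (s * r)"
  proof -
    have "(1 + r) powr s \<le> (exp r) powr s"
      using r by (intro powr_mono2 s exp_ge_add_one_self) auto
    then show ?thesis by (simp add: exp_powr_real mult.commute)
  qed
  ultimately have "(1 + r) powr s \<le> exp (pi / 2 * r\<^sup>2 + s\<^sup>2 / (2 * pi))"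
    by (meson exp_le_cancel_iff order_trans)
  then have "(1 + r) powr s * exp (- pi / 2 * r\<^sup>2) \<le> exp (pi / 2 * r\<^sup>2 + s\<^sup>2 / (2 * pi)) * exp (- pi / 2 * r\<^sup>2)"
    by (rule mult_right_mono) simp
  also have "\<dots> = exp (s\<^sup>2 / (2 * pi))" by (simp add: exp_add[symmetric])
  finally have "exp (- pi / 2 * r\<^sup>2) * (1 + r) powr s \<le> exp (s\<^sup>2 / (2 * pi))" by (simp add: mult.commute)
  then show ?thesis
    using one_plus_norm_pos[of v] by (simp add: decay_def powr_minus r_def field_simps)
qed

lemma offdiag_id: "s \<ge> 0 \<Longrightarrow> offdiag s (exp (s\<^sup>2 / (2 * pi))) (\<lambda>f. f)"
  unfolding offdiag_def cmod_cinner_coherent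
  by (intro allI) (metis exp_neg_square_le_decay norm_minus_commute)

context gaussian_gabor_frame
begin

text \<open>For each intermediate point \<open>u\<close> one of the distances \<open>|z - u|\<close>, \<open>|u - w|\<close> is at least
  \<open>|z - w| / 2\<close>. That factor supplies the full weight, the other one is integrated.\<close>

lemma offdiag_apply:
  fixes S :: "'a L2 \<Rightarrow> 'a L2"
  assumes S: "bounded_clinear S" and s: "s \<ge> 0" and t: "t > 2 * real DIM('a)"
    and jS: "offdiag s j S" and gk: "\<And>u. cmod (cinner g (coherent u)) \<le> k * decay s (u - w)"
    and bS: "offdiag t b S" and gc: "\<And>u. cmod (cinner g (coherent u)) \<le> c * decay t (u - w)"
    and nn: "j \<ge> 0" "k \<ge> 0" "b \<ge> 0" "c \<ge> 0"
  shows "cmod (cinner (S g) (coherent z))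
      \<le> 2 powr s * decay_integral TYPE('a \<times> 'a) t * (j * c + k * b) * decay s (z - w)"
proof -
  define D where "D = 2 powr s * decay s (z - w)"
  define I where "I = decay_integral TYPE('a \<times> 'a) t"
  have D0: "D \<ge> 0" by (simp add: D_def decay_nonneg)
  define A where "A u = cmod (cinner g (coherent u))" for u
  define B where "B u = cmod (cinner (S (coherent u)) (coherent z))" for u
  have t': "t > real DIM('a \<times> 'a)" using t by simp
  note di = decay_integral_shift[OF t']
  have cn: "cnj (stft (cadjoint S (coherent z)) u) = cinner (S (coherent u)) (coherent z)" for u
    unfolding stft_def by (subst cinner_commute) (simp add: cinner_cadjoint[OF S])
  have "cinner (S g) (coherent z) = cinner g (cadjoint S (coherent z))"
    by (rule cinner_cadjoint[OF S])
  also have "\<dots> = (\<integral>u. stft g u * cnj (stft (cadjoint S (coherent z)) u) \<partial>lborel)"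
    by (rule moyal_integral(2)[symmetric])
  finally have "cmod (cinner (S g) (coherent z))
      \<le> (\<integral>u. cmod (stft g u * cnj (stft (cadjoint S (coherent z)) u)) \<partial>lborel)"
    by (simp only: integral_norm_bound)
  also have "\<dots> \<le> (\<integral>u. D * (j * c * decay t (u - w) + k * b * decay t (z - u)) \<partial>lborel)"
  proof (rule integral_mono)
    show "integrable lborel (\<lambda>u. cmod (stft g u * cnj (stft (cadjoint S (coherent z)) u)))"
      by (intro integrable_norm moyal_integral)
    show "integrable lborel (\<lambda>u. D * (j * c * decay t (u - w) + k * b * decay t (z - u)))"
      by (intro integrable_mult_right Bochner_Integration.integrable_add di)
    fix u
    have A0: "0 \<le> A u" and B0: "0 \<le> B u" by (simp_all add: A_def B_def)
    have Au: "A u \<le> k * decay s (u - w)" "A u \<le> c * decay t (u - w)"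
      unfolding A_def by (rule gk, rule gc)
    have Bu: "B u \<le> j * decay s (z - u)" "B u \<le> b * decay t (z - u)"
      unfolding B_def by (rule offdiagD[OF jS], rule offdiagD[OF bS])
    have p1: "0 \<le> j * c * decay t (u - w)" and p2: "0 \<le> k * b * decay t (z - u)"
      using nn by (simp_all add: decay_nonneg)
    have "(z - u) + (u - w) = z - w" by simp
    then consider "decay s (z - u) \<le> D" | "decay s (u - w) \<le> D"
      using decay_half[OF s, of "z - u" "u - w"] by (auto simp: D_def)
    then have "A u * B u \<le> D * (j * c * decay t (u - w) + k * b * decay t (z - u))"
    proof cases
      case 1
      have "A u * B u \<le> (c * decay t (u - w)) * (j * D)"
        using Bu(1) mult_left_mono[OF 1 nn(1)]
        by (intro mult_mono Au B0) (auto intro: mult_nonneg_nonneg nn decay_nonneg)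
      also have "\<dots> = D * (j * c * decay t (u - w))" by (simp add: mult_ac)
      also have "\<dots> \<le> D * (j * c * decay t (u - w) + k * b * decay t (z - u))"
        using p2 by (intro mult_left_mono D0) simp
      finally show ?thesis .
    next
      case 2
      have "A u * B u \<le> (k * D) * (b * decay t (z - u))"
        using Au(1) mult_left_mono[OF 2 nn(2)]
        by (intro mult_mono Bu B0) (auto intro: mult_nonneg_nonneg nn D0)
      also have "\<dots> = D * (k * b * decay t (z - u))" by (simp add: mult_ac)
      also have "\<dots> \<le> D * (j * c * decay t (u - w) + k * b * decay t (z - u))"
        using p1 by (intro mult_left_mono D0) simp
      finally show ?thesis .
    qed
    then show "cmod (stft g u * cnj (stft (cadjoint S (coherent z)) u))
        \<le> D * (j * c * decay t (u - w) + k * b * decay t (z - u))"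
      unfolding cn norm_mult by (simp add: A_def B_def stft_def)
  qed
  also have "\<dots> = D * (j * c * I + k * b * I)"
    using di(1)[of w] di(3)[of z]
    by (simp add: di(2)[of w] di(4)[of z] I_def Bochner_Integration.integral_add)
  also have "\<dots> = 2 powr s * I * (j * c + k * b) * decay s (z - w)"
    by (simp add: D_def algebra_simps)
  finally show "cmod (cinner (S g) (coherent z))
      \<le> 2 powr s * decay_integral TYPE('a \<times> 'a) t * (j * c + k * b) * decay s (z - w)"
    by (simp add: I_def)
qed

lemma offdiag_product:
  fixes S T :: "'a L2 \<Rightarrow> 'a L2"
  assumes S: "bounded_clinear S" and s: "s \<ge> 0" and t: "t > 2 * real DIM('a)"
    and jS: "offdiag s j S" and jT: "offdiag s k T"
    and bS: "offdiag t b S" and bT: "offdiag t c T"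
    and nn: "j \<ge> 0" "k \<ge> 0" "b \<ge> 0" "c \<ge> 0"
  shows "offdiag s (2 powr s * decay_integral TYPE('a \<times> 'a) t * (j * c + k * b)) (\<lambda>f. S (T f))"
  unfolding offdiag_def
  by (intro allI offdiag_apply[OF S s t jS offdiagD[OF jT] bS offdiagD[OF bT] nn])

text \<open>Geometric mean of the decay estimate and the estimate by the operator norm.\<close>

lemma offdiag_interpolate:
  fixes T :: "'a L2 \<Rightarrow> 'a L2"
  assumes T: "offdiag s j T" and b: "\<And>x. norm (T x) \<le> b * norm x" and nn: "j \<ge> 0" "b \<ge> 0"
    and th: "0 \<le> th" "th \<le> 1"
  shows "offdiag (s * th) (j powr th * b powr (1 - th)) T"
  unfolding offdiag_def
proof (intro allI)
  fix w z :: "'a \<times> 'a"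
  define x where "x = cmod (cinner (T (coherent w)) (coherent z))"
  have x0: "x \<ge> 0" by (simp add: x_def)
  have x1: "x \<le> j * decay s (z - w)" unfolding x_def by (rule offdiagD[OF T])
  have x2: "x \<le> b"
    using order_trans[OF norm_cinner_le, of "T (coherent w)" "coherent z" b] b[of "coherent w"]
    by (simp add: x_def norm_coherent)
  have "x = x powr th * x powr (1 - th)"
    using x0 by (cases "x = 0") (auto simp: powr_add[symmetric])
  also have "\<dots> \<le> (j * decay s (z - w)) powr th * b powr (1 - th)"
    by (intro mult_mono powr_mono2 x1 x2 x0) (use th in auto)
  also have "\<dots> = j powr th * b powr (1 - th) * decay (s * th) (z - w)"
    using nn by (simp add: powr_mult decay_nonneg decay_powr)
  finally show "cmod (cinner (T (coherent w)) (coherent z)) \<le> j powr th * b powr (1 - th) * decay (s * th) (z - w)"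
    by (simp add: x_def)
qed

end

lemma doubly_exponential_tendsto_0:
  fixes a q th :: real
  assumes a: "a \<ge> 1" and q: "0 < q" "q < 1" and th: "0 \<le> th" "th < 1"
  shows "(\<lambda>k::nat. a powr ((1 + th) ^ k) * q ^ (2 ^ k)) \<longlonglongrightarrow> 0"
proof -
  have l: "(\<lambda>k::nat. ((1 + th) / 2) ^ k * ln a + ln q) \<longlonglongrightarrow> 0 * ln a + ln q"
    using th by (intro tendsto_intros LIMSEQ_realpow_zero) auto
  have lq: "ln q < 0" using q by simp
  then have "\<forall>\<^sub>F k in sequentially. ((1 + th) / 2) ^ k * ln a + ln q < ln q / 2"
    by (intro order_tendstoD(2)[OF l]) simp
  then have ev: "\<forall>\<^sub>F k in sequentially. a powr ((1 + th) ^ k) * q ^ (2 ^ k) \<le> sqrt q ^ (2 ^ k)"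
  proof eventually_elim
    case (elim k)
    have "a powr ((1 + th) ^ k) * q ^ (2 ^ k) = exp ((1 + th) ^ k * ln a + 2 ^ k * ln q)"
    proof -
      have "q ^ (2 ^ k) = exp (2 ^ k * ln q)" using exp_of_nat_mult[of "2 ^ k" "ln q"] q by simp
      then show ?thesis using a by (simp add: powr_def exp_add)
    qed
    also have "(1 + th) ^ k * ln a + 2 ^ k * ln q = 2 ^ k * (((1 + th) / 2) ^ k * ln a + ln q)"
      by (simp add: power_divide algebra_simps)
    also have "exp \<dots> \<le> exp (2 ^ k * (ln q / 2))" using elim by simp
    also have "\<dots> = sqrt q ^ (2 ^ k)"
    proof -
      have "sqrt q = exp (ln q / 2)" using q by (subst ln_sqrt[symmetric]) auto
      then show ?thesis using exp_of_nat_mult[of "2 ^ k" "ln q / 2"] by simp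
    qed
    finally show ?case .
  qed
  have sm: "strict_mono (\<lambda>k::nat. 2 ^ k :: nat)" by (simp add: strict_mono_def)
  have "(\<lambda>n. sqrt q ^ n) \<longlonglongrightarrow> 0" using q by (intro LIMSEQ_realpow_zero) simp_all
  then have lim: "(\<lambda>k::nat. sqrt q ^ (2 ^ k)) \<longlonglongrightarrow> 0"
    using LIMSEQ_subseq_LIMSEQ[OF _ sm] by (simp add: comp_def)
  have nn: "0 \<le> a powr ((1 + th) ^ k) * q ^ (2 ^ k)" for k using q by simp
  show ?thesis
  proof (rule Lim_null_comparison[OF _ lim])
    show "\<forall>\<^sub>F k in sequentially. norm (a powr ((1 + th) ^ k) * q ^ (2 ^ k)) \<le> sqrt q ^ (2 ^ k)"
      using ev unfolding real_norm_def abs_of_nonneg[OF nn] .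
  qed
qed

lemma summable_half_power_div:
  fixes m :: nat assumes m: "m > 0" shows "summable (\<lambda>n. (1/2::real) ^ (n div m))"
proof (rule summable_comparison_test')
  define rho where "rho = (1/2::real) powr (1 / real m)"
  have r: "0 < rho" "rho < 1"
    using m powr_less_mono'[of "1/2" 0 "1 / real m"] by (auto simp: rho_def)
  show "summable (\<lambda>n. 2 * rho ^ n)"
    using r by (intro summable_mult summable_geometric) auto
  show "norm ((1/2::real) ^ (n div m)) \<le> 2 * rho ^ n" for n
  proof -
    have "real n \<le> real m * (real (n div m) + 1)"
    proof -
      have "n = m * (n div m) + n mod m" by simp
      moreover have "n mod m < m" using m by simp
      ultimately have "n \<le> m * (n div m) + m" by linarith
      then have "real n \<le> real (m * (n div m) + m)" by (simp only: of_nat_le_iff)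
      then show ?thesis by (simp add: distrib_left)
    qed
    then have "real n / real m - 1 \<le> real (n div m)" using m by (simp add: field_simps)
    then have "(1/2::real) powr real (n div m) \<le> (1/2) powr (real n / real m - 1)"
      by (intro powr_mono') auto
    also have "\<dots> = 2 * rho ^ n"
      using r by (simp add: rho_def powr_diff powr_power field_simps)
    finally show ?thesis by (simp add: powr_realpow)
  qed
qed

context gaussian_gabor_frame
begin

text \<open>Brandenburg's trick. Squaring \<open>R\<^sup>m\<close> costs only the power \<open>1 + \<theta> < 2\<close> of its decay constant, the
  rest being paid by the operator norm \<open>q\<^sup>m\<close>. Hence along \<open>m = 2\<^sup>k\<close> the constants are dominated by
  \<open>a^(1 + \<theta>)\<^sup>k * q^2\<^sup>k\<close>, which tends to \<open>0\<close>, and once one power has a small constant the submultiplicativity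
  of the constants makes all later ones decay geometrically. The bound depends on \<open>R\<close> only through
  \<open>q\<close> and \<open>j\<close>.\<close>

theorem offdiag_powers_summable:
  assumes s: "s > 2 * real DIM('a)" and q: "0 < q" "q < 1" and j: "j \<ge> 0"
  shows "\<exists>b. summable b \<and> (\<forall>n. b n \<ge> 0) \<and> (\<forall>R :: 'a L2 \<Rightarrow> 'a L2. bounded_clinear R \<longrightarrow>
    (\<forall>x. norm (R x) \<le> q * norm x) \<longrightarrow> offdiag s j R \<longrightarrow> (\<forall>n. offdiag s (b n) (R ^^ n)))"
proof -
  have s0: "s > 0" using s by (rule le_less_trans[rotated]) simp
  \<comment> \<open>chosen so that \<open>s th\<close> is the mean of \<open>s\<close> and \<open>2d\<close>: the interpolated kernel is still integrable\<close>
  define th where "th = (s + 2 * real DIM('a)) / (2 * s)"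
  have th: "0 < th" "th < 1"
    unfolding th_def by (intro divide_pos_pos add_pos_nonneg) (use s s0 in \<open>simp_all add: divide_less_eq\<close>)
  have sth: "s * th > 2 * real DIM('a)" using s s0 by (simp add: th_def)
  define I where "I = decay_integral TYPE('a \<times> 'a) (s * th)"
  define I1 where "I1 = decay_integral TYPE('a \<times> 'a) s"
  have I: "I \<ge> 0" "I1 \<ge> 0" by (simp_all add: I_def I1_def decay_integral_nonneg)
  define C where "C = 2 powr s * I * 2 + 1"
  have C: "C > 0" "2 powr s * I * 2 \<le> C" using I by (auto simp: C_def intro!: add_nonneg_pos)
  define c1 where "c1 = 2 powr s * I1 * 2 + 1"
  have c1: "c1 > 0" "2 powr s * I1 * 2 \<le> c1" using I by (auto simp: c1_def intro!: add_nonneg_pos)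
  define D where "D = C powr (- (1 / th))"
  have D: "D > 0" using C by (simp add: D_def)
  have CD: "C * D powr th = 1"
  proof -
    have "D powr th = C powr (- 1)" using th by (simp add: D_def powr_powr)
    then show ?thesis using C by (simp add: powr_minus)
  qed
  define a where "a = max 1 (j / (D * q))"
  have a: "a \<ge> 1" "j \<le> D * a * q"
  proof -
    show "a \<ge> 1" by (simp add: a_def)
    have "j / (D * q) \<le> a" by (simp add: a_def)
    then have "j \<le> a * (D * q)" using D q by (simp add: pos_divide_le_eq)
    then show "j \<le> D * a * q" by (simp add: mult_ac)
  qed
  \<comment> \<open>solution of \<open>C x\<^sub>k\<^sup>1\<^sup>+\<^sup>t\<^sup>h (q\<^sup>m)\<^sup>1\<^sup>-\<^sup>t\<^sup>h = x\<^sub>k\<^sub>+\<^sub>1\<close> with \<open>m = 2\<^sup>k\<close>; \<open>D\<close> and \<open>a\<close> make it start above \<open>j\<close>\<close>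
  define x where "x k = D * (a powr ((1 + th) ^ k) * q ^ (2 ^ k))" for k :: nat
  have x0: "x k \<ge> 0" for k using D q by (simp add: x_def)
  have xstep: "C * (x k powr (1 + th) * (q ^ (2 ^ k)) powr (1 - th)) = x (Suc k)" for k
  proof -
    define p where "p = q ^ (2 ^ k)"
    have p: "p > 0" using q by (simp add: p_def)
    have "x k powr (1 + th) * p powr (1 - th)
        = D powr (1 + th) * (a powr ((1 + th) ^ k)) powr (1 + th) * (p powr (1 + th) * p powr (1 - th))"
      using D p by (simp add: x_def p_def[symmetric] powr_mult mult_ac)
    also have "p powr (1 + th) * p powr (1 - th) = p\<^sup>2" using p by (simp add: powr_add[symmetric])
    also have "p\<^sup>2 = q ^ (2 ^ Suc k)" by (simp add: p_def power_mult[symmetric] mult.commute)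
    also have "(a powr ((1 + th) ^ k)) powr (1 + th) = a powr ((1 + th) ^ Suc k)"
      by (simp add: powr_powr mult.commute)
    also have "D powr (1 + th) = D * D powr th" using D by (simp add: powr_add)
    finally have "C * (x k powr (1 + th) * p powr (1 - th))
        = (C * D powr th) * (D * (a powr ((1 + th) ^ Suc k) * q ^ (2 ^ Suc k)))"
      by (simp only: mult_ac)
    then show ?thesis unfolding CD p_def x_def by simp
  qed
  have "(\<lambda>k::nat. a powr ((1 + th) ^ k) * q ^ (2 ^ k)) \<longlonglongrightarrow> 0"
    by (rule doubly_exponential_tendsto_0[OF a(1) q]) (use th in auto)
  from tendsto_mult_left[OF this, of D] have "x \<longlonglongrightarrow> 0"
    by (simp add: x_def[abs_def])
  then have "\<forall>\<^sub>F k in sequentially. x k < 1 / (2 * c1)"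
    by (rule order_tendstoD) (use c1 in simp)
  then obtain k0 where k0: "x k0 < 1 / (2 * c1)" by (auto simp: eventually_sequentially)
  define y where "y = x k0"
  define m where "m = (2::nat) ^ k0"
  have m: "m > 0" by (simp add: m_def)
  have y: "y \<ge> 0" "c1 * y \<le> 1 / 2"
    using x0[of k0] mult_left_mono[OF less_imp_le[OF k0], of c1] c1(1) by (simp_all add: y_def)
  define K where "K = exp (s\<^sup>2 / (2 * pi))"
  have K: "K > 0" by (simp add: K_def)
  define e where "e r = K * (c1 * j) ^ r" for r :: nat
  have e0: "e r \<ge> 0" for r using K c1 j by (simp add: e_def)
  define E where "E = (\<Sum>r<m. e r)"
  have E: "e r \<le> E" if "r < m" for r
    unfolding E_def by (rule member_le_sum) (use that e0 in auto)
  have E0: "E \<ge> 0" unfolding E_def by (rule sum_nonneg) (rule e0)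
  define b where "b n = c1 * K * E * (1/2) ^ (n div m)" for n
  have "offdiag s (b n) (R ^^ n)"
    if R: "bounded_clinear R" and Rq: "\<And>x. norm (R x) \<le> q * norm x" and Rj: "offdiag s j R" for R :: "'a L2 \<Rightarrow> 'a L2" and n
  proof -
    have bc: "bounded_clinear (R ^^ n)" for n by (rule bounded_clinear_funpow[OF R])
    have nR: "norm ((R ^^ n) f) \<le> q ^ n * norm f" for n f
      by (rule norm_funpow_le[OF Rq]) (use q in simp)
    have alg: "offdiag s (c1 * v * u) (R ^^ (n1 + n2))"
      if "offdiag s v (R ^^ n1)" "offdiag s u (R ^^ n2)" "v \<ge> 0" "u \<ge> 0" for v u n1 n2
    proof -
      have "offdiag s (2 powr s * I1 * (v * u + u * v)) (\<lambda>f. (R ^^ n1) ((R ^^ n2) f))"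
        unfolding I1_def using that by (intro offdiag_product bc s less_imp_le[OF s0])
      then have "offdiag s (2 powr s * I1 * (v * u + u * v)) (R ^^ (n1 + n2))"
        by (simp add: funpow_add comp_def)
      moreover have "2 powr s * I1 * (v * u + u * v) \<le> c1 * v * u"
        using mult_right_mono[OF c1(2), of "v * u"] that by (simp add: mult_ac)
      ultimately show ?thesis by (rule offdiag_mono)
    qed
    have P0: "offdiag s K (R ^^ 0)"
      using offdiag_id[of s] s0 unfolding K_def by (simp add: offdiag_def)
    have dyadic: "offdiag s (x k) (R ^^ (2 ^ k))" for k
    proof (induction k)
      case 0
      show ?case using offdiag_mono[OF Rj, of "x 0"] a by (simp add: x_def mult_ac)
    next
      case (Suc k)
      define \<beta> where "\<beta> = x k powr th * (q ^ (2 ^ k)) powr (1 - th)"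
      have b0: "\<beta> \<ge> 0" by (simp add: \<beta>_def)
      have it: "offdiag (s * th) \<beta> (R ^^ (2 ^ k))"
        unfolding \<beta>_def by (rule offdiag_interpolate[OF Suc nR x0]) (use q th in auto)
      have "offdiag s (2 powr s * I * (x k * \<beta> + x k * \<beta>)) (\<lambda>f. (R ^^ (2 ^ k)) ((R ^^ (2 ^ k)) f))"
        unfolding I_def by (rule offdiag_product[OF bc less_imp_le[OF s0] sth Suc Suc it it x0 x0 b0 b0])
      moreover have "R ^^ (2 ^ Suc k) = (\<lambda>f. (R ^^ (2 ^ k)) ((R ^^ (2 ^ k)) f))"
        by (simp only: power_Suc mult_2 funpow_add comp_def)
      ultimately have "offdiag s (2 powr s * I * (x k * \<beta> + x k * \<beta>)) (R ^^ (2 ^ Suc k))"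
        by (simp only:)
      moreover have "2 powr s * I * (x k * \<beta> + x k * \<beta>) \<le> x (Suc k)"
      proof -
        have xb: "x k * \<beta> = x k powr (1 + th) * (q ^ (2 ^ k)) powr (1 - th)"
          using x0[of k] by (cases "x k = 0") (auto simp: \<beta>_def powr_add)
        have "2 powr s * I * (x k * \<beta> + x k * \<beta>) = (2 powr s * I * 2) * (x k * \<beta>)" by simp
        also have "\<dots> \<le> C * (x k * \<beta>)" using x0[of k] b0 C by (intro mult_right_mono) auto
        also have "\<dots> = x (Suc k)" unfolding xb by (rule xstep)
        finally show ?thesis .
      qed
      ultimately show ?case by (rule offdiag_mono)
    qed
    have blocks: "offdiag s (K * (1/2) ^ i) (R ^^ (m * i))" for i
    proof (induction i)
      case 0
      show ?case using P0 by (simp only: mult_0_right power_0 mult_1_right)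
    next
      case (Suc i)
      have "offdiag s (c1 * y * (K * (1/2) ^ i)) (R ^^ (m + m * i))"
        using K y by (intro alg Suc) (auto simp: y_def m_def dyadic)
      moreover have "c1 * y * (K * (1/2) ^ i) \<le> K * (1/2) ^ Suc i"
        using mult_right_mono[OF y(2), of "K * (1/2) ^ i"] K by simp
      ultimately have "offdiag s (K * (1/2) ^ Suc i) (R ^^ (m + m * i))" by (rule offdiag_mono)
      then show ?case by (simp only: mult_Suc_right)
    qed
    have small: "offdiag s (e r) (R ^^ r)" for r
    proof (induction r)
      case 0
      show ?case using P0 by (simp only: e_def power_0 mult_1_right)
    next
      case (Suc r)
      have "offdiag s j (R ^^ 1)" using Rj by simp
      then have "offdiag s (c1 * j * e r) (R ^^ (1 + r))" using j e0 by (intro alg Suc) auto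
      moreover have "c1 * j * e r = e (Suc r)" by (simp add: e_def mult_ac)
      ultimately show ?case by (simp only: plus_1_eq_Suc)
    qed
    have "offdiag s (c1 * (K * (1/2) ^ (n div m)) * e (n mod m)) (R ^^ (m * (n div m) + n mod m))"
      using K e0 by (intro alg blocks small) auto
    then have "offdiag s (c1 * (K * (1/2) ^ (n div m)) * e (n mod m)) (R ^^ n)" by (simp only: mult_div_mod_eq)
    moreover have "c1 * (K * (1/2) ^ (n div m)) * e (n mod m) \<le> b n"
      unfolding b_def using mult_left_mono[OF E[of "n mod m"], of "c1 * (K * (1/2) ^ (n div m))"] m c1 K
      by (simp add: mult_ac)
    ultimately show ?thesis by (rule offdiag_mono)
  qed
  moreover have "summable b"
    unfolding b_def by (intro summable_mult summable_half_power_div m)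
  moreover have "b n \<ge> 0" for n unfolding b_def using c1 K E0 by simp
  ultimately show ?thesis by blast
qed

text \<open>Applied to the Neumann series of a frame operator. The bound is uniform over all frames with the
  same frame bounds and the same decay constant.\<close>

theorem frame_inverse_offdiag:
  assumes s: "s > 2 * real DIM('a)" and AB: "0 < A" "A < B" and j: "j \<ge> 0"
  shows "\<exists>J\<ge>0. \<forall>U :: 'a \<times> 'a \<Rightarrow> 'a L2 \<Rightarrow> 'a L2. frame_bounds \<Lambda> U A B \<longrightarrow> offdiag s j (g_frame_operator \<Lambda> U)
      \<longrightarrow> offdiag s J (inv (g_frame_operator \<Lambda> U))"
proof -
  have s0: "s > 0" using s by (rule le_less_trans[rotated]) simp
  have B: "B > 0" using AB by simp
  define q where "q = 1 - A / B"
  have q: "0 < q" "q < 1" using AB B by (auto simp: q_def)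
  define j0 where "j0 = exp (s\<^sup>2 / (2 * pi)) + j / B"
  have j0: "j0 \<ge> 0" using j B by (simp add: j0_def)
  obtain b where b: "summable b" "\<And>n. b n \<ge> 0" and
    bR: "\<And>R n. bounded_clinear R \<Longrightarrow> (\<And>x. norm (R x) \<le> q * norm x) \<Longrightarrow> offdiag s j0 R \<Longrightarrow>
      offdiag s (b n) (R ^^ n :: 'a L2 \<Rightarrow> 'a L2)"
    using offdiag_powers_summable[OF s q j0] by blast
  define J where "J = (1 / B) * suminf b"
  have "offdiag s J (inv (g_frame_operator \<Lambda> U))"
    if U: "frame_bounds \<Lambda> U A B" and S: "offdiag s j (g_frame_operator \<Lambda> U)" for U :: "'a \<times> 'a \<Rightarrow> 'a L2 \<Rightarrow> 'a L2"
  proof -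
    define R where "R = neumann_step B (g_frame_operator \<Lambda> U)"
    note fn = frame_neumann[OF U, folded R_def]
    have "offdiag s j0 R"
      unfolding offdiag_def
    proof (intro allI)
      fix w z :: "'a \<times> 'a"
      have "cmod (cinner (R (coherent w)) (coherent z))
          \<le> cmod (cinner (coherent w) (coherent z)) + cmod (complex_of_real (1/B) * cinner (g_frame_operator \<Lambda> U (coherent w)) (coherent z))"
        unfolding R_def neumann_step_def cinner_diff_left cinner_scaleR_left by (rule norm_triangle_ineq4)
      also have "\<dots> \<le> exp (s\<^sup>2 / (2 * pi)) * decay s (z - w) + 1/B * (j * decay s (z - w))"
        unfolding norm_mult norm_of_real
        using offdiagD[OF S, of w z] offdiagD[OF offdiag_id, of s w z] s0 B
        by (intro add_mono mult_mono) auto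
      also have "\<dots> = j0 * decay s (z - w)" by (simp add: j0_def distrib_right)
      finally show "cmod (cinner (R (coherent w)) (coherent z)) \<le> j0 * decay s (z - w)" .
    qed
    then have Rn: "offdiag s (b n) (R ^^ n)" for n
      using fn(3) by (intro bR fn(8)) (auto simp: q_def)
    show ?thesis
      unfolding offdiag_def
    proof (intro allI)
      fix w z :: "'a \<times> 'a"
      have sm: "(\<lambda>n. cinner ((1/B) *\<^sub>R (R ^^ n) (coherent w)) (coherent z)) sums cinner (inv (g_frame_operator \<Lambda> U) (coherent w)) (coherent z)"
        by (rule bounded_linear.sums[OF bounded_linear_cinner_left fn(2)])
      have le: "cmod (cinner ((1/B) *\<^sub>R (R ^^ n) (coherent w)) (coherent z)) \<le> (1/B) * decay s (z - w) * b n" for n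
        using mult_left_mono[OF offdiagD[OF Rn, of n w z], of "1/B"] B
        by (simp add: cinner_scaleR_left norm_mult norm_divide mult_ac)
      have sb: "summable (\<lambda>n. (1/B) * decay s (z - w) * b n)" by (intro summable_mult b)
      have "cmod (\<Sum>n. cinner ((1/B) *\<^sub>R (R ^^ n) (coherent w)) (coherent z)) \<le> (\<Sum>n. (1/B) * decay s (z - w) * b n)"
        using norm_suminf_le[OF le sb] .
      also have "\<dots> = (1/B) * decay s (z - w) * suminf b" by (rule suminf_mult[OF b(1)])
      finally show "cmod (cinner (inv (g_frame_operator \<Lambda> U) (coherent w)) (coherent z)) \<le> J * decay s (z - w)"
        unfolding sums_unique[OF sm, symmetric] J_def by (simp add: mult_ac)
    qed
  qed
  moreover have "J \<ge> 0" using B b by (simp add: J_def suminf_nonneg)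
  ultimately show ?thesis by blast
qed

end

section \<open>Localized frames\<close>

lemma has_sum_norm_le:
  fixes f :: "'i \<Rightarrow> 'b::real_normed_vector"
  assumes f: "(f has_sum S) I" and X: "\<And>F. finite F \<Longrightarrow> F \<subseteq> I \<Longrightarrow> norm (sum f F) \<le> X"
  shows "norm S \<le> X"
proof (rule tendsto_upperbound)
  show "((\<lambda>F. norm (sum f F)) \<longlongrightarrow> norm S) (finite_subsets_at_top I)"
    using f unfolding has_sum_def by (rule tendsto_norm)
  show "\<forall>\<^sub>F F in finite_subsets_at_top I. norm (sum f F) \<le> X"
    by (rule eventually_finite_subsets_at_top_weakI) (rule X)
qed simp

text \<open>\<open>f\<close> is localized at the point \<open>w\<close> of phase space.\<close>

definition coherent_decay :: "real \<Rightarrow> real \<Rightarrow> 'a \<times> 'a \<Rightarrow> 'a::euclidean_space L2 \<Rightarrow> bool" where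
  "coherent_decay s C w f \<longleftrightarrow> (\<forall>u. cmod (cinner f (coherent u)) \<le> C * decay s (u - w))"

lemma coherent_decayD: "coherent_decay s C w f \<Longrightarrow> cmod (cinner f (coherent u)) \<le> C * decay s (u - w)"
  unfolding coherent_decay_def by blast

lemma coherent_decay_coherent: "s \<ge> 0 \<Longrightarrow> coherent_decay s (exp (s\<^sup>2 / (2 * pi))) w (coherent w)"
  using offdiag_id[of s] unfolding coherent_decay_def offdiag_def by blast

lemma coherent_decay_offdiag: "offdiag s j T \<Longrightarrow> coherent_decay s j w (T (coherent w))"
  unfolding coherent_decay_def offdiag_def by blast

text \<open>Moving the centre of decay by a bounded amount costs only a constant.\<close>

lemma coherent_decay_shift:
  assumes f: "coherent_decay s C (z0 + w) f" and s: "s \<ge> 0" and C: "C \<ge> 0" and z0: "norm z0 \<le> d"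
  shows "coherent_decay s ((1 + d) powr s * C) w f"
  unfolding coherent_decay_def
proof
  fix u
  have "cmod (cinner f (coherent u)) \<le> C * decay s (u - (z0 + w))" by (rule coherent_decayD[OF f])
  also have "\<dots> \<le> C * ((1 + norm z0) powr s * decay s (u - (z0 + w) + z0))"
    by (intro mult_left_mono decay_le_shift s C)
  also have "\<dots> \<le> C * ((1 + d) powr s * decay s (u - (z0 + w) + z0))"
    by (intro mult_left_mono mult_right_mono powr_mono2 s C) (use z0 in \<open>auto simp: decay_nonneg\<close>)
  also have "u - (z0 + w) + z0 = u - w" by simp
  finally show "cmod (cinner f (coherent u)) \<le> (1 + d) powr s * C * decay s (u - w)" by (simp add: mult_ac)
qed

text \<open>Phrased through localized vectors with arbitrary centre, because this property is shared by shifted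
  coherent frames and by the families underlying admissible dictionaries.\<close>

definition localized_family ::
    "('a \<times> 'a) set \<Rightarrow> real \<Rightarrow> real \<Rightarrow> ('a \<times> 'a \<Rightarrow> 'a::euclidean_space L2 \<Rightarrow> 'a L2) \<Rightarrow> bool" where
  "localized_family \<Lambda> s M U \<longleftrightarrow> (\<forall>l\<in>\<Lambda>. \<forall>f w C. C \<ge> 0 \<longrightarrow> coherent_decay s C w f \<longrightarrow>
     norm (U l f) \<le> C * M * decay s (l - w))"

context gaussian_gabor_frame
begin

lemma coherent_decay_apply:
  fixes T :: "'a L2 \<Rightarrow> 'a L2"
  assumes T: "bounded_clinear T" and s: "s > 2 * real DIM('a)" and j: "offdiag s j T"
    and f: "coherent_decay s C w f" and nn: "j \<ge> 0" "C \<ge> 0"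
  shows "coherent_decay s (2 powr s * decay_integral TYPE('a \<times> 'a) s * (2 * j * C)) w (T f)"
proof -
  have s0: "s \<ge> 0" using s by (rule le_less_trans[rotated, THEN less_imp_le]) simp
  have "cmod (cinner (T f) (coherent z)) \<le> 2 powr s * decay_integral TYPE('a \<times> 'a) s * (j * C + C * j) * decay s (z - w)" for z
    by (rule offdiag_apply[OF T s0 s j coherent_decayD[OF f] j coherent_decayD[OF f] nn nn])
  then show ?thesis unfolding coherent_decay_def by (simp add: mult_ac)
qed

text \<open>The kernel of the frame operator at \<open>(w, z)\<close> is bounded by \<open>\<Sum>\<^sub>l (1 + |l - w|)\<^sup>-\<^sup>s (1 + |l - z|)\<^sup>-\<^sup>s\<close>, which
  decays in \<open>z - w\<close>; the decay is inherited by the inverse.\<close>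

theorem localized_frame_inverse:
  assumes s: "s > 2 * real DIM('a)" and AB: "0 < A" "A < B" and M: "M \<ge> 0"
  shows "\<exists>J\<ge>0. \<forall>U. frame_bounds \<Lambda> U A B \<longrightarrow> localized_family \<Lambda> s M U \<longrightarrow>
    offdiag s J (inv (g_frame_operator \<Lambda> U))"
proof -
  have s0: "s \<ge> 0" using s by (rule le_less_trans[rotated, THEN less_imp_le]) simp
  obtain C where C: "C \<ge> 0" "\<And>z F. finite F \<Longrightarrow> F \<subseteq> \<Lambda> \<Longrightarrow> (\<Sum>l\<in>F. decay s (l - z)) \<le> C"
    using lattice_decay_sum[OF s] by blast
  define K where "K = exp (s\<^sup>2 / (2 * pi))"
  have K: "K \<ge> 0" by (simp add: K_def)
  define j where "j = (K * M)\<^sup>2 * (2 powr s * (2 * C))"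
  have j: "j \<ge> 0" using C by (simp add: j_def)
  have "offdiag s j (g_frame_operator \<Lambda> U)" if U: "frame_bounds \<Lambda> U A B" and L: "localized_family \<Lambda> s M U" for U
    unfolding offdiag_def
  proof (intro allI)
    fix w z :: "'a \<times> 'a"
    have nU: "norm (U l (coherent v)) \<le> K * M * decay s (l - v)" if "l \<in> \<Lambda>" for l v
      using L that K coherent_decay_coherent[OF s0, of v] unfolding localized_family_def K_def by blast
    show "cmod (cinner (g_frame_operator \<Lambda> U (coherent w)) (coherent z)) \<le> j * decay s (z - w)"
    proof (rule has_sum_norm_le[OF g_frame_operator_cinner[OF frame_bounds_bessel[OF U]]])
      fix F assume F: "finite F" "F \<subseteq> \<Lambda>"
      have "cmod (\<Sum>l\<in>F. cinner (U l (coherent w)) (U l (coherent z)))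
          \<le> (\<Sum>l\<in>F. (K * M * decay s (l - w)) * (K * M * decay s (l - z)))"
      proof (rule order_trans[OF norm_sum sum_mono])
        fix l assume "l \<in> F"
        then have l: "l \<in> \<Lambda>" using F by blast
        have "cmod (cinner (U l (coherent w)) (U l (coherent z))) \<le> norm (U l (coherent w)) * norm (U l (coherent z))"
          by (rule norm_cinner_le)
        also have "\<dots> \<le> (K * M * decay s (l - w)) * (K * M * decay s (l - z))"
          by (intro mult_mono nU l) (simp_all add: decay_nonneg K M)
        finally show "cmod (cinner (U l (coherent w)) (U l (coherent z)))
          \<le> (K * M * decay s (l - w)) * (K * M * decay s (l - z))" .
      qed
      also have "\<dots> = (K * M)\<^sup>2 * (\<Sum>l\<in>F. decay s (l - w) * decay s (l - z))"
        by (simp add: sum_distrib_left power2_eq_square mult_ac)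
      also have "\<dots> \<le> (K * M)\<^sup>2 * (2 powr s * (2 * C) * decay s (w - z))"
        by (intro mult_left_mono decay_convolution_sum[OF C(2) s0 F]) auto
      also have "\<dots> = j * decay s (z - w)" by (simp add: j_def decay_minus_commute[of s w])
      finally show "cmod (\<Sum>l\<in>F. cinner (U l (coherent w)) (U l (coherent z))) \<le> j * decay s (z - w)" .
    qed
  qed
  then show ?thesis using frame_inverse_offdiag[OF s AB j] by metis
qed

lemma coherent_op_localized:
  assumes s: "s \<ge> 0" and z0: "norm z0 \<le> d"
  shows "localized_family \<Lambda> s ((1 + d) powr s) (coherent_op z0)"
  unfolding localized_family_def norm_coherent_op
proof (intro ballI allI impI)
  fix l w :: "'a \<times> 'a" and f :: "'a L2" and C :: real
  assume C: "0 \<le> C" and f: "coherent_decay s C w f"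
  have "cmod (cinner f (coherent (z0 + l))) \<le> C * decay s (z0 + l - w)" by (rule coherent_decayD[OF f])
  also have "\<dots> \<le> C * ((1 + norm (- z0)) powr s * decay s (z0 + l - w + - z0))"
    by (intro mult_left_mono decay_le_shift s C)
  also have "\<dots> \<le> C * ((1 + d) powr s * decay s (z0 + l - w + - z0))"
    by (intro mult_left_mono mult_right_mono powr_mono2 s C) (use z0 in \<open>auto simp: decay_nonneg\<close>)
  also have "z0 + l - w + - z0 = l - w" by simp
  finally show "cmod (cinner f (coherent (z0 + l))) \<le> C * (1 + d) powr s * decay s (l - w)" by (simp add: mult_ac)
qed

section \<open>Windows in the weighted modulation space\<close>

definition window_norm :: "real \<Rightarrow> 'a L2 \<Rightarrow> real" where
  "window_norm s f = enn2real (M1_norm s f)"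

lemma window_norm_integral:
  assumes f: "M1_norm s f < \<infinity>"
  shows "integrable lborel (\<lambda>z. cmod (cinner f (coherent z)) * (1 + norm z) powr s)"
    "(\<integral>z. cmod (cinner f (coherent z)) * (1 + norm z) powr s \<partial>lborel) = window_norm s f"
proof -
  have m: "(\<lambda>z. cmod (cinner f (coherent z)) * (1 + norm z) powr s) \<in> borel_measurable borel"
    using stft_measurable[of f] unfolding stft_def[abs_def] by measurable
  show "integrable lborel (\<lambda>z. cmod (cinner f (coherent z)) * (1 + norm z) powr s)"
    by (rule integrableI_bounded) (use f m in \<open>auto simp: M1_norm_def\<close>)
  show "(\<integral>z. cmod (cinner f (coherent z)) * (1 + norm z) powr s \<partial>lborel) = window_norm s f"
    unfolding window_norm_def M1_norm_def by (rule integral_eq_nn_integral) (use m in auto)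
qed

lemma window_norm_nonneg: "window_norm s f \<ge> 0"
  by (simp add: window_norm_def)

text \<open>Since \<open>|\<langle>f, \<pi>(z)\<phi>\<^sub>0\<rangle>| \<le> |f|\<close>, Moyal's identity gives \<open>|f|\<^sup>2 \<le> |f| \<integral> |\<langle>f, \<pi>(z)\<phi>\<^sub>0\<rangle>| dz\<close>.\<close>

lemma norm_le_window_norm:
  assumes f: "M1_norm s f < \<infinity>" and s: "s \<ge> 0"
  shows "norm f \<le> window_norm s f"
proof (cases "f = 0")
  case False
  have "complex_of_real ((norm f)\<^sup>2) = (\<integral>u. stft f u * cnj (stft f u) \<partial>lborel)"
    by (simp add: moyal_integral cinner_self)
  from arg_cong[OF this, of cmod] have "(norm f)\<^sup>2 \<le> (\<integral>u. cmod (stft f u * cnj (stft f u)) \<partial>lborel)"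
    by (simp only: integral_norm_bound norm_of_real abs_power2)
  also have "\<dots> \<le> (\<integral>u. norm f * (cmod (cinner f (coherent u)) * (1 + norm u) powr s) \<partial>lborel)"
  proof (rule integral_mono)
    show "integrable lborel (\<lambda>u. cmod (stft f u * cnj (stft f u)))" by (intro integrable_norm moyal_integral)
    show "integrable lborel (\<lambda>u. norm f * (cmod (cinner f (coherent u)) * (1 + norm u) powr s))"
      by (intro integrable_mult_right window_norm_integral f)
    fix u :: "'a \<times> 'a"
    have "1 \<le> (1 + norm u) powr s" by (rule ge_one_powr_ge_zero) (use s in auto)
    then have "cmod (stft f u) * 1 \<le> cmod (stft f u) * (1 + norm u) powr s" by (intro mult_left_mono) auto
    moreover have "cmod (stft f u) \<le> norm f"
      using norm_cinner_le[of f "coherent u"] by (simp add: stft_def norm_coherent)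
    ultimately have "cmod (stft f u) * cmod (stft f u) \<le> norm f * (cmod (stft f u) * (1 + norm u) powr s)"
      by (intro mult_mono) auto
    then show "cmod (stft f u * cnj (stft f u)) \<le> norm f * (cmod (cinner f (coherent u)) * (1 + norm u) powr s)"
      by (simp add: norm_mult stft_def)
  qed
  also have "\<dots> = norm f * window_norm s f" by (simp add: window_norm_integral(2)[OF f])
  finally show ?thesis using False by (simp add: power2_eq_square)
qed (simp add: window_norm_nonneg)

text \<open>By Moyal's identity the pairing is an integral of two short-time Fourier transforms. The weight in
  the norm of \<open>g\<close> pays for moving the decay of \<open>f\<close> from the integration variable to \<open>l\<close>.\<close>

lemma window_pairing:
  assumes g: "M1_norm s g < \<infinity>" and s: "s \<ge> 0" and C: "C \<ge> 0" and f: "coherent_decay s C w f"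
  shows "cmod (cinner f (tf_shift l g)) \<le> C * window_norm s g * decay s (l - w)"
proof -
  define G where "G z = cmod (cinner g (coherent z)) * (1 + norm z) powr s" for z
  have Gm: "G \<in> borel_measurable borel"
    using borel_measurable_integrable[OF window_norm_integral(1)[OF g]] by (simp add: G_def[abs_def])
  have Gi: "integrable lborel G" "(\<integral>z. G z \<partial>lborel) = window_norm s g"
    using window_norm_integral[OF g] by (simp_all add: G_def[abs_def])
  have Gt: "integrable lborel (\<lambda>u. G (- l + u))" "(\<integral>u. G (- l + u) \<partial>lborel) = window_norm s g"
    using lborel_translate[OF Gm, of "- l"] Gi by simp_all
  have "cmod (cinner f (tf_shift l g)) = cmod (\<integral>u. stft f u * cnj (stft (tf_shift l g) u) \<partial>lborel)"
    by (simp add: moyal_integral)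
  also have "\<dots> \<le> (\<integral>u. cmod (stft f u * cnj (stft (tf_shift l g) u)) \<partial>lborel)" by (rule integral_norm_bound)
  also have "\<dots> \<le> (\<integral>u. C * decay s (l - w) * G (- l + u) \<partial>lborel)"
  proof (rule integral_mono)
    show "integrable lborel (\<lambda>u. cmod (stft f u * cnj (stft (tf_shift l g) u)))"
      by (intro integrable_norm moyal_integral)
    show "integrable lborel (\<lambda>u. C * decay s (l - w) * G (- l + u))" by (intro integrable_mult_right Gt)
    fix u
    have e: "cmod (stft (tf_shift l g) u) = cmod (cinner g (coherent (- l + u)))"
      using cmod_cinner_tf_shift_coherent(1)[of l g "- l + u"] by (simp add: stft_def)
    have "cmod (stft f u) \<le> C * decay s (u - w)" unfolding stft_def by (rule coherent_decayD[OF f])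
    also have "\<dots> \<le> C * ((1 + norm (l - u)) powr s * decay s (u - w + (l - u)))"
      by (intro mult_left_mono decay_le_shift s C)
    also have "u - w + (l - u) = l - w" by simp
    also have "norm (l - u) = norm (- l + u)" by (simp add: norm_minus_commute)
    finally have "cmod (stft f u) * cmod (stft (tf_shift l g) u)
        \<le> C * ((1 + norm (- l + u)) powr s * decay s (l - w)) * cmod (stft (tf_shift l g) u)"
      by (rule mult_right_mono) simp
    then show "cmod (stft f u * cnj (stft (tf_shift l g) u)) \<le> C * decay s (l - w) * G (- l + u)"
      unfolding e by (simp add: norm_mult G_def e mult_ac)
  qed
  also have "\<dots> = C * window_norm s g * decay s (l - w)"
    unfolding Bochner_Integration.integral_mult_right_zero Gt(2) by (simp only: mult_ac)
  finally show ?thesis .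
qed

text \<open>As \<open>\<Psi>\<^sup>* \<pi>(l)\<^sup>* f = \<Sum>\<^sub>k \<langle>f, \<pi>(l) \<phi>\<^sub>k\<rangle> \<psi>\<^sub>k\<close>, the estimate for a single window can be summed over \<open>k\<close>.\<close>

lemma admissible_operator:
  fixes \<phi> \<psi> :: "nat \<Rightarrow> 'a L2"
  assumes \<phi>: "\<And>k. M1_norm s (\<phi> k) < \<infinity>"
    and fin: "(\<Sum>k. M1_norm s (\<phi> k) * ennreal (norm (\<psi> k))) < \<infinity>"
    and \<Psi>: "\<And>h. (\<lambda>k. rank_one (\<phi> k) (\<psi> k) h) sums \<Psi> h" and s: "s \<ge> 0"
  shows "bounded_clinear \<Psi>"
    and "\<exists>M\<ge>0. localized_family \<Lambda> s M (\<lambda>l. cadjoint \<Psi> \<circ> cadjoint (tf_shift l))"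
proof -
  define c where "c k = window_norm s (\<phi> k) * norm (\<psi> k)" for k
  have c0: "c k \<ge> 0" for k by (simp add: c_def window_norm_nonneg)
  have ce: "M1_norm s (\<phi> k) * ennreal (norm (\<psi> k)) = ennreal (c k)" for k
    using \<phi>[of k] by (simp add: c_def ennreal_mult window_norm_nonneg) (simp add: window_norm_def)
  have csum: "summable c"
    by (rule summable_suminf_not_top) (use fin c0 in \<open>auto simp: ce\<close>)
  define M where "M = suminf c"
  have M0: "M \<ge> 0" unfolding M_def by (rule suminf_nonneg[OF csum c0])
  have term_le: "norm (rank_one (\<phi> k) (\<psi> k) h) \<le> norm h * c k" for k h
  proof -
    have "norm (rank_one (\<phi> k) (\<psi> k) h) \<le> (norm h * norm (\<psi> k)) * window_norm s (\<phi> k)"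
      unfolding rank_one_def norm_scaleC
      by (intro mult_mono norm_cinner_le norm_le_window_norm \<phi> s) auto
    then show ?thesis by (simp add: c_def mult_ac)
  qed
  show bc: "bounded_clinear \<Psi>"
  proof (rule bounded_clinearI)
    note r = bounded_clinear_rank_one
    show "\<Psi> (x + y) = \<Psi> x + \<Psi> y" for x y
      using sums_unique2[OF \<Psi>[of "x + y"]] sums_add[OF \<Psi>[of x] \<Psi>[of y]] by (simp add: bounded_clinear_add[OF r])
    show "\<Psi> (a *\<^sub>C x) = a *\<^sub>C \<Psi> x" for a x
      using sums_unique2[OF \<Psi>[of "a *\<^sub>C x"]] bounded_linear.sums[OF bounded_linear_scaleC[of a] \<Psi>[of x]]
      by (simp add: bounded_clinear_scaleC[OF r])
    show "norm (\<Psi> h) \<le> M * norm h" for h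
    proof -
      have "norm (\<Psi> h) \<le> (\<Sum>k. norm h * c k)"
        unfolding sums_unique[OF \<Psi>[of h]] by (rule norm_suminf_le[OF term_le summable_mult[OF csum]])
      also have "\<dots> = M * norm h" using suminf_mult[OF csum, of "norm h"] by (simp add: M_def mult.commute)
      finally show ?thesis .
    qed
  qed
  have "norm ((cadjoint \<Psi> \<circ> cadjoint (tf_shift l)) f) \<le> C * M * decay s (l - w)"
    if C: "C \<ge> 0" and f: "coherent_decay s C w f" for l f w C
  proof -
    define v where "v = (cadjoint \<Psi> \<circ> cadjoint (tf_shift l)) f"
    define D where "D = C * decay s (l - w)"
    have D: "D \<ge> 0" using C by (simp add: D_def decay_nonneg)
    have pr: "cmod (cinner f (tf_shift l (\<phi> k))) \<le> window_norm s (\<phi> k) * D" for k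
      using window_pairing[OF \<phi> s C f] by (simp add: D_def mult_ac)
    have "(\<lambda>k. cinner (rank_one (\<phi> k) (\<psi> k) v) (cadjoint (tf_shift l) f)) sums cinner (\<Psi> v) (cadjoint (tf_shift l) f)"
      by (rule bounded_linear.sums[OF bounded_linear_cinner_left \<Psi>])
    then have sm: "(\<lambda>k. cinner v (\<psi> k) * cinner (tf_shift l (\<phi> k)) f) sums cinner v v"
    proof -
      assume *: "(\<lambda>k. cinner (rank_one (\<phi> k) (\<psi> k) v) (cadjoint (tf_shift l) f)) sums cinner (\<Psi> v) (cadjoint (tf_shift l) f)"
      have "cinner (rank_one (\<phi> k) (\<psi> k) v) (cadjoint (tf_shift l) f) = cinner v (\<psi> k) * cinner (tf_shift l (\<phi> k)) f" for k
        by (simp add: rank_one_def cinner_scaleC_left cinner_cadjoint[OF bounded_clinear_tf_shift, symmetric]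
            bounded_clinear_scaleC[OF bounded_clinear_tf_shift])
      moreover have "cinner (\<Psi> v) (cadjoint (tf_shift l) f) = cinner v v"
        by (simp only: cinner_cadjoint[OF bc] v_def comp_apply)
      ultimately show ?thesis using * by (simp only:)
    qed
    have le: "cmod (cinner v (\<psi> k) * cinner (tf_shift l (\<phi> k)) f) \<le> norm v * D * c k" for k
    proof -
      have "cmod (cinner v (\<psi> k)) * cmod (cinner f (tf_shift l (\<phi> k))) \<le> (norm v * norm (\<psi> k)) * (window_norm s (\<phi> k) * D)"
        by (intro mult_mono norm_cinner_le pr) auto
      then show ?thesis by (simp add: norm_mult c_def mult_ac cmod_cinner_commute[of f])
    qed
    have "cmod (cinner v v) \<le> (\<Sum>k. norm v * D * c k)"
      unfolding sums_unique[OF sm] by (rule norm_suminf_le[OF le summable_mult[OF csum]])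
    also have "\<dots> = norm v * D * M" unfolding M_def by (rule suminf_mult[OF csum])
    finally have "(norm v)\<^sup>2 \<le> norm v * (D * M)" by (simp add: cinner_self mult_ac del: of_real_power)
    then have "norm v \<le> D * M" using D M0 by (cases "v = 0") (auto simp: power2_eq_square)
    then show ?thesis by (simp add: v_def D_def mult_ac)
  qed
  then have "localized_family \<Lambda> s M (\<lambda>l. cadjoint \<Psi> \<circ> cadjoint (tf_shift l))"
    unfolding localized_family_def by blast
  then show "\<exists>M\<ge>0. localized_family \<Lambda> s M (\<lambda>l. cadjoint \<Psi> \<circ> cadjoint (tf_shift l))" using M0 by blast
qed

end

section \<open>Convolution with a polynomially decaying kernel\<close>

lemma powr_sum_le:
  fixes x :: "'i \<Rightarrow> real"
  assumes F: "finite F" and x: "\<And>i. i \<in> F \<Longrightarrow> x i \<ge> 0" and p: "0 < p" "p \<le> 1"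
  shows "(\<Sum>i\<in>F. x i) powr p \<le> (\<Sum>i\<in>F. x i powr p)"
proof (cases "(\<Sum>i\<in>F. x i) = 0")
  case True
  then show ?thesis using p by (simp add: sum_nonneg)
next
  case False
  define S where "S = (\<Sum>i\<in>F. x i)"
  have S: "S > 0" using False x by (simp add: S_def less_le sum_nonneg)
  have "1 = (\<Sum>i\<in>F. x i / S)" using S by (simp add: S_def sum_divide_distrib[symmetric])
  also have "\<dots> \<le> (\<Sum>i\<in>F. (x i / S) powr p)"
  proof (rule sum_mono)
    fix i assume i: "i \<in> F"
    have "x i \<le> S" unfolding S_def by (rule member_le_sum) (use i x F in auto)
    then show "x i / S \<le> (x i / S) powr p"
      using powr_mono'[of p 1 "x i / S"] p S x[OF i] by simp
  qed
  also have "\<dots> = (\<Sum>i\<in>F. x i powr p / S powr p)"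
    by (intro sum.cong refl powr_divide)
  finally show ?thesis using S by (simp add: S_def[symmetric] sum_divide_distrib[symmetric] pos_le_divide_eq)
qed

text \<open>Jensen's inequality for the convex function \<open>t \<mapsto> t\<^sup>p\<close> with weights \<open>a\<close>.\<close>

lemma weighted_power_mean_le:
  fixes a x :: "'i \<Rightarrow> real"
  assumes F: "finite F" and a: "\<And>i. i \<in> F \<Longrightarrow> a i \<ge> 0" and x: "\<And>i. i \<in> F \<Longrightarrow> x i \<ge> 0" and p: "p \<ge> 1"
  shows "(\<Sum>i\<in>F. a i * x i) powr p \<le> (\<Sum>i\<in>F. a i) powr (p - 1) * (\<Sum>i\<in>F. a i * x i powr p)"
proof (cases "(\<Sum>i\<in>F. a i) = 0 \<or> p = 1")
  case True
  then consider "p = 1" | "p \<noteq> 1" "\<forall>i\<in>F. a i = 0" using sum_nonneg_eq_0_iff[OF F, of a] a by auto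
  then show ?thesis
  proof cases
    case 1
    then show ?thesis using x a by (cases "(\<Sum>i\<in>F. a i) = 0")
       (auto simp: sum_nonneg sum_nonneg_eq_0_iff[OF F])
  qed (use p in auto)
next
  case False
  define A where "A = (\<Sum>i\<in>F. a i)"
  define c where "c = (\<Sum>i\<in>F. a i * x i) / A"
  have A: "A > 0" using False a by (simp add: A_def less_le sum_nonneg)
  have p1: "p > 1" using p False by simp
  have c: "c \<ge> 0" using A a x by (simp add: c_def sum_nonneg)
  have cA: "c * A = (\<Sum>i\<in>F. a i * x i)" using A by (simp add: c_def)
  \<comment> \<open>the tangent line of \<open>t \<mapsto> t\<^sup>p\<close> at the weighted mean \<open>c\<close>\<close>
  have tangent: "c powr p + p * c powr (p - 1) * (y - c) \<le> y powr p" if y: "y \<ge> 0" for y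
  proof -
    define q where "q = p / (p - 1)"
    have q: "q > 1" "1/p + 1/q = 1" using p1 by (auto simp: q_def field_simps)
    have "y * c powr (p - 1) \<le> y powr p / p + (c powr (p - 1)) powr q / q"
      by (rule Youngs_inequality[OF p1 q y]) simp
    also have "(c powr (p - 1)) powr q = c powr p" using p1 by (simp add: powr_powr q_def)
    also have "c powr p / q = c powr p * (p - 1) / p" using p1 by (simp add: q_def)
    finally have "p * (y * c powr (p - 1)) \<le> y powr p + c powr p * (p - 1)"
      using p1 by (simp add: field_simps)
    moreover have "c powr (p - 1) * c = c powr p"
      using c by (cases "c = 0") (auto simp: powr_mult_base[of c "p - 1"] mult.commute)
    ultimately show ?thesis by (simp add: algebra_simps)
  qed
  have "A * c powr p = (\<Sum>i\<in>F. a i * (c powr p + p * c powr (p - 1) * (x i - c)))"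
  proof -
    have "(\<Sum>i\<in>F. a i * (c powr p + p * c powr (p - 1) * (x i - c)))
        = (\<Sum>i\<in>F. c powr p * a i + p * c powr (p - 1) * (a i * x i) - p * c powr (p - 1) * c * a i)"
      by (intro sum.cong refl) (simp add: algebra_simps)
    also have "\<dots> = c powr p * A + p * c powr (p - 1) * (\<Sum>i\<in>F. a i * x i) - p * c powr (p - 1) * c * A"
      unfolding A_def by (simp only: sum.distrib sum_subtractf sum_distrib_left[symmetric])
    also have "(\<Sum>i\<in>F. a i * x i) = c * A" by (rule cA[symmetric])
    finally show ?thesis by (simp add: algebra_simps)
  qed
  also have "\<dots> \<le> (\<Sum>i\<in>F. a i * x i powr p)"
    by (intro sum_mono mult_left_mono tangent a x)
  finally have le: "A * c powr p \<le> (\<Sum>i\<in>F. a i * x i powr p)" .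
  have "(\<Sum>i\<in>F. a i * x i) powr p = c powr p * A powr p"
    unfolding cA[symmetric] using c A by (simp add: powr_mult)
  also have "A powr p = A powr (p - 1) * A" using A powr_add[of A "p - 1" 1] by simp
  also have "c powr p * (A powr (p - 1) * A) = A powr (p - 1) * (A * c powr p)" by (simp add: mult_ac)
  also have "\<dots> \<le> A powr (p - 1) * (\<Sum>i\<in>F. a i * x i powr p)"
    by (rule mult_left_mono[OF le]) simp
  finally show ?thesis by (simp add: A_def)
qed

context gaussian_gabor_frame
begin

text \<open>For \<open>p \<le> 1\<close> this is subadditivity of \<open>t \<mapsto> t\<^sup>p\<close> and summability of the \<open>p\<close>-th power of the kernel, which is
  where \<open>p > 2d/s\<close> enters; for \<open>p \<ge> 1\<close> it is Jensen's inequality and summability of the kernel.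
  The hypothesis on \<open>h\<close> says that \<open>h\<close> is dominated by the convolution, without presupposing that the
  latter converges.\<close>

theorem decay_convolution_lp:
  assumes s: "s > 2 * real DIM('a)" and p: "2 * real DIM('a) / s < p" and K: "K \<ge> 0"
  shows "\<exists>C\<ge>0. \<forall>(\<rho> :: 'a \<times> 'a \<Rightarrow> real) h. (\<forall>m. \<rho> m \<ge> 0) \<longrightarrow> (\<lambda>m. \<rho> m powr p) summable_on \<Lambda> \<longrightarrow>
    (\<forall>l\<in>\<Lambda>. h l \<ge> 0 \<and> (\<forall>X. (\<forall>F. finite F \<longrightarrow> F \<subseteq> \<Lambda> \<longrightarrow> (\<Sum>m\<in>F. K * decay s (l - m) * \<rho> m) \<le> X) \<longrightarrow> h l \<le> X)) \<longrightarrow>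
    (\<lambda>l. h l powr p) summable_on \<Lambda> \<and> (\<Sum>\<^sub>\<infinity>l\<in>\<Lambda>. h l powr p) \<le> C * (\<Sum>\<^sub>\<infinity>m\<in>\<Lambda>. \<rho> m powr p)"
proof -
  have s0: "s > 0" using s by (rule le_less_trans[rotated]) simp
  have "0 \<le> 2 * real DIM('a) / s" using s0 by simp
  then have p0: "p > 0" using p by linarith
  have sp: "2 * real DIM('a) < s * p" using p s0 by (simp add: field_simps)
  obtain C1 where C1: "C1 \<ge> 0" "\<And>z F. finite F \<Longrightarrow> F \<subseteq> \<Lambda> \<Longrightarrow> (\<Sum>l\<in>F. decay s (l - z)) \<le> C1"
    using lattice_decay_sum[OF s] by blast
  \<comment> \<open>pointwise bound of the \<open>p\<close>-th power by a convolution with an exponent above the dimension\<close>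
  have "\<exists>t B. 2 * real DIM('a) < t \<and> B \<ge> 0 \<and> (\<forall>F l \<rho>. finite F \<longrightarrow> F \<subseteq> \<Lambda> \<longrightarrow> (\<forall>m. \<rho> m \<ge> 0) \<longrightarrow>
      (\<Sum>m\<in>F. K * decay s (l - m) * \<rho> m) powr p \<le> B * (\<Sum>m\<in>F. decay t (l - m) * \<rho> m powr p))"
  proof (cases "p \<le> 1")
    case True
    have "(\<Sum>m\<in>F. K * decay s (l - m) * \<rho> m) powr p \<le> K powr p * (\<Sum>m\<in>F. decay (s * p) (l - m) * \<rho> m powr p)"
      if F: "finite F" "\<forall>m. \<rho> m \<ge> 0" for F l and \<rho> :: "'a \<times> 'a \<Rightarrow> real"
    proof -
      have "(\<Sum>m\<in>F. K * decay s (l - m) * \<rho> m) powr p \<le> (\<Sum>m\<in>F. (K * decay s (l - m) * \<rho> m) powr p)"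
        using F K p0 True by (intro powr_sum_le) (auto simp: decay_nonneg)
      also have "\<dots> = K powr p * (\<Sum>m\<in>F. decay (s * p) (l - m) * \<rho> m powr p)"
        unfolding sum_distrib_left
        using F K by (intro sum.cong refl) (simp add: powr_mult decay_nonneg decay_powr mult_ac)
      finally show ?thesis .
    qed
    then show ?thesis using sp by (intro exI[of _ "s * p"] exI[of _ "K powr p"]) auto
  next
    case False
    have "(\<Sum>m\<in>F. K * decay s (l - m) * \<rho> m) powr p \<le> (K * C1) powr (p - 1) * K * (\<Sum>m\<in>F. decay s (l - m) * \<rho> m powr p)"
      if F: "finite F" "F \<subseteq> \<Lambda>" "\<forall>m. \<rho> m \<ge> 0" for F l and \<rho> :: "'a \<times> 'a \<Rightarrow> real"
    proof -
      have r: "\<rho> m \<ge> 0" for m using F by blast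
      have "(\<Sum>m\<in>F. K * decay s (l - m) * \<rho> m) powr p
          \<le> (\<Sum>m\<in>F. K * decay s (l - m)) powr (p - 1) * (\<Sum>m\<in>F. K * decay s (l - m) * \<rho> m powr p)"
        using F(1) K False by (intro weighted_power_mean_le) (auto simp: decay_nonneg r)
      also have "\<dots> \<le> (K * C1) powr (p - 1) * (\<Sum>m\<in>F. K * decay s (l - m) * \<rho> m powr p)"
      proof (intro mult_right_mono powr_mono2)
        show "(\<Sum>m\<in>F. K * decay s (l - m)) \<le> K * C1"
          unfolding sum_distrib_left[symmetric] decay_minus_commute[of s l] by (intro mult_left_mono C1 F K)
      qed (use K False in \<open>auto intro!: sum_nonneg simp: decay_nonneg r\<close>)
      also have "\<dots> = (K * C1) powr (p - 1) * K * (\<Sum>m\<in>F. decay s (l - m) * \<rho> m powr p)"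
        by (simp add: sum_distrib_left mult_ac)
      finally show ?thesis .
    qed
    then show ?thesis using s K by (intro exI[of _ s] exI[of _ "(K * C1) powr (p - 1) * K"]) auto
  qed
  then obtain t B where t: "2 * real DIM('a) < t" and B: "B \<ge> 0" and
    pt: "\<And>F l \<rho>. finite F \<Longrightarrow> F \<subseteq> \<Lambda> \<Longrightarrow> (\<forall>m. \<rho> m \<ge> 0) \<Longrightarrow>
      (\<Sum>m\<in>F. K * decay s (l - m) * \<rho> m) powr p \<le> B * (\<Sum>m\<in>F. decay t (l - m) * \<rho> m powr p)"
    by blast
  have t0: "t \<ge> 0" using t by (rule le_less_trans[rotated, THEN less_imp_le]) simp
  obtain Ct where Ct: "Ct \<ge> 0" "\<And>z F. finite F \<Longrightarrow> F \<subseteq> \<Lambda> \<Longrightarrow> (\<Sum>l\<in>F. decay t (l - z)) \<le> Ct"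
    using lattice_decay_sum[OF t] by blast
  define C where "C = B * Ct"
  have main: "(\<lambda>l. h l powr p) summable_on \<Lambda> \<and> (\<Sum>\<^sub>\<infinity>l\<in>\<Lambda>. h l powr p) \<le> C * (\<Sum>\<^sub>\<infinity>m\<in>\<Lambda>. \<rho> m powr p)"
    if \<rho>: "\<forall>m. \<rho> m \<ge> 0" and sm: "(\<lambda>m. \<rho> m powr p) summable_on \<Lambda>"
      and h: "\<forall>l\<in>\<Lambda>. h l \<ge> 0 \<and> (\<forall>X. (\<forall>F. finite F \<longrightarrow> F \<subseteq> \<Lambda> \<longrightarrow> (\<Sum>m\<in>F. K * decay s (l - m) * \<rho> m) \<le> X) \<longrightarrow> h l \<le> X)"
    for \<rho> :: "'a \<times> 'a \<Rightarrow> real" and h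
  proof -
    define Y where "Y l = (\<Sum>\<^sub>\<infinity>m\<in>\<Lambda>. decay t (l - m) * \<rho> m powr p)" for l
    have sY: "(\<lambda>m. decay t (l - m) * \<rho> m powr p) summable_on \<Lambda>" for l
    proof (rule summable_on_comparison_test[OF sm])
      show "decay t (l - m) * \<rho> m powr p \<le> \<rho> m powr p" for m
        using mult_right_mono[OF decay_le_1[OF t0, of "l - m"], of "\<rho> m powr p"] by simp
    qed (simp add: decay_nonneg)
    have Y0: "Y l \<ge> 0" for l unfolding Y_def by (rule infsum_nonneg) (simp add: decay_nonneg)
    have hY: "h l powr p \<le> B * Y l" if l: "l \<in> \<Lambda>" for l
    proof -
      have "h l \<le> (B * Y l) powr (1 / p)"
      proof -
        have "(\<Sum>m\<in>F. K * decay s (l - m) * \<rho> m) \<le> (B * Y l) powr (1 / p)" if F: "finite F" "F \<subseteq> \<Lambda>" for F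
        proof -
          define x where "x = (\<Sum>m\<in>F. K * decay s (l - m) * \<rho> m)"
          have r: "\<rho> m \<ge> 0" for m using \<rho> by blast
          have x0: "x \<ge> 0" unfolding x_def using K r by (intro sum_nonneg) (simp add: decay_nonneg)
          have "x powr p \<le> B * (\<Sum>m\<in>F. decay t (l - m) * \<rho> m powr p)" unfolding x_def by (rule pt[OF F \<rho>])
          also have "\<dots> \<le> B * Y l"
            unfolding Y_def by (intro mult_left_mono B finite_sum_le_infsum sY F) (simp add: decay_nonneg)
          finally have "(x powr p) powr (1 / p) \<le> (B * Y l) powr (1 / p)"
            by (intro powr_mono2) (use p0 in auto)
          then show ?thesis using x0 p0 by (simp add: powr_powr x_def)
        qed
        then show ?thesis using h l by blast
      qed
      then have "h l powr p \<le> ((B * Y l) powr (1 / p)) powr p"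
        using h l p0 by (intro powr_mono2) auto
      then show ?thesis using p0 B Y0[of l] by (simp add: powr_powr)
    qed
    have fin: "(\<Sum>l\<in>F. h l powr p) \<le> C * (\<Sum>\<^sub>\<infinity>m\<in>\<Lambda>. \<rho> m powr p)" if F: "finite F" "F \<subseteq> \<Lambda>" for F
    proof -
      have "(\<Sum>l\<in>F. h l powr p) \<le> (\<Sum>l\<in>F. B * Y l)" using F by (intro sum_mono hY) auto
      also have "\<dots> = B * (\<Sum>l\<in>F. Y l)" by (simp add: sum_distrib_left)
      also have "(\<Sum>l\<in>F. Y l) = (\<Sum>\<^sub>\<infinity>m\<in>\<Lambda>. \<Sum>l\<in>F. decay t (l - m) * \<rho> m powr p)"
        unfolding Y_def by (rule infsumI[OF has_sum_sum[OF sY], symmetric])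
      also have "\<dots> \<le> (\<Sum>\<^sub>\<infinity>m\<in>\<Lambda>. Ct * \<rho> m powr p)"
      proof (rule infsum_mono)
        show "(\<lambda>m. \<Sum>l\<in>F. decay t (l - m) * \<rho> m powr p) summable_on \<Lambda>"
          by (rule has_sum_imp_summable[OF has_sum_sum[OF sY]])
        show "(\<lambda>m. Ct * \<rho> m powr p) summable_on \<Lambda>" by (intro summable_on_cmult_right sm)
        show "(\<Sum>l\<in>F. decay t (l - m) * \<rho> m powr p) \<le> Ct * \<rho> m powr p" for m
          unfolding sum_distrib_right[symmetric] by (intro mult_right_mono Ct F) simp
      qed
      also have "\<dots> = Ct * (\<Sum>\<^sub>\<infinity>m\<in>\<Lambda>. \<rho> m powr p)" by (rule infsum_cmult_right) (rule sm)
      finally show ?thesis using B by (simp add: C_def mult_left_mono mult.assoc)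
    qed
    have "(\<lambda>l. h l powr p) summable_on \<Lambda>"
      by (rule nonneg_bdd_above_summable_on) (use fin in \<open>auto intro!: bdd_aboveI2\<close>)
    moreover from this have "(\<Sum>\<^sub>\<infinity>l\<in>\<Lambda>. h l powr p) \<le> C * (\<Sum>\<^sub>\<infinity>m\<in>\<Lambda>. \<rho> m powr p)"
      by (rule infsum_le_finite_sums) (rule fin)
    ultimately show ?thesis by blast
  qed
  have "C \<ge> 0" using B Ct by (simp add: C_def)
  then show ?thesis using main by (intro exI[of _ C]) blast
qed

end

section \<open>Best n-term approximation\<close>

text \<open>Each level is exceeded only finitely often, so a largest remaining entry can be picked again and
  again. Indices with value \<open>0\<close> may never be reached.\<close>

lemma decreasing_enumeration:
  fixes h :: "'i \<Rightarrow> real"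
  assumes inf: "infinite I" and h0: "\<And>i. i \<in> I \<Longrightarrow> h i \<ge> 0"
    and fin: "\<And>\<epsilon>. \<epsilon> > 0 \<Longrightarrow> finite {i\<in>I. h i \<ge> \<epsilon>}"
  obtains e :: "nat \<Rightarrow> 'i" where "inj e" "range e \<subseteq> I" "decseq (\<lambda>n. h (e n))"
    "\<And>i. i \<in> I \<Longrightarrow> i \<notin> range e \<Longrightarrow> h i = 0"
proof -
  have ex: "\<exists>i\<in>I - K. \<forall>j\<in>I - K. h j \<le> h i" if K: "finite K" for K
  proof (cases "\<exists>j\<in>I - K. h j > 0")
    case True
    then obtain j where j: "j \<in> I - K" "h j > 0" by blast
    define M where "M = {i\<in>I - K. h i \<ge> h j}"
    have "finite M" by (rule finite_subset[OF _ fin[OF j(2)]]) (auto simp: M_def)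
    moreover have "M \<noteq> {}" using j by (auto simp: M_def)
    ultimately have "Max (h ` M) \<in> h ` M" and ge: "\<And>k. k \<in> M \<Longrightarrow> h k \<le> Max (h ` M)" by auto
    then obtain i where "i \<in> M" "Max (h ` M) = h i" by blast
    with ge have i: "i \<in> M" "\<forall>k\<in>M. h k \<le> h i" by auto
    then have "h k \<le> h i" if "k \<in> I - K" for k
      using that by (cases "h k \<ge> h j") (auto simp: M_def)
    then show ?thesis using i by (auto simp: M_def)
  next
    case False
    have "infinite (I - K)" using inf K by (rule Diff_infinite_finite[rotated])
    then obtain i where "i \<in> I - K" by (metis finite.emptyI all_not_in_conv)
    then show ?thesis using False h0 by (metis DiffD1 not_less order_trans)
  qed
  define pick where "pick K = (SOME i. i \<in> I - K \<and> (\<forall>j\<in>I - K. h j \<le> h i))" for K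
  have pick: "pick K \<in> I - K" "\<And>j. j \<in> I - K \<Longrightarrow> h j \<le> h (pick K)" if "finite K" for K
  proof -
    have "\<exists>i. i \<in> I - K \<and> (\<forall>j\<in>I - K. h j \<le> h i)" using ex[OF that] by blast
    from someI_ex[OF this] show "pick K \<in> I - K" "\<And>j. j \<in> I - K \<Longrightarrow> h j \<le> h (pick K)"
      unfolding pick_def by blast+
  qed
  define K where "K = rec_nat {} (\<lambda>_ A. insert (pick A) A)"
  define e where "e n = pick (K n)" for n
  have K0: "K 0 = {}" and KS: "K (Suc n) = insert (e n) (K n)" for n by (simp_all add: K_def e_def)
  have Kfin: "finite (K n)" for n by (induction n) (simp_all add: K0 KS)
  have Kmono: "K m \<subseteq> K n" if "m \<le> n" for m n
    using that by (induction n) (auto simp: KS le_Suc_eq)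
  have eI: "e n \<in> I - K n" for n unfolding e_def by (rule pick(1)[OF Kfin])
  have emax: "h j \<le> h (e n)" if "j \<in> I - K n" for j n unfolding e_def by (rule pick(2)[OF Kfin that])
  have ne: "e m \<noteq> e n" if "m < n" for m n
    using that Kmono[of "Suc m" n] eI[of n] by (auto simp: KS)
  have inj: "inj e" by (rule injI) (metis ne linorder_neqE_nat)
  have KR: "K n \<subseteq> range e" for n by (induction n) (auto simp: K0 KS)
  show ?thesis
  proof
    show "inj e" by (rule inj)
    show "range e \<subseteq> I" using eI by auto
    show "decseq (\<lambda>n. h (e n))"
    proof (rule decseq_SucI)
      fix n
      have "e (Suc n) \<in> I - K n" using eI[of "Suc n"] Kmono[of n "Suc n"] by auto
      then show "h (e (Suc n)) \<le> h (e n)" by (rule emax)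
    qed
    fix i assume i: "i \<in> I" "i \<notin> range e"
    show "h i = 0"
    proof (rule ccontr)
      assume "h i \<noteq> 0"
      then have pos: "h i > 0" using h0[OF i(1)] by simp
      have "h i \<le> h (e n)" for n using i KR[of n] by (intro emax) auto
      then have "range e \<subseteq> {j\<in>I. h j \<ge> h i}" using eI by auto
      then have "finite (range e)" using fin[OF pos] by (rule finite_subset)
      then show False using inj by (simp add: finite_image_iff)
    qed
  qed
qed

lemma power2_powr_half: "0 \<le> y \<Longrightarrow> (y\<^sup>2) powr (p/2) = y powr p" for y p :: real
  by (cases "y = 0") (simp_all add: powr_powr flip: powr_numeral)

lemma two_power_powr: "(2::real) ^ n = 2 powr real n"
  by (simp add: powr_realpow)

lemma dyadic_blocks:
  fixes f :: "nat \<Rightarrow> real"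
  assumes "j \<le> J"
  shows "sum f {2^j - 1..<2^J - 1} = (\<Sum>i\<in>{j..<J}. sum f {2^i - 1..<2^Suc i - 1})"
  using assms
proof (induction J rule: dec_induct)
  case (step n)
  have "sum f {2^j - 1..<2^Suc n - 1} = sum f {2^j - 1..<2^n - 1} + sum f {2^n - 1..<2^Suc n - 1}"
    using step by (intro sum.atLeastLessThan_concat[symmetric] diff_le_mono power_increasing) auto
  then show ?case using step by (simp add: sum.atLeastLessThan_Suc)
qed simp

lemma card_dyadic_block: "card {2^i - 1..<(2::nat)^Suc i - 1} = 2^i"
proof -
  have "(2::nat)^i \<ge> 1" by simp
  then show ?thesis by (simp del: one_le_power)
qed

text \<open>A Hardy-type inequality. On the dyadic block \<open>2\<^sup>i - 1 \<le> k < 2\<^sup>i\<^sup>+\<^sup>1 - 1\<close> the sequence is at most its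
  first value \<open>y\<^sub>i\<close>, so the tail is at most \<open>\<Sum>\<^sub>i\<^sub>\<ge>\<^sub>j 2\<^sup>i y\<^sub>i\<^sup>2\<close>; subadditivity of \<open>t \<mapsto> t\<^sup>p\<^sup>/\<^sup>2\<close> and exchanging the two
  sums leave a geometric sum with positive exponent \<open>1 - p/2\<close>.\<close>

lemma hardy_tail_finite:
  fixes x :: "nat \<Rightarrow> real"
  assumes dec: "decseq x" and x0: "\<And>n. x n \<ge> 0" and p: "0 < p" "p < 2"
    and X: "\<And>n. (\<Sum>k<n. x k powr p) \<le> X"
  shows "(\<Sum>n<2^J - 1. real (Suc n) powr (-(p/2)) * (\<Sum>k\<in>{n..<2^J - 1}. (x k)\<^sup>2) powr (p/2))
    \<le> 3 / (1 - 2 powr -(1 - p/2)) * X"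
proof -
  define a where "a = 1 - p/2"
  have a: "0 < a" using p by (simp add: a_def)
  define y where "y i = x (2^i - 1)" for i :: nat
  have y0: "y i \<ge> 0" for i by (simp add: y_def x0)
  define B where "B i = {2^i - 1..<(2::nat)^Suc i - 1}" for i :: nat
  have cB: "card (B i) = 2^i" for i unfolding B_def by (rule card_dyadic_block)
  have fB: "finite (B i)" for i by (simp add: B_def)
  define T where "T n = (\<Sum>k\<in>{n..<2^J - 1}. (x k)\<^sup>2)" for n
  have T0: "T n \<ge> 0" for n unfolding T_def by (intro sum_nonneg) simp
  have xB: "x k \<le> y i" if "k \<in> B i" for k i
    unfolding y_def using dec that by (intro decseqD[of x]) (auto simp: B_def)
  have Tj: "T n powr (p/2) \<le> (\<Sum>i\<in>{j..<J}. 2 powr (real i * (p/2)) * y i powr p)" if n: "n \<in> B j" and j: "j \<le> J" for n j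
  proof -
    have "T n \<le> T (2^j - 1)"
      unfolding T_def using n by (intro sum_mono2) (auto simp: B_def)
    also have "\<dots> = (\<Sum>i\<in>{j..<J}. \<Sum>k\<in>B i. (x k)\<^sup>2)"
      unfolding T_def B_def by (rule dyadic_blocks[OF j])
    also have "\<dots> \<le> (\<Sum>i\<in>{j..<J}. 2^i * (y i)\<^sup>2)"
    proof (rule sum_mono)
      fix i
      have "(\<Sum>k\<in>B i. (x k)\<^sup>2) \<le> (\<Sum>k\<in>B i. (y i)\<^sup>2)" by (intro sum_mono power_mono xB x0)
      then show "(\<Sum>k\<in>B i. (x k)\<^sup>2) \<le> 2^i * (y i)\<^sup>2" by (simp add: cB)
    qed
    finally have "T n powr (p/2) \<le> (\<Sum>i\<in>{j..<J}. 2^i * (y i)\<^sup>2) powr (p/2)"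
      using p T0 by (intro powr_mono2) auto
    also have "\<dots> \<le> (\<Sum>i\<in>{j..<J}. (2^i * (y i)\<^sup>2) powr (p/2))"
      using p by (intro powr_sum_le) auto
    also have "\<dots> = (\<Sum>i\<in>{j..<J}. 2 powr (real i * (p/2)) * y i powr p)"
    proof (intro sum.cong refl)
      fix i
      have "(2^i * (y i)\<^sup>2) powr (p/2) = (2 powr real i) powr (p/2) * ((y i)\<^sup>2) powr (p/2)"
        by (simp add: powr_mult powr_realpow)
      also have "((y i)\<^sup>2) powr (p/2) = y i powr p"
        by (rule power2_powr_half[OF y0])
      finally show "(2^i * (y i)\<^sup>2) powr (p/2) = 2 powr (real i * (p/2)) * y i powr p" by (simp add: powr_powr)
    qed
    finally show ?thesis .
  qed
  have block: "(\<Sum>n\<in>B j. real (Suc n) powr (-(p/2)) * T n powr (p/2))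
      \<le> 2 powr (real j * a) * (\<Sum>i\<in>{j..<J}. 2 powr (real i * (p/2)) * y i powr p)" if j: "j < J" for j
  proof -
    define R where "R = (\<Sum>i\<in>{j..<J}. 2 powr (real i * (p/2)) * y i powr p)"
    have "(\<Sum>n\<in>B j. real (Suc n) powr (-(p/2)) * T n powr (p/2)) \<le> (\<Sum>n\<in>B j. 2 powr (- (real j * (p/2))) * R)"
    proof (intro sum_mono mult_mono)
      fix n assume n: "n \<in> B j"
      show "T n powr (p/2) \<le> R" unfolding R_def by (rule Tj[OF n]) (use j in simp)
      have "2^j \<le> Suc n" using n by (auto simp: B_def)
      then have "real (2^j) \<le> real (Suc n)" by (simp only: of_nat_le_iff)
      then have "real (Suc n) powr (-(p/2)) \<le> (2^j) powr (-(p/2))"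
        using p by (intro powr_mono2') auto
      also have "\<dots> = 2 powr (- (real j * (p/2)))" by (simp only: two_power_powr powr_powr mult_minus_right)
      finally show "real (Suc n) powr (-(p/2)) \<le> 2 powr (- (real j * (p/2)))" .
    qed (auto simp: y0)
    also have "\<dots> = 2^j * 2 powr (- (real j * (p/2))) * R" by (simp add: cB)
    also have "2^j * 2 powr (- (real j * (p/2))) = (2::real) powr (real j * a)"
      by (simp only: two_power_powr powr_add[symmetric]) (simp add: a_def algebra_simps)
    finally show ?thesis by (simp add: R_def)
  qed
  define G where "G = 1 / (1 - 2 powr -a)"
  have ra: "0 < (2::real) powr -a" "(2::real) powr -a < 1"
    using a powr_less_mono[of "-a" 0 2] by auto
  have G: "G > 0" using ra by (simp add: G_def)
  have geo: "(\<Sum>j\<le>i. 2 powr (real j * a)) \<le> G * 2 powr (real i * a)" for i :: nat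
  proof (induction i)
    case 0
    show ?case using ra by (simp add: G_def field_simps)
  next
    case (Suc i)
    have g: "G * 2 powr (real i * a) + 2 powr (real (Suc i) * a) = G * 2 powr (real (Suc i) * a)"
    proof -
      have "2 powr (real i * a) = 2 powr -a * 2 powr (real (Suc i) * a)"
        by (simp add: powr_add[symmetric] algebra_simps)
      moreover have "G * 2 powr -a + 1 = G"
      proof -
        have "1 - 2 powr -a \<noteq> 0" using ra by linarith
        then have "G * (1 - 2 powr -a) = 1" by (simp add: G_def)
        then show ?thesis by (simp add: right_diff_distrib)
      qed
      ultimately show ?thesis by (metis distrib_right mult.assoc mult_1)
    qed
    show ?case using Suc g by simp
  qed
  have Bn: "{..<2^J - 1} = {2^0 - 1..<(2::nat)^J - 1}" by auto
  have "(\<Sum>n<2^J - 1. real (Suc n) powr (-(p/2)) * T n powr (p/2))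
      = (\<Sum>j\<in>{0..<J}. \<Sum>n\<in>B j. real (Suc n) powr (-(p/2)) * T n powr (p/2))"
    unfolding Bn B_def by (rule dyadic_blocks) simp
  also have "\<dots> \<le> (\<Sum>j\<in>{0..<J}. 2 powr (real j * a) * (\<Sum>i\<in>{j..<J}. 2 powr (real i * (p/2)) * y i powr p))"
    by (intro sum_mono block) simp
  also have "\<dots> = (\<Sum>i\<in>{0..<J}. \<Sum>j\<in>{0..i}. 2 powr (real j * a) * (2 powr (real i * (p/2)) * y i powr p))"
  proof -
    define f where "f j i = 2 powr (real j * a) * (2 powr (real i * (p/2)) * y i powr p)" for j i
    have "(\<Sum>j\<in>{0..<J}. sum (f j) {j..<J}) = (\<Sum>j\<in>{0..<J}. \<Sum>i\<in>{i\<in>{0..<J}. j \<le> i}. f j i)"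
      by (intro sum.cong refl) auto
    also have "\<dots> = (\<Sum>i\<in>{0..<J}. \<Sum>j\<in>{j\<in>{0..<J}. j \<le> i}. f j i)"
      by (rule sum.swap_restrict) auto
    also have "\<dots> = (\<Sum>i\<in>{0..<J}. \<Sum>j\<in>{0..i}. f j i)"
      by (intro sum.cong refl) auto
    finally show ?thesis unfolding f_def[abs_def] sum_distrib_left .
  qed
  also have "\<dots> = (\<Sum>i\<in>{0..<J}. (\<Sum>j\<le>i. 2 powr (real j * a)) * (2 powr (real i * (p/2)) * y i powr p))"
    by (simp add: sum_distrib_right atLeast0AtMost)
  also have "\<dots> \<le> (\<Sum>i\<in>{0..<J}. (G * 2 powr (real i * a)) * (2 powr (real i * (p/2)) * y i powr p))"
    by (intro sum_mono mult_right_mono geo) simp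
  also have "\<dots> = G * (\<Sum>i\<in>{0..<J}. 2^i * y i powr p)"
  proof -
    have "2 powr (real i * a) * 2 powr (real i * (p/2)) = (2::real)^i" for i :: nat
      by (simp add: powr_add[symmetric] a_def algebra_simps powr_realpow)
    then show ?thesis unfolding sum_distrib_left by (intro sum.cong refl) (simp add: mult.assoc[symmetric])
  qed
  also have "\<dots> \<le> G * (3 * X)"
  proof (rule mult_left_mono)
    have X0: "X \<ge> 0" using X[of 0] by simp
    have "(\<Sum>i\<in>{0..<J}. 2^i * y i powr p) \<le> y 0 powr p + (\<Sum>i\<in>{0..<J}. 2 * (\<Sum>k\<in>B i. x k powr p))"
    proof (cases J)
      case (Suc J')
      have st: "2^Suc i * y (Suc i) powr p \<le> 2 * (\<Sum>k\<in>B i. x k powr p)" for i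
      proof -
        have "(\<Sum>k\<in>B i. y (Suc i) powr p) \<le> (\<Sum>k\<in>B i. x k powr p)"
        proof (rule sum_mono)
          fix k assume "k \<in> B i"
          then have "y (Suc i) \<le> x k" unfolding y_def using dec by (intro decseqD[of x]) (auto simp: B_def)
          then show "y (Suc i) powr p \<le> x k powr p" using p y0 by (intro powr_mono2) auto
        qed
        then show ?thesis by (simp add: cB)
      qed
      have "(\<Sum>i\<in>{0..<J}. 2^i * y i powr p) = y 0 powr p + (\<Sum>i\<in>{0..<J'}. 2^Suc i * y (Suc i) powr p)"
        unfolding Suc by (subst sum.atLeast0_lessThan_Suc_shift) simp
      also have "\<dots> \<le> y 0 powr p + (\<Sum>i\<in>{0..<J'}. 2 * (\<Sum>k\<in>B i. x k powr p))"
        by (intro add_left_mono sum_mono st)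
      also have "\<dots> \<le> y 0 powr p + (\<Sum>i\<in>{0..<J}. 2 * (\<Sum>k\<in>B i. x k powr p))"
        unfolding Suc by (simp add: sum_nonneg)
      finally show ?thesis .
    qed (simp add: y0)
    also have "(\<Sum>i\<in>{0..<J}. 2 * (\<Sum>k\<in>B i. x k powr p)) = 2 * (\<Sum>k<2^J - 1. x k powr p)"
      unfolding Bn B_def sum_distrib_left[symmetric] by (subst dyadic_blocks) simp_all
    also have "y 0 powr p \<le> X" using X[of 1] by (simp add: y_def)
    finally show "(\<Sum>i\<in>{0..<J}. 2^i * y i powr p) \<le> 3 * X" using X[of "2^J - 1"] by simp
  qed (use G in simp)
  finally show ?thesis by (simp add: T_def G_def a_def)
qed

lemma hardy_tail:
  fixes x :: "nat \<Rightarrow> real"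
  assumes dec: "decseq x" and x0: "\<And>n. x n \<ge> 0" and p: "0 < p" "p < 2"
    and X: "\<And>n. (\<Sum>k<n. x k powr p) \<le> X"
  shows "summable (\<lambda>k. (x k)\<^sup>2)"
    and "(\<Sum>n<m. real (Suc n) powr (-(p/2)) * (\<Sum>k. (x (k + n))\<^sup>2) powr (p/2)) \<le> 3 / (1 - 2 powr -(1 - p/2)) * X"
proof -
  have sp: "summable (\<lambda>k. x k powr p)"
    by (rule summableI_nonneg_bounded[OF _ X]) simp
  show s2: "summable (\<lambda>k. (x k)\<^sup>2)"
  proof (rule summable_comparison_test')
    show "summable (\<lambda>k. x 0 powr (2 - p) * x k powr p)" by (rule summable_mult[OF sp])
    show "norm ((x k)\<^sup>2) \<le> x 0 powr (2 - p) * x k powr p" for k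
    proof -
      have "(x k)\<^sup>2 = x k powr (2 - p) * x k powr p"
        using x0[of k] by (cases "x k = 0") (auto simp: powr_add[symmetric])
      also have "\<dots> \<le> x 0 powr (2 - p) * x k powr p"
        using p x0 dec by (intro mult_right_mono powr_mono2) (auto simp: decseqD)
      finally show ?thesis by simp
    qed
  qed
  have lim: "(\<lambda>J. (\<Sum>k\<in>{n..<2^J - 1}. (x k)\<^sup>2)) \<longlonglongrightarrow> (\<Sum>k. (x (k + n))\<^sup>2)" for n
  proof -
    have "(\<lambda>M. \<Sum>k<M. (x k)\<^sup>2) \<longlonglongrightarrow> (\<Sum>k. (x k)\<^sup>2)" by (rule summable_LIMSEQ[OF s2])
    moreover have "strict_mono (\<lambda>J. (2::nat)^J - 1)"
      by (rule strict_monoI) (simp add: diff_less_mono)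
    ultimately have "(\<lambda>J. \<Sum>k<2^J - 1. (x k)\<^sup>2) \<longlonglongrightarrow> (\<Sum>k. (x k)\<^sup>2)"
      using LIMSEQ_subseq_LIMSEQ[of "\<lambda>M. \<Sum>k<M. (x k)\<^sup>2" _ "\<lambda>J. 2^J - 1"] by (simp add: comp_def)
    then have "(\<lambda>J. (\<Sum>k<2^J - 1. (x k)\<^sup>2) - (\<Sum>k<n. (x k)\<^sup>2)) \<longlonglongrightarrow> (\<Sum>k. (x k)\<^sup>2) - (\<Sum>k<n. (x k)\<^sup>2)"
      by (intro tendsto_intros)
    also have "(\<Sum>k. (x k)\<^sup>2) - (\<Sum>k<n. (x k)\<^sup>2) = (\<Sum>k. (x (k + n))\<^sup>2)"
      using suminf_minus_initial_segment[OF s2, of n] by simp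
    finally show ?thesis
    proof (rule Lim_transform_eventually)
      have "n < 2^n" by (rule less_exp)
      show "\<forall>\<^sub>F J in sequentially. (\<Sum>k<2^J - 1. (x k)\<^sup>2) - (\<Sum>k<n. (x k)\<^sup>2) = (\<Sum>k\<in>{n..<2^J - 1}. (x k)\<^sup>2)"
        using eventually_ge_at_top[of n]
      proof eventually_elim
        case (elim J)
        have "(2::nat)^n \<le> 2^J" using elim by (rule power_increasing) simp
        then have "n \<le> 2^J - 1" using \<open>n < 2^n\<close> by linarith
        then have "(\<Sum>k<n. (x k)\<^sup>2) + (\<Sum>k\<in>{n..<2^J - 1}. (x k)\<^sup>2) = (\<Sum>k<2^J - 1. (x k)\<^sup>2)"
          using sum.atLeastLessThan_concat[of 0 n "2^J - 1" "\<lambda>k. (x k)\<^sup>2"] by (simp add: atLeast0LessThan)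
        then show ?case by simp
      qed
    qed
  qed
  show "(\<Sum>n<m. real (Suc n) powr (-(p/2)) * (\<Sum>k. (x (k + n))\<^sup>2) powr (p/2)) \<le> 3 / (1 - 2 powr -(1 - p/2)) * X"
  proof (rule tendsto_upperbound)
    show "(\<lambda>J. \<Sum>n<m. real (Suc n) powr (-(p/2)) * (\<Sum>k\<in>{n..<2^J - 1}. (x k)\<^sup>2) powr (p/2))
       \<longlonglongrightarrow> (\<Sum>n<m. real (Suc n) powr (-(p/2)) * (\<Sum>k. (x (k + n))\<^sup>2) powr (p/2))"
    proof (intro tendsto_sum tendsto_mult tendsto_const tendsto_powr' lim)
      show "(\<Sum>k. (x (k + n))\<^sup>2) \<noteq> 0 \<or> 0 < p / 2 \<and> (\<forall>\<^sub>F J in sequentially. 0 \<le> (\<Sum>k\<in>{n..<2^J - 1}. (x k)\<^sup>2))" for n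
        using p by (auto intro!: always_eventually sum_nonneg)
    qed
    show "\<forall>\<^sub>F J in sequentially. (\<Sum>n<m. real (Suc n) powr (-(p/2)) * (\<Sum>k\<in>{n..<2^J - 1}. (x k)\<^sup>2) powr (p/2))
       \<le> 3 / (1 - 2 powr -(1 - p/2)) * X"
      using eventually_ge_at_top[of m]
    proof eventually_elim
      case (elim J)
      have "m < 2^m" by (rule less_exp)
      moreover have "(2::nat)^m \<le> 2^J" using elim by (rule power_increasing) simp
      ultimately have "m \<le> 2^J - 1" by linarith
      then have "(\<Sum>n<m. real (Suc n) powr (-(p/2)) * (\<Sum>k\<in>{n..<2^J - 1}. (x k)\<^sup>2) powr (p/2))
        \<le> (\<Sum>n<2^J - 1. real (Suc n) powr (-(p/2)) * (\<Sum>k\<in>{n..<2^J - 1}. (x k)\<^sup>2) powr (p/2))"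
        by (intro sum_mono2) auto
      also have "\<dots> \<le> 3 / (1 - 2 powr -(1 - p/2)) * X" by (rule hardy_tail_finite[OF dec x0 p X])
      finally show ?case .
    qed
  qed simp
qed

lemma n_term_error_nonneg: "n_term_error I W n F \<ge> 0"
  unfolding n_term_error_def
proof (rule cINF_greatest)
  have "0 \<in> n_term I W n"
    unfolding n_term_def by (rule CollectI, rule exI[of _ "{}"], rule exI[of _ "\<lambda>_. 0"]) simp
  then show "n_term I W n \<noteq> {}" by blast
qed simp

lemma n_term_error_le:
  assumes "K \<subseteq> I" "finite K" "card K \<le> n"
  shows "n_term_error I W n F \<le> norm (F - (\<Sum>l\<in>K. cadjoint (W l) (H l)))"
  unfolding n_term_error_def
  by (rule cINF_lower) (use assms in \<open>auto simp: n_term_def intro!: bdd_belowI2[of _ 0]\<close>)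

text \<open>Keeping the \<open>n\<close> largest coefficients leaves an error controlled by the Bessel bound and the
  \<open>\<ell>\<^sup>2\<close> tail of the decreasing rearrangement, to which the Hardy-type inequality applies.\<close>

theorem lp_coefficients_approx_space:
  fixes W :: "'i \<Rightarrow> 'k::complex_hilbert \<Rightarrow> 'k"
  assumes W: "bessel I W B" and inf: "infinite I" and p: "0 < p" "p < 2" and \<alpha>: "\<alpha> = 1 / p - 1 / 2"
  shows "\<exists>C\<ge>0. \<forall>H F. (\<lambda>l. norm (H l) powr p) summable_on I \<longrightarrow> ((\<lambda>l. cadjoint (W l) (H l)) has_sum F) I \<longrightarrow>
    F \<in> approx_space I W \<alpha> p \<and> approx_norm I W \<alpha> p F \<le> C * (\<Sum>\<^sub>\<infinity>l\<in>I. norm (H l) powr p) powr (1 / p)"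
proof -
  define D where "D = B powr (p/2) * (3 / (1 - 2 powr -(1 - p/2)))"
  have B: "B \<ge> 0" using W by (simp add: bessel_def)
  have D: "D \<ge> 0"
    using B p powr_less_mono[of "-(1 - p/2)" 0 2] by (simp add: D_def)
  have "F \<in> approx_space I W \<alpha> p \<and> approx_norm I W \<alpha> p F \<le> D powr (1 / p) * (\<Sum>\<^sub>\<infinity>l\<in>I. norm (H l) powr p) powr (1 / p)"
    if sm: "(\<lambda>l. norm (H l) powr p) summable_on I" and F: "((\<lambda>l. cadjoint (W l) (H l)) has_sum F) I" for H F
  proof -
    define X where "X = (\<Sum>\<^sub>\<infinity>l\<in>I. norm (H l) powr p)"
    have X0: "X \<ge> 0" unfolding X_def by (rule infsum_nonneg) simp
    have fin: "finite {i\<in>I. norm (H i) \<ge> \<epsilon>}" if \<epsilon>: "\<epsilon> > 0" for \<epsilon>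
    proof (rule ccontr)
      assume "infinite {i\<in>I. norm (H i) \<ge> \<epsilon>}"
      then obtain G where G: "G \<subseteq> {i\<in>I. norm (H i) \<ge> \<epsilon>}" "finite G" "card G = Suc (nat \<lceil>X / \<epsilon> powr p\<rceil>)"
        using infinite_arbitrarily_large by metis
      have "X / \<epsilon> powr p < real (card G)" unfolding G(3) by linarith
      then have "X < real (card G) * \<epsilon> powr p" using \<epsilon> by (simp add: pos_divide_less_eq)
      also have "\<dots> = (\<Sum>i\<in>G. \<epsilon> powr p)" by simp
      also have "\<dots> \<le> (\<Sum>i\<in>G. norm (H i) powr p)" using G \<epsilon> p by (intro sum_mono powr_mono2) auto
      also have "\<dots> \<le> X" unfolding X_def using G by (intro finite_sum_le_infsum sm) auto
      finally show False by simp
    qed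
    obtain e where e: "inj e" "range e \<subseteq> I" "decseq (\<lambda>n. norm (H (e n)))"
      "\<And>i. i \<in> I \<Longrightarrow> i \<notin> range e \<Longrightarrow> norm (H i) = 0"
      using decreasing_enumeration[OF inf, of "\<lambda>i. norm (H i)"] fin by auto
    define x where "x n = norm (H (e n))" for n
    have x0: "x n \<ge> 0" for n by (simp add: x_def)
    have dx: "decseq x" using e(3) by (simp add: x_def[abs_def])
    have Xb: "(\<Sum>k<n. x k powr p) \<le> X" for n
    proof -
      have "(\<Sum>k<n. x k powr p) = (\<Sum>i\<in>e ` {..<n}. norm (H i) powr p)"
        unfolding x_def by (subst sum.reindex) (use e(1) in \<open>auto intro: inj_on_subset\<close>)
      also have "\<dots> \<le> X" unfolding X_def using e(2) by (intro finite_sum_le_infsum sm) auto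
      finally show ?thesis .
    qed
    note ht = hardy_tail[OF dx x0 p Xb]
    define \<tau> where "\<tau> n = (\<Sum>k. (x (k + n))\<^sup>2)" for n
    have \<tau>0: "\<tau> n \<ge> 0" for n
      unfolding \<tau>_def by (rule suminf_nonneg[OF summable_ignore_initial_segment[OF ht(1)]]) simp
    have err: "n_term_error I W n F \<le> sqrt (B * \<tau> n)" for n
    proof -
      define K where "K = e ` {..<n}"
      have K: "K \<subseteq> I" "finite K" "card K \<le> n"
        using e(2) card_image_le[of "{..<n}" e] by (auto simp: K_def)
      have "((\<lambda>l. cadjoint (W l) (H l)) has_sum (F - (\<Sum>l\<in>K. cadjoint (W l) (H l)))) (I - K)"
        by (rule has_sum_Diff[OF F has_sum_finite[OF K(2)] K(1)])
      then have "norm (F - (\<Sum>l\<in>K. cadjoint (W l) (H l))) \<le> sqrt (B * \<tau> n)"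
      proof (rule has_sum_norm_le)
        fix G assume G: "finite G" "G \<subseteq> I - K"
        define Z where "Z = {k. e k \<in> G}"
        have Z: "finite Z" unfolding Z_def using finite_vimageI[OF G(1) e(1)] by (simp add: vimage_def)
        have Zn: "n \<le> k" if "k \<in> Z" for k
          using that G(2) by (force simp: Z_def K_def not_less[symmetric])
        have "(\<Sum>l\<in>G. (norm (H l))\<^sup>2) = (\<Sum>l\<in>e ` Z. (norm (H l))\<^sup>2)"
          using G e(4) by (intro sum.mono_neutral_right) (auto simp: Z_def)
        also have "\<dots> = (\<Sum>k\<in>Z. (x k)\<^sup>2)"
          unfolding x_def by (subst sum.reindex) (use e(1) in \<open>auto intro: inj_on_subset\<close>)
        also have "\<dots> = (\<Sum>k\<in>(\<lambda>k. k - n) ` Z. (x (k + n))\<^sup>2)"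
          by (subst sum.reindex) (use Zn in \<open>auto intro!: inj_onI simp: eq_diff_iff\<close>)
        also have "\<dots> \<le> \<tau> n"
          unfolding \<tau>_def by (rule sum_le_suminf[OF summable_ignore_initial_segment[OF ht(1)]]) (use Z in auto)
        finally have t: "(\<Sum>l\<in>G. (norm (H l))\<^sup>2) \<le> \<tau> n" .
        have "(norm (\<Sum>l\<in>G. cadjoint (W l) (H l)))\<^sup>2 \<le> B * (\<Sum>l\<in>G. (norm (H l))\<^sup>2)"
          by (rule bessel_synthesis_le[OF W G(1)]) (use G in blast)
        also have "\<dots> \<le> B * \<tau> n" by (rule mult_left_mono[OF t B])
        finally show "norm (\<Sum>l\<in>G. cadjoint (W l) (H l)) \<le> sqrt (B * \<tau> n)" by (rule real_le_rsqrt)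
      qed
      then show ?thesis using n_term_error_le[OF K, where W = W and F = F and H = H] by linarith
    qed
    have term_le: "approx_term I W \<alpha> p F n \<le> B powr (p/2) * (real (Suc n) powr (-(p/2)) * \<tau> n powr (p/2))" for n
    proof -
      define \<sigma> where "\<sigma> = n_term_error I W n F"
      define N where "N = real (Suc n)"
      have N: "N > 0" by (simp add: N_def)
      have \<sigma>0: "\<sigma> \<ge> 0" unfolding \<sigma>_def by (rule n_term_error_nonneg)
      have "\<alpha> * p - 1 = -(p/2)" using p by (simp add: \<alpha> field_simps)
      then have "N powr (\<alpha> * p) * (1 / N) = N powr (-(p/2))"
        using N powr_diff[of N "\<alpha> * p" 1] by simp
      then have "approx_term I W \<alpha> p F n = N powr (-(p/2)) * \<sigma> powr p"
        unfolding approx_term_def N_def[symmetric] \<sigma>_def[symmetric]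
        using \<sigma>0 by (simp add: powr_mult powr_powr mult_ac) (metis (no_types) mult.commute mult.assoc times_divide_eq_right mult_1_right)
      also have "\<sigma> powr p \<le> (sqrt (B * \<tau> n)) powr p"
        using err[of n] \<sigma>0 p by (intro powr_mono2) (auto simp: \<sigma>_def)
      also have "\<dots> = B powr (p/2) * \<tau> n powr (p/2)"
        using B \<tau>0[of n] by (simp add: powr_half_sqrt[symmetric] powr_powr powr_mult del: powr_half_sqrt)
      finally show ?thesis by (simp add: N_def mult_ac mult_left_mono)
    qed
    have t0: "approx_term I W \<alpha> p F n \<ge> 0" for n by (simp add: approx_term_def)
    have part: "(\<Sum>n<m. approx_term I W \<alpha> p F n) \<le> D * X" for m
    proof -
      have "(\<Sum>n<m. approx_term I W \<alpha> p F n) \<le> B powr (p/2) * (\<Sum>n<m. real (Suc n) powr (-(p/2)) * \<tau> n powr (p/2))"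
        unfolding sum_distrib_left by (intro sum_mono term_le)
      also have "\<dots> \<le> B powr (p/2) * (3 / (1 - 2 powr -(1 - p/2)) * X)"
        unfolding \<tau>_def by (intro mult_left_mono ht(2)) simp
      finally show ?thesis by (simp add: D_def mult_ac)
    qed
    have smb: "summable (approx_term I W \<alpha> p F)" by (rule summableI_nonneg_bounded[OF t0 part])
    have "suminf (approx_term I W \<alpha> p F) \<le> D * X" by (rule suminf_le_const[OF smb part])
    then have "approx_norm I W \<alpha> p F \<le> (D * X) powr (1 / p)"
      unfolding approx_norm_def using p suminf_nonneg[OF smb t0] by (intro powr_mono2) auto
    also have "\<dots> = D powr (1 / p) * X powr (1 / p)" using D X0 by (simp add: powr_mult)
    finally show ?thesis using smb by (simp add: approx_space_def X_def)
  qed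
  then show ?thesis by (intro exI[of _ "D powr (1 / p)"]) auto
qed

lemma bessel_cong:
  assumes eq: "\<And>l. l \<in> I \<Longrightarrow> W l = W' l" and W': "bessel I W' B"
  shows "bessel I W B"
  unfolding bessel_def
proof (intro conjI ballI allI impI)
  fix F f assume F: "finite F" "F \<subseteq> I"
  then have "(\<Sum>l\<in>F. (norm (W l f))\<^sup>2) = (\<Sum>l\<in>F. (norm (W' l f))\<^sup>2)"
    by (intro sum.cong refl) (use eq in auto)
  then show "(\<Sum>l\<in>F. (norm (W l f))\<^sup>2) \<le> B * (norm f)\<^sup>2" using W' F by (simp add: bessel_def)
qed (use W' eq in \<open>auto simp: bessel_def\<close>)

lemma summable_powr_imp_square:
  fixes h :: "'i \<Rightarrow> real"
  assumes sm: "(\<lambda>l. h l powr p) summable_on I" and h: "\<And>l. l \<in> I \<Longrightarrow> h l \<ge> 0" and p: "0 < p" "p < 2"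
  shows "(\<lambda>l. (h l)\<^sup>2) summable_on I"
proof (rule summable_on_comparison_test)
  define X where "X = (\<Sum>\<^sub>\<infinity>l\<in>I. h l powr p)"
  show "(\<lambda>l. (X powr (1/p)) powr (2 - p) * h l powr p) summable_on I" by (rule summable_on_cmult_right[OF sm])
  fix l assume l: "l \<in> I"
  have "h l powr p \<le> X"
    using finite_sum_le_infsum[OF sm, of "{l}"] l by (simp add: X_def)
  then have "(h l powr p) powr (1/p) \<le> X powr (1/p)" using p by (intro powr_mono2) auto
  then have hX: "h l \<le> X powr (1/p)" using p h[OF l] by (simp add: powr_powr)
  have "(h l)\<^sup>2 = h l powr (2 - p) * h l powr p"
    using h[OF l] by (cases "h l = 0") (auto simp: powr_add[symmetric])
  also have "\<dots> \<le> (X powr (1/p)) powr (2 - p) * h l powr p"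
    using p h[OF l] by (intro mult_right_mono powr_mono2 hX) auto
  finally show "(h l)\<^sup>2 \<le> (X powr (1/p)) powr (2 - p) * h l powr p" .
qed simp

section \<open>Localized expansions lie in the approximation space\<close>

context gaussian_gabor_frame
begin

lemma infinite_Lambda: "infinite \<Lambda>"
proof -
  obtain b :: 'a where b: "b \<in> Basis" using nonempty_Basis by blast
  define f where "f n = ((real n / real N) *\<^sub>R b, 0::'a)" for n :: nat
  have "inj f" using b N_pos by (auto simp: f_def inj_def nonzero_Basis)
  moreover have "range f \<subseteq> \<Lambda>"
    using b N_pos by (auto simp: f_def Lat lattice_def inner_Basis)
  ultimately show ?thesis by (meson finite_subset range_inj_infinite)
qed

text \<open>The coefficients \<open>H\<^sub>l = U\<^sub>l S\<^sup>-\<^sup>1 F\<close> of \<open>F\<close> in the dictionary are \<open>\<Sum>\<^sub>m U\<^sub>l S\<^sup>-\<^sup>1 \<gamma>\<^sub>m \<otimes> r\<^sub>m\<close>. Since \<open>S\<^sup>-\<^sup>1\<close> preserves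
  localization, the norm of \<open>U\<^sub>l S\<^sup>-\<^sup>1 \<gamma>\<^sub>m\<close> decays in \<open>l - m\<close>, and \<open>|H\<^sub>l|\<close> is dominated by a convolution of
  \<open>|r\<^sub>m|\<close> with a summable kernel. The constant depends on \<open>\<gamma>\<close> only through \<open>C\<^sub>0\<close>.\<close>

theorem localized_expansion_approx_space:
  fixes W :: "'a \<times> 'a \<Rightarrow> 'a L2 hs \<Rightarrow> 'a L2 hs"
  assumes W: "s_admissible_dictionary \<Lambda> s W" and p: "2 * real DIM('a) / s < p" "p < 2"
    and \<alpha>: "\<alpha> = 1 / p - 1 / 2" and C0: "C0 \<ge> 0"
  shows "\<exists>C\<ge>0. \<forall>\<gamma> r F. (\<forall>m\<in>\<Lambda>. coherent_decay s C0 m (\<gamma> m)) \<longrightarrow> (\<lambda>m. norm (r m) powr p) summable_on \<Lambda> \<longrightarrow>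
      ((\<lambda>m. hs_rank_one (\<gamma> m) (r m)) has_sum F) \<Lambda> \<longrightarrow>
      F \<in> approx_space \<Lambda> W \<alpha> p \<and> approx_norm \<Lambda> W \<alpha> p F \<le> C * (\<Sum>\<^sub>\<infinity>m\<in>\<Lambda>. norm (r m) powr p) powr (1 / p)"
proof -
  from W obtain \<Psi> and \<phi> \<psi> :: "nat \<Rightarrow> 'a L2" where s: "2 * real DIM('a) < s"
    and \<phi>: "\<forall>k. M1_norm s (\<phi> k) < \<infinity>" and fin: "(\<Sum>k. M1_norm s (\<phi> k) * ennreal (norm (\<psi> k))) < \<infinity>"
    and \<Psi>: "\<forall>h. (\<lambda>k. rank_one (\<phi> k) (\<psi> k) h) sums \<Psi> h"
    and gf: "g_frame \<Lambda> (\<lambda>l. cadjoint \<Psi> \<circ> cadjoint (tf_shift l))"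
    and WU: "\<forall>l\<in>\<Lambda>. W l = left_mult (cadjoint \<Psi> \<circ> cadjoint (tf_shift l))"
    unfolding s_admissible_dictionary_def by blast
  have s0: "s > 0" using s by (rule le_less_trans[rotated]) simp
  have "0 \<le> 2 * real DIM('a) / s" using s0 by simp
  then have p0: "p > 0" using p by linarith
  define U where "U l = cadjoint \<Psi> \<circ> cadjoint (tf_shift l)" for l
  obtain A B where U: "frame_bounds \<Lambda> U A B"
    using g_frame_imp_frame_bounds[OF gf] unfolding U_def[symmetric] by blast
  have AB: "0 < A" "A < B" using U by (auto simp: frame_bounds_def)
  have bU: "bounded_clinear (U l)" if "l \<in> \<Lambda>" for l using U that by (simp add: frame_bounds_def)
  obtain M where M: "M \<ge> 0" "localized_family \<Lambda> s M U"
    using admissible_operator(2)[OF _ fin _ less_imp_le[OF s0], of \<Psi>] \<phi> \<Psi> unfolding U_def[abs_def] by blast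
  define S where "S = g_frame_operator \<Lambda> U"
  obtain J where J: "J \<ge> 0" "offdiag s J (inv S)"
    using localized_frame_inverse[OF s AB M(1)] U M(2) unfolding S_def by blast
  note fi = frame_operator_inverse[OF U, folded S_def]
  have bV: "bounded_clinear (\<lambda>f. U l (inv S f))" if "l \<in> \<Lambda>" for l
    by (rule bounded_clinear_comp[OF bU[OF that] fi(3)])
  define C1 where "C1 = 2 powr s * decay_integral TYPE('a \<times> 'a) s * (2 * J * C0)"
  have C1: "C1 \<ge> 0" using J C0 by (simp add: C1_def decay_integral_nonneg)
  define K where "K = C1 * M"
  have K: "K \<ge> 0" using C1 M by (simp add: K_def)
  have bes: "bessel \<Lambda> (\<lambda>l. left_mult (U l)) B" by (rule bessel_left_mult[OF frame_bounds_bessel[OF U]])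
  have besW: "bessel \<Lambda> W B"
    by (rule bessel_cong[OF _ bes]) (use WU in \<open>simp add: U_def\<close>)
  obtain Ca where Ca: "Ca \<ge> 0" "\<And>H F. (\<lambda>l. norm (H l) powr p) summable_on \<Lambda> \<Longrightarrow> ((\<lambda>l. cadjoint (W l) (H l)) has_sum F) \<Lambda> \<Longrightarrow>
    F \<in> approx_space \<Lambda> W \<alpha> p \<and> approx_norm \<Lambda> W \<alpha> p F \<le> Ca * (\<Sum>\<^sub>\<infinity>l\<in>\<Lambda>. norm (H l) powr p) powr (1 / p)"
    using lp_coefficients_approx_space[OF besW infinite_Lambda p0 p(2) \<alpha>] by blast
  obtain Cb where Cb: "Cb \<ge> 0" "\<And>(\<rho> :: 'a \<times> 'a \<Rightarrow> real) h. (\<forall>m. \<rho> m \<ge> 0) \<Longrightarrow> (\<lambda>m. \<rho> m powr p) summable_on \<Lambda> \<Longrightarrow>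
    (\<forall>l\<in>\<Lambda>. h l \<ge> 0 \<and> (\<forall>X. (\<forall>F. finite F \<longrightarrow> F \<subseteq> \<Lambda> \<longrightarrow> (\<Sum>m\<in>F. K * decay s (l - m) * \<rho> m) \<le> X) \<longrightarrow> h l \<le> X)) \<Longrightarrow>
    (\<lambda>l. h l powr p) summable_on \<Lambda> \<and> (\<Sum>\<^sub>\<infinity>l\<in>\<Lambda>. h l powr p) \<le> Cb * (\<Sum>\<^sub>\<infinity>m\<in>\<Lambda>. \<rho> m powr p)"
    using decay_convolution_lp[OF s p(1) K] by blast
  have main: "F \<in> approx_space \<Lambda> W \<alpha> p \<and> approx_norm \<Lambda> W \<alpha> p F \<le> Ca * Cb powr (1 / p) * (\<Sum>\<^sub>\<infinity>m\<in>\<Lambda>. norm (r m) powr p) powr (1 / p)"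
    if \<gamma>: "\<forall>m\<in>\<Lambda>. coherent_decay s C0 m (\<gamma> m)" and r: "(\<lambda>m. norm (r m) powr p) summable_on \<Lambda>"
      and F: "((\<lambda>m. hs_rank_one (\<gamma> m) (r m)) has_sum F) \<Lambda>" for \<gamma> r F
  proof -
    define H where "H l = left_mult (\<lambda>f. U l (inv S f)) F" for l
    have nV: "norm (U l (inv S (\<gamma> m))) \<le> K * decay s (l - m)" if l: "l \<in> \<Lambda>" and m: "m \<in> \<Lambda>" for l m
    proof -
      have "coherent_decay s C1 m (inv S (\<gamma> m))"
        unfolding C1_def using \<gamma> m by (intro coherent_decay_apply fi s J C0) auto
      then show ?thesis using M(2) l C1 unfolding localized_family_def K_def by blast
    qed
    have Hl: "norm (H l) \<le> X"
      if l: "l \<in> \<Lambda>" and X: "\<forall>G. finite G \<longrightarrow> G \<subseteq> \<Lambda> \<longrightarrow> (\<Sum>m\<in>G. K * decay s (l - m) * norm (r m)) \<le> X" for l X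
    proof (rule has_sum_norm_le)
      show "((\<lambda>m. left_mult (\<lambda>f. U l (inv S f)) (hs_rank_one (\<gamma> m) (r m))) has_sum H l) \<Lambda>"
        unfolding H_def by (rule bounded_clinear_infsum_bound[OF bounded_clinear_left_mult[OF bV[OF l]] F])
      fix G assume G: "finite G" "G \<subseteq> \<Lambda>"
      have "norm (\<Sum>m\<in>G. left_mult (\<lambda>f. U l (inv S f)) (hs_rank_one (\<gamma> m) (r m)))
          \<le> (\<Sum>m\<in>G. K * decay s (l - m) * norm (r m))"
      proof (rule order_trans[OF norm_sum sum_mono])
        fix m assume "m \<in> G"
        then have m: "m \<in> \<Lambda>" using G by blast
        have "norm (left_mult (\<lambda>f. U l (inv S f)) (hs_rank_one (\<gamma> m) (r m))) \<le> norm (U l (inv S (\<gamma> m))) * norm (r m)"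
          by (rule norm_left_mult_rank_le[OF bV[OF l] hs_rank_one.rep_eq])
        also have "\<dots> \<le> K * decay s (l - m) * norm (r m)" by (intro mult_right_mono nV l m) simp
        finally show "norm (left_mult (\<lambda>f. U l (inv S f)) (hs_rank_one (\<gamma> m) (r m))) \<le> K * decay s (l - m) * norm (r m)" .
      qed
      also have "\<dots> \<le> X" using X G by blast
      finally show "norm (\<Sum>m\<in>G. left_mult (\<lambda>f. U l (inv S f)) (hs_rank_one (\<gamma> m) (r m))) \<le> X" .
    qed
    have hp: "(\<lambda>l. norm (H l) powr p) summable_on \<Lambda> \<and>
        (\<Sum>\<^sub>\<infinity>l\<in>\<Lambda>. norm (H l) powr p) \<le> Cb * (\<Sum>\<^sub>\<infinity>m\<in>\<Lambda>. norm (r m) powr p)"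
      by (rule Cb(2)) (use r Hl in auto)
    have h2: "(\<lambda>l. (norm (H l))\<^sup>2) summable_on \<Lambda>"
      by (rule summable_powr_imp_square[OF conjunct1[OF hp] _ p0 p(2)]) simp
    define F' where "F' = (\<Sum>\<^sub>\<infinity>l\<in>\<Lambda>. cadjoint (left_mult (U l)) (H l))"
    have hsF': "((\<lambda>l. cadjoint (left_mult (U l)) (H l)) has_sum F') \<Lambda>"
      unfolding F'_def by (rule has_sum_infsum[OF bessel_synthesis_summable(1)[OF bes h2]])
    have "F' = F"
    proof (rule hs_eqI)
      fix x
      have "((\<lambda>l. hs_apply (cadjoint (left_mult (U l)) (H l)) x) has_sum hs_apply F' x) \<Lambda>"
        by (rule has_sum_hs_apply[OF hsF'])
      moreover have "hs_apply (cadjoint (left_mult (U l)) (H l)) x = cadjoint (U l) (U l (inv S (hs_apply F x)))" if l: "l \<in> \<Lambda>" for l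
        by (simp add: cadjoint_left_mult[OF bU[OF l]] hs_apply_left_mult[OF bounded_clinear_cadjoint[OF bU[OF l]]]
            H_def hs_apply_left_mult[OF bV[OF l]])
      ultimately have "((\<lambda>l. cadjoint (U l) (U l (inv S (hs_apply F x)))) has_sum hs_apply F' x) \<Lambda>"
        by (simp cong: has_sum_cong)
      then show "hs_apply F' x = hs_apply F x" using fi(5) has_sum_unique by blast
    qed
    then have hsF: "((\<lambda>l. cadjoint (left_mult (U l)) (H l)) has_sum F) \<Lambda>" using hsF' by (simp only:)
    have "((\<lambda>l. cadjoint (W l) (H l)) has_sum F) \<Lambda> \<longleftrightarrow> ((\<lambda>l. cadjoint (left_mult (U l)) (H l)) has_sum F) \<Lambda>"
      by (rule has_sum_cong) (use WU in \<open>simp add: U_def\<close>)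
    with hsF have "((\<lambda>l. cadjoint (W l) (H l)) has_sum F) \<Lambda>" by blast
    from Ca(2)[OF conjunct1[OF hp] this]
    have a: "F \<in> approx_space \<Lambda> W \<alpha> p" "approx_norm \<Lambda> W \<alpha> p F \<le> Ca * (\<Sum>\<^sub>\<infinity>l\<in>\<Lambda>. norm (H l) powr p) powr (1 / p)"
      by blast+
    have "(\<Sum>\<^sub>\<infinity>l\<in>\<Lambda>. norm (H l) powr p) powr (1 / p) \<le> (Cb * (\<Sum>\<^sub>\<infinity>m\<in>\<Lambda>. norm (r m) powr p)) powr (1 / p)"
      using hp p0 by (intro powr_mono2) (auto intro: infsum_nonneg)
    also have "\<dots> = Cb powr (1 / p) * (\<Sum>\<^sub>\<infinity>m\<in>\<Lambda>. norm (r m) powr p) powr (1 / p)"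
      using Cb by (simp add: powr_mult infsum_nonneg)
    finally have "Ca * (\<Sum>\<^sub>\<infinity>l\<in>\<Lambda>. norm (H l) powr p) powr (1 / p)
        \<le> Ca * (Cb powr (1 / p) * (\<Sum>\<^sub>\<infinity>m\<in>\<Lambda>. norm (r m) powr p) powr (1 / p))"
      by (rule mult_left_mono) (rule Ca(1))
    with a(2) have "approx_norm \<Lambda> W \<alpha> p F \<le> Ca * Cb powr (1 / p) * (\<Sum>\<^sub>\<infinity>m\<in>\<Lambda>. norm (r m) powr p) powr (1 / p)"
      by (simp only: mult.assoc)
    with a(1) show ?thesis by blast
  qed
  have "Ca * Cb powr (1 / p) \<ge> 0" using Ca by simp
  then show ?thesis using main by blast
qed

end

section \<open>Calculus of Schwartz functions\<close>

abbreviation partial :: "'a \<Rightarrow> ('a::euclidean_space \<Rightarrow> complex) \<Rightarrow> 'a \<Rightarrow> complex" where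
  "partial b f \<equiv> \<lambda>x. frechet_derivative f (at x) b"

lemma partialI: "(f has_derivative f') (at x) \<Longrightarrow> frechet_derivative f (at x) b = f' b"
  using frechet_derivative_at by metis

lemma iter_partial_append: "iter_partial (bs @ cs) f = iter_partial bs (iter_partial cs f)"
  by (induction bs) auto

lemma schwartz_derivative:
  assumes "f \<in> schwartz" "set bs \<subseteq> Basis"
  shows "(iter_partial bs f has_derivative frechet_derivative (iter_partial bs f) (at x)) (at x)"
  using assms by (auto simp: schwartz_def differentiable_on_def frechet_derivative_works[symmetric])

lemma schwartz_bound:
  assumes "f \<in> schwartz" "set bs \<subseteq> Basis"
  shows "\<exists>C\<ge>0. \<forall>x. (1 + norm x) ^ k * cmod (iter_partial bs f x) \<le> C"
proof -
  have "bounded (range (\<lambda>x. (1 + norm x) ^ k *\<^sub>R iter_partial bs f x))"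
    using assms by (auto simp: schwartz_def)
  then obtain C where "C > 0" "\<And>x. norm ((1 + norm x) ^ k *\<^sub>R iter_partial bs f x) \<le> C"
    unfolding bounded_pos by auto
  then show ?thesis
    by (intro exI[of _ C]) (simp add: abs_of_nonneg)
qed

lemma schwartzI:
  assumes "\<And>bs x. set bs \<subseteq> Basis \<Longrightarrow> iter_partial bs f differentiable (at x)"
    and "\<And>bs k. set bs \<subseteq> Basis \<Longrightarrow> \<exists>C. \<forall>x. (1 + norm x) ^ k * cmod (iter_partial bs f x) \<le> C"
  shows "f \<in> schwartz"
  unfolding schwartz_def
proof (intro CollectI allI impI conjI)
  fix bs :: "'a list" assume bs: "set bs \<subseteq> Basis"
  show "iter_partial bs f differentiable_on UNIV" using assms(1)[OF bs] by (simp add: differentiable_on_def)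
  show "bounded (range (\<lambda>x. (1 + norm x) ^ k *\<^sub>R iter_partial bs f x))" for k
  proof -
    obtain C where C: "\<And>x. (1 + norm x) ^ k * cmod (iter_partial bs f x) \<le> C" using assms(2)[OF bs] by blast
    have "norm ((1 + norm x) ^ k *\<^sub>R iter_partial bs f x) \<le> C" for x using C[of x] by (simp add: abs_of_nonneg)
    then show ?thesis unfolding bounded_iff by (intro exI[of _ C]) blast
  qed
qed

lemma schwartz_continuous: "f \<in> schwartz \<Longrightarrow> continuous_on UNIV f"
  using schwartz_derivative[of f "[]"]
  by (intro continuous_at_imp_continuous_on ballI has_derivative_continuous) auto

lemma power_decay: "(1 + norm x) ^ k * decay (real k) x = 1"
  using one_plus_norm_pos[of x] by (simp add: decay_def powr_minus powr_realpow)

lemma le_decayI: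
  assumes "(1 + norm x) ^ k * y \<le> C" shows "y \<le> C * decay (real k) x"
proof -
  have "y = decay (real k) x * ((1 + norm x) ^ k * y)" using power_decay[of x k] by (simp add: mult_ac)
  also have "\<dots> \<le> decay (real k) x * C" by (rule mult_left_mono[OF assms decay_nonneg])
  finally show ?thesis by (simp add: mult.commute)
qed

lemma schwartz_decay:
  assumes "f \<in> schwartz" "set bs \<subseteq> Basis"
  shows "\<exists>C\<ge>0. \<forall>x. cmod (iter_partial bs f x) \<le> C * decay (real k) x"
  using schwartz_bound[OF assms, of k] le_decayI by blast

lemma schwartz_sq_int:
  assumes f: "f \<in> schwartz" shows "square_integrable (f :: 'a::euclidean_space \<Rightarrow> complex)"
proof -
  obtain C where C: "C \<ge> 0" "\<And>x. cmod (f x) \<le> C * decay (real (DIM('a) + 1)) x"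
    using schwartz_decay[OF f, of "[]" "DIM('a) + 1"] by auto
  have m: "f \<in> borel_measurable borel" by (rule borel_measurable_continuous_onI[OF schwartz_continuous[OF f]])
  have "integrable lborel (\<lambda>x. C\<^sup>2 * decay (real (DIM('a) + 1)) (x::'a))"
    by (intro integrable_mult_right decay_integrable) simp
  then have "integrable lborel (\<lambda>x. (cmod (f x))\<^sup>2)"
  proof (rule Bochner_Integration.integrable_bound)
    show "AE x in lborel. norm ((cmod (f x))\<^sup>2) \<le> norm (C\<^sup>2 * decay (real (DIM('a) + 1)) x)"
    proof (rule AE_I2)
      fix x :: 'a
      define d where "d = decay (real (DIM('a) + 1)) x"
      have d: "0 \<le> d" "d \<le> 1" by (simp_all add: d_def decay_nonneg decay_le_1)
      have "(cmod (f x))\<^sup>2 \<le> (C * d)\<^sup>2" using C(2)[of x] by (intro power_mono) (auto simp: d_def)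
      also have "\<dots> = C\<^sup>2 * (d * d)" by (simp add: power2_eq_square)
      also have "\<dots> \<le> C\<^sup>2 * d" using d by (intro mult_left_mono) (auto simp: mult_left_le)
      finally show "norm ((cmod (f x))\<^sup>2) \<le> norm (C\<^sup>2 * decay (real (DIM('a) + 1)) x)" using d by (simp add: d_def)
    qed
  qed (use m in measurable)
  then show ?thesis using m by (simp add: square_integrable_def)
qed

lemma iter_partial_lincomb:
  assumes f: "f \<in> schwartz" and g: "g \<in> schwartz" and bs: "set bs \<subseteq> Basis"
  shows "iter_partial bs (\<lambda>x. a * f x + b * g x) = (\<lambda>x. a * iter_partial bs f x + b * iter_partial bs g x)"
  using bs
proof (induction bs)
  case (Cons c bs)
  have IH: "iter_partial bs (\<lambda>x. a * f x + b * g x) = (\<lambda>x. a * iter_partial bs f x + b * iter_partial bs g x)"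
    using Cons by simp
  have d: "((\<lambda>x. a * iter_partial bs f x + b * iter_partial bs g x) has_derivative
    (\<lambda>h. a * frechet_derivative (iter_partial bs f) (at x) h + b * frechet_derivative (iter_partial bs g) (at x) h)) (at x)" for x
    using Cons.prems by (intro derivative_intros schwartz_derivative f g) auto
  show ?case unfolding iter_partial.simps IH by (rule ext) (simp only: partialI[OF d])
qed simp

lemma schwartz_lincomb:
  assumes f: "f \<in> schwartz" and g: "g \<in> schwartz"
  shows "(\<lambda>x. a * f x + b * g x) \<in> schwartz"
proof (rule schwartzI)
  fix bs :: "'a list" assume bs: "set bs \<subseteq> Basis"
  note e = iter_partial_lincomb[OF f g bs, of a b]
  show "iter_partial bs (\<lambda>x. a * f x + b * g x) differentiable (at x)" for x
    unfolding e by (intro differentiable_add differentiable_mult differentiable_const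
        differentiableI[OF schwartz_derivative[OF f bs]] differentiableI[OF schwartz_derivative[OF g bs]])
  fix k
  obtain C D where C: "\<And>x. (1 + norm x) ^ k * cmod (iter_partial bs f x) \<le> C"
    and D: "\<And>x. (1 + norm x) ^ k * cmod (iter_partial bs g x) \<le> D"
    using schwartz_bound[OF f bs, of k] schwartz_bound[OF g bs, of k] by blast
  have "(1 + norm x) ^ k * cmod (a * iter_partial bs f x + b * iter_partial bs g x) \<le> cmod a * C + cmod b * D" for x
  proof -
    have "(1 + norm x) ^ k * cmod (a * iter_partial bs f x + b * iter_partial bs g x)
        \<le> (1 + norm x) ^ k * (cmod a * cmod (iter_partial bs f x) + cmod b * cmod (iter_partial bs g x))"
      by (intro mult_left_mono order_trans[OF norm_triangle_ineq]) (auto simp: norm_mult)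
    also have "\<dots> = cmod a * ((1 + norm x) ^ k * cmod (iter_partial bs f x)) + cmod b * ((1 + norm x) ^ k * cmod (iter_partial bs g x))"
      by (simp add: algebra_simps)
    also have "\<dots> \<le> cmod a * C + cmod b * D" by (intro add_mono mult_left_mono C D) auto
    finally show ?thesis .
  qed
  then show "\<exists>C. \<forall>x. (1 + norm x) ^ k * cmod (iter_partial bs (\<lambda>x. a * f x + b * g x) x) \<le> C"
    unfolding e by blast
qed

lemma schwartz_zero: "(\<lambda>x. 0) \<in> schwartz"
proof -
  have "iter_partial bs (\<lambda>x::'a. 0) = (\<lambda>x. 0)" for bs :: "'a list"
    by (induction bs) (auto simp: frechet_derivative_const)
  then show ?thesis by (intro schwartzI) auto
qed

lemma schwartz_partial:
  assumes f: "f \<in> schwartz" and b: "b \<in> Basis"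
  shows "partial b f \<in> schwartz"
proof -
  have e: "iter_partial bs (partial b f) = iter_partial (bs @ [b]) f" for bs
    by (simp add: iter_partial_append)
  show ?thesis
  proof (rule schwartzI)
    fix bs :: "'a list" and x assume bs: "set bs \<subseteq> Basis"
    have "set (bs @ [b]) \<subseteq> Basis" using bs b by simp
    from differentiableI[OF schwartz_derivative[OF f this]] show "iter_partial bs (partial b f) differentiable (at x)"
      unfolding e .
  next
    fix bs :: "'a list" and k assume bs: "set bs \<subseteq> Basis"
    have "set (bs @ [b]) \<subseteq> Basis" using bs b by simp
    from schwartz_bound[OF f this, of k] show "\<exists>C. \<forall>x. (1 + norm x) ^ k * cmod (iter_partial bs (partial b f) x) \<le> C"
      unfolding e by blast
  qed
qed

text \<open>Commuting a derivative past multiplication by a coordinate produces derivatives of lower order;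
  these are collected in \<open>L\<close>.\<close>

lemma iter_partial_coord:
  assumes f: "f \<in> schwartz" and b: "b \<in> Basis" and bs: "set bs \<subseteq> Basis"
  shows "\<exists>L. (\<forall>cs\<in>set L. set cs \<subseteq> Basis) \<and> iter_partial bs (\<lambda>x. complex_of_real (x \<bullet> b) * f x)
    = (\<lambda>x. complex_of_real (x \<bullet> b) * iter_partial bs f x + (\<Sum>cs\<leftarrow>L. iter_partial cs f x))"
  using bs
proof (induction bs)
  case Nil
  show ?case by (intro exI[of _ "[]"]) simp
next
  case (Cons c bs)
  then obtain L where L: "\<And>cs. cs \<in> set L \<Longrightarrow> set cs \<subseteq> Basis"
    and e: "iter_partial bs (\<lambda>x. complex_of_real (x \<bullet> b) * f x)
      = (\<lambda>x. complex_of_real (x \<bullet> b) * iter_partial bs f x + (\<Sum>cs\<leftarrow>L. iter_partial cs f x))"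
    by auto
  have dL: "((\<lambda>x. \<Sum>cs\<leftarrow>L. iter_partial cs f x) has_derivative (\<lambda>h. \<Sum>cs\<leftarrow>L. frechet_derivative (iter_partial cs f) (at x) h)) (at x)" for x
    using L
  proof (induction L)
    case (Cons l L)
    then show ?case by (auto intro!: derivative_intros schwartz_derivative f)
  qed simp
  have d: "((\<lambda>x. complex_of_real (x \<bullet> b) * iter_partial bs f x + (\<Sum>cs\<leftarrow>L. iter_partial cs f x)) has_derivative
    (\<lambda>h. complex_of_real (x \<bullet> b) * frechet_derivative (iter_partial bs f) (at x) h + complex_of_real (h \<bullet> b) * iter_partial bs f x
       + (\<Sum>cs\<leftarrow>L. frechet_derivative (iter_partial cs f) (at x) h))) (at x)" for x
  proof -
    have co: "((\<lambda>x. complex_of_real (x \<bullet> b)) has_derivative (\<lambda>h. complex_of_real (h \<bullet> b))) (at x)"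
      by (intro derivative_intros has_derivative_inner_left[OF has_derivative_ident])
    show ?thesis
      using Cons.prems by (intro has_derivative_add has_derivative_mult co dL schwartz_derivative f) auto
  qed
  define L' where "L' = (if c = b then [bs] else []) @ map ((#) c) L"
  have "iter_partial (c # bs) (\<lambda>x. complex_of_real (x \<bullet> b) * f x)
    = (\<lambda>x. complex_of_real (x \<bullet> b) * iter_partial (c # bs) f x + (\<Sum>cs\<leftarrow>L'. iter_partial cs f x))"
  proof
    fix x
    have "complex_of_real (c \<bullet> b) * iter_partial bs f x = (\<Sum>cs\<leftarrow>(if c = b then [bs] else []). iter_partial cs f x)"
      using Cons.prems b by (auto simp: inner_Basis)
    then show "iter_partial (c # bs) (\<lambda>x. complex_of_real (x \<bullet> b) * f x) x
      = complex_of_real (x \<bullet> b) * iter_partial (c # bs) f x + (\<Sum>cs\<leftarrow>L'. iter_partial cs f x)"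
      by (simp add: e partialI[OF d] L'_def comp_def)
  qed
  moreover have "\<forall>cs\<in>set L'. set cs \<subseteq> Basis"
    using Cons.prems by (auto simp: L'_def split: if_splits dest!: L)
  ultimately show ?case by blast
qed

lemma schwartz_coord:
  assumes f: "f \<in> schwartz" and b: "b \<in> Basis"
  shows "(\<lambda>x. complex_of_real (x \<bullet> b) * f x) \<in> schwartz"
proof (rule schwartzI)
  fix bs :: "'a list" assume bs: "set bs \<subseteq> Basis"
  obtain L where L: "\<And>cs. cs \<in> set L \<Longrightarrow> set cs \<subseteq> Basis"
    and e: "iter_partial bs (\<lambda>x. complex_of_real (x \<bullet> b) * f x)
      = (\<lambda>x. complex_of_real (x \<bullet> b) * iter_partial bs f x + (\<Sum>cs\<leftarrow>L. iter_partial cs f x))"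
    using iter_partial_coord[OF f b bs] by blast
  have dL: "(\<lambda>x. \<Sum>cs\<leftarrow>L. iter_partial cs f x) differentiable (at x)" for x
    using L
  proof (induction L)
    case (Cons l L)
    then have "iter_partial l f differentiable (at x)" using differentiableI[OF schwartz_derivative[OF f, of l]] by simp
    then show ?case using Cons by simp
  qed simp
  show "iter_partial bs (\<lambda>x. complex_of_real (x \<bullet> b) * f x) differentiable (at x)" for x
  proof -
    have "(\<lambda>x. complex_of_real (x \<bullet> b)) differentiable (at x)"
      by (rule differentiableI[OF has_derivative_of_real[OF has_derivative_inner_left[OF has_derivative_ident]]])
    then show ?thesis
      unfolding e by (intro differentiable_add differentiable_mult differentiableI[OF schwartz_derivative[OF f bs]] dL)
  qed
  fix k
  have bL: "\<exists>C. \<forall>x. (1 + norm x) ^ k * cmod (\<Sum>cs\<leftarrow>L. iter_partial cs f x) \<le> C"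
    using L
  proof (induction L)
    case (Cons l L)
    obtain C where C: "\<And>x. (1 + norm x) ^ k * cmod (\<Sum>cs\<leftarrow>L. iter_partial cs f x) \<le> C" using Cons by auto
    obtain D where D: "\<And>x. (1 + norm x) ^ k * cmod (iter_partial l f x) \<le> D"
      using schwartz_bound[OF f, of l k] Cons.prems by auto
    have "(1 + norm x) ^ k * cmod (iter_partial l f x + (\<Sum>cs\<leftarrow>L. iter_partial cs f x)) \<le> D + C" for x
    proof -
      have "(1 + norm x) ^ k * cmod (iter_partial l f x + (\<Sum>cs\<leftarrow>L. iter_partial cs f x))
        \<le> (1 + norm x) ^ k * (cmod (iter_partial l f x) + cmod (\<Sum>cs\<leftarrow>L. iter_partial cs f x))"
        by (intro mult_left_mono norm_triangle_ineq) auto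
      then show ?thesis using C[of x] D[of x] by (simp add: distrib_left)
    qed
    then show ?case by auto
  qed (auto intro!: exI[of _ 0])
  obtain C where C: "\<And>x. (1 + norm x) ^ k * cmod (\<Sum>cs\<leftarrow>L. iter_partial cs f x) \<le> C" using bL by blast
  obtain D where D: "\<And>x. (1 + norm x) ^ Suc k * cmod (iter_partial bs f x) \<le> D"
    using schwartz_bound[OF f bs, of "Suc k"] by blast
  have "(1 + norm x) ^ k * cmod (complex_of_real (x \<bullet> b) * iter_partial bs f x + (\<Sum>cs\<leftarrow>L. iter_partial cs f x)) \<le> D + C" for x
  proof -
    have "\<bar>x \<bullet> b\<bar> \<le> 1 + norm x" using Basis_le_norm[OF b, of x] by simp
    then have "(1 + norm x) ^ k * (\<bar>x \<bullet> b\<bar> * cmod (iter_partial bs f x)) \<le> (1 + norm x) ^ k * ((1 + norm x) * cmod (iter_partial bs f x))"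
      by (intro mult_left_mono mult_right_mono) auto
    also have "\<dots> \<le> D" using D[of x] by (simp add: mult_ac)
    finally have 1: "(1 + norm x) ^ k * cmod (complex_of_real (x \<bullet> b) * iter_partial bs f x) \<le> D"
      by (simp add: norm_mult)
    have "(1 + norm x) ^ k * cmod (complex_of_real (x \<bullet> b) * iter_partial bs f x + (\<Sum>cs\<leftarrow>L. iter_partial cs f x))
      \<le> (1 + norm x) ^ k * (cmod (complex_of_real (x \<bullet> b) * iter_partial bs f x) + cmod (\<Sum>cs\<leftarrow>L. iter_partial cs f x))"
      by (intro mult_left_mono norm_triangle_ineq) auto
    then show ?thesis using 1 C[of x] by (simp add: distrib_left)
  qed
  then show "\<exists>C. \<forall>x. (1 + norm x) ^ k * cmod (iter_partial bs (\<lambda>x. complex_of_real (x \<bullet> b) * f x) x) \<le> C"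
    unfolding e by blast
qed

lemma mean_value_bound:
  fixes g :: "real \<Rightarrow> complex"
  assumes h: "h \<ge> 0" and d: "\<And>t. 0 \<le> t \<Longrightarrow> t \<le> h \<Longrightarrow> (g has_vector_derivative g' t) (at t)"
    and M: "\<And>t. 0 \<le> t \<Longrightarrow> t \<le> h \<Longrightarrow> cmod (g' t) \<le> M"
  shows "cmod (g h - g 0) \<le> M * h"
proof -
  have "norm (g h - g 0) \<le> M * norm (h - 0)"
  proof (rule differentiable_bound[of "{0..h}" g "\<lambda>t d. d *\<^sub>R g' t"])
    show "(g has_derivative (\<lambda>d. d *\<^sub>R g' t)) (at t within {0..h})" if "t \<in> {0..h}" for t
      using d[of t] that by (auto simp: has_vector_derivative_def intro: has_derivative_at_withinI)
    show "onorm (\<lambda>d. d *\<^sub>R g' t) \<le> M" if "t \<in> {0..h}" for t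
      using M[of t] that by (intro onorm_le) (auto simp: mult.commute[of M] intro: mult_left_mono)
  qed (use h in auto)
  then show ?thesis using h by simp
qed

lemma line_derivative:
  assumes "f differentiable (at (t + \<tau> *\<^sub>R b))"
  shows "((\<lambda>\<tau>. f (t + \<tau> *\<^sub>R b)) has_vector_derivative partial b f (t + \<tau> *\<^sub>R b)) (at \<tau>)"
proof -
  have f: "(f has_derivative frechet_derivative f (at (t + \<tau> *\<^sub>R b))) (at (t + \<tau> *\<^sub>R b))"
    using assms by (simp add: frechet_derivative_works)
  have "((\<lambda>\<tau>. t + \<tau> *\<^sub>R b) has_derivative (\<lambda>d. d *\<^sub>R b)) (at \<tau>)" by (auto intro!: derivative_eq_intros)
  from has_derivative_compose[OF this f] show ?thesis
    unfolding has_vector_derivative_def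
    by (simp add: linear_simps[OF has_derivative_bounded_linear[OF f]])
qed

text \<open>Landau's inequality: \<open>u(t + h b) - u(t) = h \<partial>\<^sub>b u(t) + O(h\<^sup>2 M)\<close>.\<close>

lemma landau_bound:
  assumes d: "\<And>x. u differentiable (at x)" "\<And>x. partial b u differentiable (at x)"
    and e: "\<And>x. cmod (u x) \<le> e" and M: "\<And>x. cmod (partial b (partial b u) x) \<le> M" and h: "h > 0"
  shows "cmod (partial b u t) \<le> 2 * e / h + M * h"
proof -
  have M0: "M \<ge> 0" using order_trans[OF norm_ge_zero M] .
  have step: "cmod (partial b u (t + \<tau> *\<^sub>R b) - partial b u t) \<le> M * h" if \<tau>: "0 \<le> \<tau>" "\<tau> \<le> h" for \<tau>
  proof -
    have "cmod (partial b u (t + \<tau> *\<^sub>R b) - partial b u (t + 0 *\<^sub>R b)) \<le> M * \<tau>"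
      by (rule mean_value_bound[where g = "\<lambda>\<tau>. partial b u (t + \<tau> *\<^sub>R b)", OF \<tau>(1) line_derivative[OF d(2)] M])
    also have "\<dots> \<le> M * h" using \<tau> M0 by (intro mult_left_mono)
    finally show ?thesis by simp
  qed
  define v where "v = partial b u t"
  have "cmod ((u (t + h *\<^sub>R b) - h *\<^sub>R v) - (u (t + 0 *\<^sub>R b) - 0 *\<^sub>R v)) \<le> (M * h) * h"
  proof (rule mean_value_bound[where g = "\<lambda>\<tau>. u (t + \<tau> *\<^sub>R b) - \<tau> *\<^sub>R v"])
    show "((\<lambda>\<tau>. u (t + \<tau> *\<^sub>R b) - \<tau> *\<^sub>R v) has_vector_derivative (partial b u (t + \<tau> *\<^sub>R b) - v)) (at \<tau>)" for \<tau>
      by (intro has_vector_derivative_diff line_derivative d(1)) (auto intro!: derivative_eq_intros simp: has_vector_derivative_def)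
    show "cmod (partial b u (t + \<tau> *\<^sub>R b) - v) \<le> M * h" if "0 \<le> \<tau>" "\<tau> \<le> h" for \<tau>
      unfolding v_def by (rule step[OF that])
  qed (use h in simp)
  then have 1: "cmod (u (t + h *\<^sub>R b) - h *\<^sub>R v - u t) \<le> M * h * h" by simp
  have "h *\<^sub>R v = (u (t + h *\<^sub>R b) - u t) - (u (t + h *\<^sub>R b) - h *\<^sub>R v - u t)" by simp
  then have "cmod (h *\<^sub>R v) \<le> cmod (u (t + h *\<^sub>R b) - u t) + cmod (u (t + h *\<^sub>R b) - h *\<^sub>R v - u t)"
    by (metis norm_triangle_ineq4)
  also have "\<dots> \<le> (e + e) + M * h * h"
    using 1 e[of "t + h *\<^sub>R b"] e[of t] norm_triangle_ineq4[of "u (t + h *\<^sub>R b)" "u t"] by linarith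
  finally have "h * cmod v \<le> 2 * e + M * h * h" using h by simp
  then show ?thesis using h by (simp add: v_def field_simps)
qed

lemma lipschitz_of_partials:
  fixes f :: "'a::euclidean_space \<Rightarrow> complex"
  assumes d: "\<And>x. f differentiable (at x)" and M: "\<And>b x. b \<in> Basis \<Longrightarrow> cmod (partial b f x) \<le> M"
  shows "cmod (f x - f y) \<le> (real DIM('a) * M) * norm (x - y)"
proof (rule differentiable_bound[of UNIV f "\<lambda>x. frechet_derivative f (at x)"])
  show "(f has_derivative frechet_derivative f (at x)) (at x within UNIV)" for x
    using d[of x] by (simp add: frechet_derivative_works)
  show "onorm (frechet_derivative f (at x)) \<le> real DIM('a) * M" for x
  proof (rule onorm_le)
    fix h :: 'a
    have lin: "bounded_linear (frechet_derivative f (at x))"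
      using d[of x] by (simp add: frechet_derivative_works has_derivative_bounded_linear)
    have "frechet_derivative f (at x) h = frechet_derivative f (at x) (\<Sum>b\<in>Basis. (h \<bullet> b) *\<^sub>R b)"
      by (simp add: euclidean_representation)
    also have "\<dots> = (\<Sum>b\<in>Basis. (h \<bullet> b) *\<^sub>R partial b f x)"
      by (simp only: linear_sum[OF bounded_linear.linear[OF lin]] linear_scale[OF bounded_linear.linear[OF lin]])
    finally have "cmod (frechet_derivative f (at x) h) \<le> (\<Sum>b\<in>Basis. cmod ((h \<bullet> b) *\<^sub>R partial b f x))"
      by (simp only: norm_sum)
    also have "\<dots> \<le> (\<Sum>b\<in>(Basis::'a set). norm h * M)"
    proof (rule sum_mono)
      fix b :: 'a assume b: "b \<in> Basis"
      show "cmod ((h \<bullet> b) *\<^sub>R partial b f x) \<le> norm h * M"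
        unfolding norm_scaleR by (intro mult_mono Basis_le_norm[OF b] M[OF b]) auto
    qed
    finally show "cmod (frechet_derivative f (at x) h) \<le> real DIM('a) * M * norm h" by (simp add: mult_ac)
  qed
qed auto

text \<open>On bounded sets of \<open>\<S>\<close> the \<open>L\<^sup>2\<close> norm controls the topology: a Lipschitz function that is large
  somewhere has large \<open>L\<^sup>2\<close> norm, Landau's inequality passes smallness on to the derivatives, and
  the polynomial weights are absorbed by \<open>w |u| = sqrt (w\<^sup>2 |u| |u|)\<close>.\<close>

theorem schwartz_norm_tendsto_0:
  fixes r :: "nat \<Rightarrow> 'a::euclidean_space \<Rightarrow> complex"
  assumes S: "\<And>n. r n \<in> schwartz"
    and bd: "\<And>bs k. set bs \<subseteq> Basis \<Longrightarrow> \<exists>C. \<forall>n x. (1 + norm x) ^ k * cmod (iter_partial bs (r n) x) \<le> C"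
    and L2: "(\<lambda>n. norm (to_L2 (r n))) \<longlonglongrightarrow> 0"
  shows "(\<lambda>n. schwartz_norm k (r n)) \<longlonglongrightarrow> 0"
proof -
  have df: "iter_partial bs (r n) differentiable (at x)" if "set bs \<subseteq> Basis" for bs n x
    by (rule differentiableI[OF schwartz_derivative[OF S that]])
  have bd0: "\<exists>C>0. \<forall>n x. cmod (iter_partial bs (r n) x) \<le> C" if bs: "set bs \<subseteq> Basis" for bs
  proof -
    obtain C where "\<And>n x. cmod (iter_partial bs (r n) x) \<le> C" using bd[OF bs, of 0] by auto
    then show ?thesis by (intro exI[of _ "max C 1"]) (auto simp: max_def intro: order_trans)
  qed
  have base: "\<forall>\<^sub>F n in sequentially. \<forall>x. cmod (r n x) \<le> e" if e: "e > 0" for e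
  proof -
    have "\<exists>M>0. \<forall>n x. cmod (partial b (r n) x) \<le> M" if "b \<in> Basis" for b
      using bd0[of "[b]"] that by simp
    then obtain m where m: "\<And>b n x. b \<in> Basis \<Longrightarrow> m b > 0 \<and> cmod (partial b (r n) x) \<le> m b" by metis
    define M where "M = (\<Sum>b\<in>(Basis::'a set). m b)"
    have mM: "m b \<le> M" if "b \<in> Basis" for b
      unfolding M_def using that m by (intro member_le_sum) (auto intro: less_imp_le)
    have M: "cmod (partial b (r n) x) \<le> M" if "b \<in> Basis" for b n x
      using m[OF that, of n x] mM[OF that] by linarith
    obtain b0 :: 'a where "b0 \<in> Basis" using nonempty_Basis by blast
    then have Mpos: "M > 0" using m[of b0] mM[of b0] by force
    define K where "K = real DIM('a) * M"
    have K: "K > 0" using Mpos by (simp add: K_def)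
    have lip: "cmod (r n x - r n y) \<le> K * norm (x - y)" for n x y
      unfolding K_def by (rule lipschitz_of_partials[OF _ M]) (use df[of "[]"] in auto)
    define \<rho> where "\<rho> = e / (2 * K)"
    have \<rho>: "\<rho> > 0" using e K by (simp add: \<rho>_def)
    define V where "V = measure lborel (ball (0::'a) \<rho>)"
    have V: "V > 0" using \<rho> by (simp add: V_def)
    have large: "(e / 2)\<^sup>2 * V \<le> (norm (to_L2 (r n)))\<^sup>2" if x: "cmod (r n x) > e" for n x
    proof -
      have "emeasure lborel (ball x \<rho>) = ennreal V"
        unfolding V_def using \<rho> by (simp add: emeasure_ball content_ball)
      then have "ennreal ((e / 2)\<^sup>2 * V) = (\<integral>\<^sup>+y. ennreal ((e/2)\<^sup>2) * indicator (ball x \<rho>) y \<partial>lborel)"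
        using V by (simp add: nn_integral_cmult_indicator ennreal_mult)
      also have "\<dots> \<le> (\<integral>\<^sup>+y. ennreal ((cmod (r n y))\<^sup>2) \<partial>lborel)"
      proof (rule nn_integral_mono)
        fix y
        show "ennreal ((e/2)\<^sup>2) * indicator (ball x \<rho>) y \<le> ennreal ((cmod (r n y))\<^sup>2)"
        proof (cases "y \<in> ball x \<rho>")
          case True
          have "cmod (r n x - r n y) \<le> K * \<rho>"
            using True K by (intro order_trans[OF lip] mult_left_mono) (auto simp: dist_norm)
          also have "\<dots> = e / 2" using K by (simp add: \<rho>_def)
          finally have "e / 2 \<le> cmod (r n y)"
            using x norm_triangle_ineq2[of "r n x" "r n y"] by linarith
          then have "(e/2)\<^sup>2 \<le> (cmod (r n y))\<^sup>2" using e by (intro power_mono) auto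
          then show ?thesis using True by (simp add: ennreal_leI)
        qed simp
      qed
      also have "\<dots> = ennreal ((norm (to_L2 (r n)))\<^sup>2)" by (rule norm_to_L2[OF schwartz_sq_int[OF S], symmetric])
      finally show ?thesis by (subst (asm) ennreal_le_iff) auto
    qed
    have "(\<lambda>n. (norm (to_L2 (r n)))\<^sup>2) \<longlonglongrightarrow> 0\<^sup>2" by (intro tendsto_power L2)
    then have "\<forall>\<^sub>F n in sequentially. (norm (to_L2 (r n)))\<^sup>2 < (e / 2)\<^sup>2 * V"
      by (rule order_tendstoD) (use e V in simp)
    then show ?thesis
    proof eventually_elim
      case (elim n)
      show ?case using large[of n] elim by (meson not_le order_less_irrefl less_le_trans le_less_trans)
    qed
  qed
  have deriv: "\<forall>\<^sub>F n in sequentially. \<forall>x. cmod (iter_partial bs (r n) x) \<le> e" if "set bs \<subseteq> Basis" "e > 0" for bs e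
    using that
  proof (induction bs arbitrary: e)
    case Nil
    then show ?case using base by simp
  next
    case (Cons b bs)
    have sub: "set bs \<subseteq> Basis" "set (b # bs) \<subseteq> Basis" "set (b # b # bs) \<subseteq> Basis" using Cons.prems by auto
    obtain M where M: "M > 0" "\<And>n x. cmod (iter_partial (b # b # bs) (r n) x) \<le> M" using bd0[OF sub(3)] by blast
    define h where "h = e / (2 * M)"
    have h: "h > 0" using M Cons.prems by (simp add: h_def)
    have "\<forall>\<^sub>F n in sequentially. \<forall>x. cmod (iter_partial bs (r n) x) \<le> h * e / 4"
      by (rule Cons.IH[OF sub(1)]) (use h Cons.prems in simp)
    then show ?case
    proof eventually_elim
      case (elim n)
      show ?case
      proof
        fix x
        have "cmod (partial b (iter_partial bs (r n)) x) \<le> 2 * (h * e / 4) / h + M * h"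
          by (rule landau_bound[OF df[OF sub(1)] _ _ _ h]) (use df[OF sub(2)] elim M(2) in auto)
        also have "\<dots> = e" using h M by (simp add: h_def)
        finally show "cmod (iter_partial (b # bs) (r n) x) \<le> e" by simp
      qed
    qed
  qed
  have wt: "(\<lambda>n. SUP x. (1 + norm x) ^ k * cmod (iter_partial bs (r n) x)) \<longlonglongrightarrow> 0" if bs: "set bs \<subseteq> Basis" for bs
  proof (rule tendstoI)
    fix e :: real assume e: "e > 0"
    obtain C where C: "\<And>n x. (1 + norm x) ^ (2 * k) * cmod (iter_partial bs (r n) x) \<le> C" using bd[OF bs] by blast
    define C' where "C' = max C 1"
    have C': "C' > 0" "\<And>n x. (1 + norm x) ^ (2 * k) * cmod (iter_partial bs (r n) x) \<le> C'"
      using C by (auto simp: C'_def le_max_iff_disj)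
    define d where "d = (e / 2)\<^sup>2 / C'"
    have d: "d > 0" using e C' by (simp add: d_def)
    show "\<forall>\<^sub>F n in sequentially. dist (SUP x. (1 + norm x) ^ k * cmod (iter_partial bs (r n) x)) 0 < e"
      using deriv[OF bs d]
    proof eventually_elim
      case (elim n)
      define s where "s x = (1 + norm x) ^ k * cmod (iter_partial bs (r n) x)" for x
      have s0: "s x \<ge> 0" for x by (simp add: s_def)
      have se: "s x \<le> e / 2" for x
      proof (rule power2_le_imp_le)
        have "(s x)\<^sup>2 = ((1 + norm x) ^ (2 * k) * cmod (iter_partial bs (r n) x)) * cmod (iter_partial bs (r n) x)"
        proof -
          have "(1 + norm x) ^ (2 * k) = (1 + norm x) ^ k * (1 + norm x) ^ k" by (simp only: mult_2 power_add)
          then show ?thesis by (simp add: s_def power2_eq_square mult_ac)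
        qed
        also have "\<dots> \<le> C' * d" using C' elim d by (intro mult_mono) auto
        also have "\<dots> = (e / 2)\<^sup>2" using C' by (simp add: d_def)
        finally show "(s x)\<^sup>2 \<le> (e / 2)\<^sup>2" .
      qed (use e in simp)
      have "(SUP x. s x) \<le> e / 2" by (rule cSUP_least) (use se in auto)
      moreover have "0 \<le> (SUP x. s x)"
        using s0[of 0] by (rule cSUP_upper2[OF bdd_aboveI2[of UNIV s "e / 2"], rotated 2]) (use se in auto)
      ultimately show ?case using e by (simp add: s_def dist_real_def)
    qed
  qed
  have "(\<lambda>n. \<Sum>bs | set bs \<subseteq> (Basis::'a set) \<and> length bs \<le> k. SUP x. (1 + norm x) ^ k * cmod (iter_partial bs (r n) x))
    \<longlonglongrightarrow> (\<Sum>bs | set bs \<subseteq> (Basis::'a set) \<and> length bs \<le> k. 0)"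
    by (intro tendsto_sum wt) simp
  then show ?thesis by (simp add: schwartz_norm_def)
qed

section \<open>Coherent states as Schwartz functions\<close>

abbreviation coherent_fun :: "'a \<times> 'a \<Rightarrow> 'a::euclidean_space \<Rightarrow> complex" where
  "coherent_fun z \<equiv> tf_shift_fun z gaussian_fun"

text \<open>Polynomials in the frequency and in the position relative to the centre. All derivatives of
  coherent states are such polynomials times the state itself.\<close>

inductive_set phase_poly :: "('a::euclidean_space \<times> 'a \<Rightarrow> 'a \<Rightarrow> complex) set" where
  pp_const: "(\<lambda>z t. c) \<in> phase_poly"
| pp_pos: "(\<lambda>z t. complex_of_real ((t - fst z) \<bullet> b)) \<in> phase_poly"
| pp_freq: "(\<lambda>z t. complex_of_real (snd z \<bullet> b)) \<in> phase_poly"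
| pp_add: "p \<in> phase_poly \<Longrightarrow> q \<in> phase_poly \<Longrightarrow> (\<lambda>z t. p z t + q z t) \<in> phase_poly"
| pp_mult: "p \<in> phase_poly \<Longrightarrow> q \<in> phase_poly \<Longrightarrow> (\<lambda>z t. p z t * q z t) \<in> phase_poly"

lemma phase_poly_growth:
  assumes "p \<in> phase_poly"
  shows "\<exists>C m. C \<ge> 0 \<and> (\<forall>z t. cmod (p z t) \<le> C * ((1 + norm z) * (1 + norm (t - fst z))) ^ m)"
  using assms
proof induction
  case (pp_const c)
  show ?case by (intro exI[of _ "cmod c"] exI[of _ 0]) simp
next
  case (pp_pos b)
  have "\<bar>(t - fst z) \<bullet> b\<bar> \<le> norm b * ((1 + norm z) * (1 + norm (t - fst z))) ^ 1" for z :: "'a \<times> 'a" and t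
  proof -
    have "\<bar>(t - fst z) \<bullet> b\<bar> \<le> norm (t - fst z) * norm b" by (rule Cauchy_Schwarz_ineq2)
    also have "\<dots> \<le> ((1 + norm z) * (1 + norm (t - fst z))) * norm b"
      by (rule mult_right_mono) (simp_all add: algebra_simps)
    finally show ?thesis by (simp add: mult.commute)
  qed
  then show ?case by (intro exI[of _ "norm b"] exI[of _ 1]) (simp only: norm_of_real norm_ge_zero simp_thms)
next
  case (pp_freq b)
  have "\<bar>snd z \<bullet> b\<bar> \<le> norm b * ((1 + norm z) * (1 + norm (t - fst z))) ^ 1" for z :: "'a \<times> 'a" and t
  proof -
    have sz: "norm (snd z) \<le> norm z" using norm_snd_le[of "snd z" "fst z"] by simp
    have "\<bar>snd z \<bullet> b\<bar> \<le> norm (snd z) * norm b" by (rule Cauchy_Schwarz_ineq2)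
    also have "\<dots> \<le> norm z * norm b" by (rule mult_right_mono[OF sz]) simp
    also have "\<dots> \<le> ((1 + norm z) * (1 + norm (t - fst z))) * norm b"
      by (rule mult_right_mono) (simp_all add: algebra_simps)
    finally show ?thesis by (simp add: mult.commute)
  qed
  then show ?case by (intro exI[of _ "norm b"] exI[of _ 1]) (simp only: norm_of_real norm_ge_zero simp_thms)
next
  case (pp_add p q)
  then obtain C m D n where C: "C \<ge> 0" "\<And>z t. cmod (p z t) \<le> C * ((1 + norm z) * (1 + norm (t - fst z))) ^ m"
    and D: "D \<ge> 0" "\<And>z t. cmod (q z t) \<le> D * ((1 + norm z) * (1 + norm (t - fst z))) ^ n" by blast
  have "cmod (p z t + q z t) \<le> (C + D) * ((1 + norm z) * (1 + norm (t - fst z))) ^ (m + n)" for z t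
  proof -
    define w where "w = (1 + norm z) * (1 + norm (t - fst z))"
    have w: "w \<ge> 1" unfolding w_def using mult_mono[of 1 "1 + norm z" 1 "1 + norm (t - fst z)"] by simp
    have "cmod (p z t + q z t) \<le> C * w ^ m + D * w ^ n"
      unfolding w_def by (rule order_trans[OF norm_triangle_ineq add_mono[OF C(2) D(2)]])
    also have "\<dots> \<le> C * w ^ (m + n) + D * w ^ (m + n)"
      by (intro add_mono mult_left_mono power_increasing w C D) auto
    finally show ?thesis by (simp add: w_def distrib_right)
  qed
  then show ?case using C D by (intro exI[of _ "C + D"] exI[of _ "m + n"]) simp
next
  case (pp_mult p q)
  then obtain C m D n where C: "C \<ge> 0" "\<And>z t. cmod (p z t) \<le> C * ((1 + norm z) * (1 + norm (t - fst z))) ^ m"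
    and D: "D \<ge> 0" "\<And>z t. cmod (q z t) \<le> D * ((1 + norm z) * (1 + norm (t - fst z))) ^ n" by blast
  have "cmod (p z t * q z t) \<le> (C * D) * ((1 + norm z) * (1 + norm (t - fst z))) ^ (m + n)" for z t
  proof -
    have "cmod (p z t * q z t) \<le> (C * ((1 + norm z) * (1 + norm (t - fst z))) ^ m) * (D * ((1 + norm z) * (1 + norm (t - fst z))) ^ n)"
      unfolding norm_mult by (intro mult_mono C D) (use C in auto)
    then show ?thesis by (simp only: power_add mult_ac)
  qed
  then show ?case using C D by (intro exI[of _ "C * D"] exI[of _ "m + n"]) simp
qed

lemma phase_poly_derivative:
  assumes "p \<in> phase_poly"
  shows "\<exists>q. (\<forall>b. q b \<in> phase_poly) \<and> (\<forall>z t. \<exists>p'. (p z has_derivative p') (at t) \<and> (\<forall>b\<in>Basis. p' b = q b z t))"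
  using assms
proof induction
  case (pp_const c)
  show ?case by (intro exI[of _ "\<lambda>b z t. 0"]) (auto intro!: phase_poly.pp_const derivative_eq_intros)
next
  case (pp_pos c)
  have d: "((\<lambda>t. complex_of_real ((t - fst z) \<bullet> c)) has_derivative (\<lambda>h. complex_of_real (h \<bullet> c))) (at t)" for z :: "'a \<times> 'a" and t
    by (auto intro!: derivative_eq_intros)
  show ?case
  proof (intro exI[of _ "\<lambda>b z t. complex_of_real (b \<bullet> c)"] conjI allI)
    show "(\<lambda>z t. complex_of_real (b \<bullet> c)) \<in> phase_poly" for b by (rule phase_poly.pp_const)
    show "\<exists>p'. ((\<lambda>t. complex_of_real ((t - fst z) \<bullet> c)) has_derivative p') (at t) \<and> (\<forall>b\<in>Basis. p' b = complex_of_real (b \<bullet> c))"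
      for z :: "'a \<times> 'a" and t
      by (intro exI[of _ "\<lambda>h. complex_of_real (h \<bullet> c)"] conjI ballI d refl)
  qed
next
  case (pp_freq c)
  show ?case by (intro exI[of _ "\<lambda>b z t. 0"]) (auto intro!: phase_poly.pp_const derivative_eq_intros)
next
  case (pp_add p1 p2)
  then obtain q1 q2 where q: "\<And>b. q1 b \<in> phase_poly" "\<And>b. q2 b \<in> phase_poly"
    and d1: "\<And>z t. \<exists>p'. (p1 z has_derivative p') (at t) \<and> (\<forall>b\<in>Basis. p' b = q1 b z t)"
    and d2: "\<And>z t. \<exists>p'. (p2 z has_derivative p') (at t) \<and> (\<forall>b\<in>Basis. p' b = q2 b z t)" by blast
  have "\<exists>p'. ((\<lambda>t. p1 z t + p2 z t) has_derivative p') (at t) \<and> (\<forall>b\<in>Basis. p' b = q1 b z t + q2 b z t)" for z t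
  proof -
    obtain a b where "(p1 z has_derivative a) (at t)" "\<forall>c\<in>Basis. a c = q1 c z t"
      "(p2 z has_derivative b) (at t)" "\<forall>c\<in>Basis. b c = q2 c z t" using d1 d2 by metis
    then show ?thesis by (intro exI[of _ "\<lambda>h. a h + b h"]) (auto intro: has_derivative_add)
  qed
  then show ?case by (intro exI[of _ "\<lambda>b z t. q1 b z t + q2 b z t"]) (use q in \<open>blast intro: phase_poly.pp_add\<close>)
next
  case (pp_mult p1 p2)
  then obtain q1 q2 where q: "\<And>b. q1 b \<in> phase_poly" "\<And>b. q2 b \<in> phase_poly"
    and d1: "\<And>z t. \<exists>p'. (p1 z has_derivative p') (at t) \<and> (\<forall>b\<in>Basis. p' b = q1 b z t)"
    and d2: "\<And>z t. \<exists>p'. (p2 z has_derivative p') (at t) \<and> (\<forall>b\<in>Basis. p' b = q2 b z t)" by blast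
  have D: "\<exists>p'. ((\<lambda>t. p1 z t * p2 z t) has_derivative p') (at t) \<and> (\<forall>b\<in>Basis. p' b = p1 z t * q2 b z t + q1 b z t * p2 z t)" for z t
  proof -
    obtain a b where "(p1 z has_derivative a) (at t)" "\<forall>c\<in>Basis. a c = q1 c z t"
      "(p2 z has_derivative b) (at t)" "\<forall>c\<in>Basis. b c = q2 c z t" using d1 d2 by metis
    then show ?thesis by (intro exI[of _ "\<lambda>h. p1 z t * b h + a h * p2 z t"]) (auto intro: has_derivative_mult)
  qed
  show ?case
    by (intro exI[of _ "\<lambda>b z t. p1 z t * q2 b z t + q1 b z t * p2 z t"] conjI allI
        phase_poly.pp_add phase_poly.pp_mult pp_mult.hyps q D)
qed

definition coherent_factor :: "'a::euclidean_space \<Rightarrow> 'a \<times> 'a \<Rightarrow> 'a \<Rightarrow> complex" where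
  "coherent_factor b z t = 2 * pi * \<i> * complex_of_real (snd z \<bullet> b) + (- 2 * pi) * complex_of_real ((t - fst z) \<bullet> b)"

lemma coherent_factor_poly: "coherent_factor b \<in> phase_poly"
  unfolding coherent_factor_def[abs_def] by (intro phase_poly.intros)

lemma coherent_fun_derivative:
  fixes z :: "'a::euclidean_space \<times> 'a"
  shows "\<exists>f'. (coherent_fun z has_derivative f') (at t) \<and> (\<forall>b. f' b = coherent_factor b z t * coherent_fun z t)"
proof -
  define c where "c = complex_of_real (2 powr (real DIM('a) / 4))"
  have e: "coherent_fun z t = exp (2 * pi * \<i> * (snd z \<bullet> t) + complex_of_real (- pi * ((t - fst z) \<bullet> (t - fst z)))) * c" for t
    unfolding exp_add exp_of_real
    by (simp add: tf_shift_fun_def gaussian_fun_def c_def power2_norm_eq_inner mult_ac)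
  have "((\<lambda>t. 2 * pi * \<i> * complex_of_real (snd z \<bullet> t) + complex_of_real (- pi * ((t - fst z) \<bullet> (t - fst z)))) has_derivative
      (\<lambda>h. 2 * pi * \<i> * complex_of_real (snd z \<bullet> h) + complex_of_real (- pi * (2 * ((t - fst z) \<bullet> h))))) (at t)"
    by (auto intro!: derivative_eq_intros simp: inner_commute)
  note D = has_derivative_mult_left[OF has_derivative_compose[OF this DERIV_exp[unfolded has_field_derivative_def]], of c]
  show ?thesis
  proof (intro exI conjI allI)
    show "(coherent_fun z has_derivative (\<lambda>h. exp (2 * pi * \<i> * (snd z \<bullet> t) + complex_of_real (- pi * ((t - fst z) \<bullet> (t - fst z))))
        * (2 * pi * \<i> * complex_of_real (snd z \<bullet> h) + complex_of_real (- pi * (2 * ((t - fst z) \<bullet> h)))) * c)) (at t)"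
      unfolding e[abs_def] by (rule D)
    fix b
    show "exp (2 * pi * \<i> * (snd z \<bullet> t) + complex_of_real (- pi * ((t - fst z) \<bullet> (t - fst z))))
        * (2 * pi * \<i> * complex_of_real (snd z \<bullet> b) + complex_of_real (- pi * (2 * ((t - fst z) \<bullet> b)))) * c
        = coherent_factor b z t * coherent_fun z t"
      unfolding e by (simp add: coherent_factor_def mult_ac)
  qed
qed

lemma coherent_iter_partial:
  assumes "set bs \<subseteq> (Basis :: 'a::euclidean_space set)"
  shows "\<exists>p\<in>phase_poly. (\<forall>z. iter_partial bs (coherent_fun z) = (\<lambda>t. p z t * coherent_fun z t)) \<and>
    (\<forall>z t. iter_partial bs (coherent_fun z) differentiable (at t))"
  using assms
proof (induction bs)
  case Nil
  have "coherent_fun z differentiable (at t)" for z :: "'a \<times> 'a" and t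
    using coherent_fun_derivative[of z t] by (auto simp: differentiable_def)
  then show ?case by (intro bexI[of _ "\<lambda>z t. 1"]) (auto intro: phase_poly.pp_const)
next
  case (Cons b bs)
  then obtain p where p: "p \<in> phase_poly" "\<And>z. iter_partial bs (coherent_fun z) = (\<lambda>t. p z t * coherent_fun z t)" by auto
  have dd: "\<exists>q. q \<in> phase_poly \<and> (\<forall>z t. \<exists>D. ((\<lambda>t. p z t * coherent_fun z t) has_derivative D) (at t) \<and> D b = q z t * coherent_fun z t)"
    if p: "p \<in> phase_poly" and b: "b \<in> Basis" for p :: "'a \<times> 'a \<Rightarrow> 'a \<Rightarrow> complex" and b
  proof -
    obtain q where q: "\<And>b. q b \<in> phase_poly" "\<And>z t. \<exists>p'. (p z has_derivative p') (at t) \<and> (\<forall>b\<in>Basis. p' b = q b z t)"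
      using phase_poly_derivative[OF p] by blast
    have D: "\<exists>D. ((\<lambda>t. p z t * coherent_fun z t) has_derivative D) (at t) \<and> D b = (p z t * coherent_factor b z t + q b z t) * coherent_fun z t" for z t
    proof -
      obtain p' f' where "(p z has_derivative p') (at t)" "\<forall>b\<in>Basis. p' b = q b z t"
        "(coherent_fun z has_derivative f') (at t)" "\<forall>b. f' b = coherent_factor b z t * coherent_fun z t"
        using q(2) coherent_fun_derivative by metis
      note D = this
      show ?thesis
      proof (intro exI conjI)
        show "((\<lambda>t. p z t * coherent_fun z t) has_derivative (\<lambda>h. p z t * f' h + p' h * coherent_fun z t)) (at t)"
          by (rule has_derivative_mult[OF D(1,3)])
        show "p z t * f' b + p' b * coherent_fun z t = (p z t * coherent_factor b z t + q b z t) * coherent_fun z t"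
          using D(2,4) b by (simp add: algebra_simps)
      qed
    qed
    show ?thesis
      by (intro exI[of _ "\<lambda>z t. p z t * coherent_factor b z t + q b z t"] conjI allI
          phase_poly.pp_add phase_poly.pp_mult p q(1) coherent_factor_poly D)
  qed
  have b: "b \<in> Basis" using Cons.prems by simp
  obtain q where q: "q \<in> phase_poly" "\<And>z t. \<exists>D. ((\<lambda>t. p z t * coherent_fun z t) has_derivative D) (at t) \<and> D b = q z t * coherent_fun z t"
    using dd[OF p(1) b] by blast
  have e: "iter_partial (b # bs) (coherent_fun z) = (\<lambda>t. q z t * coherent_fun z t)" for z
  proof
    fix t
    obtain D where "((\<lambda>t. p z t * coherent_fun z t) has_derivative D) (at t)" "D b = q z t * coherent_fun z t" using q(2) by blast
    then show "iter_partial (b # bs) (coherent_fun z) t = q z t * coherent_fun z t" by (simp add: p(2) partialI)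
  qed
  have "iter_partial (b # bs) (coherent_fun z) differentiable (at t)" for z t
    unfolding e using dd[OF q(1) b] by (meson differentiableI)
  then show ?case using q(1) e by blast
qed

text \<open>The polynomial growth in \<open>z\<close> is harmless, because it will be paired with rapidly decaying
  coefficients.\<close>

lemma coherent_schwartz_bound:
  assumes bs: "set bs \<subseteq> (Basis :: 'a::euclidean_space set)"
  shows "\<exists>C m. C \<ge> 0 \<and> (\<forall>z t. (1 + norm t) ^ k * cmod (iter_partial bs (coherent_fun z) t) \<le> C * (1 + norm z) ^ m)"
proof -
  obtain p where p: "p \<in> phase_poly" "\<And>z. iter_partial bs (coherent_fun z) = (\<lambda>t. p z t * coherent_fun z t)"
    using coherent_iter_partial[OF bs] by blast
  obtain C m where C: "C \<ge> 0" "\<And>z t. cmod (p z t) \<le> C * ((1 + norm z) * (1 + norm (t - fst z))) ^ m"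
    using phase_poly_growth[OF p(1)] by blast
  define c where "c = 2 powr (real DIM('a) / 4)"
  define E where "E = exp ((real (k + m))\<^sup>2 / (2 * pi))"
  have "(1 + norm t) ^ k * cmod (p z t * coherent_fun z t) \<le> (C * c * E) * (1 + norm z) ^ (k + m)" for z t
  proof -
    define r where "r = norm (t - fst z)"
    define w where "w = 1 + norm z"
    have w: "w \<ge> 1" by (simp add: w_def)
    have r: "r \<ge> 0" by (simp add: r_def)
    have "norm t \<le> r + norm (fst z)" using norm_triangle_ineq[of "t - fst z" "fst z"] by (simp add: r_def)
    moreover have "norm (fst z) \<le> norm z" using norm_fst_le[of "fst z" "snd z"] by simp
    moreover have "w * (1 + r) = 1 + norm z + r + norm z * r" by (simp add: w_def algebra_simps)
    moreover have "0 \<le> norm z * r" using r by simp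
    ultimately have "1 + norm t \<le> w * (1 + r)" by linarith
    then have tk: "(1 + norm t) ^ k \<le> (w * (1 + r)) ^ k" by (intro power_mono) auto
    have ph: "cmod (coherent_fun z t) = c * exp (- pi * r\<^sup>2)"
      by (simp add: tf_shift_fun_cis norm_mult gaussian_fun_def c_def r_def)
    have "exp (- pi * r\<^sup>2) \<le> exp (- pi / 2 * (norm (t - fst z))\<^sup>2)" by (simp add: r_def)
    also have "\<dots> \<le> E * decay (real (k + m)) (t - fst z)"
      unfolding E_def by (rule exp_neg_square_le_decay) simp
    finally have "(1 + r) ^ (k + m) * exp (- pi * r\<^sup>2) \<le> (1 + r) ^ (k + m) * (E * decay (real (k + m)) (t - fst z))"
      using r by (intro mult_left_mono) auto
    also have "\<dots> = E" using power_decay[of "t - fst z" "k + m"] by (simp add: r_def mult_ac)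
    finally have g: "(1 + r) ^ (k + m) * exp (- pi * r\<^sup>2) \<le> E" .
    have "(1 + norm t) ^ k * cmod (p z t * coherent_fun z t) \<le> (w * (1 + r)) ^ k * ((C * (w * (1 + r)) ^ m) * (c * exp (- pi * r\<^sup>2)))"
      unfolding norm_mult ph using C w r by (intro mult_mono tk) (auto simp: w_def r_def c_def)
    also have "\<dots> = C * c * ((1 + r) ^ (k + m) * exp (- pi * r\<^sup>2)) * w ^ (k + m)"
      by (simp add: power_mult_distrib power_add mult_ac)
    also have "\<dots> \<le> C * c * E * w ^ (k + m)"
      using g C w by (intro mult_right_mono mult_left_mono) (auto simp: c_def)
    finally show ?thesis by (simp add: w_def)
  qed
  then show ?thesis
    unfolding p(2) using C by (intro exI[of _ "C * c * E"] exI[of _ "k + m"]) (auto simp: c_def E_def)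
qed

lemma coherent_fun_schwartz: "coherent_fun z \<in> (schwartz :: ('a::euclidean_space \<Rightarrow> complex) set)"
proof (rule schwartzI)
  fix bs :: "'a list" assume bs: "set bs \<subseteq> Basis"
  show "iter_partial bs (coherent_fun z) differentiable (at x)" for x
    using coherent_iter_partial[OF bs] by blast
  show "\<exists>C. \<forall>x. (1 + norm x) ^ k * cmod (iter_partial bs (coherent_fun z) x) \<le> C" for k
    using coherent_schwartz_bound[OF bs, of k] by blast
qed

section \<open>Rapid decay of the short-time Fourier transform of a Schwartz function\<close>

text \<open>Difference quotients in direction \<open>b\<close> integrate to \<open>0\<close> by translation invariance, and they
  converge dominatedly to the partial derivative.\<close>

lemma integral_partial_0:
  fixes G :: "'a::euclidean_space \<Rightarrow> complex"
  assumes d: "\<And>x. G differentiable (at x)" and b: "b \<in> Basis" and k: "k > real DIM('a)" and C: "C \<ge> 0"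
    and G: "\<And>x. cmod (G x) \<le> C * decay k x" and G': "\<And>x. cmod (partial b G x) \<le> C * decay k x"
  shows "integrable lborel (partial b G)" "(\<integral>x. partial b G x \<partial>lborel) = 0"
proof -
  have cG: "continuous_on UNIV G"
    using d by (simp add: continuous_on_eq_continuous_within differentiable_imp_continuous_within)
  have mG [measurable]: "G \<in> borel_measurable borel" by (rule borel_measurable_continuous_onI[OF cG])
  have iG: "integrable lborel G"
    by (rule Bochner_Integration.integrable_bound[OF integrable_mult_right[of C, OF decay_integrable[OF k]]])
       (use G C in \<open>auto simp: abs_mult decay_nonneg\<close>)
  define h where "h n = 1 / real (Suc n)" for n
  have h: "h n > 0" "h n \<le> 1" for n by (auto simp: h_def)
  define D where "D n t = (1 / h n) *\<^sub>R (G (h n *\<^sub>R b + t) - G t)" for n t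
  have mD [measurable]: "D n \<in> borel_measurable borel" for n unfolding D_def by measurable
  have shift: "integrable lborel (\<lambda>t. G (h n *\<^sub>R b + t))" for n
    using iG lborel_translate(1)[OF mG] by blast
  have int0: "(\<integral>t. D n t \<partial>lborel) = 0" for n
    unfolding D_def using shift[of n] iG lborel_translate(2)[OF mG, of "h n *\<^sub>R b"] by simp
  have lim: "(\<lambda>n. D n t) \<longlonglongrightarrow> partial b G t" for t
  proof -
    have "((\<lambda>\<tau>. G (t + \<tau> *\<^sub>R b)) has_vector_derivative partial b G t) (at 0)"
      using line_derivative[of G t 0 b] d by simp
    then have slope: "((\<lambda>\<tau>. norm (G (t + \<tau> *\<^sub>R b) - G t - \<tau> *\<^sub>R partial b G t) / norm \<tau>) \<longlongrightarrow> 0) (at 0)"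
      by (simp add: has_vector_derivative_def has_derivative_at)
    have "h \<longlonglongrightarrow> 0"
      unfolding h_def[abs_def] using LIMSEQ_inverse_real_of_nat by (simp add: inverse_eq_divide)
    moreover have "h n \<noteq> 0" for n using h(1)[of n] by simp
    ultimately have h0: "filterlim h (at 0) sequentially" by (simp add: filterlim_at)
    have "(\<lambda>n. norm (D n t - partial b G t)) \<longlonglongrightarrow> 0"
    proof (rule Lim_transform_eventually[OF filterlim_compose[OF slope h0]], rule always_eventually, rule allI)
      fix n
      have "D n t - partial b G t = (1 / h n) *\<^sub>R (G (t + h n *\<^sub>R b) - G t - h n *\<^sub>R partial b G t)"
        using h(1)[of n] by (simp add: D_def add.commute[of t] scaleR_diff_right)
      then show "norm (G (t + h n *\<^sub>R b) - G t - h n *\<^sub>R partial b G t) / norm (h n) = norm (D n t - partial b G t)"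
        by simp
    qed
    then show ?thesis by (simp add: tendsto_norm_zero_iff LIM_zero_iff)
  qed
  have bound: "cmod (D n t) \<le> C * 2 powr k * decay k t" for n t
  proof -
    have "cmod (G (t + h n *\<^sub>R b) - G (t + 0 *\<^sub>R b)) \<le> (C * 2 powr k * decay k t) * h n"
    proof (rule mean_value_bound)
      show "0 \<le> h n" using h[of n] by simp
      fix \<tau> assume \<tau>: "0 \<le> \<tau>" "\<tau> \<le> h n"
      show "((\<lambda>\<tau>. G (t + \<tau> *\<^sub>R b)) has_vector_derivative partial b G (t + \<tau> *\<^sub>R b)) (at \<tau>)"
        by (rule line_derivative[OF d])
      have nb: "norm (- (\<tau> *\<^sub>R b)) \<le> 1" using \<tau> h[of n] b by simp
      have k0: "k \<ge> 0" using k by simp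
      have "decay k (t + \<tau> *\<^sub>R b) \<le> (1 + norm (- (\<tau> *\<^sub>R b))) powr k * decay k ((t + \<tau> *\<^sub>R b) + - (\<tau> *\<^sub>R b))"
        by (rule decay_le_shift[OF k0])
      also have "\<dots> \<le> 2 powr k * decay k t"
        using nb k0 by (intro mult_mono powr_mono2) (auto simp: decay_nonneg)
      finally show "cmod (partial b G (t + \<tau> *\<^sub>R b)) \<le> C * 2 powr k * decay k t"
        using G'[of "t + \<tau> *\<^sub>R b"] C by (simp add: mult.assoc) (metis mult_left_mono order_trans)
    qed
    then show ?thesis
      using h[of n] by (simp add: D_def add.commute[of t] norm_divide divide_simps)
  qed
  have mP: "partial b G \<in> borel_measurable lborel"
    by (rule borel_measurable_LIMSEQ_metric[of D]) (use lim in auto)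
  have dom: "integrable lborel (\<lambda>t::'a. C * 2 powr k * decay k t)"
    by (intro integrable_mult_right decay_integrable k)
  show "integrable lborel (partial b G)"
    by (rule integrable_dominated_convergence[OF mP _ dom, of D]) (use lim bound in auto)
  have "(\<lambda>n. \<integral>t. D n t \<partial>lborel) \<longlonglongrightarrow> (\<integral>x. partial b G x \<partial>lborel)"
    by (rule integral_dominated_convergence[OF mP _ dom]) (use lim bound in auto)
  then show "(\<integral>x. partial b G x \<partial>lborel) = 0"
    by (simp add: int0 LIMSEQ_const_iff)
qed

text \<open>Up to a factor the creation operator in direction \<open>b\<close>. Coherent states are the eigenvectors of
  its adjoint, the annihilation operator; hence it acts on the short-time Fourier transform as
  multiplication by a coordinate.\<close>

definition ladder :: "'a \<Rightarrow> ('a::euclidean_space \<Rightarrow> complex) \<Rightarrow> 'a \<Rightarrow> complex" where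
  "ladder b g = (\<lambda>t. (2 * pi) * (complex_of_real (t \<bullet> b) * g t) + (-1) * partial b g t)"

lemma ladder_schwartz: "g \<in> schwartz \<Longrightarrow> b \<in> Basis \<Longrightarrow> ladder b g \<in> schwartz"
  unfolding ladder_def by (intro schwartz_lincomb schwartz_coord schwartz_partial)

lemma cmod_coherent_fun_le: "cmod (coherent_fun z (t::'a::euclidean_space)) \<le> 2 powr (real DIM('a) / 4)"
  by (simp add: tf_shift_fun_cis norm_mult gaussian_fun_def)

lemma coherent_fun_L2: "to_L2 (coherent_fun z) = coherent z"
  by (simp add: coherent_to_L2)

lemma cinner_ladder:
  fixes g :: "'a::euclidean_space \<Rightarrow> complex"
  assumes g: "g \<in> schwartz" and b: "b \<in> Basis"
  shows "cinner (to_L2 (ladder b g)) (coherent z)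
    = 2 * pi * Complex (fst z \<bullet> b) (- (snd z \<bullet> b)) * cinner (to_L2 g) (coherent z)"
proof -
  define q where "q = 2 * pi * Complex (fst z \<bullet> b) (- (snd z \<bullet> b))"
  define P where "P = (\<lambda>t. (-1) * ladder b g t + q * g t)"
  define G where "G t = g t * cnj (coherent_fun z t)" for t
  define M where "M = 2 powr (real DIM('a) / 4)"
  have PS: "P \<in> schwartz" unfolding P_def by (intro schwartz_lincomb ladder_schwartz g b)
  have q: "cnj (coherent_factor b z t) = q - 2 * pi * complex_of_real (t \<bullet> b)" for t
    by (simp add: coherent_factor_def q_def complex_eq_iff inner_diff_left algebra_simps)
  have dG: "G differentiable (at t)" and pG: "partial b G t = P t * cnj (coherent_fun z t)" for t
  proof -
    obtain f' where f': "(coherent_fun z has_derivative f') (at t)" "f' b = coherent_factor b z t * coherent_fun z t"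
      using coherent_fun_derivative by blast
    have "(G has_derivative (\<lambda>h. g t * cnj (f' h) + frechet_derivative g (at t) h * cnj (coherent_fun z t))) (at t)"
      unfolding G_def using schwartz_derivative[OF g, of "[]" t]
      by (intro has_derivative_mult has_derivative_cnj f') auto
    from this partialI[OF this, of b] show "G differentiable (at t)" "partial b G t = P t * cnj (coherent_fun z t)"
      by (auto simp: differentiable_def f'(2) q P_def ladder_def algebra_simps)
  qed
  define k where "k = Suc DIM('a)"
  obtain C1 C2 where C: "C1 \<ge> 0" "\<And>x. cmod (g x) \<le> C1 * decay (real k) x" "C2 \<ge> 0" "\<And>x. cmod (P x) \<le> C2 * decay (real k) x"
    using schwartz_decay[OF g, of "[]" k] schwartz_decay[OF PS, of "[]" k] by auto
  have M: "M \<ge> 0" by (simp add: M_def)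
  have le: "cmod (f t * cnj (coherent_fun z t)) \<le> (C1 + C2) * M * decay (real k) t"
    if "cmod (f t) \<le> C' * decay (real k) t" "C' \<le> C1 + C2" for f C' t
  proof -
    have "cmod (f t) \<le> (C1 + C2) * decay (real k) t"
      using that decay_nonneg by (meson mult_right_mono order_trans)
    then have "cmod (f t) * cmod (coherent_fun z t) \<le> ((C1 + C2) * decay (real k) t) * M"
      using cmod_coherent_fun_le[of z t] C by (intro mult_mono) (auto simp: M_def decay_nonneg)
    then show ?thesis by (simp add: norm_mult mult_ac)
  qed
  have "(\<integral>t. partial b G t \<partial>lborel) = 0"
  proof (rule integral_partial_0(2)[OF dG b])
    show "real k > real DIM('a)" by (simp add: k_def)
    show "(C1 + C2) * M \<ge> 0" using C M by simp
    show "cmod (G t) \<le> (C1 + C2) * M * decay (real k) t" for t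
      unfolding G_def by (rule le[OF C(2)]) (use C in simp)
    show "cmod (partial b G t) \<le> (C1 + C2) * M * decay (real k) t" for t
      unfolding pG by (rule le[OF C(4)]) (use C in simp)
  qed
  then have "(\<integral>t. P t * cnj (coherent_fun z t) \<partial>lborel) = 0" by (simp only: pG)
  then have "cinner (to_L2 P) (coherent z) = 0"
    by (simp add: coherent_to_L2 cinner_to_L2 schwartz_sq_int PS coherent_fun_schwartz)
  moreover have "to_L2 P = (-1) *\<^sub>C to_L2 (ladder b g) + q *\<^sub>C to_L2 g"
    using schwartz_sq_int[OF ladder_schwartz[OF g b]] schwartz_sq_int[OF g]
    by (simp only: P_def to_L2_scaleC to_L2_add sq_int_cmult)
  ultimately show ?thesis
    by (simp add: cinner_add_left cinner_scaleC_left q_def)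
qed

text \<open>Each power of \<open>1 + \<bar>z\<bar>\<close> is paid for by one application of a ladder operator.\<close>

lemma stft_rapid_decay:
  fixes g :: "'a::euclidean_space \<Rightarrow> complex"
  assumes "g \<in> schwartz"
  shows "\<exists>C\<ge>0. coherent_decay (real m) C 0 (to_L2 g)"
proof -
  have "\<exists>C. \<forall>z. (1 + norm z) ^ m * cmod (cinner (to_L2 g) (coherent z)) \<le> C"
    using assms
  proof (induction m arbitrary: g)
    case 0
    have "cmod (cinner (to_L2 g) (coherent z)) \<le> norm (to_L2 g)" for z
      using norm_cinner_le[of "to_L2 g" "coherent z"] by (simp add: norm_coherent)
    then show ?case by (intro exI[of _ "norm (to_L2 g)"] allI) simp
  next
    case (Suc m)
    obtain C0 where C0: "\<And>z. (1 + norm z) ^ m * cmod (cinner (to_L2 g) (coherent z)) \<le> C0"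
      using Suc.IH[OF Suc.prems] by blast
    have "\<forall>b\<in>Basis. \<exists>C. \<forall>z. (1 + norm z) ^ m * cmod (cinner (to_L2 (ladder b g)) (coherent z)) \<le> C"
      using Suc.IH ladder_schwartz[OF Suc.prems] by blast
    then obtain D where D: "\<And>b z. b \<in> Basis \<Longrightarrow> (1 + norm z) ^ m * cmod (cinner (to_L2 (ladder b g)) (coherent z)) \<le> D b"
      by metis
    have "(1 + norm z) ^ Suc m * cmod (cinner (to_L2 g) (coherent z)) \<le> C0 + (\<Sum>b\<in>Basis. D b)" for z
    proof -
      define y where "y = cmod (cinner (to_L2 g) (coherent z))"
      have "norm z \<le> norm (fst z) + norm (snd z)" using norm_Pair_le[of "fst z" "snd z"] by simp
      also have "\<dots> \<le> (\<Sum>b\<in>Basis. \<bar>fst z \<bullet> b\<bar>) + (\<Sum>b\<in>Basis. \<bar>snd z \<bullet> b\<bar>)"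
        by (intro add_mono norm_le_l1)
      also have "\<dots> \<le> (\<Sum>b\<in>Basis. 2 * pi * cmod (Complex (fst z \<bullet> b) (- (snd z \<bullet> b))))"
        unfolding sum.distrib[symmetric]
      proof (rule sum_mono)
        fix b :: 'a
        define w where "w = Complex (fst z \<bullet> b) (- (snd z \<bullet> b))"
        have "\<bar>fst z \<bullet> b\<bar> + \<bar>snd z \<bullet> b\<bar> \<le> 2 * cmod w"
          using abs_Re_le_cmod[of w] abs_Im_le_cmod[of w] by (simp add: w_def)
        also have "\<dots> \<le> 2 * pi * cmod w"
          using pi_ge_two mult_right_mono[of 1 pi "cmod w"] by simp
        finally show "\<bar>fst z \<bullet> b\<bar> + \<bar>snd z \<bullet> b\<bar> \<le> 2 * pi * cmod (Complex (fst z \<bullet> b) (- (snd z \<bullet> b)))"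
          by (simp add: w_def)
      qed
      finally have nz: "norm z \<le> (\<Sum>b\<in>Basis. 2 * pi * cmod (Complex (fst z \<bullet> b) (- (snd z \<bullet> b))))" .
      have "norm z * y \<le> (\<Sum>b\<in>Basis. cmod (cinner (to_L2 (ladder b g)) (coherent z)))"
        using mult_right_mono[OF nz, of y]
        by (simp add: cinner_ladder[OF Suc.prems] norm_mult sum_distrib_right y_def)
      then have "(1 + norm z) ^ m * (y + norm z * y)
        \<le> (1 + norm z) ^ m * y + (\<Sum>b\<in>Basis. (1 + norm z) ^ m * cmod (cinner (to_L2 (ladder b g)) (coherent z)))"
        by (simp add: distrib_left sum_distrib_left[symmetric] mult_left_mono)
      also have "\<dots> \<le> C0 + (\<Sum>b\<in>Basis. D b)"
        unfolding y_def by (intro add_mono sum_mono C0 D)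
      finally show ?thesis by (simp add: y_def algebra_simps)
    qed
    then show ?case by blast
  qed
  then obtain C where C: "\<And>z. (1 + norm z) ^ m * cmod (cinner (to_L2 g) (coherent z)) \<le> C" by blast
  have "C \<ge> 0" using C[of 0] by (rule order_trans[rotated]) simp
  then show ?thesis using C le_decayI unfolding coherent_decay_def by (metis diff_zero)
qed

section \<open>The case of exponents below one\<close>

context gaussian_gabor_frame
begin

text \<open>Coherent states are Schwartz functions with dense span.\<close>

lemma inj_hs_form: "inj (hs_form :: 'a L2 hs \<Rightarrow> 'a form)"
proof (rule injI)
  fix H H' :: "'a L2 hs" assume eq: "hs_form H = hs_form H'"
  have coh: "hs_apply H (coherent z) = hs_apply H' (coherent z)" for z
  proof -
    have "cinner (hs_apply H (coherent z) - hs_apply H' (coherent z)) (coherent w) = 0" for w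
      using fun_cong[OF fun_cong[OF eq, of "coherent_fun z"], of "coherent_fun w"]
      by (simp add: hs_form_def coherent_fun_schwartz coherent_fun_L2 cinner_diff_left)
    then have "hs_apply H (coherent z) - hs_apply H' (coherent z) = 0"
      by (intro coherent_total) auto
    then show ?thesis by simp
  qed
  have "cadjoint (hs_apply H) y = cadjoint (hs_apply H') y" for y
  proof -
    have "cinner (cadjoint (hs_apply H) y - cadjoint (hs_apply H') y) (coherent z) = 0" for z
      by (simp add: cinner_diff_left cinner_cadjoint'[OF bounded_clinear_hs_apply] coh)
    then have "cadjoint (hs_apply H) y - cadjoint (hs_apply H') y = 0"
      by (intro coherent_total) auto
    then show ?thesis by simp
  qed
  then have "hs_apply H x = hs_apply H' x" for x
    by (intro cinner_ext_left) (simp add: cinner_cadjoint[OF bounded_clinear_hs_apply])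
  then show "H = H'" by (rule hs_eqI)
qed

text \<open>\<open>G\<^sub>l\<^sup>* K = \<pi>(l)(\<phi>\<^sub>0 \<otimes> \<phi>\<^sub>0) K = \<pi>(l)\<phi>\<^sub>0 \<otimes> K\<^sup>*\<phi>\<^sub>0\<close>.\<close>

lemma cadjoint_gabor_G:
  "cadjoint (gabor_G l) K = hs_rank_one (coherent l) (cadjoint (hs_apply K) gaussian)"
proof -
  let ?V = "rank_one gaussian gaussian \<circ> cadjoint (tf_shift l)"
  have ad: "cadjoint ?V x = cinner x gaussian *\<^sub>C coherent l" for x
    by (rule cinner_ext_left)
       (simp add: cinner_cadjoint'[OF bounded_clinear_gabor] rank_one_def cinner_scaleC_left cinner_scaleC_right
         cinner_cadjoint'[OF bounded_clinear_tf_shift] mult_ac,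
        subst cinner_commute, simp add: cinner_cadjoint'[OF bounded_clinear_tf_shift])
  show ?thesis
    by (rule hs_eqI)
       (simp add: gabor_G_def cadjoint_left_mult[OF bounded_clinear_gabor] ad hs_rank_one.rep_eq rank_one_def
         hs_apply_left_mult[OF bounded_clinear_cadjoint[OF bounded_clinear_gabor]]
         cinner_cadjoint[OF bounded_clinear_hs_apply])
qed

text \<open>The frame expansion with respect to \<open>G\<close> is itself of the required form, with the coherent
  states as localized vectors.\<close>

lemma coorbit_approx_space:
  fixes W :: "'a \<times> 'a \<Rightarrow> 'a L2 hs \<Rightarrow> 'a L2 hs"
  assumes W: "s_admissible_dictionary \<Lambda> s W" and p: "2 * real DIM('a) / s < p" "p < 2"
    and \<alpha>: "\<alpha> = 1 / p - 1 / 2"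
  shows "\<exists>C\<ge>0. \<forall>F\<in>coorbit \<Lambda> p. F \<in> approx_space \<Lambda> W \<alpha> p \<and> approx_norm \<Lambda> W \<alpha> p F \<le> C * coorbit_norm \<Lambda> p F"
proof -
  have s: "s > 2 * real DIM('a)" using W by (simp add: s_admissible_dictionary_def)
  then have "s > 0" by (simp add: order.strict_trans1[rotated])
  then have p0: "p > 0" using p(1) by (intro order.strict_trans1[OF _ p(1)]) simp
  obtain C where C: "C \<ge> 0" "\<And>\<gamma> r F. (\<forall>m\<in>\<Lambda>. coherent_decay s (exp (s\<^sup>2 / (2 * pi))) m (\<gamma> m)) \<Longrightarrow>
      (\<lambda>m. norm (r m) powr p) summable_on \<Lambda> \<Longrightarrow> ((\<lambda>m. hs_rank_one (\<gamma> m) (r m)) has_sum F) \<Lambda> \<Longrightarrow>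
      F \<in> approx_space \<Lambda> W \<alpha> p \<and> approx_norm \<Lambda> W \<alpha> p F \<le> C * (\<Sum>\<^sub>\<infinity>m\<in>\<Lambda>. norm (r m) powr p) powr (1 / p)"
    using localized_expansion_approx_space[OF W p \<alpha>, of "exp (s\<^sup>2 / (2 * pi))"] by auto
  obtain A B where AB: "frame_bounds \<Lambda> (gabor_G :: _ \<Rightarrow> 'a L2 hs \<Rightarrow> _) A B"
    using g_frame_imp_frame_bounds[OF frame] by blast
  have "F \<in> approx_space \<Lambda> W \<alpha> p \<and> approx_norm \<Lambda> W \<alpha> p F \<le> C * coorbit_norm \<Lambda> p F" if F: "F \<in> coorbit \<Lambda> p" for F
  proof -
    define K where "K l = canonical_dual \<Lambda> gabor_G l F" for l
    define r where "r l = cadjoint (hs_apply (K l)) gaussian" for l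
    have rK: "norm (r l) powr p \<le> norm (K l) powr p" for l
      using norm_cadjoint_le[OF bounded_clinear_hs_apply norm_hs_apply_le norm_ge_zero, of "K l" gaussian] p0
      by (intro powr_mono2) (auto simp: r_def norm_gaussian)
    have Ks: "(\<lambda>l. norm (K l) powr p) summable_on \<Lambda>" using F by (simp add: coorbit_def K_def)
    have rs: "(\<lambda>l. norm (r l) powr p) summable_on \<Lambda>"
      by (rule summable_on_comparison_test[OF Ks]) (use rK in auto)
    have "((\<lambda>l. hs_rank_one (coherent l) (r l)) has_sum F) \<Lambda>"
      using frame_operator_inverse(5)[OF AB, of F] by (simp add: cadjoint_gabor_G r_def K_def canonical_dual_def)
    from C(2)[OF _ rs this] have "F \<in> approx_space \<Lambda> W \<alpha> p" "approx_norm \<Lambda> W \<alpha> p F \<le> C * (\<Sum>\<^sub>\<infinity>m\<in>\<Lambda>. norm (r m) powr p) powr (1 / p)"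
      using coherent_decay_coherent[OF less_imp_le[OF \<open>s > 0\<close>]] by blast+
    moreover have "(\<Sum>\<^sub>\<infinity>m\<in>\<Lambda>. norm (r m) powr p) \<le> (\<Sum>\<^sub>\<infinity>m\<in>\<Lambda>. norm (K m) powr p)"
      by (rule infsum_mono[OF rs Ks rK])
    then have "(\<Sum>\<^sub>\<infinity>m\<in>\<Lambda>. norm (r m) powr p) powr (1 / p) \<le> coorbit_norm \<Lambda> p F"
      unfolding coorbit_norm_def K_def[symmetric] using p0 by (intro powr_mono2) (auto simp: infsum_nonneg)
    then have "C * (\<Sum>\<^sub>\<infinity>m\<in>\<Lambda>. norm (r m) powr p) powr (1 / p) \<le> C * coorbit_norm \<Lambda> p F"
      using C(1) by (rule mult_left_mono)
    ultimately show ?thesis by auto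
  qed
  then show ?thesis using C(1) by blast
qed

end

section \<open>Functionals on Schwartz functions\<close>

lemma to_L2_lincomb:
  assumes "f \<in> schwartz" "g \<in> schwartz"
  shows "to_L2 (\<lambda>x. a * f x + b * g x) = a *\<^sub>C to_L2 f + b *\<^sub>C to_L2 g"
  using assms by (simp add: to_L2_scaleC to_L2_add sq_int_cmult schwartz_sq_int)

lemma schwartz_sum:
  fixes f :: "'i \<Rightarrow> 'a::euclidean_space \<Rightarrow> complex"
  assumes "\<And>i. i \<in> I \<Longrightarrow> f i \<in> schwartz" "finite I"
  shows "(\<lambda>x. \<Sum>i\<in>I. c i * f i x) \<in> schwartz"
    "set bs \<subseteq> Basis \<Longrightarrow> iter_partial bs (\<lambda>x. \<Sum>i\<in>I. c i * f i x) = (\<lambda>x. \<Sum>i\<in>I. c i * iter_partial bs (f i) x)"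
    "to_L2 (\<lambda>x. \<Sum>i\<in>I. c i * f i x) = (\<Sum>i\<in>I. c i *\<^sub>C to_L2 (f i))"
proof -
  have zero: "to_L2 (\<lambda>x. 0) = (0 :: 'a L2)"
    using to_L2_lincomb[OF schwartz_zero schwartz_zero, of 0 0] by (simp add: scaleC_zero_left)
  have zp: "iter_partial bs (\<lambda>x. 0) = (\<lambda>x::'a. 0)" if "set bs \<subseteq> Basis" for bs
    using iter_partial_lincomb[OF schwartz_zero schwartz_zero that, of 0 0] by simp
  have "(\<lambda>x. \<Sum>i\<in>I. c i * f i x) \<in> schwartz \<and>
    (\<forall>bs. set bs \<subseteq> Basis \<longrightarrow> iter_partial bs (\<lambda>x. \<Sum>i\<in>I. c i * f i x) = (\<lambda>x. \<Sum>i\<in>I. c i * iter_partial bs (f i) x)) \<and>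
    to_L2 (\<lambda>x. \<Sum>i\<in>I. c i * f i x) = (\<Sum>i\<in>I. c i *\<^sub>C to_L2 (f i))"
    using assms(2,1)
  proof (induction I)
    case empty
    show ?case by (simp add: schwartz_zero zp zero)
  next
    case (insert i I)
    then have IH: "(\<lambda>x. \<Sum>i\<in>I. c i * f i x) \<in> schwartz"
      "\<And>bs. set bs \<subseteq> Basis \<Longrightarrow> iter_partial bs (\<lambda>x. \<Sum>i\<in>I. c i * f i x) = (\<lambda>x. \<Sum>i\<in>I. c i * iter_partial bs (f i) x)"
      "to_L2 (\<lambda>x. \<Sum>i\<in>I. c i * f i x) = (\<Sum>i\<in>I. c i *\<^sub>C to_L2 (f i))" and fi: "f i \<in> schwartz" by auto
    show ?case
      using insert.hyps schwartz_lincomb[OF fi IH(1), of "c i" 1] iter_partial_lincomb[OF fi IH(1), of _ "c i" 1]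
        to_L2_lincomb[OF fi IH(1), of "c i" 1] IH(2,3)
      by (simp add: scaleC_one)
  qed
  then show "(\<lambda>x. \<Sum>i\<in>I. c i * f i x) \<in> schwartz"
    "set bs \<subseteq> Basis \<Longrightarrow> iter_partial bs (\<lambda>x. \<Sum>i\<in>I. c i * f i x) = (\<lambda>x. \<Sum>i\<in>I. c i * iter_partial bs (f i) x)"
    "to_L2 (\<lambda>x. \<Sum>i\<in>I. c i * f i x) = (\<Sum>i\<in>I. c i *\<^sub>C to_L2 (f i))" by blast+
qed

lemma antilinear_sum:
  assumes u: "\<And>f g a b. f \<in> schwartz \<Longrightarrow> g \<in> schwartz \<Longrightarrow> u (\<lambda>x. a * f x + b * g x) = cnj a * u f + cnj b * u g"
    and f: "\<And>i. i \<in> I \<Longrightarrow> f i \<in> schwartz" and I: "finite I"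
  shows "u (\<lambda>x. \<Sum>i\<in>I. c i * f i x) = (\<Sum>i\<in>I. cnj (c i) * u (f i))"
  using I f
proof (induction I)
  case empty
  show ?case using u[OF schwartz_zero schwartz_zero, of 0 0] by simp
next
  case (insert i I)
  then have "(\<lambda>x. \<Sum>i\<in>I. c i * f i x) \<in> schwartz" by (intro schwartz_sum) auto
  then show ?case using insert u[of "f i" "\<lambda>x. \<Sum>i\<in>I. c i * f i x" "c i" 1] by simp
qed

context gaussian_gabor_frame
begin

lemma schwartz_functional_riesz:
  fixes u :: "('a \<Rightarrow> complex) \<Rightarrow> complex"
  assumes u: "\<And>f g a b. f \<in> schwartz \<Longrightarrow> g \<in> schwartz \<Longrightarrow> u (\<lambda>x. a * f x + b * g x) = a * u f + b * u g"
    and bd: "\<And>f. f \<in> schwartz \<Longrightarrow> cmod (u f) \<le> m * norm (to_L2 f)" and m: "m \<ge> 0"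
  shows "\<exists>r. norm r \<le> m \<and> (\<forall>f\<in>schwartz. u f = cinner (to_L2 f) r)"
proof -
  define v where "v x = u (SOME f. f \<in> schwartz \<and> to_L2 f = x)" for x
  \<comment> \<open>\<open>u f\<close> depends only on the class of \<open>f\<close>\<close>
  have v: "v (to_L2 f) = u f" if f: "f \<in> schwartz" for f
  proof -
    define g where "g = (SOME g. g \<in> schwartz \<and> to_L2 g = to_L2 f)"
    have g: "g \<in> schwartz" "to_L2 g = to_L2 f"
      using someI[of "\<lambda>g. g \<in> schwartz \<and> to_L2 g = to_L2 f" f] f by (auto simp: g_def)
    have "to_L2 (\<lambda>x. 1 * g x + (-1) * f x) = 0"
      unfolding to_L2_lincomb[OF g(1) f] g(2) scaleC_add_left[symmetric] by (simp add: scaleC_zero_left)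
    then have "u (\<lambda>x. 1 * g x + (-1) * f x) = 0"
      using bd[OF schwartz_lincomb[OF g(1) f, of 1 "-1"]] by simp
    then show ?thesis unfolding u[OF g(1) f] by (simp add: v_def g_def)
  qed
  have add2: "v (a *\<^sub>C to_L2 f + b *\<^sub>C to_L2 g) = a * u f + b * u g \<and> a *\<^sub>C to_L2 f + b *\<^sub>C to_L2 g \<in> to_L2 ` schwartz"
    if f: "f \<in> schwartz" and g: "g \<in> schwartz" for f g a b
    unfolding to_L2_lincomb[OF f g, symmetric]
    using v[OF schwartz_lincomb[OF f g]] u[OF f g] schwartz_lincomb[OF f g] by auto
  have "\<exists>r. norm r \<le> m \<and> (\<forall>x\<in>to_L2 ` (schwartz :: ('a \<Rightarrow> complex) set). v x = cinner x r)"
  proof (rule riesz_on_dense[OF _ _ _ _ _ _ m])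
    show "0 \<in> to_L2 ` (schwartz :: ('a \<Rightarrow> complex) set)"
      using add2[OF schwartz_zero schwartz_zero, of 0 0] by (simp add: scaleC_zero_left)
    fix x y :: "'a L2" and c assume "x \<in> to_L2 ` schwartz"
    then obtain f where f: "f \<in> schwartz" "x = to_L2 f" by blast
    show "c *\<^sub>C x \<in> to_L2 ` schwartz" "v (c *\<^sub>C x) = c * v x" "cmod (v x) \<le> m * norm x"
      using add2[OF f(1) f(1), of c 0] v[OF f(1)] bd[OF f(1)] f by (auto simp: scaleC_zero_left)
    assume "y \<in> to_L2 ` schwartz"
    then obtain g where g: "g \<in> schwartz" "y = to_L2 g" by blast
    show "x + y \<in> to_L2 ` schwartz" "v (x + y) = v x + v y"
      using add2[OF f(1) g(1), of 1 1] v[OF f(1)] v[OF g(1)] f g by (auto simp: scaleC_one)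
  next
    fix z :: "'a L2" assume z: "\<And>x. x \<in> to_L2 ` schwartz \<Longrightarrow> cinner z x = 0"
    show "z = 0"
      by (rule coherent_total) (rule z, simp flip: coherent_fun_L2 add: coherent_fun_schwartz)
  qed
  then show ?thesis using v by auto
qed

section \<open>Coherent state expansions in the Schwartz space\<close>

text \<open>If the coefficients decay rapidly then the partial sums are bounded in every Schwartz
  seminorm. As they converge in \<open>L\<^sup>2\<close>, interpolation upgrades this to convergence in the Schwartz
  space, so that continuous functionals may be applied term by term.\<close>

lemma coherent_series_functional:
  fixes u :: "('a \<Rightarrow> complex) \<Rightarrow> complex"
  assumes u: "\<And>f g a b. f \<in> schwartz \<Longrightarrow> g \<in> schwartz \<Longrightarrow> u (\<lambda>x. a * f x + b * g x) = cnj a * u f + cnj b * u g"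
    and cont: "schwartz_bounded u" and g: "g \<in> schwartz"
    and c: "\<And>m. \<exists>C\<ge>0. \<forall>l\<in>\<Lambda>. cmod (c l) \<le> C * decay (real m) (z0 + l)"
    and ex: "((\<lambda>l. c l *\<^sub>C coherent (z0 + l)) has_sum to_L2 g) \<Lambda>"
    and e: "bij_betw e UNIV \<Lambda>"
  shows "(\<lambda>i. cnj (c (e i)) * u (coherent_fun (z0 + e i))) sums u g"
proof -
  define P where "P n x = (\<Sum>i<n. c (e i) * coherent_fun (z0 + e i) x)" for n x
  define r where "r n = (\<lambda>x. 1 * g x + (-1) * P n x)" for n :: nat
  have eL: "e i \<in> \<Lambda>" for i using e by (auto simp: bij_betw_def)
  have P: "P n \<in> schwartz" "to_L2 (P n) = (\<Sum>i<n. c (e i) *\<^sub>C coherent (z0 + e i))"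
    "set bs \<subseteq> Basis \<Longrightarrow> iter_partial bs (P n) = (\<lambda>x. \<Sum>i<n. c (e i) * iter_partial bs (coherent_fun (z0 + e i)) x)"
    for n bs
    using schwartz_sum(1,3)[of "{..<n}" "\<lambda>i. coherent_fun (z0 + e i)" "\<lambda>i. c (e i)"] coherent_fun_schwartz
      schwartz_sum(2)[of "{..<n}" "\<lambda>i. coherent_fun (z0 + e i)" bs "\<lambda>i. c (e i)"]
    unfolding P_def[abs_def] coherent_fun_L2 by blast+
  have rS: "r n \<in> schwartz" for n unfolding r_def by (rule schwartz_lincomb[OF g P(1)])
  have "(\<lambda>i. c (e i) *\<^sub>C coherent (z0 + e i)) sums to_L2 g"
    using ex has_sum_reindex_bij_betw[OF e, of "\<lambda>l. c l *\<^sub>C coherent (z0 + l)"] by (intro has_sum_imp_sums) simp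
  then have "(\<lambda>n. to_L2 g - to_L2 (P n)) \<longlonglongrightarrow> to_L2 g - to_L2 g"
    unfolding sums_def P(2) by (intro tendsto_diff tendsto_const)
  moreover have "to_L2 (r n) = to_L2 g - to_L2 (P n)" for n
    unfolding r_def to_L2_lincomb[OF g P(1)] using scaleR_scaleC[of "-1" "to_L2 (P n)"] by (simp add: scaleC_one)
  ultimately have L2: "(\<lambda>n. norm (to_L2 (r n))) \<longlonglongrightarrow> 0" by (simp add: tendsto_norm_zero)
  have bd: "\<exists>C. \<forall>n x. (1 + norm x) ^ k * cmod (iter_partial bs (r n) x) \<le> C" if bs: "set bs \<subseteq> Basis" for bs k
  proof -
    obtain Cg where Cg: "\<And>x. (1 + norm x) ^ k * cmod (iter_partial bs g x) \<le> Cg"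
      using schwartz_bound[OF g bs, of k] by blast
    obtain D m where D: "D \<ge> 0"
      "\<And>z t. (1 + norm t) ^ k * cmod (iter_partial bs (coherent_fun z) t) \<le> D * (1 + norm z) ^ m"
      using coherent_schwartz_bound[OF bs, of k] by blast
    define M where "M = 2 * DIM('a) + 1"
    obtain C where C: "C \<ge> 0" "\<And>l. l \<in> \<Lambda> \<Longrightarrow> cmod (c l) \<le> C * decay (real (m + M)) (z0 + l)"
      using c by blast
    obtain L where L: "L \<ge> 0" "\<And>z F. finite F \<Longrightarrow> F \<subseteq> \<Lambda> \<Longrightarrow> (\<Sum>l\<in>F. decay (real M) (l - z)) \<le> L"
      using lattice_decay_sum[of "real M"] by (auto simp: M_def)
    have "(1 + norm x) ^ k * cmod (iter_partial bs (r n) x) \<le> Cg + C * D * L" for n x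
    proof -
      have summand: "(1 + norm x) ^ k * cmod (c (e i) * iter_partial bs (coherent_fun (z0 + e i)) x) \<le> C * D * decay (real M) (e i - (- z0))" for i
      proof -
        define w where "w = z0 + e i"
        have "(1 + norm x) ^ k * cmod (c (e i) * iter_partial bs (coherent_fun w) x)
            = cmod (c (e i)) * ((1 + norm x) ^ k * cmod (iter_partial bs (coherent_fun w) x))"
          by (simp add: norm_mult mult_ac)
        also have "\<dots> \<le> (C * decay (real (m + M)) w) * (D * (1 + norm w) ^ m)"
          by (rule mult_mono[OF C(2)[OF eL, of i, folded w_def] D(2)]) (use C(1) in \<open>auto simp: decay_nonneg\<close>)
        also have "decay (real (m + M)) w = decay (real m) w * decay (real M) w"
          by (simp add: decay_def powr_add[symmetric])
        also have "(C * (decay (real m) w * decay (real M) w)) * (D * (1 + norm w) ^ m)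
            = C * D * decay (real M) w * ((1 + norm w) ^ m * decay (real m) w)" by simp
        also have "\<dots> = C * D * decay (real M) w" by (simp only: power_decay mult_1_right)
        finally show ?thesis by (simp add: w_def add.commute)
      qed
      have "(1 + norm x) ^ k * cmod (iter_partial bs (r n) x)
          \<le> (1 + norm x) ^ k * (cmod (iter_partial bs g x) + (\<Sum>i<n. cmod (c (e i) * iter_partial bs (coherent_fun (z0 + e i)) x)))"
        unfolding r_def iter_partial_lincomb[OF g P(1) bs] P(3)[OF bs]
        by (intro mult_left_mono order_trans[OF norm_triangle_ineq] add_mono) (auto intro: norm_sum)
      also have "\<dots> \<le> Cg + (\<Sum>i<n. C * D * decay (real M) (e i - (- z0)))"
        unfolding distrib_left sum_distrib_left by (intro add_mono Cg sum_mono summand)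
      also have "(\<Sum>i<n. C * D * decay (real M) (e i - (- z0))) = C * D * (\<Sum>l\<in>e ` {..<n}. decay (real M) (l - (- z0)))"
        using bij_betw_imp_inj_on[OF e] by (subst sum.reindex) (auto simp: sum_distrib_left inj_on_def)
      also have "\<dots> \<le> C * D * L"
        using C D eL by (intro mult_left_mono L(2)) auto
      finally show ?thesis by simp
    qed
    then show ?thesis by blast
  qed
  obtain K k where K: "\<And>f. f \<in> schwartz \<Longrightarrow> cmod (u f) \<le> K * schwartz_norm k f"
    using cont by (auto simp: schwartz_bounded_def)
  have lim: "(\<lambda>n. K * schwartz_norm k (r n)) \<longlonglongrightarrow> K * 0"
    by (intro tendsto_intros schwartz_norm_tendsto_0[OF rS bd L2])
  have "(\<lambda>n. u (r n)) \<longlonglongrightarrow> 0"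
  proof (rule Lim_null_comparison)
    show "\<forall>\<^sub>F n in sequentially. norm (u (r n)) \<le> K * schwartz_norm k (r n)" using K[OF rS] by simp
    show "(\<lambda>n. K * schwartz_norm k (r n)) \<longlonglongrightarrow> 0" using lim by simp
  qed
  then have "(\<lambda>n. u g - u (r n)) \<longlonglongrightarrow> u g - 0" by (intro tendsto_intros)
  moreover have "u g - u (r n) = (\<Sum>i<n. cnj (c (e i)) * u (coherent_fun (z0 + e i)))" for n
  proof -
    have "u (P n) = (\<Sum>i<n. cnj (c (e i)) * u (coherent_fun (z0 + e i)))"
      unfolding P_def by (rule antilinear_sum[where u = u]) (rule u, assumption, assumption, rule coherent_fun_schwartz, rule finite_lessThan)
    moreover have "u (r n) = cnj 1 * u g + cnj (-1) * u (P n)" unfolding r_def by (rule u[OF g P(1)])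
    ultimately show ?thesis by simp
  qed
  ultimately show ?thesis by (simp add: sums_def)
qed

end

section \<open>The localized norm of a form\<close>

text \<open>The operator norm of \<^term>\<open>localized F z\<close>. Being a supremum of continuous functions of \<open>z\<close> it
  is lower semicontinuous, hence measurable.\<close>

definition form_size :: "'a::euclidean_space form \<Rightarrow> 'a \<times> 'a \<Rightarrow> ennreal" where
  "form_size F z = (SUP f\<in>{f\<in>schwartz. norm (to_L2 f) \<le> 1}. ennreal (cmod (F f (coherent_fun z))))"

text \<open>The Gaussian has norm \<open>1\<close>, and the operator norm is at most the Hilbert--Schmidt norm.\<close>

lemma form_size_le: "form_size F z \<le> hs_ennorm (localized F z)"
  unfolding hs_ennorm_def
proof (rule INF_greatest, clarify)
  fix H assume H: "\<forall>f\<in>schwartz. hs_apply H (to_L2 f) = localized F z f"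
  show "form_size F z \<le> ennreal (norm H)"
    unfolding form_size_def
  proof (rule SUP_least, clarify)
    fix f :: "'a \<Rightarrow> complex" assume f: "f \<in> schwartz" "norm (to_L2 f) \<le> 1"
    have "cmod (F f (coherent_fun z)) = norm (hs_apply H (to_L2 f))"
      using H f by (simp add: localized_def norm_scaleC norm_gaussian)
    also have "\<dots> \<le> norm H * 1"
      using norm_hs_apply_le[of H "to_L2 f"] mult_left_mono[OF f(2) norm_ge_zero[of H]] by linarith
    finally show "ennreal (cmod (F f (coherent_fun z))) \<le> ennreal (norm H)" by (simp add: ennreal_leI)
  qed
qed

lemma form_size_bound:
  assumes F: "F \<in> schwartz_operators_dual" and f: "f \<in> schwartz" and m: "form_size F z \<le> ennreal m" "m \<ge> 0"
  shows "cmod (F f (coherent_fun z)) \<le> m * norm (to_L2 f)"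
proof -
  have scaled: "t * cmod (F f (coherent_fun z)) \<le> m" if t: "t \<ge> 0" "t * norm (to_L2 f) \<le> 1" for t :: real
  proof -
    define g where "g = (\<lambda>x. complex_of_real t * f x + 0 * f x)"
    have g: "g \<in> schwartz" "norm (to_L2 g) \<le> 1"
      unfolding g_def using schwartz_lincomb[OF f f, of "complex_of_real t" 0] to_L2_lincomb[OF f f, of "complex_of_real t" 0] t
      by (simp_all add: norm_scaleC scaleC_zero_left)
    have "F g (coherent_fun z) = complex_of_real t * F f (coherent_fun z) + 0 * F f (coherent_fun z)"
      using F f coherent_fun_schwartz[of z] unfolding schwartz_operators_dual_def g_def by blast
    then have "ennreal (t * cmod (F f (coherent_fun z))) = ennreal (cmod (F g (coherent_fun z)))"
      using t by (simp add: norm_mult)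
    also have "\<dots> \<le> form_size F z" unfolding form_size_def using g by (intro SUP_upper) auto
    finally have "ennreal (t * cmod (F f (coherent_fun z))) \<le> ennreal m" using m(1) by (rule order_trans)
    then show ?thesis using m(2) by (simp add: ennreal_le_iff)
  qed
  show ?thesis
  proof (cases "norm (to_L2 f) = 0")
    case True
    then have all: "t * cmod (F f (coherent_fun z)) \<le> m" if "t \<ge> 0" for t
      using scaled[OF that] by simp
    have "cmod (F f (coherent_fun z)) = 0"
    proof (rule ccontr)
      assume "cmod (F f (coherent_fun z)) \<noteq> 0"
      then show False using all[of "(m + 1) / cmod (F f (coherent_fun z))"] m(2) by simp
    qed
    then show ?thesis using m(2) by simp
  next
    case False
    then show ?thesis using scaled[of "1 / norm (to_L2 f)"] by (simp add: field_simps)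
  qed
qed

text \<open>A convergent sequence of coherent states is bounded in all seminorms, so its convergence in \<open>L\<^sup>2\<close> is
  convergence in the Schwartz space.\<close>

lemma schwartz_functional_continuous:
  fixes u :: "('a::euclidean_space \<Rightarrow> complex) \<Rightarrow> complex"
  assumes u: "\<And>f g a b. f \<in> schwartz \<Longrightarrow> g \<in> schwartz \<Longrightarrow> u (\<lambda>x. a * f x + b * g x) = cnj a * u f + cnj b * u g"
    and cont: "schwartz_bounded u"
  shows "continuous_on UNIV (\<lambda>z. u (coherent_fun z))"
  unfolding continuous_on_sequentially
proof (intro allI ballI impI, elim conjE)
  fix x :: "nat \<Rightarrow> 'a \<times> 'a" and z assume x: "x \<longlonglongrightarrow> z"
  define r where "r n = (\<lambda>t. 1 * coherent_fun (x n) t + (-1) * coherent_fun z t)" for n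
  have rS: "r n \<in> schwartz" for n unfolding r_def by (intro schwartz_lincomb coherent_fun_schwartz)
  have "to_L2 (r n) = coherent (x n) - coherent z" for n
    unfolding r_def to_L2_lincomb[OF coherent_fun_schwartz coherent_fun_schwartz] coherent_fun_L2
    using scaleR_scaleC[of "-1" "coherent z"] by (simp add: scaleC_one)
  moreover have "(\<lambda>n. coherent (x n)) \<longlonglongrightarrow> coherent z"
    by (rule continuous_on_tendsto_compose[OF continuous_coherent x]) auto
  ultimately have L2: "(\<lambda>n. norm (to_L2 (r n))) \<longlonglongrightarrow> 0"
    by (simp add: tendsto_norm_zero LIM_zero)
  obtain R where R: "R \<ge> 0" "\<And>n. norm (x n) \<le> R" "norm z \<le> R"
  proof -
    obtain R where "\<And>n. norm (x n) \<le> R"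
      using convergent_imp_bounded[OF x] by (auto simp: bounded_iff)
    then show ?thesis using that[of "max R (norm z)"] by (auto simp: le_max_iff_disj)
  qed
  have bd: "\<exists>C. \<forall>n t. (1 + norm t) ^ k * cmod (iter_partial bs (r n) t) \<le> C" if bs: "set bs \<subseteq> Basis" for bs k
  proof -
    obtain D m where D: "D \<ge> 0"
      "\<And>z t. (1 + norm t) ^ k * cmod (iter_partial bs (coherent_fun z) t) \<le> D * (1 + norm z) ^ m"
      using coherent_schwartz_bound[OF bs, of k] by blast
    have D': "(1 + norm t) ^ k * cmod (iter_partial bs (coherent_fun w) t) \<le> D * (1 + R) ^ m" if "norm w \<le> R" for w t
      using D(2)[of t w] that D(1) by (elim order_trans) (intro mult_left_mono power_mono; simp)
    have "(1 + norm t) ^ k * cmod (iter_partial bs (r n) t) \<le> D * (1 + R) ^ m + D * (1 + R) ^ m" for n t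
    proof -
      have "cmod (iter_partial bs (r n) t) \<le> cmod (iter_partial bs (coherent_fun (x n)) t) + cmod (iter_partial bs (coherent_fun z) t)"
        unfolding r_def iter_partial_lincomb[OF coherent_fun_schwartz coherent_fun_schwartz bs]
        using norm_triangle_ineq4[of "iter_partial bs (coherent_fun (x n)) t" "iter_partial bs (coherent_fun z) t"] by simp
      then have "(1 + norm t) ^ k * cmod (iter_partial bs (r n) t)
        \<le> (1 + norm t) ^ k * (cmod (iter_partial bs (coherent_fun (x n)) t) + cmod (iter_partial bs (coherent_fun z) t))"
        by (intro mult_left_mono) auto
      also have "\<dots> \<le> D * (1 + R) ^ m + D * (1 + R) ^ m"
        unfolding distrib_left by (intro add_mono D' R)
      finally show ?thesis .
    qed
    then show ?thesis by blast
  qed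
  obtain K k where K: "\<And>f. f \<in> schwartz \<Longrightarrow> cmod (u f) \<le> K * schwartz_norm k f"
    using cont by (auto simp: schwartz_bounded_def)
  have lim: "(\<lambda>n. K * schwartz_norm k (r n)) \<longlonglongrightarrow> K * 0"
    by (intro tendsto_intros schwartz_norm_tendsto_0[OF rS bd L2])
  have "(\<lambda>n. u (r n)) \<longlonglongrightarrow> 0"
  proof (rule Lim_null_comparison)
    show "\<forall>\<^sub>F n in sequentially. norm (u (r n)) \<le> K * schwartz_norm k (r n)" using K[OF rS] by simp
    show "(\<lambda>n. K * schwartz_norm k (r n)) \<longlonglongrightarrow> 0" using lim by simp
  qed
  moreover have "u (r n) = u (coherent_fun (x n)) - u (coherent_fun z)" for n
    unfolding r_def u[OF coherent_fun_schwartz coherent_fun_schwartz] by simp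
  ultimately show "((\<lambda>z. u (coherent_fun z)) \<circ> x) \<longlonglongrightarrow> u (coherent_fun z)"
    by (simp add: o_def LIM_zero_iff)
qed

lemma form_size_measurable:
  assumes F: "F \<in> schwartz_operators_dual"
  shows "form_size (F :: 'a::euclidean_space form) \<in> borel_measurable borel"
proof (rule borel_measurableI_greater)
  fix y :: ennreal
  have "{z \<in> space borel. y < form_size F z}
    = (\<Union>f\<in>{f\<in>schwartz. norm (to_L2 f) \<le> 1}. {z. y < ennreal (cmod (F f (coherent_fun z)))})"
    by (auto simp: form_size_def less_SUP_iff)
  also have "open \<dots>"
  proof (rule open_UN, rule ballI)
    fix f :: "'a \<Rightarrow> complex" assume "f \<in> {f\<in>schwartz. norm (to_L2 f) \<le> 1}"
    then have f: "f \<in> schwartz" by simp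
    have "continuous_on UNIV (\<lambda>z. F f (coherent_fun z))"
      by (rule schwartz_functional_continuous) (use F f in \<open>auto simp: schwartz_operators_dual_def\<close>)
    then have "continuous_on UNIV (\<lambda>z. ennreal (cmod (F f (coherent_fun z))))"
      by (intro continuous_on_ennreal continuous_on_norm)
    then show "open {z. y < ennreal (cmod (F f (coherent_fun z)))}"
      by (intro open_Collect_less continuous_on_const)
  qed
  finally show "{z \<in> space borel. y < form_size F z} \<in> sets borel" by (rule borel_open)
qed

lemma ennpowr_mono: "x \<le> y \<Longrightarrow> p \<ge> 0 \<Longrightarrow> ennpowr x p \<le> ennpowr y p"
  unfolding ennpowr_def
  by (auto simp: top_unique less_top intro!: ennreal_leI powr_mono2 enn2real_mono)

lemma ennpowr_measurable [measurable (raw)]: "f \<in> borel_measurable M \<Longrightarrow> (\<lambda>x. ennpowr (f x) p) \<in> borel_measurable M"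
proof -
  assume [measurable]: "f \<in> borel_measurable M"
  have [measurable]: "{x \<in> space M. f x = \<infinity>} \<in> sets M" by measurable
  show ?thesis unfolding ennpowr_def by (intro measurable_If) measurable
qed

section \<open>Discretizing the modulation norm\<close>

context gaussian_gabor_frame
begin

text \<open>The translates of the lattice by points of a small ball are disjoint, so averaging over the ball
  produces a translate on which the sum is controlled by the integral.\<close>

lemma good_shift:
  fixes h :: "'a \<times> 'a \<Rightarrow> ennreal"
  assumes h: "h \<in> borel_measurable borel" and J: "(\<integral>\<^sup>+u. h u \<partial>lborel) \<le> ennreal J" "J \<ge> 0"
  shows "\<exists>z0\<in>ball 0 sep_radius. \<forall>F. finite F \<longrightarrow> F \<subseteq> \<Lambda> \<longrightarrow>
    (\<Sum>l\<in>F. h (z0 + l)) \<le> ennreal (J / measure lborel (ball 0 sep_radius :: ('a \<times> 'a) set))"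
proof (rule ccontr)
  assume no: "\<not> ?thesis"
  let ?B = "ball 0 sep_radius :: ('a \<times> 'a) set"
  define v where "v = measure lborel ?B"
  define a where "a = ennreal (J / v)"
  define \<Phi> where "\<Phi> u = (\<integral>\<^sup>+l. h (l + u) \<partial>count_space \<Lambda>)" for u
  have ev: "emeasure lborel ?B = ennreal v"
    unfolding v_def by (rule emeasure_eq_ennreal_measure) (use emeasure_bounded_finite[of ?B] in \<open>simp add: less_top\<close>)
  have v: "v > 0"
    unfolding v_def using content_ball_pos[OF sep_radius_pos, of "0 :: 'a \<times> 'a"] by simp
  note [measurable] = h
  have bij: "bij_betw (from_nat_into \<Lambda>) UNIV \<Lambda>"
    by (rule bij_betw_from_nat_into[OF countable_Lambda infinite_Lambda])
  have \<Phi>: "\<Phi> = (\<lambda>u. \<Sum>i. h (from_nat_into \<Lambda> i + u))"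
    unfolding \<Phi>_def[abs_def] nn_integral_bij_count_space[OF bij, symmetric] by (simp add: nn_integral_count_space_nat)
  have [measurable]: "\<Phi> \<in> borel_measurable borel" unfolding \<Phi> by measurable
  have big: "a < \<Phi> u" if u: "u \<in> ?B" for u
  proof -
    obtain F where F: "finite F" "F \<subseteq> \<Lambda>" "\<not> (\<Sum>l\<in>F. h (u + l)) \<le> a"
      using no u unfolding a_def v_def by blast
    have "(\<Sum>l\<in>F. h (l + u)) \<le> \<Phi> u"
      unfolding \<Phi>_def by (rule sum_le_nn_integral_count_space[OF F(1,2)])
    then show ?thesis using F(3) by (simp add: add.commute[of u] not_le)
  qed
  have [measurable]: "?B \<in> sets borel" by simp
  have "(\<integral>\<^sup>+u. a * indicator ?B u \<partial>lborel) = a * ennreal v"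
    by (simp add: nn_integral_cmult ev)
  also have av: "a * ennreal v = ennreal J"
    using v J(2) by (simp add: a_def ennreal_mult[symmetric])
  finally have lhs: "(\<integral>\<^sup>+u. a * indicator ?B u \<partial>lborel) = ennreal J" .
  have "(\<integral>\<^sup>+u. a * indicator ?B u \<partial>lborel) < (\<integral>\<^sup>+u. \<Phi> u * indicator ?B u \<partial>lborel)"
  proof (rule nn_integral_less)
    show "(\<integral>\<^sup>+u. a * indicator ?B u \<partial>lborel) \<noteq> \<infinity>" unfolding lhs by simp
    show "AE u in lborel. a * indicator ?B u \<le> \<Phi> u * indicator ?B u"
      using big by (intro AE_I2) (auto simp: indicator_def less_imp_le)
    show "\<not> (AE u in lborel. \<Phi> u * indicator ?B u \<le> a * indicator ?B u)"
    proof
      assume "AE u in lborel. \<Phi> u * indicator ?B u \<le> a * indicator ?B u"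
      then have "AE u in lborel. u \<notin> ?B"
        by eventually_elim (use big in \<open>fastforce simp: indicator_def split: if_splits\<close>)
      then have "emeasure lborel ?B = 0"
        by (subst (asm) AE_iff_measurable[of ?B]) auto
      then show False using ev v by simp
    qed
  qed simp_all
  also have "\<dots> \<le> (\<integral>\<^sup>+u. h u \<partial>lborel)"
    unfolding \<Phi>_def by (rule separated_tile[OF countable_Lambda Lambda_separated h])
  also have "\<dots> \<le> ennreal J" by (rule J(1))
  finally show False unfolding lhs by simp
qed

text \<open>The expansion is with respect to the Gabor frame over a shifted lattice. The dual vectors
  \<open>\<gamma>\<^sub>l\<close> are localized uniformly in the shift, and \<open>r\<^sub>l\<close> represents the functional
  \<open>f \<mapsto> \<langle>F f, \<pi>(z\<^sub>0 + l)\<phi>\<^sub>0\<rangle>\<close>.\<close>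

theorem modulation_expansion:
  fixes p s :: real
  assumes s: "s > 2 * real DIM('a)" and p: "0 < p" "p < 2"
  shows "\<exists>C0\<ge>0. \<exists>K\<ge>0. \<forall>F :: 'a form. F \<in> schwartz_operators_dual \<longrightarrow> op_modulation_ennorm p F < \<infinity> \<longrightarrow>
    (\<exists>\<gamma> r H. (\<forall>m\<in>\<Lambda>. coherent_decay s C0 m (\<gamma> m)) \<and> (\<lambda>m. norm (r m) powr p) summable_on \<Lambda> \<and>
      ((\<lambda>m. hs_rank_one (\<gamma> m) (r m)) has_sum H) \<Lambda> \<and> hs_form H = F \<and>
      (\<Sum>\<^sub>\<infinity>m\<in>\<Lambda>. norm (r m) powr p) powr (1 / p) \<le> K * enn2real (op_modulation_ennorm p F))"
proof -
  have s0: "s \<ge> 0" using s by (rule less_imp_le[OF le_less_trans[rotated]]) simp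
  obtain A B where AB: "\<And>z0. frame_bounds \<Lambda> (coherent_op z0) A B"
    using coherent_frame_bounds by blast
  have AB0: "0 < A" "A < B" using AB[of 0] by (auto simp: frame_bounds_def)
  have loc: "\<exists>J\<ge>0. \<forall>z0\<in>ball 0 sep_radius. offdiag t J (inv (g_frame_operator \<Lambda> (coherent_op z0)))"
    if t: "t > 2 * real DIM('a)" for t
  proof -
    have t0: "t \<ge> 0" using t by (rule less_imp_le[OF le_less_trans[rotated]]) simp
    obtain J where J: "J \<ge> 0" "\<And>U. frame_bounds \<Lambda> U A B \<Longrightarrow> localized_family \<Lambda> t ((1 + sep_radius) powr t) U \<Longrightarrow>
        offdiag t J (inv (g_frame_operator \<Lambda> U))"
      using localized_frame_inverse[OF t AB0, of "(1 + sep_radius) powr t"] by auto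
    have "offdiag t J (inv (g_frame_operator \<Lambda> (coherent_op z0)))" if "z0 \<in> ball 0 sep_radius" for z0
      by (rule J(2)[OF AB coherent_op_localized[OF t0]]) (use that in simp)
    then show ?thesis using J(1) by blast
  qed
  obtain J where J: "J \<ge> 0" "\<And>z0. z0 \<in> ball 0 sep_radius \<Longrightarrow> offdiag s J (inv (g_frame_operator \<Lambda> (coherent_op z0)))"
    using loc[OF s] by blast
  define C0 where "C0 = (1 + sep_radius) powr s * J"
  define v where "v = measure lborel (ball 0 sep_radius :: ('a \<times> 'a) set)"
  define K where "K = (1 / v) powr (1 / p)"
  have v: "v > 0"
    unfolding v_def using content_ball_pos[OF sep_radius_pos, of "0 :: 'a \<times> 'a"] by simp
  define e where "e = from_nat_into \<Lambda>"
  have e: "bij_betw e UNIV \<Lambda>"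
    unfolding e_def by (rule bij_betw_from_nat_into[OF countable_Lambda infinite_Lambda])
  have eL: "e i \<in> \<Lambda>" for i using e by (auto simp: bij_betw_def)
  have main: "\<exists>\<gamma> r H. (\<forall>m\<in>\<Lambda>. coherent_decay s C0 m (\<gamma> m)) \<and> (\<lambda>m. norm (r m) powr p) summable_on \<Lambda> \<and>
      ((\<lambda>m. hs_rank_one (\<gamma> m) (r m)) has_sum H) \<Lambda> \<and> hs_form H = F \<and>
      (\<Sum>\<^sub>\<infinity>m\<in>\<Lambda>. norm (r m) powr p) powr (1 / p) \<le> K * enn2real (op_modulation_ennorm p F)"
    if F: "F \<in> schwartz_operators_dual" and fin: "op_modulation_ennorm p F < \<infinity>" for F :: "'a form"
  proof -
    have linL: "F (\<lambda>x. a * f x + b * g x) k = a * F f k + b * F g k"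
      and linR: "F k (\<lambda>x. a * f x + b * g x) = cnj a * F k f + cnj b * F k g"
      if "f \<in> schwartz" "g \<in> schwartz" "k \<in> schwartz" for f g k a b
      using F that unfolding schwartz_operators_dual_def by blast+
    have cont: "schwartz_bounded (F f)" if "f \<in> schwartz" for f
      using F that unfolding schwartz_operators_dual_def by blast
    define I where "I = (\<integral>\<^sup>+z. ennpowr (hs_ennorm (localized F z)) p \<partial>lborel)"
    have nI: "op_modulation_ennorm p F = ennpowr I (1 / p)" by (simp add: op_modulation_ennorm_def I_def)
    have Ifin: "I < \<infinity>" using fin unfolding nI by (cases "I = \<infinity>") (simp_all add: ennpowr_def less_top)
    define J0 where "J0 = enn2real I"
    have J0: "J0 \<ge> 0" "I = ennreal J0" using Ifin by (simp_all add: J0_def less_top)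
    have nF: "enn2real (op_modulation_ennorm p F) = J0 powr (1 / p)"
      using Ifin by (simp add: nI ennpowr_def J0_def)
    define h where "h z = ennpowr (form_size F z) p" for z
    have hm: "h \<in> borel_measurable borel"
      unfolding h_def[abs_def] by (rule ennpowr_measurable[OF form_size_measurable[OF F]])
    have "(\<integral>\<^sup>+z. h z \<partial>lborel) \<le> ennreal J0"
      unfolding J0(2)[symmetric] I_def h_def
      by (intro nn_integral_mono ennpowr_mono form_size_le) (use p in simp)
    from good_shift[OF hm this J0(1)] obtain z0 where z0: "z0 \<in> ball 0 sep_radius"
      and sum_h: "\<And>G. finite G \<Longrightarrow> G \<subseteq> \<Lambda> \<Longrightarrow> (\<Sum>l\<in>G. h (z0 + l)) \<le> ennreal (J0 / v)"
      unfolding v_def by blast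
    define S where "S = g_frame_operator \<Lambda> (coherent_op z0)"
    note inv = frame_operator_inverse[OF AB[of z0], folded S_def]
    define \<gamma> where "\<gamma> l = inv S (coherent (z0 + l))" for l
    have \<gamma>: "coherent_decay s C0 l (\<gamma> l)" for l
      unfolding C0_def \<gamma>_def
      by (rule coherent_decay_shift[OF coherent_decay_offdiag[OF J(2)[OF z0, folded S_def]] s0 J(1)])
         (use z0 in simp)
    define m where "m l = enn2real (form_size F (z0 + l))" for l
    have hl: "h (z0 + l) = ennreal (m l powr p) \<and> form_size F (z0 + l) = ennreal (m l)" if l: "l \<in> \<Lambda>" for l
    proof -
      have "h (z0 + l) \<le> ennreal (J0 / v)" using sum_h[of "{l}"] l by simp
      then have "form_size F (z0 + l) \<noteq> \<infinity>" by (auto simp: h_def ennpowr_def top_unique)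
      then show ?thesis by (simp add: h_def ennpowr_def m_def less_top)
    qed
    have m0: "m l \<ge> 0" for l by (simp add: m_def)
    have "\<forall>l\<in>\<Lambda>. \<exists>r. norm r \<le> m l \<and> (\<forall>f\<in>schwartz. F f (coherent_fun (z0 + l)) = cinner (to_L2 f) r)"
    proof
      fix l assume l: "l \<in> \<Lambda>"
      show "\<exists>r. norm r \<le> m l \<and> (\<forall>f\<in>schwartz. F f (coherent_fun (z0 + l)) = cinner (to_L2 f) r)"
      proof (rule schwartz_functional_riesz[OF linL[OF _ _ coherent_fun_schwartz] _ m0])
        show "cmod (F f (coherent_fun (z0 + l))) \<le> m l * norm (to_L2 f)" if "f \<in> schwartz" for f
          by (rule form_size_bound[OF F that _ m0]) (use hl[OF l] in simp)
      qed
    qed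
    then obtain r where r: "\<And>l. l \<in> \<Lambda> \<Longrightarrow> norm (r l) \<le> m l"
      "\<And>l f. l \<in> \<Lambda> \<Longrightarrow> f \<in> schwartz \<Longrightarrow> F f (coherent_fun (z0 + l)) = cinner (to_L2 f) (r l)" by metis
    have sum_r: "(\<Sum>l\<in>G. norm (r l) powr p) \<le> J0 / v" if G: "finite G" "G \<subseteq> \<Lambda>" for G
    proof -
      have "(\<Sum>l\<in>G. norm (r l) powr p) \<le> (\<Sum>l\<in>G. m l powr p)"
        using G r(1) p by (intro sum_mono powr_mono2) auto
      moreover have "ennreal (\<Sum>l\<in>G. m l powr p) = (\<Sum>l\<in>G. h (z0 + l))"
      proof -
        have "(\<Sum>l\<in>G. h (z0 + l)) = (\<Sum>l\<in>G. ennreal (m l powr p))"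
          by (rule sum.cong[OF refl]) (use hl G in blast)
        then show ?thesis by simp
      qed
      then have "(\<Sum>l\<in>G. m l powr p) \<le> J0 / v"
        using sum_h[OF G] J0(1) v ennreal_le_iff[of "J0 / v" "\<Sum>l\<in>G. m l powr p"]
        by (simp only: divide_nonneg_pos)
      ultimately show ?thesis by linarith
    qed
    have rs: "(\<lambda>l. norm (r l) powr p) summable_on \<Lambda>"
      by (rule nonneg_bdd_above_summable_on) (use sum_r in \<open>auto intro!: bdd_aboveI2\<close>)
    have "(\<Sum>\<^sub>\<infinity>l\<in>\<Lambda>. norm (r l) powr p) \<le> J0 / v" by (rule infsum_le_finite_sums[OF rs sum_r])
    then have "(\<Sum>\<^sub>\<infinity>l\<in>\<Lambda>. norm (r l) powr p) powr (1 / p) \<le> (1 / v * J0) powr (1 / p)"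
      using p by (intro powr_mono2) (auto simp: infsum_nonneg)
    also have "\<dots> = K * J0 powr (1 / p)" using v J0(1) by (simp only: K_def powr_mult)
    finally have norm_r: "(\<Sum>\<^sub>\<infinity>l\<in>\<Lambda>. norm (r l) powr p) powr (1 / p) \<le> K * enn2real (op_modulation_ennorm p F)"
      by (simp add: nF)
    \<comment> \<open>the dual vectors form a Bessel family, so the series converges in the Hilbert-Schmidt norm\<close>
    obtain k where k: "\<And>x. norm (inv S x) \<le> k * norm x" "k \<ge> 0"
      using bounded_clinear_pos[OF inv(3)] by blast
    have bes: "(norm (\<Sum>l\<in>G. c l *\<^sub>C \<gamma> l))\<^sup>2 \<le> (k\<^sup>2 * B) * (\<Sum>l\<in>G. (cmod (c l))\<^sup>2)" if G: "finite G" "G \<subseteq> \<Lambda>" for G c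
    proof -
      have syn: "cadjoint (coherent_op z0 l) (c l *\<^sub>C gaussian) = c l *\<^sub>C coherent (z0 + l)" for l
        by (simp add: coherent_op_def cadjoint_rank_one rank_one_def cinner_scaleC_left cinner_self norm_gaussian)
      have "(\<Sum>l\<in>G. c l *\<^sub>C \<gamma> l) = inv S (\<Sum>l\<in>G. c l *\<^sub>C coherent (z0 + l))"
        by (simp add: \<gamma>_def bounded_clinear_sum[OF inv(3)] bounded_clinear_scaleC[OF inv(3)])
      then have "(norm (\<Sum>l\<in>G. c l *\<^sub>C \<gamma> l))\<^sup>2 \<le> (k * norm (\<Sum>l\<in>G. c l *\<^sub>C coherent (z0 + l)))\<^sup>2"
        using k by (simp add: power_mono)
      also have "\<dots> = k\<^sup>2 * (norm (\<Sum>l\<in>G. c l *\<^sub>C coherent (z0 + l)))\<^sup>2" by (rule power_mult_distrib)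
      also have "\<dots> \<le> k\<^sup>2 * (B * (\<Sum>l\<in>G. (cmod (c l))\<^sup>2))"
        using bessel_synthesis_le[OF frame_bounds_bessel[OF AB[of z0]] G, of "\<lambda>l. c l *\<^sub>C gaussian"]
        by (intro mult_left_mono) (simp_all add: syn norm_scaleC norm_gaussian)
      finally show ?thesis by (simp add: mult.assoc)
    qed
    have kB: "k\<^sup>2 * B \<ge> 0" using AB0 by simp
    have r2: "(\<lambda>l. (norm (r l))\<^sup>2) summable_on \<Lambda>" by (rule summable_powr_imp_square[OF rs _ p]) simp
    have "(\<lambda>l. hs_rank_one (\<gamma> l) (r l)) summable_on \<Lambda>"
      by (rule square_dominated_summable(1)[OF hs_rank_one_sum_le[where I = \<Lambda> and \<gamma> = \<gamma>] r2 _ kB])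
         (use bes kB in auto)
    then obtain H where H: "((\<lambda>l. hs_rank_one (\<gamma> l) (r l)) has_sum H) \<Lambda>" by (auto simp: summable_on_def)
    have HF: "hs_form H f g = F f g" for f g
    proof (cases "f \<in> schwartz \<and> g \<in> schwartz")
      case False
      then show ?thesis using F by (auto simp: hs_form_def schwartz_operators_dual_def)
    next
      case True
      then have f: "f \<in> schwartz" and g: "g \<in> schwartz" by auto
      define c where "c l = cinner (inv S (to_L2 g)) (coherent (z0 + l))" for l
      have c_dual: "cinner (\<gamma> l) (to_L2 g) = cnj (c l)" for l
        unfolding \<gamma>_def c_def by (subst inv(4)) (rule cinner_commute)
      have "\<exists>C\<ge>0. \<forall>l\<in>\<Lambda>. cmod (c l) \<le> C * decay (real n) (z0 + l)" for n
      proof -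
        define N where "N = n + 2 * DIM('a) + 1"
        have N: "real N > 2 * real DIM('a)" by (simp add: N_def)
        obtain C where C: "C \<ge> 0" "coherent_decay (real N) C 0 (to_L2 g)" using stft_rapid_decay[OF g] by blast
        obtain J' where J': "J' \<ge> 0" "offdiag (real N) J' (inv S)" using loc[OF N] z0 unfolding S_def by blast
        define C' where "C' = 2 powr real N * decay_integral TYPE('a \<times> 'a) (real N) * (2 * J' * C)"
        have C': "C' \<ge> 0" using C J' by (simp add: C'_def decay_integral_nonneg)
        have "coherent_decay (real N) C' 0 (inv S (to_L2 g))"
          unfolding C'_def by (rule coherent_decay_apply[OF inv(3) N J'(2) C(2) J'(1) C(1)])
        then have "cmod (c l) \<le> C' * decay (real N) (z0 + l)" for l
          unfolding c_def using coherent_decayD by fastforce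
        moreover have "C' * decay (real N) (z0 + l) \<le> C' * decay (real n) (z0 + l)" for l
          by (intro mult_left_mono decay_mono C') (simp add: N_def)
        ultimately show ?thesis using C' by (meson order_trans)
      qed
      moreover have "((\<lambda>l. c l *\<^sub>C coherent (z0 + l)) has_sum to_L2 g) \<Lambda>"
        using inv(5)[of "to_L2 g"] by (simp add: coherent_op_adjoint c_def)
      ultimately have 1: "(\<lambda>i. cnj (c (e i)) * F f (coherent_fun (z0 + e i))) sums F f g"
        by (intro coherent_series_functional[OF _ cont[OF f] g _ _ e] linR f)
      have "((\<lambda>l. cinner (hs_apply (hs_rank_one (\<gamma> l) (r l)) (to_L2 f)) (to_L2 g)) has_sum
          cinner (hs_apply H (to_L2 f)) (to_L2 g)) \<Lambda>"
        by (rule has_sum_bounded_linear[OF bounded_linear_cinner_left has_sum_hs_apply[OF H]])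
      then have "((\<lambda>l. cinner (to_L2 f) (r l) * cnj (c l)) has_sum cinner (hs_apply H (to_L2 f)) (to_L2 g)) \<Lambda>"
        by (simp add: hs_rank_one.rep_eq rank_one_def cinner_scaleC_left c_dual)
      then have "(\<lambda>i. cinner (to_L2 f) (r (e i)) * cnj (c (e i))) sums cinner (hs_apply H (to_L2 f)) (to_L2 g)"
        using has_sum_reindex_bij_betw[OF e, of "\<lambda>l. cinner (to_L2 f) (r l) * cnj (c l)"]
        by (intro has_sum_imp_sums) simp
      with 1 have "F f g = cinner (hs_apply H (to_L2 f)) (to_L2 g)"
        by (simp add: r(2)[OF eL f] mult.commute sums_unique2)
      then show ?thesis using f g by (simp add: hs_form_def)
    qed
    then have "hs_form H = F" by (intro ext)
    then show ?thesis using \<gamma> rs H norm_r by blast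
  qed
  have "C0 \<ge> 0" "K \<ge> 0" using J(1) by (simp_all add: C0_def K_def)
  then show ?thesis using main by blast
qed

lemma op_modulation_embedded:
  fixes W :: "'a \<times> 'a \<Rightarrow> 'a L2 hs \<Rightarrow> 'a L2 hs"
  assumes W: "s_admissible_dictionary \<Lambda> s W" and p: "2 * real DIM('a) / s < p" "p < 2"
    and \<alpha>: "\<alpha> = 1 / p - 1 / 2"
  shows "continuously_embedded (op_modulation \<Lambda> p) (op_modulation_norm \<Lambda> p) hs_form
    (approx_space \<Lambda> W \<alpha> p) (approx_norm \<Lambda> W \<alpha> p)"
proof -
  have s: "s > 2 * real DIM('a)" using W by (simp add: s_admissible_dictionary_def)
  then have s0: "s > 0" by (rule le_less_trans[rotated]) simp
  have p0: "p > 0" using p(1) by (rule le_less_trans[rotated]) (use s0 in simp)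
  obtain C where C: "\<And>F. F \<in> op_modulation \<Lambda> p \<Longrightarrow> \<exists>H. hs_form H = F \<and> H \<in> approx_space \<Lambda> W \<alpha> p \<and>
      approx_norm \<Lambda> W \<alpha> p H \<le> C * op_modulation_norm \<Lambda> p F"
  proof (cases "p < 1")
    case True
    obtain C where C: "\<And>H. H \<in> coorbit \<Lambda> p \<Longrightarrow> H \<in> approx_space \<Lambda> W \<alpha> p \<and> approx_norm \<Lambda> W \<alpha> p H \<le> C * coorbit_norm \<Lambda> p H"
      using coorbit_approx_space[OF W p \<alpha>] by blast
    show ?thesis
    proof (rule that[of C])
      fix F :: "'a form" assume "F \<in> op_modulation \<Lambda> p"
      then obtain H where "H \<in> coorbit \<Lambda> p" "F = hs_form H" using True by (auto simp: op_modulation_def)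
      then show "\<exists>H. hs_form H = F \<and> H \<in> approx_space \<Lambda> W \<alpha> p \<and> approx_norm \<Lambda> W \<alpha> p H \<le> C * op_modulation_norm \<Lambda> p F"
        using C True by (auto simp: op_modulation_norm_def inv_f_f[OF inj_hs_form])
    qed
  next
    case False
    obtain C0 K where K: "C0 \<ge> 0" "K \<ge> 0" "\<And>F :: 'a form. F \<in> schwartz_operators_dual \<Longrightarrow> op_modulation_ennorm p F < \<infinity> \<Longrightarrow>
      \<exists>\<gamma> r H. (\<forall>m\<in>\<Lambda>. coherent_decay s C0 m (\<gamma> m)) \<and> (\<lambda>m. norm (r m) powr p) summable_on \<Lambda> \<and>
        ((\<lambda>m. hs_rank_one (\<gamma> m) (r m)) has_sum H) \<Lambda> \<and> hs_form H = F \<and>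
        (\<Sum>\<^sub>\<infinity>m\<in>\<Lambda>. norm (r m) powr p) powr (1 / p) \<le> K * enn2real (op_modulation_ennorm p F)"
      using modulation_expansion[OF s p0 p(2)] by blast
    obtain C where C: "C \<ge> 0" "\<And>\<gamma> r H. (\<forall>m\<in>\<Lambda>. coherent_decay s C0 m (\<gamma> m)) \<Longrightarrow>
        (\<lambda>m. norm (r m) powr p) summable_on \<Lambda> \<Longrightarrow> ((\<lambda>m. hs_rank_one (\<gamma> m) (r m)) has_sum H) \<Lambda> \<Longrightarrow>
        H \<in> approx_space \<Lambda> W \<alpha> p \<and> approx_norm \<Lambda> W \<alpha> p H \<le> C * (\<Sum>\<^sub>\<infinity>m\<in>\<Lambda>. norm (r m) powr p) powr (1 / p)"
      using localized_expansion_approx_space[OF W p \<alpha> K(1)] by blast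
    show ?thesis
    proof (rule that[of "C * K"])
      fix F :: "'a form" assume "F \<in> op_modulation \<Lambda> p"
      then have F: "F \<in> schwartz_operators_dual" "op_modulation_ennorm p F < \<infinity>"
        using False by (auto simp: op_modulation_def)
      obtain \<gamma> r H where H: "\<forall>m\<in>\<Lambda>. coherent_decay s C0 m (\<gamma> m)" "(\<lambda>m. norm (r m) powr p) summable_on \<Lambda>"
        "((\<lambda>m. hs_rank_one (\<gamma> m) (r m)) has_sum H) \<Lambda>" "hs_form H = F"
        "(\<Sum>\<^sub>\<infinity>m\<in>\<Lambda>. norm (r m) powr p) powr (1 / p) \<le> K * enn2real (op_modulation_ennorm p F)"
        using K(3)[OF F] by blast
      have "approx_norm \<Lambda> W \<alpha> p H \<le> C * (K * enn2real (op_modulation_ennorm p F))"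
        using C(2)[OF H(1-3)] mult_left_mono[OF H(5) C(1)] by linarith
      then show "\<exists>H. hs_form H = F \<and> H \<in> approx_space \<Lambda> W \<alpha> p \<and> approx_norm \<Lambda> W \<alpha> p H \<le> C * K * op_modulation_norm \<Lambda> p F"
        using C(2)[OF H(1-3)] H(4) False by (auto simp: op_modulation_norm_def mult.assoc)
    qed
  qed
  have "op_modulation \<Lambda> p \<subseteq> hs_form ` approx_space \<Lambda> W \<alpha> p" using C by blast
  moreover have "approx_norm \<Lambda> W \<alpha> p H \<le> C * op_modulation_norm \<Lambda> p (hs_form H)" if "hs_form H \<in> op_modulation \<Lambda> p" for H
    using C[OF that] inj_hs_form by (metis injD)
  ultimately show ?thesis unfolding continuously_embedded_def by blast
qed

end

theorem theorem5p11:
  fixes N :: nat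
    and W :: "(real ^ 'n) \<times> (real ^ 'n) \<Rightarrow> (real ^ 'n) L2 hs \<Rightarrow> (real ^ 'n) L2 hs"
    and \<Lambda> :: "((real ^ 'n) \<times> (real ^ 'n)) set"
  assumes "N > 0"
    and "\<Lambda> = lattice N"
    and "g_frame \<Lambda> gabor_G"
  shows "(\<forall>s p \<alpha>. s_admissible_dictionary \<Lambda> s W \<and>
              2 * real CARD('n) / s < p \<and> p < 2 \<and> \<alpha> = 1 / p - 1 / 2 \<longrightarrow>
            continuously_embedded (op_modulation \<Lambda> p) (op_modulation_norm \<Lambda> p) hs_form
              (approx_space \<Lambda> W \<alpha> p) (approx_norm \<Lambda> W \<alpha> p)) \<and>
         (\<forall>p \<alpha>. admissible_dictionary \<Lambda> W \<and>
              0 < p \<and> p < 2 \<and> \<alpha> = 1 / p - 1 / 2 \<longrightarrow>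
            continuously_embedded (op_modulation \<Lambda> p) (op_modulation_norm \<Lambda> p) hs_form
              (approx_space \<Lambda> W \<alpha> p) (approx_norm \<Lambda> W \<alpha> p))"
proof -
  interpret gaussian_gabor_frame N \<Lambda> by unfold_locales (use assms in auto)
  have D: "DIM(real ^ 'n) = CARD('n)" by simp
  have first: "continuously_embedded (op_modulation \<Lambda> p) (op_modulation_norm \<Lambda> p) hs_form
      (approx_space \<Lambda> W \<alpha> p) (approx_norm \<Lambda> W \<alpha> p)"
    if "s_admissible_dictionary \<Lambda> s W" "2 * real CARD('n) / s < p" "p < 2" "\<alpha> = 1 / p - 1 / 2" for s p \<alpha>
    using op_modulation_embedded[of s W p \<alpha>] that unfolding D by blast
  moreover have "continuously_embedded (op_modulation \<Lambda> p) (op_modulation_norm \<Lambda> p) hs_form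
      (approx_space \<Lambda> W \<alpha> p) (approx_norm \<Lambda> W \<alpha> p)"
    if W: "admissible_dictionary \<Lambda> W" and p: "0 < p" "p < 2" "\<alpha> = 1 / p - 1 / 2" for p \<alpha>
  proof (rule first[OF _ _ p(2,3)])
    \<comment> \<open>any exponent above both \<open>2d\<close> and \<open>2d / p\<close> will do\<close>
    define s where "s = 2 * real CARD('n) / p + 2 * real CARD('n) + 1"
    have "2 * real CARD('n) / p \<ge> 0" using p(1) by simp
    then have s: "s > 2 * real CARD('n)" by (simp add: s_def)
    show "s_admissible_dictionary \<Lambda> s W" using W s unfolding admissible_dictionary_def D by blast
    have "s > 2 * real CARD('n) / p" by (simp add: s_def)
    then show "2 * real CARD('n) / s < p"
      using s p(1) by (simp add: divide_less_eq mult.commute)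
  qed
  ultimately show ?thesis by blast
qed

end
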